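(* Let $d$ be a Dirac system with Lipschitz coefficients with Dirac operator $D$, and let $D^0=\gamma_0(\partial_t+A_0)$ be the Dirac operator of the constant coefficient Dirac system $d^0=(H_0,A_0,\gamma_0)$. Let $\mathcal{D}_{\max}$ and $\mathcal{D}^0_{\max}$ be the domains of the maximal extensions of $D$ and $D^0$, respectively. If $\sigma\in L^2(\mathcal{H})$ has compact support, then $\sigma\in\mathcal{D}_{\max}$ if and only if $\sigma\in\mathcal{D}^0_{\max}$.
   Context: Write $\mathbb{R}_+=[0,\infty)$. A Dirac system with Lipschitz coefficients $d$ consists of the following data. (I) A separable complex Hilbert space $H$ with scalar products $\langle\cdot,\cdot\rangle_t$, $t\in\mathbb{R}_+$, with norms $\|\cdot\|_t$ compatible with the Hilbert space structure of $H$, such that for every $T\ge 0$ there is $C_T$ with $|\langle u,v\rangle_r-\langle u,v\rangle_s|\le C_T\|u\|_t\|v\|_t|r-s|$ for all $u,v\in H$, $r,s,t\in[0,T]$. Put $H_t=(H,\langle\cdot,\cdot\rangle_t)$, define $G_t$ by $\langle G_tu,v\rangle_0=\langle u,v\rangle_t$ (locally Lipschitz in $t$, hence weakly differentiable a.e.), $\Gamma=\frac12G_t^{-1}G_t'$ and $\partial=\partial_t+\Gamma$ acting on $\mathrm{Lip}_{\mathrm{loc}}(\mathbb{R}_+,H)$. (II) Self-adjoint operators $A_t$ in $H_t$, $t\in\mathbb{R}_+$, with common domain $H_A$ and graph norms $\|\cdot\|_{A_t}$, such that the embedding $(H_A,\|\cdot\|_{A_0})\to H$ is compact and for every $T\ge0$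 there is $C_T$ with $|\langle A_ru,v\rangle_r-\langle A_su,v\rangle_s|\le C_T\|u\|_{A_t}\|v\|_t|r-s|$ for $u\in H_A$, $v\in H$, $r,s,t\in[0,T]$. (III) A section $\gamma\in\mathrm{Lip}_{\mathrm{loc}}(\mathbb{R}_+,\mathcal{L}(H))\cap L^\infty_{\mathrm{loc}}(\mathbb{R}_+,\mathcal{L}(H_A))$ with $-\gamma_t=\gamma_t^*=\gamma_t^{-1}$ on $H_t$, $A_t\gamma_t+\gamma_tA_t=0$ on $H_A$, and $[\partial,\gamma]=0$ on $\mathrm{Lip}_{\mathrm{loc}}(\mathbb{R}_+,H)$. Let $\mathcal{L}_c$ be the space of compactly supported $\sigma\in\mathrm{Lip}_{\mathrm{loc}}(\mathbb{R}_+,H)\cap L^\infty_{\mathrm{loc}}(\mathbb{R}_+,H_A)$ and $\mathcal{L}_{0,c}=\{\sigma\in\mathcal{L}_c:\sigma(0)=0\}$. Let $L^2(\mathcal{H})$ be the Hilbert space of (classes of) measurable $\sigma:\mathbb{R}_+\to H$ with $\int_0^\infty\|\sigma(t)\|_t^2\,dt<\infty$. The Dirac operator is $D=\gamma(\partial+A)$. Its restriction $D_{0,c}$ to $\mathcal{L}_{0,c}$ is symmetric in $L^2(\mathcal{H})$, and the maximal extension is $D_{\max}=(D_{0,c})^*$, adjoint in $L^2(\mathcal{H})$, with domain $\mathcal{D}_{\max}$. For $d^0$ the same definitions apply with $H_t,A_t,\gamma_t$ replaced by $H_0,A_0,\gamma_0$ for all $t$ (so $\Gamma=0$), the adjoint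 being taken in $L^2(\mathbb{R}_+,H_0)$. Compactly supported elements of $L^2(\mathcal{H})$ and of $L^2(\mathbb{R}_+,H_0)$ are the same functions. *)

theory Defs
  imports "HOL-Analysis.Analysis"
begin

section \<open>Complex Hilbert spaces\<close>

text \<open>Scalar products are linear in the first and conjugate linear in the second argument.
  Separability is imposed by the additional sort \<open>second_countable_topology\<close>.\<close>

class complex_hilbert_space = banach +
  fixes scaleC :: "complex \<Rightarrow> 'a \<Rightarrow> 'a"
    and cinner :: "'a \<Rightarrow> 'a \<Rightarrow> complex"
  assumes scaleC_add_right: "scaleC c (x + y) = scaleC c x + scaleC c y"
    and scaleC_add_left: "scaleC (c + d) x = scaleC c x + scaleC d x"
    and scaleC_scaleC: "scaleC c (scaleC d x) = scaleC (c * d) x"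
    and scaleC_of_real: "scaleC (complex_of_real r) x = scaleR r x"
    and cinner_commute: "cinner x y = cnj (cinner y x)"
    and cinner_add_left: "cinner (x + y) z = cinner x z + cinner y z"
    and cinner_scaleC_left: "cinner (scaleC c x) y = c * cinner x y"
    and cinner_self: "cinner x x = complex_of_real ((norm x)\<^sup>2)"

definition sp_norm :: "('h \<Rightarrow> 'h \<Rightarrow> complex) \<Rightarrow> 'h \<Rightarrow> real" where
  "sp_norm s u = sqrt (Re (s u u))"

definition compatible_scalar_product :: "('h::complex_hilbert_space \<Rightarrow> 'h \<Rightarrow> complex) \<Rightarrow> bool" where
  "compatible_scalar_product s \<longleftrightarrow>
     (\<forall>u v w. s (u + v) w = s u w + s v w) \<and>
     (\<forall>c u v. s (scaleC c u) v = c * s u v) \<and>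
     (\<forall>u v. s u v = cnj (s v u)) \<and>
     (\<forall>u. u \<noteq> 0 \<longrightarrow> 0 < Re (s u u)) \<and>
     (\<exists>c>0. \<exists>C. \<forall>u. c * norm u \<le> sp_norm s u \<and> sp_norm s u \<le> C * norm u)"

definition csubspace :: "'h::complex_hilbert_space set \<Rightarrow> bool" where
  "csubspace S \<longleftrightarrow> 0 \<in> S \<and> (\<forall>u\<in>S. \<forall>v\<in>S. u + v \<in> S) \<and> (\<forall>c. \<forall>u\<in>S. scaleC c u \<in> S)"

definition clinear_on ::
  "'h::complex_hilbert_space set \<Rightarrow> ('h \<Rightarrow> 'h) \<Rightarrow> bool" where
  "clinear_on S T \<longleftrightarrow>
     (\<forall>u\<in>S. \<forall>v\<in>S. T (u + v) = T u + T v) \<and> (\<forall>c. \<forall>u\<in>S. T (scaleC c u) = scaleC c (T u))"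


section \<open>Unbounded operators\<close>

text \<open>The graph of the adjoint of the operator \<open>T\<close> with domain \<open>S\<close>, in the space \<open>X\<close> with
  scalar product \<open>s\<close>. Here \<open>X\<close> may also be a space of functions which represent the elements of
  a Hilbert space of classes modulo null functions.\<close>

definition adjoint_graph ::
  "'b set \<Rightarrow> ('b \<Rightarrow> 'b \<Rightarrow> complex) \<Rightarrow> 'b set \<Rightarrow> ('b \<Rightarrow> 'b) \<Rightarrow> ('b \<times> 'b) set" where
  "adjoint_graph X s S T = {(v, w). v \<in> X \<and> w \<in> X \<and> (\<forall>u\<in>S. s (T u) v = s u w)}"

definition self_adjoint_op ::
  "('h::complex_hilbert_space \<Rightarrow> 'h \<Rightarrow> complex) \<Rightarrow> 'h set \<Rightarrow> ('h \<Rightarrow> 'h) \<Rightarrow> bool" where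
  "self_adjoint_op s S T \<longleftrightarrow>
     csubspace S \<and> closure S = UNIV \<and> clinear_on S T \<and>
     adjoint_graph UNIV s S T = {(v, T v) |v. v \<in> S}"

definition graph_norm :: "('h \<Rightarrow> 'h \<Rightarrow> complex) \<Rightarrow> ('h \<Rightarrow> 'h) \<Rightarrow> 'h \<Rightarrow> real" where
  "graph_norm s T u = sqrt ((sp_norm s u)\<^sup>2 + (sp_norm s (T u))\<^sup>2)"


section \<open>Function spaces on the half line\<close>

text \<open>A function on the half line is given by a function on \<^typ>\<open>real\<close>. Its values at negative
  arguments are irrelevant in everything below.\<close>

definition Lip_loc :: "(real \<Rightarrow> 'b::metric_space) set" where
  "Lip_loc = {\<sigma>. \<forall>T\<ge>0. \<exists>C. C-lipschitz_on {0..T} \<sigma>}"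

text \<open>Locally bounded measurable functions with values in the domain \<open>S\<close> of \<open>T\<close>, with respect to
  the graph norm. A function is measurable with respect to the graph norm iff it and its
  composition with \<open>T\<close> are measurable.\<close>

definition Linf_loc_dom ::
  "('h::complex_hilbert_space \<Rightarrow> 'h \<Rightarrow> complex) \<Rightarrow> 'h set \<Rightarrow> ('h \<Rightarrow> 'h) \<Rightarrow> (real \<Rightarrow> 'h) set" where
  "Linf_loc_dom s S T = {\<sigma>.
     \<sigma> \<in> borel_measurable (lebesgue_on {0..}) \<and>
     (\<lambda>t. T (\<sigma> t)) \<in> borel_measurable (lebesgue_on {0..}) \<and>
     (AE t in lebesgue_on {0..}. \<sigma> t \<in> S) \<and>
     (\<forall>b\<ge>0. \<exists>C. AE t in lebesgue_on {0..b}. graph_norm s T (\<sigma> t) \<le> C)}"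

definition L2_space ::
  "(real \<Rightarrow> 'h::complex_hilbert_space \<Rightarrow> 'h \<Rightarrow> complex) \<Rightarrow> (real \<Rightarrow> 'h) set" where
  "L2_space ip = {\<sigma>. \<sigma> \<in> borel_measurable (lebesgue_on {0..}) \<and>
     integrable (lebesgue_on {0..}) (\<lambda>t. (sp_norm (ip t) (\<sigma> t))\<^sup>2)}"

definition L2_inner ::
  "(real \<Rightarrow> 'h \<Rightarrow> 'h \<Rightarrow> complex) \<Rightarrow> (real \<Rightarrow> 'h) \<Rightarrow> (real \<Rightarrow> 'h) \<Rightarrow> complex" where
  "L2_inner ip \<sigma> \<tau> = (LINT t|lebesgue_on {0..}. ip t (\<sigma> t) (\<tau> t))"

text \<open>Compactness of the support of a class of functions.\<close>

definition compact_support_AE :: "(real \<Rightarrow> 'h::zero) \<Rightarrow> bool" where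
  "compact_support_AE \<sigma> \<longleftrightarrow> (\<exists>R. AE t in lebesgue_on {0..}. t > R \<longrightarrow> \<sigma> t = 0)"


section \<open>Dirac systems\<close>

definition metric_op ::
  "(real \<Rightarrow> 'h \<Rightarrow> 'h \<Rightarrow> complex) \<Rightarrow> real \<Rightarrow> 'h \<Rightarrow> 'h" where
  "metric_op ip t u = (THE w. \<forall>v. ip 0 w v = ip t u v)"

text \<open>The weak derivative, which exists for almost every \<open>t\<close>.\<close>

definition metric_op_deriv ::
  "(real \<Rightarrow> 'h \<Rightarrow> 'h \<Rightarrow> complex) \<Rightarrow> real \<Rightarrow> 'h \<Rightarrow> 'h" where
  "metric_op_deriv ip t u =
     (THE w. \<forall>v. ((\<lambda>r. ip 0 (metric_op ip r u) v) has_vector_derivative ip 0 w v)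
       (at t within {0..}))"

definition Gamma_op ::
  "(real \<Rightarrow> 'h::complex_hilbert_space \<Rightarrow> 'h \<Rightarrow> complex) \<Rightarrow> real \<Rightarrow> 'h \<Rightarrow> 'h" where
  "Gamma_op ip t u = (1/2) *\<^sub>R inv (metric_op ip t) (metric_op_deriv ip t u)"

definition partial_op ::
  "(real \<Rightarrow> 'h::complex_hilbert_space \<Rightarrow> 'h \<Rightarrow> complex) \<Rightarrow> (real \<Rightarrow> 'h) \<Rightarrow> real \<Rightarrow> 'h" where
  "partial_op ip \<sigma> t = vector_derivative \<sigma> (at t within {0..}) + Gamma_op ip t (\<sigma> t)"

text \<open>The type of \<open>\<gamma>\<close> only provides bounded real linear operators; complex linearity is an axiom.
  For an operator valued function with values in the bounded operators on \<open>H_A\<close>, measurability is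
  understood in the strong operator topology.\<close>

locale dirac_system =
  fixes ip :: "real \<Rightarrow> 'h::{complex_hilbert_space, second_countable_topology} \<Rightarrow> 'h \<Rightarrow> complex"
    and H_A :: "'h set"
    and A :: "real \<Rightarrow> 'h \<Rightarrow> 'h"
    and \<gamma> :: "real \<Rightarrow> 'h \<Rightarrow>\<^sub>L 'h"
  assumes ip_compatible: "\<And>t. 0 \<le> t \<Longrightarrow> compatible_scalar_product (ip t)"
    and ip_lipschitz: "\<And>T. 0 \<le> T \<Longrightarrow> \<exists>C. \<forall>u v. \<forall>r\<in>{0..T}. \<forall>s\<in>{0..T}. \<forall>t\<in>{0..T}.
      cmod (ip r u v - ip s u v) \<le> C * sp_norm (ip t) u * sp_norm (ip t) v * \<bar>r - s\<bar>"
    and A_self_adjoint: "\<And>t. 0 \<le> t \<Longrightarrow> self_adjoint_op (ip t) H_A (A t)"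
    and H_A_compact: "compact (closure {u \<in> H_A. graph_norm (ip 0) (A 0) u \<le> 1})"
    and A_lipschitz: "\<And>T. 0 \<le> T \<Longrightarrow>
      \<exists>C. \<forall>u\<in>H_A. \<forall>v. \<forall>r\<in>{0..T}. \<forall>s\<in>{0..T}. \<forall>t\<in>{0..T}.
        cmod (ip r (A r u) v - ip s (A s u) v)
          \<le> C * graph_norm (ip t) (A t) u * sp_norm (ip t) v * \<bar>r - s\<bar>"
    and \<gamma>_clinear: "\<And>t. 0 \<le> t \<Longrightarrow> clinear_on UNIV (\<gamma> t)"
    and \<gamma>_Lip_loc: "\<gamma> \<in> Lip_loc"
    and \<gamma>_Linf_loc_measurable:
      "\<And>u. u \<in> H_A \<Longrightarrow> (\<lambda>t. A 0 (\<gamma> t u)) \<in> borel_measurable (lebesgue_on {0..})"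
    and \<gamma>_Linf_loc_bound: "\<And>T. 0 \<le> T \<Longrightarrow>
      \<exists>C. AE t in lebesgue_on {0..T}. \<forall>u\<in>H_A. \<gamma> t u \<in> H_A \<and>
        graph_norm (ip 0) (A 0) (\<gamma> t u) \<le> C * graph_norm (ip 0) (A 0) u"
    and \<gamma>_adjoint: "\<And>t u v. 0 \<le> t \<Longrightarrow> ip t (\<gamma> t u) v = ip t u (- \<gamma> t v)"
    and \<gamma>_square: "\<And>t u. 0 \<le> t \<Longrightarrow> \<gamma> t (\<gamma> t u) = - u"
    and \<gamma>_anticommute: "\<And>t u. 0 \<le> t \<Longrightarrow> u \<in> H_A \<Longrightarrow>
      \<gamma> t u \<in> H_A \<and> A t (\<gamma> t u) + \<gamma> t (A t u) = 0"
    and \<gamma>_parallel: "\<And>\<sigma>. \<sigma> \<in> Lip_loc \<Longrightarrow>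
      AE t in lebesgue_on {0..}. partial_op ip (\<lambda>r. \<gamma> r (\<sigma> r)) t = \<gamma> t (partial_op ip \<sigma> t)"

definition L_c ::
  "(real \<Rightarrow> 'h::complex_hilbert_space \<Rightarrow> 'h \<Rightarrow> complex) \<Rightarrow> 'h set \<Rightarrow> (real \<Rightarrow> 'h \<Rightarrow> 'h) \<Rightarrow> (real \<Rightarrow> 'h) set" where
  "L_c ip H_A A = {\<sigma>. \<sigma> \<in> Lip_loc \<and> \<sigma> \<in> Linf_loc_dom (ip 0) H_A (A 0) \<and> (\<exists>R. \<forall>t>R. \<sigma> t = 0)}"

definition L_0c ::
  "(real \<Rightarrow> 'h::complex_hilbert_space \<Rightarrow> 'h \<Rightarrow> complex) \<Rightarrow> 'h set \<Rightarrow> (real \<Rightarrow> 'h \<Rightarrow> 'h) \<Rightarrow> (real \<Rightarrow> 'h) set" where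
  "L_0c ip H_A A = {\<sigma> \<in> L_c ip H_A A. \<sigma> 0 = 0}"

definition dirac_op ::
  "(real \<Rightarrow> 'h::complex_hilbert_space \<Rightarrow> 'h \<Rightarrow> complex) \<Rightarrow> (real \<Rightarrow> 'h \<Rightarrow> 'h) \<Rightarrow> (real \<Rightarrow> 'h \<Rightarrow>\<^sub>L 'h)
    \<Rightarrow> (real \<Rightarrow> 'h) \<Rightarrow> real \<Rightarrow> 'h" where
  "dirac_op ip A \<gamma> \<sigma> t = \<gamma> t (partial_op ip \<sigma> t + A t (\<sigma> t))"

definition D_max_dom ::
  "(real \<Rightarrow> 'h::complex_hilbert_space \<Rightarrow> 'h \<Rightarrow> complex) \<Rightarrow> 'h set \<Rightarrow> (real \<Rightarrow> 'h \<Rightarrow> 'h)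
    \<Rightarrow> (real \<Rightarrow> 'h \<Rightarrow>\<^sub>L 'h) \<Rightarrow> (real \<Rightarrow> 'h) set" where
  "D_max_dom ip H_A A \<gamma> =
     Domain (adjoint_graph (L2_space ip) (L2_inner ip) (L_0c ip H_A A) (dirac_op ip A \<gamma>))"

end

theory Submission
  imports Defs
begin

text \<open>
  The maximal domain is described by a condition in which the metric and \<open>\<gamma>\<close> no longer occur and
  in which \<open>A t\<close> may be replaced by \<open>A 0\<close> (\<open>regular_pair\<close>). Since \<open>\<gamma>\<close> commutes with \<open>\<partial>\<close> and
  anticommutes with \<open>A\<close>, the Dirac operator is \<open>\<partial> - A\<close> in terms of \<open>\<rho> = \<gamma> \<tau>\<close>. Hence \<open>\<sigma>\<close> lies in the
  maximal domain iff \<open>(\<partial> + A) \<sigma>\<close>, taken in the weak sense against sections \<open>\<rho>\<close> with \<open>\<rho> 0 = 0\<close>, is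
  square integrable. A compactly supported \<open>\<sigma>\<close> is thus a weak solution on an interval \<open>[0,R]\<close>, and
  test functions may be arbitrary at \<open>R\<close>.

  The heart of the matter is a regularity statement (\<open>weak_solution.regularity\<close>): for such \<open>\<sigma>\<close> the
  value \<open>\<sigma> t\<close> lies in \<open>H_A\<close> for almost every \<open>t\<close>, and \<open>t A \<sigma>\<close> is square integrable, although
  \<open>A \<sigma>\<close> itself need not be. Then \<open>A\<close> can be moved from the test section to \<open>\<sigma>\<close>: a Lipschitz
  section vanishing at \<open>0\<close> is \<open>O(t)\<close>, so \<open>\<sigma>\<close> has a weak derivative \<open>f\<close> with \<open>t f\<close> integrable and
  \<open>f + A \<sigma>\<close> square integrable. This is \<open>regular_pair\<close>, and it characterises the maximal domain
  (\<open>D_max_iff_regular_pair\<close>). The theorem follows, because the Lipschitz condition on the family gives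
  \<open>|A t (\<sigma> t) - A 0 (\<sigma> t)| \<le> C t (|\<sigma> t| + |A t (\<sigma> t)|)\<close>, which is square integrable
  (\<open>regular_pair_perturb\<close>); the factor \<open>t\<close> compensates exactly the weight in the regularity
  statement.

  For the regularity, put \<open>x = t \<sigma>\<close>, which satisfies \<open>\<partial> x + A x = h\<close> with \<open>h\<close> square integrable.
  Formally the derivative of the energy \<open>\<langle>A x, x\<rangle>\<close> is \<open>2 Re \<langle>A x, h - A x\<rangle>\<close> up to terms bounded by
  \<open>(|x| + |A x|) |x|\<close>, and the energy vanishes at both ends of the interval; so the integral of
  \<open>|A x|\<^sup>2\<close> is bounded. This becomes rigorous by two regularisations. Time is mollified to one side
  at scale \<open>\<delta>\<close>, and with \<open>G\<close> the operator of the metric and \<open>B = G A\<close> the section is replaced by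
  the image of \<open>G x\<close> under the resolvent \<open>(G + i \<epsilon> B)\<^sup>-\<^sup>1\<close>, which maps into \<open>H_A\<close>. The energy estimate for the
  resolvent is uniform in \<open>\<epsilon>\<close> (\<open>energy_derivative\<close>), and the mollification error is small if \<open>\<delta>\<close> is
  small compared with \<open>\<epsilon>\<close>. In the limit the bound survives by Fatou's lemma, and self-adjointness
  turns boundedness of \<open>A\<close> along the approximation into membership in the domain.

  Coefficients are only Lipschitz, so derivatives exist almost everywhere at best. For Hilbert space
  valued functions this rests on the martingale of dyadic difference quotients, which is bounded and
  hence converges in mean, and on Lebesgue points.
\<close>

section \<open>Complex Hilbert spaces\<close>

lemma scaleC_zero_right [simp]: "scaleC c 0 = (0::'a::complex_hilbert_space)"
  using scaleC_add_right[of c 0 0] by simp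
lemma scaleC_zero_left [simp]: "scaleC 0 (x::'a::complex_hilbert_space) = 0"
  using scaleC_add_left[of 0 0 x] by simp
lemma scaleC_one [simp]: "scaleC 1 (x::'a::complex_hilbert_space) = x"
  using scaleC_of_real[of 1 x] by simp
lemma scaleC_minus_right: "scaleC c (- x) = - scaleC c (x::'a::complex_hilbert_space)"
  using scaleC_add_right[of c x "-x"] by (metis add.right_inverse minus_unique scaleC_zero_left scaleC_zero_right)
lemma scaleC_minus_left: "scaleC (- c) x = - scaleC c (x::'a::complex_hilbert_space)"
  using scaleC_add_left[of c "-c" x] by (metis add.right_inverse minus_unique scaleC_zero_left scaleC_zero_right)
lemma scaleC_diff_right: "scaleC c (x - y) = scaleC c x - scaleC c (y::'a::complex_hilbert_space)"
  using scaleC_add_right[of c x "-y"] by (simp add: scaleC_minus_right)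
lemma cinner_add_right: "cinner x (y + z) = cinner x y + cinner x (z::'a::complex_hilbert_space)"
  by (metis cinner_add_left cinner_commute complex_cnj_add)
lemma cinner_scaleC_right: "cinner x (scaleC c y) = cnj c * cinner x (y::'a::complex_hilbert_space)"
  by (metis cinner_scaleC_left cinner_commute complex_cnj_mult)
lemma cinner_scaleR_left: "cinner (r *\<^sub>R x) y = complex_of_real r * cinner x (y::'a::complex_hilbert_space)"
  by (metis cinner_scaleC_left scaleC_of_real)
lemma cinner_scaleR_right: "cinner x (r *\<^sub>R y) = complex_of_real r * cinner x (y::'a::complex_hilbert_space)"
  by (metis cinner_scaleC_right scaleC_of_real complex_cnj_complex_of_real)
lemma cinner_zero_left [simp]: "cinner 0 (y::'a::complex_hilbert_space) = 0"
  using cinner_add_left[of 0 0 y] by simp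
lemma cinner_zero_right [simp]: "cinner (y::'a::complex_hilbert_space) 0 = 0"
  using cinner_add_right[of y 0 0] by simp
lemma cinner_minus_left: "cinner (- x) y = - cinner x (y::'a::complex_hilbert_space)"
  using cinner_add_left[of x "-x" y] by (metis add.right_inverse minus_unique cinner_zero_left cinner_zero_right)
lemma cinner_minus_right: "cinner x (- y) = - cinner x (y::'a::complex_hilbert_space)"
  using cinner_add_right[of x y "-y"] by (metis add.right_inverse minus_unique cinner_zero_left cinner_zero_right)
lemma cinner_diff_left: "cinner (x - y) z = cinner x z - cinner y (z::'a::complex_hilbert_space)"
  using cinner_add_left[of x "-y" z] by (simp add: cinner_minus_left)
lemma cinner_diff_right: "cinner x (y - z) = cinner x y - cinner x (z::'a::complex_hilbert_space)"
  using cinner_add_right[of x y "-z"] by (simp add: cinner_minus_right)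

lemmas cinner_algebra = cinner_add_left cinner_add_right cinner_diff_left cinner_diff_right
  cinner_minus_left cinner_minus_right cinner_scaleC_left cinner_scaleC_right
  cinner_scaleR_left cinner_scaleR_right

lemma Re_cinner_self: "Re (cinner x x) = (norm (x::'h::complex_hilbert_space))\<^sup>2"
  by (simp add: cinner_self)

lemma Re_cinner_commute: "Re (cinner x y) = Re (cinner y (x::'h::complex_hilbert_space))"
  by (subst cinner_commute) simp

lemma norm_add_squared:
  "(norm (x + y))\<^sup>2 = (norm x)\<^sup>2 + 2 * Re (cinner x y) + (norm (y::'h::complex_hilbert_space))\<^sup>2"
  unfolding Re_cinner_self[symmetric] by (simp add: cinner_algebra Re_cinner_commute[of y x])

lemma norm_diff_squared:
  "(norm (x - y))\<^sup>2 = (norm x)\<^sup>2 - 2 * Re (cinner x y) + (norm (y::'h::complex_hilbert_space))\<^sup>2"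
  unfolding Re_cinner_self[symmetric] by (simp add: cinner_algebra Re_cinner_commute[of y x])

lemma parallelogram:
  "(norm (x + y))\<^sup>2 + (norm (x - y))\<^sup>2 = 2 * (norm x)\<^sup>2 + 2 * (norm (y::'h::complex_hilbert_space))\<^sup>2"
  by (simp add: norm_add_squared norm_diff_squared)

lemma norm_scaleC: "norm (scaleC c x) = cmod c * norm (x::'h::complex_hilbert_space)"
proof -
  have "(norm (scaleC c x))\<^sup>2 = (cmod c * norm x)\<^sup>2"
  proof -
    have "complex_of_real ((norm (scaleC c x))\<^sup>2) = c * cnj c * complex_of_real ((norm x)\<^sup>2)"
      unfolding cinner_self[symmetric] by (simp add: cinner_algebra)
    also have "\<dots> = complex_of_real ((cmod c * norm x)\<^sup>2)"
      by (simp add: complex_norm_square[symmetric] power_mult_distrib)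
    finally show ?thesis using of_real_eq_iff by blast
  qed
  then show ?thesis by (simp add: power2_eq_iff_nonneg)
qed

text \<open>Subtract from \<open>x\<close> its projection to the line spanned by \<open>y\<close>.\<close>
lemma cinner_cauchy_schwarz:
  "cmod (cinner x y) \<le> norm x * norm (y::'h::complex_hilbert_space)"
proof (cases "y = 0")
  case False
  then have ny: "norm y > 0" by simp
  define c where "c = cinner x y / complex_of_real ((norm y)\<^sup>2)"
  have cy: "cinner (scaleC c y) (scaleC c y) = c * cnj c * complex_of_real ((norm y)\<^sup>2)"
    by (simp only: cinner_scaleC_left cinner_scaleC_right cinner_self[of y] mult.assoc mult.left_commute)
  have "cinner x y = c * complex_of_real ((norm y)\<^sup>2)" using ny by (simp add: c_def)
  then have xy: "cinner x (scaleC c y) = c * cnj c * complex_of_real ((norm y)\<^sup>2)"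
    by (simp only: cinner_scaleC_right mult.assoc mult.left_commute)
  have cc: "c * cnj c = complex_of_real ((cmod c)\<^sup>2)" by (rule complex_norm_square[symmetric])
  have "0 \<le> (norm (x - scaleC c y))\<^sup>2" by simp
  also have "\<dots> = (norm x)\<^sup>2 - 2 * Re (cinner x (scaleC c y)) + Re (cinner (scaleC c y) (scaleC c y))"
    by (simp add: norm_diff_squared Re_cinner_self)
  also have "\<dots> = (norm x)\<^sup>2 - (cmod c)\<^sup>2 * (norm y)\<^sup>2"
    unfolding xy cy cc of_real_mult[symmetric] Re_complex_of_real by simp
  also have "(cmod c)\<^sup>2 * (norm y)\<^sup>2 = (cmod (cinner x y) / norm y)\<^sup>2"
    unfolding c_def using ny by (simp add: norm_divide norm_mult power2_eq_square field_simps)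
  finally have "cmod (cinner x y) / norm y \<le> norm x"
    using abs_le_square_iff[of "cmod (cinner x y) / norm y" "norm x"] by simp
  then show ?thesis using ny by (simp add: divide_le_eq)
qed simp

lemma Re_cinner_le: "Re (cinner x y) \<le> norm x * norm (y::'h::complex_hilbert_space)"
  using complex_Re_le_cmod cinner_cauchy_schwarz order_trans by blast

lemma abs_Re_cinner_le: "\<bar>Re (cinner x y)\<bar> \<le> norm x * norm (y::'h::complex_hilbert_space)"
  using abs_Re_le_cmod cinner_cauchy_schwarz order_trans by blast

lemma bounded_bilinear_cinner:
  "bounded_bilinear (cinner :: 'h::complex_hilbert_space \<Rightarrow> 'h \<Rightarrow> complex)"
proof
  show "\<exists>K. \<forall>a b. norm (cinner (a::'h) b) \<le> norm a * norm b * K"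
    by (rule exI[of _ 1]) (simp add: cinner_cauchy_schwarz)
qed (simp_all add: cinner_algebra scaleR_conv_of_real)

interpretation cinner: bounded_bilinear
  "cinner :: 'h::complex_hilbert_space \<Rightarrow> 'h \<Rightarrow> complex"
  by (rule bounded_bilinear_cinner)

lemma bounded_linear_scaleC: "bounded_linear (scaleC c :: 'h::complex_hilbert_space \<Rightarrow> 'h)"
proof (rule bounded_linear_intro)
  show "scaleC c (r *\<^sub>R x) = r *\<^sub>R scaleC c (x::'h)" for r x
    by (metis mult.commute scaleC_of_real scaleC_scaleC)
  show "norm (scaleC c (x::'h)) \<le> norm x * cmod c" for x by (simp add: norm_scaleC mult.commute)
qed (simp add: scaleC_add_right)

lemma cinner_eq_0_dense:
  fixes S :: "'h::complex_hilbert_space set"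
  assumes "closure S = UNIV" "\<And>u. u \<in> S \<Longrightarrow> cinner u v = 0"
  shows "v = 0"
proof -
  have "closed {u. cinner u v = 0}"
    by (intro closed_Collect_eq continuous_intros linear_continuous_on cinner.bounded_linear_left)
  moreover have "S \<subseteq> {u. cinner u v = 0}" using assms(2) by auto
  ultimately have "closure S \<subseteq> {u. cinner u v = 0}" by (rule closure_minimal[rotated])
  then have "cinner v v = 0" using assms(1) by auto
  then show ?thesis by (simp add: cinner_self)
qed

lemma cinner_eqI:
  fixes v w :: "'h::complex_hilbert_space"
  assumes "\<And>u. cinner u v = cinner u w" shows "v = w"
proof -
  have "cinner (v - w) (v - w) = 0" using assms[of "v-w"] by (simp add: cinner_diff_right)
  then show ?thesis by (simp add: cinner_self)
qed

lemma cinner_eqI_left: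
  fixes v w :: "'h::complex_hilbert_space"
  assumes "\<And>u. cinner v u = cinner w u" shows "v = w"
  by (rule cinner_eqI) (metis assms cinner_commute)

lemma csubspaceD:
  assumes "csubspace S"
  shows csubspace_0: "0 \<in> S" and csubspace_add: "\<And>u v. u \<in> S \<Longrightarrow> v \<in> S \<Longrightarrow> u + v \<in> S"
    and csubspace_scaleC: "\<And>c u. u \<in> S \<Longrightarrow> scaleC c u \<in> S"
    and csubspace_scaleR: "\<And>c u. u \<in> S \<Longrightarrow> c *\<^sub>R u \<in> S"
    and csubspace_minus: "\<And>u. u \<in> S \<Longrightarrow> - u \<in> S"
    and csubspace_diff: "\<And>u v. u \<in> S \<Longrightarrow> v \<in> S \<Longrightarrow> u - v \<in> S"
proof -
  show 0: "0 \<in> S" and a: "\<And>u v. u \<in> S \<Longrightarrow> v \<in> S \<Longrightarrow> u + v \<in> S"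
    and c: "\<And>c u. u \<in> S \<Longrightarrow> scaleC c u \<in> S" using assms by (auto simp: csubspace_def)
  show "\<And>c u. u \<in> S \<Longrightarrow> c *\<^sub>R u \<in> S" by (metis c scaleC_of_real)
  show m: "- u \<in> S" if "u \<in> S" for u
    using c[OF that, of "-1"] by (simp add: scaleC_minus_left)
  show "u - v \<in> S" if "u \<in> S" "v \<in> S" for u v using a[OF that(1) m[OF that(2)]] by simp
qed

text \<open>The vector is the difference between a point outside and its best approximation in \<open>M\<close>.\<close>
lemma closed_csubspace_orthogonal:
  fixes M :: "'h::complex_hilbert_space set"
  assumes sub: "csubspace M" and cl: "closed M" and ne: "M \<noteq> UNIV"
  obtains v where "v \<noteq> 0" "\<And>u. u \<in> M \<Longrightarrow> cinner u v = 0"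
proof -
  obtain x where x: "x \<notin> M" using ne by auto
  have M0: "M \<noteq> {}" using csubspace_0[OF sub] by auto
  define d where "d = infdist x M"
  have d0: "0 \<le> d" by (simp add: d_def infdist_nonneg)
  have dle: "d \<le> norm (x - u)" if "u \<in> M" for u
    using infdist_le[OF that, of x] by (simp add: d_def dist_norm)
  have "\<exists>m\<in>M. (norm (x - m))\<^sup>2 < d\<^sup>2 + 1 / Suc n" for n :: nat
  proof -
    have "d < sqrt (d\<^sup>2 + 1 / Suc n)" using d0 by (intro real_less_rsqrt) simp
    moreover have "d = (INF a\<in>M. dist x a)" by (simp add: d_def infdist_def M0)
    moreover have "bdd_below (dist x ` M)" by (rule bdd_belowI[of _ 0]) auto
    ultimately obtain m where m: "m \<in> M" "dist x m < sqrt (d\<^sup>2 + 1 / Suc n)"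
      using cINF_less_iff[of M "dist x"] M0 by metis
    have "(norm (x - m))\<^sup>2 < (sqrt (d\<^sup>2 + 1 / Suc n))\<^sup>2"
      using m(2) by (intro power_strict_mono) (auto simp: dist_norm)
    also have "\<dots> = d\<^sup>2 + 1 / Suc n" using d0 by (intro real_sqrt_pow2) simp
    finally show ?thesis using m(1) by blast
  qed
  then obtain m where m: "\<And>n::nat. m n \<in> M" "\<And>n::nat. (norm (x - m n))\<^sup>2 < d\<^sup>2 + 1 / Suc n"
    by metis
  \<comment> \<open>Midpoints of the minimising sequence lie in \<open>M\<close>, so the parallelogram law makes it Cauchy.\<close>
  have diff: "(norm (m j - m i))\<^sup>2 \<le> 2 / Suc i + 2 / Suc j" for i j
  proof -
    have "(1/2) *\<^sub>R (m i + m j) \<in> M" using m(1) csubspace_add csubspace_scaleR sub by blast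
    from dle[OF this] have "d\<^sup>2 \<le> (norm (x - (1/2) *\<^sub>R (m i + m j)))\<^sup>2" using d0 by (rule power_mono)
    moreover have "norm ((x - m i) + (x - m j)) = 2 * norm (x - (1/2) *\<^sub>R (m i + m j))"
    proof -
      have "(x - m i) + (x - m j) = 2 *\<^sub>R (x - (1/2) *\<^sub>R (m i + m j))"
        by (simp add: algebra_simps scaleR_2)
      then show ?thesis by simp
    qed
    ultimately have "4 * d\<^sup>2 \<le> (norm ((x - m i) + (x - m j)))\<^sup>2" by (simp add: power_mult_distrib)
    moreover have "(x - m i) - (x - m j) = m j - m i" by simp
    ultimately show ?thesis
      using parallelogram[of "x - m i" "x - m j"] m(2)[of i] m(2)[of j] by simp
  qed
  have "Cauchy m"
  proof (rule CauchyI)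
    fix e :: real assume e: "0 < e"
    obtain N :: nat where N: "4 / Suc N < e\<^sup>2"
    proof -
      obtain N :: nat where "4 / e\<^sup>2 < N" using reals_Archimedean2 by blast
      then have "4 / e\<^sup>2 < Suc N" by simp
      then have "4 / Suc N < e\<^sup>2" using e by (simp add: field_simps)
      then show ?thesis using that by blast
    qed
    show "\<exists>K. \<forall>i\<ge>K. \<forall>j\<ge>K. norm (m i - m j) < e"
    proof (intro exI allI impI)
      fix i j assume ij: "i \<ge> N" "j \<ge> N"
      have "2 / real (Suc i) \<le> 2 / Suc N" "2 / real (Suc j) \<le> 2 / Suc N"
        using ij by (auto intro!: divide_left_mono)
      then have "(norm (m i - m j))\<^sup>2 < e\<^sup>2" using diff[of i j] N by simp
      then show "norm (m i - m j) < e" using e by (simp add: power_less_imp_less_base)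
    qed
  qed
  then obtain a where a: "m \<longlonglongrightarrow> a" using Cauchy_convergent convergent_def by blast
  have aM: "a \<in> M" using closed_sequentially[OF cl] m(1) a by blast
  have "(norm (x - a))\<^sup>2 \<le> d\<^sup>2"
  proof (rule LIMSEQ_le)
    show "(\<lambda>n. (norm (x - m n))\<^sup>2) \<longlonglongrightarrow> (norm (x - a))\<^sup>2" by (intro tendsto_intros a)
    show "(\<lambda>n. d\<^sup>2 + 1 / real (Suc n)) \<longlonglongrightarrow> d\<^sup>2"
      using tendsto_add[OF tendsto_const LIMSEQ_inverse_real_of_nat, of "d\<^sup>2"]
      by (simp add: inverse_eq_divide)
    show "\<exists>N. \<forall>n\<ge>N. (norm (x - m n))\<^sup>2 \<le> d\<^sup>2 + 1 / real (Suc n)" using m(2) less_imp_le by blast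
  qed
  define v where "v = x - a"
  have vd: "(norm v)\<^sup>2 \<le> d\<^sup>2" using \<open>_ \<le> d\<^sup>2\<close> by (simp add: v_def)
  have v0: "v \<noteq> 0" using aM x by (auto simp: v_def)
  have re: "Re (cinner v u) = 0" if u: "u \<in> M" for u
  proof (cases "u = 0")
    case False
    \<comment> \<open>Moving by this multiple of \<open>u\<close> reduces the distance unless \<open>u\<close> is orthogonal to \<open>v\<close>.\<close>
    define t where "t = Re (cinner v u) / (norm u)\<^sup>2"
    have "a + t *\<^sub>R u \<in> M" using aM u csubspace_add csubspace_scaleR sub by blast
    from dle[OF this] have "d \<le> norm (v - t *\<^sub>R u)" by (simp add: v_def diff_diff_eq)
    then have "d\<^sup>2 \<le> (norm (v - t *\<^sub>R u))\<^sup>2" using d0 by (rule power_mono)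
    also have "\<dots> = (norm v)\<^sup>2 - 2 * t * Re (cinner v u) + t\<^sup>2 * (norm u)\<^sup>2"
      by (simp add: norm_diff_squared cinner_algebra power_mult_distrib)
    also have "\<dots> = (norm v)\<^sup>2 - (Re (cinner v u))\<^sup>2 / (norm u)\<^sup>2"
      using False by (simp add: t_def power2_eq_square field_simps)
    finally have "(Re (cinner v u))\<^sup>2 / (norm u)\<^sup>2 \<le> 0" using vd by linarith
    then show ?thesis using False by (simp add: divide_le_0_iff)
  qed simp
  have "cinner u v = 0" if u: "u \<in> M" for u
  proof -
    have "Re (cinner u v) = 0" using re[OF u] Re_cinner_commute by metis
    moreover have "Im (cinner u v) = 0"
      using re[OF csubspace_scaleC[OF sub u, of \<i>]] Re_cinner_commute[of v "scaleC \<i> u"]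
      by (simp add: cinner_algebra)
    ultimately show ?thesis by (simp add: complex_eq_iff)
  qed
  then show ?thesis using that v0 by blast
qed

text \<open>The kernel has codimension at most one, so the functional is determined by a vector orthogonal to it.\<close>
lemma riesz_representation:
  fixes f :: "'h::complex_hilbert_space \<Rightarrow> complex"
  assumes add: "\<And>u v. f (u + v) = f u + f v" and sc: "\<And>c u. f (scaleC c u) = c * f u"
    and bd: "\<And>u. cmod (f u) \<le> K * norm u"
  obtains w where "\<And>u. f u = cinner u w"
proof -
  have scR: "f (r *\<^sub>R u) = r *\<^sub>R f u" for r u
    using sc[of "complex_of_real r" u] by (simp add: scaleC_of_real scaleR_conv_of_real)
  have bl: "bounded_linear f"
    by (rule bounded_linear_intro[of _ K]) (use add scR bd in \<open>auto simp: mult.commute\<close>)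
  define M where "M = {u. f u = 0}"
  have "csubspace M" unfolding csubspace_def M_def
    using add sc linear_simps(3)[OF bl] by auto
  moreover have "closed M" unfolding M_def
    by (intro closed_Collect_eq continuous_intros linear_continuous_on bl)
  ultimately consider "M = UNIV" | v where "v \<noteq> 0" "\<And>u. u \<in> M \<Longrightarrow> cinner u v = 0"
    using closed_csubspace_orthogonal by blast
  then show ?thesis
  proof cases
    case 1
    then show ?thesis using that[of 0] by (auto simp: M_def)
  next
    case (2 v)
    have fdiff: "f (x - y) = f x - f y" for x y using linear_simps(2)[OF bl] by simp
    have eq: "f v * cinner u v = f u * complex_of_real ((norm v)\<^sup>2)" for u
    proof -
      have "scaleC (f v) u - scaleC (f u) v \<in> M" by (simp add: M_def fdiff sc)
      from 2(2)[OF this] show ?thesis by (simp add: cinner_algebra cinner_self)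
    qed
    show ?thesis
    proof (rule that[of "scaleC (cnj (f v) / complex_of_real ((norm v)\<^sup>2)) v"])
      show "f u = cinner u (scaleC (cnj (f v) / complex_of_real ((norm v)\<^sup>2)) v)" for u
        using eq[of u] 2(1) by (simp add: cinner_algebra field_simps)
    qed
  qed
qed

text \<open>A bounded functional on a dense subspace extends to the whole space by uniform continuity.\<close>
lemma riesz_representation_dense:
  fixes f :: "'h::complex_hilbert_space \<Rightarrow> complex"
  assumes S: "csubspace S" "closure S = UNIV"
    and add: "\<And>u v. u \<in> S \<Longrightarrow> v \<in> S \<Longrightarrow> f (u + v) = f u + f v"
    and sc: "\<And>c u. u \<in> S \<Longrightarrow> f (scaleC c u) = c * f u"
    and bd: "\<And>u. u \<in> S \<Longrightarrow> cmod (f u) \<le> K * norm u"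
  obtains w where "\<And>u. u \<in> S \<Longrightarrow> f u = cinner u w"
proof -
  have diff: "f (u - v) = f u - f v" if "u \<in> S" "v \<in> S" for u v
    using add[of "u - v" v] that csubspace_diff[OF S(1)] by simp
  have "uniformly_continuous_on S f"
  proof (rule lipschitz_on_uniformly_continuous)
    show "\<bar>K\<bar>-lipschitz_on S f"
    proof (rule lipschitz_onI)
      fix u v assume uv: "u \<in> S" "v \<in> S"
      have "cmod (f (u - v)) \<le> K * norm (u - v)" using bd csubspace_diff[OF S(1) uv] by blast
      also have "\<dots> \<le> \<bar>K\<bar> * norm (u - v)" by (intro mult_right_mono) auto
      finally show "dist (f u) (f v) \<le> \<bar>K\<bar> * dist u v" using diff[OF uv] by (simp add: dist_norm)
    qed simp
  qed
  then obtain g where g: "uniformly_continuous_on (closure S) g" "\<And>x. x \<in> S \<Longrightarrow> f x = g x"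
    using uniformly_continuous_on_extension_on_closure[of S f] by metis
  have cont: "continuous_on UNIV g" using g(1) S(2) by (metis uniformly_continuous_imp_continuous)
  have lim: "(\<lambda>n. f (s n)) \<longlonglongrightarrow> g x" if "s \<longlonglongrightarrow> x" "\<And>n. s n \<in> S" for s x
  proof -
    have "(\<lambda>n. g (s n)) \<longlonglongrightarrow> g x"
      using continuous_on_tendsto_compose[OF cont that(1)] by simp
    then show ?thesis using g(2)[OF that(2)] by simp
  qed
  have appr: "\<exists>s. s \<longlonglongrightarrow> x \<and> (\<forall>n. s n \<in> S)" for x
    using S(2) closure_sequential[of x S] by auto
  have "g (u + v) = g u + g v" for u v
  proof -
    obtain s t where st: "s \<longlonglongrightarrow> u" "\<forall>n. s n \<in> S" "t \<longlonglongrightarrow> v" "\<forall>n. t n \<in> S" using appr by metis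
    have "(\<lambda>n. f (s n + t n)) \<longlonglongrightarrow> g (u + v)"
      by (rule lim) (use st csubspace_add[OF S(1)] in \<open>auto intro: tendsto_add\<close>)
    moreover have "(\<lambda>n. f (s n) + f (t n)) \<longlonglongrightarrow> g u + g v" by (intro tendsto_add lim) (use st in auto)
    ultimately show ?thesis using add st LIMSEQ_unique by auto
  qed
  moreover have "g (scaleC c u) = c * g u" for c u
  proof -
    obtain s where st: "s \<longlonglongrightarrow> u" "\<forall>n. s n \<in> S" using appr by metis
    have "(\<lambda>n. f (scaleC c (s n))) \<longlonglongrightarrow> g (scaleC c u)"
      by (rule lim) (use st csubspace_scaleC[OF S(1)] bounded_linear.tendsto[OF bounded_linear_scaleC] in auto)
    moreover have "(\<lambda>n. c * f (s n)) \<longlonglongrightarrow> c * g u" by (intro tendsto_intros lim) (use st in auto)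
    ultimately show ?thesis using sc st LIMSEQ_unique by auto
  qed
  moreover have "cmod (g u) \<le> K * norm u" for u
  proof -
    obtain s where st: "s \<longlonglongrightarrow> u" "\<forall>n. s n \<in> S" using appr by metis
    show ?thesis
    proof (rule LIMSEQ_le)
      show "(\<lambda>n. cmod (f (s n))) \<longlonglongrightarrow> cmod (g u)" by (intro tendsto_norm lim) (use st in auto)
      show "(\<lambda>n. K * norm (s n)) \<longlonglongrightarrow> K * norm u" by (intro tendsto_intros st)
    qed (use bd st in auto)
  qed
  ultimately obtain w where "\<And>u. g u = cinner u w" using riesz_representation[of g K] by metis
  then show ?thesis using that g(2) by metis
qed

lemma clinear_onD:
  assumes "clinear_on S T" "csubspace S"
  shows clinear_on_add: "\<And>u v. u \<in> S \<Longrightarrow> v \<in> S \<Longrightarrow> T (u + v) = T u + T v"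
    and clinear_on_scaleC: "\<And>c u. u \<in> S \<Longrightarrow> T (scaleC c u) = scaleC c (T u)"
    and clinear_on_diff: "\<And>u v. u \<in> S \<Longrightarrow> v \<in> S \<Longrightarrow> T (u - v) = T u - T v"
    and clinear_on_0: "T 0 = 0"
    and clinear_on_scaleR: "\<And>c u. u \<in> S \<Longrightarrow> T (c *\<^sub>R u) = c *\<^sub>R (T u)"
proof -
  show a: "\<And>u v. u \<in> S \<Longrightarrow> v \<in> S \<Longrightarrow> T (u + v) = T u + T v"
    and c: "\<And>c u. u \<in> S \<Longrightarrow> T (scaleC c u) = scaleC c (T u)" using assms by (auto simp: clinear_on_def)
  show "T (u - v) = T u - T v" if "u \<in> S" "v \<in> S" for u v
    using a[of "u - v" v] that csubspace_diff[OF assms(2)] by simp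
  show "T 0 = 0" using c[OF csubspace_0[OF assms(2)], of 0] by simp
  show "T (c *\<^sub>R u) = c *\<^sub>R (T u)" if "u \<in> S" for c u
    using \<open>u \<in> S\<close> \<open>\<And>c u. u \<in> S \<Longrightarrow> T (scaleC c u) = scaleC c (T u)\<close> by (metis scaleC_of_real)
qed

text \<open>An operator that is bounded below has closed range if it is closed, hence it is onto as soon
  as nothing is orthogonal to its range; the inverse is then bounded.\<close>
lemma bounded_below_operator_inverse:
  fixes T :: "'h::complex_hilbert_space \<Rightarrow> 'h"
  assumes S: "csubspace S" and lin: "clinear_on S T" and c: "0 < c"
    and below: "\<And>u. u \<in> S \<Longrightarrow> c * norm u \<le> norm (T u)"
    and closed: "\<And>s u f. (\<And>n::nat. s n \<in> S) \<Longrightarrow> s \<longlonglongrightarrow> u \<Longrightarrow> (\<lambda>n. T (s n)) \<longlonglongrightarrow> f \<Longrightarrow> u \<in> S \<and> T u = f"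
    and orth: "\<And>v. (\<And>u. u \<in> S \<Longrightarrow> cinner (T u) v = 0) \<Longrightarrow> v = 0"
  obtains P :: "'h \<Rightarrow>\<^sub>L 'h" where "\<And>f. P f \<in> S" "\<And>f. T (P f) = f" "\<And>u. u \<in> S \<Longrightarrow> P (T u) = u"
    "norm P \<le> 1 / c" "\<And>a f. P (scaleC a f) = scaleC a (P f)"
proof -
  note lD = clinear_onD[OF lin S]
  have inj: "u = v" if "u \<in> S" "v \<in> S" "T u = T v" for u v
  proof -
    have "c * norm (u - v) \<le> 0"
      using below[of "u - v"] csubspace_diff[OF S] that lD(3) by simp
    then show ?thesis using c by (simp add: mult_le_0_iff)
  qed
  have "T ` S = UNIV"
  proof (rule ccontr)
    assume ne: "T ` S \<noteq> UNIV"
    have "csubspace (T ` S)" unfolding csubspace_def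
    proof (intro conjI ballI allI)
      show "0 \<in> T ` S" using lD(4) csubspace_0[OF S] by (metis image_eqI)
    next
      fix x y assume "x \<in> T ` S" "y \<in> T ` S"
      then obtain u v where "u \<in> S" "v \<in> S" "x = T u" "y = T v" by blast
      then show "x + y \<in> T ` S" using lD(1)[of u v] csubspace_add[OF S, of u v] by (metis image_eqI)
    next
      fix a x assume "x \<in> T ` S"
      then obtain u where "u \<in> S" "x = T u" by blast
      then show "scaleC a x \<in> T ` S" using lD(2)[of u a] csubspace_scaleC[OF S, of u a] by (metis image_eqI)
    qed
    moreover have "closed (T ` S)"
      unfolding closed_sequential_limits
    proof (intro allI impI, elim conjE)
      fix g f assume g: "\<forall>n. g n \<in> T ` S" "g \<longlonglongrightarrow> f"
      then have "\<forall>n. \<exists>u. u \<in> S \<and> g n = T u" by blast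
      then obtain s where s: "\<And>n. s n \<in> S" "\<And>n. g n = T (s n)" by metis
      have "Cauchy s"
      proof (rule CauchyI)
        fix e :: real assume e: "0 < e"
        have "Cauchy g" using g(2) LIMSEQ_imp_Cauchy by blast
        then obtain N where N: "\<And>i j. i \<ge> N \<Longrightarrow> j \<ge> N \<Longrightarrow> norm (g i - g j) < c * e"
          using c e CauchyD[of g "c * e"] by (metis mult_pos_pos)
        have "norm (s i - s j) < e" if "i \<ge> N" "j \<ge> N" for i j
        proof -
          have "c * norm (s i - s j) \<le> norm (T (s i - s j))" using below csubspace_diff[OF S] s(1) by blast
          also have "\<dots> = norm (g i - g j)" using s lD(3) by simp
          also have "\<dots> < c * e" using N that by blast
          finally show ?thesis using c by simp
        qed
        then show "\<exists>M. \<forall>m\<ge>M. \<forall>n\<ge>M. norm (s m - s n) < e" by blast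
      qed
      then obtain u where u: "s \<longlonglongrightarrow> u" using Cauchy_convergent convergent_def by blast
      have "u \<in> S \<and> T u = f" using closed[OF s(1) u] g(2) s(2) by (metis (no_types, lifting) ext)
      then show "f \<in> T ` S" by blast
    qed
    ultimately obtain v where "v \<noteq> 0" "\<And>w. w \<in> T ` S \<Longrightarrow> cinner w v = 0"
      using closed_csubspace_orthogonal ne by metis
    then show False using orth by blast
  qed
  then have "\<forall>f. \<exists>u. u \<in> S \<and> T u = f" by (metis UNIV_I imageE)
  then obtain p where p: "\<And>f. p f \<in> S" "\<And>f. T (p f) = f" by metis
  have pT: "p (T u) = u" if "u \<in> S" for u using inj p that by blast
  have psc: "p (scaleC a f) = scaleC a (p f)" for a f
    using pT[OF csubspace_scaleC[OF S p(1)], of a f] lD(2)[OF p(1)] p(2) by metis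
  have bl: "bounded_linear p"
  proof (rule bounded_linear_intro)
    show "p (x + y) = p x + p y" for x y
      using pT[OF csubspace_add[OF S p(1) p(1)]] lD(1)[OF p(1) p(1)] p(2) by metis
    show "p (r *\<^sub>R x) = r *\<^sub>R p x" for r x using psc by (metis scaleC_of_real)
    show "norm (p x) \<le> norm x * (1 / c)" for x
      using below[OF p(1), of x] p(2)[of x] c by (simp add: field_simps)
  qed
  have bl': "blinfun_apply (Blinfun p) = p" by (rule bounded_linear_Blinfun_apply[OF bl])
  show ?thesis
  proof (rule that[of "Blinfun p"])
    show "norm (Blinfun p) \<le> 1 / c"
    proof (rule norm_blinfun_bound)
      show "norm (blinfun_apply (Blinfun p) x) \<le> 1 / c * norm x" for x
        unfolding bl' using below[OF p(1), of x] p(2)[of x] c by (simp add: field_simps)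
    qed (use c in simp)
  qed (use p pT psc bl' in auto)
qed

section \<open>Lipschitz functions of a real variable\<close>

definition dyadic_index :: "nat \<Rightarrow> real \<Rightarrow> nat" where
  "dyadic_index n t = nat \<lfloor>2 ^ n * t\<rfloor>"

text \<open>Difference quotient over the \<open>j\<close>-th dyadic interval of length \<open>2\<^sup>-\<^sup>n\<close>.\<close>
definition dyadic_slope :: "(real \<Rightarrow> 'b::real_normed_vector) \<Rightarrow> nat \<Rightarrow> nat \<Rightarrow> 'b" where
  "dyadic_slope g n j = (2::real) ^ n *\<^sub>R (g (real (Suc j) / 2 ^ n) - g (real j / 2 ^ n))"

lemma dyadic_index_eq:
  assumes "real k / 2 ^ n \<le> t" "t < real (Suc k) / 2 ^ n"
  shows "dyadic_index n t = k"
proof -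
  have "real k \<le> 2 ^ n * t" "2 ^ n * t < real k + 1"
    using assms by (simp_all add: field_simps)
  then have "\<lfloor>2 ^ n * t\<rfloor> = int k" by (simp add: floor_eq_iff)
  then show ?thesis by (simp add: dyadic_index_def)
qed

lemma measurable_dyadic_index [measurable]: "dyadic_index n \<in> measurable borel (count_space UNIV)"
  unfolding dyadic_index_def by measurable

lemma emeasure_lborel_Ico_less_top: "emeasure lborel {a..<b::real} < top"
  by (cases "a \<le> b") auto

lemma dyadic_step_measurable: "(\<lambda>t. F (dyadic_index n t)) \<in> borel_measurable borel"
  by measurable

lemma dyadic_step_integral:
  fixes F :: "nat \<Rightarrow> 'b::{banach, second_countable_topology}"
  shows "set_integrable lborel {0..<real k / 2 ^ n} (\<lambda>t. F (dyadic_index n t)) \<and>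
    (LINT t:{0..<real k / 2 ^ n}|lborel. F (dyadic_index n t)) = (1 / 2 ^ n) *\<^sub>R (\<Sum>j<k. F j)"
proof (induction k)
  case 0
  then show ?case by (simp add: set_lebesgue_integral_def)
next
  case (Suc k)
  let ?A = "{0..<real k / 2 ^ n}" and ?B = "{real k / 2 ^ n..<real (Suc k) / 2 ^ n}"
  have AB: "{0..<real (Suc k) / 2 ^ n} = ?A \<union> ?B"
    using divide_right_mono[of "real k" "real (Suc k)" "2 ^ n"] by (intro ivl_disj_un_two(3)[symmetric]) auto
  have eq: "t \<in> ?B \<Longrightarrow> F (dyadic_index n t) = F k" for t using dyadic_index_eq[of k n t] by simp
  have c: "set_integrable lborel ?B (\<lambda>t. F k)"
    unfolding set_integrable_def
    by (intro integrable_real_indicator integrable_scaleR_left impI) (auto simp: emeasure_lborel_Ico_less_top)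
  have B: "set_integrable lborel ?B (\<lambda>t. F (dyadic_index n t))"
    using c by (rule set_integrable_cong[THEN iffD2, rotated -1]) (use eq in auto)
  have "(LINT t:?B|lborel. F (dyadic_index n t)) = (LINT t:?B|lborel. F k)"
    by (rule set_lebesgue_integral_cong) (use eq in auto)
  also have "\<dots> = measure lborel ?B *\<^sub>R F k" 
    using emeasure_lborel_Ico_less_top[of "real k / 2 ^ n" "real (Suc k) / 2 ^ n"]
    by (intro set_integral_const) (auto simp del: of_nat_Suc)
  also have "measure lborel ?B = 1 / 2 ^ n" by (simp add: field_simps)
  finally have Bi: "(LINT t:?B|lborel. F (dyadic_index n t)) = (1 / 2 ^ n) *\<^sub>R F k" .
  show ?case unfolding AB
  proof (intro conjI set_integrable_Un B)
    have "(LINT t:?A \<union> ?B|lborel. F (dyadic_index n t)) =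
       (LINT t:?A|lborel. F (dyadic_index n t)) + (LINT t:?B|lborel. F (dyadic_index n t))"
      by (rule set_integral_Un) (use Suc B in auto)
    then show "(LINT t:?A \<union> ?B|lborel. F (dyadic_index n t)) = (1 / 2 ^ n) *\<^sub>R (\<Sum>j<Suc k. F j)"
      using Suc Bi by (simp add: scaleR_add_right)
  qed (use Suc in auto)
qed

lemma dyadic_index_div:
  assumes "n \<le> m" "0 \<le> t"
  shows "dyadic_index n t = dyadic_index m t div 2 ^ (m - n)"
proof -
  have "\<lfloor>2 ^ n * t\<rfloor> = \<lfloor>2 ^ m * t / real_of_int (2 ^ (m - n))\<rfloor>"
    using assms by (simp add: power_diff_conv_inverse field_simps)
  also have "\<dots> = \<lfloor>2 ^ m * t\<rfloor> div 2 ^ (m - n)" by (rule floor_divide_real_eq_div) simp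
  finally show ?thesis
    unfolding dyadic_index_def by (simp add: nat_div_distrib assms nat_power_eq)
qed

lemma sum_lessThan_double: "(\<Sum>j<2 * (k::nat). f j) = (\<Sum>i<k. f (2 * i) + f (2 * i + 1))"
  for f :: "nat \<Rightarrow> 'a::comm_monoid_add"
  by (induction k) (simp_all add: add_ac)

lemma dyadic_slope_Suc:
  "dyadic_slope g n i = (1/2) *\<^sub>R (dyadic_slope g (Suc n) (2 * i) + dyadic_slope g (Suc n) (2 * i + 1))"
  (is "?l = ?r")
proof -
  have e: "real (2 * i) / 2 ^ Suc n = real i / 2 ^ n"
    "real (Suc (2 * i + 1)) / 2 ^ Suc n = real (Suc i) / 2 ^ n"
    "real (Suc (2 * i)) / 2 ^ Suc n = real (2 * i + 1) / 2 ^ Suc n"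
    by (simp_all add: field_simps)
  show ?thesis unfolding dyadic_slope_def e scaleR_add_right[symmetric] by (simp add: algebra_simps)
qed

text \<open>The dyadic slopes form a martingale; in a Hilbert space its increments are orthogonal, so
  the distance of two stages is the difference of their energies.\<close>
lemma dyadic_slope_energy:
  fixes g :: "real \<Rightarrow> 'b::real_normed_vector"
  assumes par: "\<And>x y::'b. (norm (x + y))\<^sup>2 + (norm (x - y))\<^sup>2 = 2 * (norm x)\<^sup>2 + 2 * (norm y)\<^sup>2"
    and "n \<le> m"
  shows "(\<Sum>j<N * 2 ^ m. (norm (dyadic_slope g m j - dyadic_slope g n (j div 2 ^ (m - n))))\<^sup>2) / 2 ^ m
    = (\<Sum>j<N * 2 ^ m. (norm (dyadic_slope g m j))\<^sup>2) / 2 ^ m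
      - (\<Sum>j<N * 2 ^ n. (norm (dyadic_slope g n j))\<^sup>2) / 2 ^ n"
  using \<open>n \<le> m\<close>
proof (induction m rule: dec_induct)
  case base
  then show ?case by simp
next
  case (step m)
  let ?x = "dyadic_slope g"
  have split: "(norm (?x (Suc m) (2 * i) - c))\<^sup>2 + (norm (?x (Suc m) (2 * i + 1) - c))\<^sup>2
     = 2 * (norm (?x m i - c))\<^sup>2 + (norm (?x (Suc m) (2 * i) - ?x (Suc m) (2 * i + 1)))\<^sup>2 / 2" for i c
  proof -
    let ?a = "?x (Suc m) (2 * i) - c" and ?b = "?x (Suc m) (2 * i + 1) - c"
    have "?a + ?b = 2 *\<^sub>R (?x m i - c)"
      unfolding dyadic_slope_Suc[of g m i] by (simp add: algebra_simps scaleR_2)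
    then have "norm (?a + ?b) = 2 * norm (?x m i - c)" by simp
    then have "(norm (?a + ?b))\<^sup>2 = 4 * (norm (?x m i - c))\<^sup>2" by (simp add: power_mult_distrib)
    moreover have "?a - ?b = ?x (Suc m) (2 * i) - ?x (Suc m) (2 * i + 1)" by simp
    ultimately show ?thesis using par[of ?a ?b] by simp
  qed
  define V where "V = (\<Sum>i<N * 2 ^ m. (norm (?x (Suc m) (2 * i) - ?x (Suc m) (2 * i + 1)))\<^sup>2 / 2)"
  have N: "N * 2 ^ Suc m = 2 * (N * 2 ^ m)" by simp
  have dv: "(2 * i) div 2 ^ (Suc m - n) = i div 2 ^ (m - n)"
    "(2 * i + 1) div 2 ^ (Suc m - n) = i div 2 ^ (m - n)" for i :: nat
  proof -
    have "Suc m - n = Suc (m - n)" using step by simp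
    then show "(2 * i) div 2 ^ (Suc m - n) = i div 2 ^ (m - n)"
      "(2 * i + 1) div 2 ^ (Suc m - n) = i div 2 ^ (m - n)" by (simp_all add: div_mult2_eq)
  qed
  have "(\<Sum>j<N * 2 ^ Suc m. (norm (?x (Suc m) j - ?x n (j div 2 ^ (Suc m - n))))\<^sup>2)
     = 2 * (\<Sum>j<N * 2 ^ m. (norm (?x m j - ?x n (j div 2 ^ (m - n))))\<^sup>2) + V"
    unfolding N sum_lessThan_double dv split V_def by (simp add: sum.distrib sum_distrib_left)
  moreover have "(\<Sum>j<N * 2 ^ Suc m. (norm (?x (Suc m) j))\<^sup>2)
     = 2 * (\<Sum>j<N * 2 ^ m. (norm (?x m j))\<^sup>2) + V"
    using split[where c=0] unfolding N sum_lessThan_double V_def by (simp add: sum.distrib sum_distrib_left)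
  ultimately show ?case using step.IH by (simp add: add_divide_distrib)
qed

lemma dyadic_slope_L1_Cauchy:
  fixes g :: "real \<Rightarrow> 'b::{banach, second_countable_topology}"
  assumes par: "\<And>x y::'b. (norm (x + y))\<^sup>2 + (norm (x - y))\<^sup>2 = 2 * (norm x)\<^sup>2 + 2 * (norm y)\<^sup>2"
    and C: "\<And>n j. norm (dyadic_slope g n j) \<le> C" and e: "0 < e"
  shows "\<exists>K. \<forall>m\<ge>K. \<forall>n\<ge>K. (LINT t:{0..<real N}|lborel.
    norm (dyadic_slope g m (dyadic_index m t) - dyadic_slope g n (dyadic_index n t))) < e"
proof -
  let ?x = "dyadic_slope g"
  define E where "E n = (\<Sum>j<N * 2 ^ n. (norm (?x n j))\<^sup>2) / 2 ^ n" for n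
  have sq: "(\<Sum>j<N * 2 ^ m. (norm (?x m j - ?x n (j div 2 ^ (m - n))))\<^sup>2) / 2 ^ m = E m - E n"
    if "n \<le> m" for m n
    using dyadic_slope_energy[OF par that, of g N] by (simp add: E_def)
  have "mono E"
  proof (rule monoI)
    fix n m :: nat assume "n \<le> m"
    have "0 \<le> (\<Sum>j<N * 2 ^ m. (norm (?x m j - ?x n (j div 2 ^ (m - n))))\<^sup>2) / 2 ^ m"
      by (intro divide_nonneg_nonneg sum_nonneg) auto
    then show "E n \<le> E m" using sq[OF \<open>n \<le> m\<close>] by simp
  qed
  moreover have Ebd: "E n \<le> N * C\<^sup>2" for n
  proof -
    have "(\<Sum>j<N * 2 ^ n. (norm (?x n j))\<^sup>2) \<le> (\<Sum>j<N * 2 ^ n. C\<^sup>2)"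
      by (intro sum_mono power_mono C) auto
    then show ?thesis by (simp add: E_def field_simps)
  qed
  ultimately have "convergent E"
    using incseq_convergent[of E "N * C\<^sup>2"] unfolding convergent_def by metis
  then have "Cauchy E" by (rule convergent_Cauchy)
  \<comment> \<open>Convergence of the energies is convergence in \<open>L\<^sup>2\<close>; on a bounded interval it yields \<open>L\<^sup>1\<close> by
    \<open>2 F \<le> k F\<^sup>2 + 1 / k\<close>, where \<open>k\<close> makes the second term contribute at most \<open>e / 2\<close>.\<close>
  define k where "k = 2 * (real N + 1) / e"
  have k: "k > 0" using e by (simp add: k_def)
  obtain K where K: "\<And>m n. m \<ge> K \<Longrightarrow> n \<ge> K \<Longrightarrow> norm (E m - E n) < e / k"
    using CauchyD[OF \<open>Cauchy E\<close>, of "e / k"] e k by auto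
  have main: "(LINT t:{0..<real N}|lborel. norm (?x m (dyadic_index m t) - ?x n (dyadic_index n t))) < e"
    if "n \<le> m" "n \<ge> K" for m n
  proof -
    define F where "F j = norm (?x m j - ?x n (j div 2 ^ (m - n)))" for j
    have Nm: "real N = real (N * 2 ^ m) / 2 ^ m" by simp
    have "(LINT t:{0..<real N}|lborel. norm (?x m (dyadic_index m t) - ?x n (dyadic_index n t)))
       = (LINT t:{0..<real N}|lborel. F (dyadic_index m t))"
      by (rule set_lebesgue_integral_cong) (auto simp: F_def dyadic_index_div[OF that(1)])
    also have "\<dots> = (1 / 2 ^ m) *\<^sub>R (\<Sum>j<N * 2 ^ m. F j)"
      using dyadic_step_integral[of "N * 2 ^ m" m F] Nm by metis
    also have "\<dots> \<le> (1 / 2 ^ m) *\<^sub>R (\<Sum>j<N * 2 ^ m. (k * (F j)\<^sup>2 + 1 / k) / 2)"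
    proof (intro scaleR_left_mono sum_mono)
      fix j
      have "0 \<le> (k * F j - 1)\<^sup>2 / k" using k by simp
      also have "\<dots> = k * (F j)\<^sup>2 + 1 / k - 2 * F j" using k by (simp add: power2_eq_square field_simps)
      finally show "F j \<le> (k * (F j)\<^sup>2 + 1 / k) / 2" by simp
    qed auto
    also have "\<dots> = (k * ((\<Sum>j<N * 2 ^ m. (F j)\<^sup>2) / 2 ^ m) + N / k) / 2"
      by (simp add: sum.distrib sum_divide_distrib[symmetric] sum_distrib_left[symmetric] field_simps)
    also have "(\<Sum>j<N * 2 ^ m. (F j)\<^sup>2) / 2 ^ m = E m - E n" using sq[OF that(1)] by (simp add: F_def)
    also have "(k * (E m - E n) + N / k) / 2 < (k * (e / k) + e) / 2"
    proof -
      have "k * (E m - E n) < k * (e / k)"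
        using K[of m n] that k by (intro mult_strict_left_mono) auto
      moreover have "N / k \<le> e"
        using e by (simp add: k_def field_simps)
      ultimately show ?thesis by (intro divide_strict_right_mono add_less_le_mono) auto
    qed
    also have "\<dots> = e" using k by simp
    finally show ?thesis .
  qed
  show ?thesis
  proof (intro exI[of _ K] allI impI)
    fix m n assume "m \<ge> K" "n \<ge> K"
    then show "(LINT t:{0..<real N}|lborel. norm (?x m (dyadic_index m t) - ?x n (dyadic_index n t))) < e"
      using main[of m n] main[of n m] by (cases "n \<le> m") (auto simp: norm_minus_commute)
  qed
qed

lemma dyadic_slope_telescope:
  "(1 / 2 ^ n) *\<^sub>R (\<Sum>j<k. dyadic_slope g n j) = g (real k / 2 ^ n) - g 0"
  by (induction k) (simp_all add: dyadic_slope_def scaleR_add_right del: of_nat_Suc)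

lemma dyadic_slope_le:
  assumes lip: "C-lipschitz_on UNIV g" shows "norm (dyadic_slope g n j) \<le> C"
proof -
  have "norm (dyadic_slope g n j) = 2 ^ n * norm (g (real (Suc j) / 2 ^ n) - g (real j / 2 ^ n))"
    by (simp add: dyadic_slope_def)
  also have "\<dots> \<le> 2 ^ n * (C * \<bar>real (Suc j) / 2 ^ n - real j / 2 ^ n\<bar>)"
    using lipschitz_onD[OF lip, of "real (Suc j) / 2 ^ n" "real j / 2 ^ n"]
    by (intro mult_left_mono) (auto simp: dist_norm)
  also have "\<dots> = C" by (simp add: diff_divide_distrib[symmetric])
  finally show ?thesis .
qed

text \<open>Lipschitz functions with values in a Hilbert space are indefinite integrals: the slopes
  converge in \<open>L\<^sup>1\<close>, and on dyadic intervals their integrals telescope.\<close>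
lemma lipschitz_indefinite_integral:
  fixes g :: "real \<Rightarrow> 'b::{banach, second_countable_topology}"
  assumes par: "\<And>x y::'b. (norm (x + y))\<^sup>2 + (norm (x - y))\<^sup>2 = 2 * (norm x)\<^sup>2 + 2 * (norm y)\<^sup>2"
    and lip: "C-lipschitz_on UNIV g"
  obtains v where "v \<in> borel_measurable borel" "\<And>t. norm (v t) \<le> C"
    "\<And>t. 0 \<le> t \<Longrightarrow> t < real N \<Longrightarrow> (LINT r:{0..<t}|lborel. v r) = g t - g 0"
proof -
  let ?x = "dyadic_slope g"
  have C0: "0 \<le> C" using lip by (rule lipschitz_on_nonneg)
  have lipD: "norm (g s - g t) \<le> C * \<bar>s - t\<bar>" for s t
    using lipschitz_onD[OF lip, of s t] by (simp add: dist_norm)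
  have C: "norm (?x n j) \<le> C" for n j by (rule dyadic_slope_le[OF lip])
  define D where "D n t = ?x n (dyadic_index n t)" for n t
  have Dm [measurable]: "D n \<in> borel_measurable borel" for n
    unfolding D_def by (rule dyadic_step_measurable)
  have DC: "norm (D n t) \<le> C" for n t by (simp add: D_def C)
  define s where "s n t = indicat_real {0..<real N} t *\<^sub>R D n t" for n t
  have si: "integrable lborel (s n)" for n
  proof -
    have "real (N * 2 ^ n) / 2 ^ n = real N" by simp
    then show ?thesis
      using dyadic_step_integral[of "N * 2 ^ n" n "?x n"] unfolding s_def D_def set_integrable_def by metis
  qed
  obtain r where r: "strict_mono r" "AE t in lborel. Cauchy (\<lambda>i. s (r i) t)"
  proof (rule cauchy_L1_AE_cauchy_subseq[of lborel s])
    show "integrable lborel (s n)" for n by (rule si)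
    fix e :: real assume "0 < e"
    have eq: "(LINT t|lborel. norm (s m t - s n t)) = (LINT t:{0..<real N}|lborel.
        norm (dyadic_slope g m (dyadic_index m t) - dyadic_slope g n (dyadic_index n t)))" for m n
      unfolding set_lebesgue_integral_def
      by (rule Bochner_Integration.integral_cong) (auto simp: s_def D_def split: split_indicator)
    show "\<exists>K. \<forall>i\<ge>K. \<forall>j\<ge>K. (LINT t|lborel. norm (s i t - s j t)) < e"
      unfolding eq by (rule dyadic_slope_L1_Cauchy[OF par C \<open>0 < e\<close>])
  qed blast
  define w where "w t = lim (\<lambda>i. s (r i) t)" for t
  \<comment> \<open>Cutting off the exceptional null set makes the bound hold everywhere.\<close>
  define v where "v t = (if norm (w t) \<le> C then w t else 0)" for t
  have sm [measurable]: "s n \<in> borel_measurable borel" for n unfolding s_def by measurable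
  have wm [measurable]: "w \<in> borel_measurable borel"
    unfolding w_def by (rule borel_measurable_lim_metric) measurable
  have vm [measurable]: "v \<in> borel_measurable borel" unfolding v_def by measurable
  have vC: "norm (v t) \<le> C" for t using C0 by (simp add: v_def)
  have sv: "AE t in lborel. (\<lambda>i. s (r i) t) \<longlonglongrightarrow> v t"
    using r(2)
  proof eventually_elim
    case (elim t)
    then have l: "(\<lambda>i. s (r i) t) \<longlonglongrightarrow> w t"
      unfolding w_def using Cauchy_convergent_iff convergent_LIMSEQ_iff by blast
    have "norm (w t) \<le> C"
      by (rule LIMSEQ_le_const2[OF tendsto_norm[OF l]])
        (use DC C0 in \<open>auto simp: s_def split: split_indicator intro!: exI[of _ 0]\<close>)
    then show ?case using l by (simp add: v_def)
  qed
  have vint: "set_integrable lborel {a..<b} v" for a b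
    unfolding set_integrable_def
  proof (rule Bochner_Integration.integrable_bound)
    show "integrable lborel (\<lambda>t. indicat_real {a..<b} t * C)"
      by (intro integrable_mult_left integrable_real_indicator) (auto simp: emeasure_lborel_Ico_less_top)
    show "AE x in lborel. norm (indicat_real {a..<b} x *\<^sub>R v x) \<le> norm (indicat_real {a..<b} x * C)"
      using vC C0 by (auto split: split_indicator)
  qed measurable
  have dy: "(LINT t:{0..<real k / 2 ^ p}|lborel. v t) = g (real k / 2 ^ p) - g 0"
    if k: "real k / 2 ^ p \<le> N" for k p
  proof -
    let ?A = "{0..<real k / 2 ^ p}"
    have "(\<lambda>i. LINT t|lborel. indicat_real ?A t *\<^sub>R s (r i) t) \<longlonglongrightarrow> (LINT t|lborel. indicat_real ?A t *\<^sub>R v t)"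
    proof (rule integral_dominated_convergence)
      show "integrable lborel (\<lambda>t. indicat_real ?A t * C)" by simp
      show "AE x in lborel. (\<lambda>i. indicat_real ?A x *\<^sub>R s (r i) x) \<longlonglongrightarrow> indicat_real ?A x *\<^sub>R v x"
        using sv by eventually_elim (intro tendsto_intros)
      show "AE x in lborel. norm (indicat_real ?A x *\<^sub>R s (r i) x) \<le> indicat_real ?A x * C" for i
        using DC C0 by (auto simp: s_def split: split_indicator)
    qed measurable
    moreover have "eventually (\<lambda>i. (LINT t|lborel. indicat_real ?A t *\<^sub>R s (r i) t) = g (real k / 2 ^ p) - g 0) sequentially"
      using eventually_ge_at_top[of p]
    proof eventually_elim
      case (elim i)
      have "i \<le> r i" using r(1) by (rule seq_suble)
      then have pr: "p \<le> r i" using elim by simp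
      define l where "l = k * 2 ^ (r i - p)"
      have kl: "real k / 2 ^ p = real l / 2 ^ r i"
      proof -
        have "(2::real) ^ r i = 2 ^ p * 2 ^ (r i - p)" using pr by (simp add: power_add[symmetric])
        then show ?thesis by (simp add: l_def)
      qed
      have "(LINT t|lborel. indicat_real ?A t *\<^sub>R s (r i) t) = (LINT t:?A|lborel. D (r i) t)"
        unfolding set_lebesgue_integral_def
        by (rule Bochner_Integration.integral_cong) (use k in \<open>auto simp: s_def split: split_indicator\<close>)
      also have "\<dots> = g (real l / 2 ^ r i) - g 0"
        unfolding kl D_def using dyadic_step_integral[of l "r i" "?x (r i)"] dyadic_slope_telescope by metis
      finally show ?case using kl by simp
    qed
    ultimately have "(LINT t|lborel. indicat_real ?A t *\<^sub>R v t) = g (real k / 2 ^ p) - g 0"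
      by (rule LIMSEQ_unique[OF _ tendsto_eventually])
    then show ?thesis by (simp add: set_lebesgue_integral_def)
  qed
  have "(LINT r:{0..<t}|lborel. v r) = g t - g 0" if t: "0 \<le> t" "t < real N" for t
  proof -
    have bd: "norm ((LINT r:{0..<t}|lborel. v r) - (g t - g 0)) \<le> 2 * C * (1 / 2 ^ p)" for p
    proof -
      define k where "k = nat \<lfloor>2 ^ p * t\<rfloor>"
      define d where "d = real k / 2 ^ p"
      have "real k \<le> 2 ^ p * t" "2 ^ p * t < real k + 1" using t(1) unfolding k_def by (simp_all add: of_nat_nat)
      then have dt: "0 \<le> d" "d \<le> t" "t - d \<le> 1 / 2 ^ p"
        unfolding d_def by (simp_all add: pos_divide_le_eq pos_less_divide_eq diff_le_eq
            add_divide_distrib[symmetric] pos_le_divide_eq mult.commute)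
      have "(LINT r:{0..<t}|lborel. v r) = (LINT r:{0..<d}|lborel. v r) + (LINT r:{d..<t}|lborel. v r)"
      proof -
        have "{0..<t} = {0..<d} \<union> {d..<t}" using dt by auto
        then show ?thesis using set_integral_Un[OF _ vint vint, of 0 d d t] by simp
      qed
      also have "(LINT r:{0..<d}|lborel. v r) = g d - g 0" using dy[of k p] dt t by (simp add: d_def)
      finally have eq: "(LINT r:{0..<t}|lborel. v r) - (g t - g 0) = (LINT r:{d..<t}|lborel. v r) + (g d - g t)" by simp
      have "norm (LINT r:{d..<t}|lborel. v r) \<le> C * (t - d)"
      proof -
        have "norm (LINT r:{d..<t}|lborel. v r) \<le> (LINT r|lborel. norm (indicat_real {d..<t} r *\<^sub>R v r))"
          unfolding set_lebesgue_integral_def by (rule integral_norm_bound)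
        also have "\<dots> \<le> (LINT r|lborel. indicat_real {d..<t} r * C)"
        proof (rule integral_mono)
          show "integrable lborel (\<lambda>r. norm (indicat_real {d..<t} r *\<^sub>R v r))"
            using vint unfolding set_integrable_def by (rule integrable_norm)
          show "integrable lborel (\<lambda>r. indicat_real {d..<t} r * C)"
            by (intro integrable_mult_left integrable_real_indicator) (auto simp: emeasure_lborel_Ico_less_top)
        qed (use vC in \<open>auto split: split_indicator\<close>)
        also have "\<dots> = C * (t - d)" using dt by simp
        finally show ?thesis .
      qed
      moreover have "norm (g d - g t) \<le> C * (t - d)" using lipD[of d t] dt by simp
      ultimately have "norm ((LINT r:{0..<t}|lborel. v r) - (g t - g 0)) \<le> 2 * (C * (t - d))"
        unfolding eq by (smt (verit) norm_triangle_ineq)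
      also have "\<dots> \<le> 2 * (C * (1 / 2 ^ p))" using dt C0 by (intro mult_left_mono) auto
      finally show ?thesis by simp
    qed
    have "(\<lambda>p. 2 * C * (1 / 2 ^ p)) \<longlonglongrightarrow> 2 * C * 0"
      by (intro tendsto_intros LIMSEQ_divide_realpow_zero) simp
    then have "norm ((LINT r:{0..<t}|lborel. v r) - (g t - g 0)) \<le> 2 * C * 0"
      by (rule LIMSEQ_le_const) (use bd in auto)
    then show ?thesis by simp
  qed
  then show ?thesis using that vm vC by blast
qed

section \<open>Lebesgue points\<close>

text \<open>Two one-sided statements are combined, the second one being the first for the reflected function.\<close>
lemma lebesgue_points_real:
  fixes f :: "real \<Rightarrow> real"
  assumes f: "\<And>a b. integrable (lebesgue_on {a..b}) f"
  shows "AE t in lebesgue. ((\<lambda>h. (LINT r|lebesgue_on {t-h..t+h}. f r) / h) \<longlongrightarrow> 2 * f t) (at_right 0)"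
proof -
  have fi: "f integrable_on {a..b}" for a b by (rule integrable_on_lebesgue_on[OF f]) simp
  have fi': "(\<lambda>x. f (- x)) integrable_on {a..b}" for a b
    using Henstock_Kurzweil_Integration.integrable_reflect_real[of f "-a" "-b"] fi by simp
  obtain N where N: "negligible N" "\<And>x e. x \<notin> N \<Longrightarrow> 0 < e \<Longrightarrow> \<exists>d>0. \<forall>h. 0 < h \<and> h < d \<longrightarrow>
      norm (integral {x..x+h} f / h - f x) < e"
    using integrable_ccontinuous_explicit[of f] fi by (auto simp: divide_inverse mult.commute)
  obtain N' where N': "negligible N'" "\<And>x e. x \<notin> N' \<Longrightarrow> 0 < e \<Longrightarrow> \<exists>d>0. \<forall>h. 0 < h \<and> h < d \<longrightarrow>
      norm (integral {x..x+h} (\<lambda>x. f (- x)) / h - f (- x)) < e"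
    using integrable_ccontinuous_explicit[of "\<lambda>x. f (- x)"] fi' by (auto simp: divide_inverse mult.commute)
  have "negligible (uminus ` N')"
    by (rule negligible_differentiable_image_negligible[OF _ N'(1)])
      (auto intro!: derivative_intros simp: differentiable_on_def)
  with N(1) have "N \<union> uminus ` N' \<in> null_sets lebesgue"
    by (simp add: negligible_iff_null_sets[symmetric])
  then have "AE t in lebesgue. t \<notin> N \<union> uminus ` N'" by (rule AE_not_in)
  then show ?thesis
  proof eventually_elim
    case (elim t)
    then have t: "t \<notin> N" "- t \<notin> N'" by (auto simp: image_iff)
    show ?case
    proof (rule tendstoI)
      fix e :: real assume "0 < e"
      then have e: "0 < e / 2" by simp
      obtain d1 where d1: "d1 > 0" "\<And>h. 0 < h \<Longrightarrow> h < d1 \<Longrightarrow> norm (integral {t..t+h} f / h - f t) < e / 2"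
        using N(2)[OF t(1) e] by blast
      obtain d2 where d2: "d2 > 0" "\<And>h. 0 < h \<Longrightarrow> h < d2 \<Longrightarrow>
          norm (integral {-t..-t+h} (\<lambda>x. f (- x)) / h - f t) < e / 2"
        using N'(2)[OF t(2) e] by auto
      have "dist ((LINT r|lebesgue_on {t-h..t+h}. f r) / h) (2 * f t) < e" if h: "0 < h" "h < min d1 d2" for h
      proof -
        have "(LINT r|lebesgue_on {t-h..t+h}. f r) = integral {t-h..t+h} f"
          by (rule lebesgue_integral_eq_integral[OF f]) simp
        also have "\<dots> = integral {t-h..t} f + integral {t..t+h} f"
          by (rule Henstock_Kurzweil_Integration.integral_combine[symmetric]) (use h fi in auto)
        also have "integral {t-h..t} f = integral {-t..-t+h} (\<lambda>x. f (- x))"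
          using Henstock_Kurzweil_Integration.integral_reflect_real[of t "t - h" f] by (simp add: algebra_simps)
        finally have "(LINT r|lebesgue_on {t-h..t+h}. f r) / h
          = integral {-t..-t+h} (\<lambda>x. f (- x)) / h + integral {t..t+h} f / h" by (simp add: add_divide_distrib)
        moreover have "\<bar>integral {t..t+h} f / h - f t\<bar> < e / 2" using d1(2)[of h] h by simp
        moreover have "\<bar>integral {-t..-t+h} (\<lambda>x. f (- x)) / h - f t\<bar> < e / 2" using d2(2)[of h] h by simp
        ultimately show ?thesis unfolding dist_real_def by linarith
      qed
      then show "\<forall>\<^sub>F h in at_right 0. dist ((LINT r|lebesgue_on {t-h..t+h}. f r) / h) (2 * f t) < e"
        unfolding eventually_at_right_field using d1(1) d2(1) by (metis min_less_iff_conj)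
    qed
  qed
qed

text \<open>For fixed \<open>d\<close> the scalar case applies to \<open>|f - d|\<close>. Letting \<open>d\<close> range over a countable dense set
  keeps the exceptional set null, and some \<open>d\<close> is close to \<open>f t\<close>.\<close>
lemma lebesgue_points:
  fixes f :: "real \<Rightarrow> 'b::{banach, second_countable_topology}"
  assumes f: "\<And>a b. integrable (lebesgue_on {a..b}) f"
  shows "AE t in lebesgue. ((\<lambda>h. (LINT r|lebesgue_on {t-h..t+h}. norm (f r - f t)) / h) \<longlongrightarrow> 0) (at_right 0)"
proof -
  obtain D :: "'b set" where D: "countable D" "\<And>X. open X \<Longrightarrow> X \<noteq> {} \<Longrightarrow> \<exists>d\<in>D. d \<in> X"
    using countable_dense_setE by blast
  have fd: "integrable (lebesgue_on {a..b}) (\<lambda>r. norm (f r - d))" for a b d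
    by (intro integrable_norm Bochner_Integration.integrable_diff f) simp
  have "AE t in lebesgue. \<forall>d\<in>D. ((\<lambda>h. (LINT r|lebesgue_on {t-h..t+h}. norm (f r - d)) / h)
      \<longlongrightarrow> 2 * norm (f t - d)) (at_right 0)"
    using lebesgue_points_real[OF fd] D(1) by (simp add: AE_ball_countable)
  then show ?thesis
  proof eventually_elim
    case (elim t)
    show ?case
    proof (rule tendstoI)
      fix e :: real assume e: "0 < e"
      obtain d where d: "d \<in> D" "norm (f t - d) < e / 8"
        using D(2)[of "ball (f t) (e / 8)"] e by (auto simp: dist_norm)
      have "\<forall>\<^sub>F h in at_right 0. (LINT r|lebesgue_on {t-h..t+h}. norm (f r - d)) / h < e / 2"
      proof (rule order_tendstoD(2))
        show "2 * norm (f t - d) < e / 2" using d(2) norm_ge_zero[of "f t - d"] e by linarith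
      qed (use elim d in blast)
      moreover have "\<forall>\<^sub>F h in at_right (0::real). 0 < h" by (rule eventually_at_right_less)
      ultimately show "\<forall>\<^sub>F h in at_right 0. dist ((LINT r|lebesgue_on {t-h..t+h}. norm (f r - f t)) / h) 0 < e"
      proof eventually_elim
        case (elim h)
        have "(LINT r|lebesgue_on {t-h..t+h}. norm (f r - f t))
          \<le> (LINT r|lebesgue_on {t-h..t+h}. norm (f r - d) + e / 8)"
        proof (rule integral_mono)
          show "norm (f r - f t) \<le> norm (f r - d) + e / 8" for r
            using norm_triangle_ineq[of "f r - d" "d - f t"] d(2) by (simp add: norm_minus_commute)
        qed (use fd in simp_all)
        also have "\<dots> = (LINT r|lebesgue_on {t-h..t+h}. norm (f r - d)) + 2 * h * (e / 8)"
          using fd elim by (subst Bochner_Integration.integral_add) (simp_all add: measure_restrict_space)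
        finally have "(LINT r|lebesgue_on {t-h..t+h}. norm (f r - f t)) / h
          \<le> (LINT r|lebesgue_on {t-h..t+h}. norm (f r - d)) / h + e / 4"
          using elim by (simp add: field_simps)
        moreover have "0 \<le> (LINT r|lebesgue_on {t-h..t+h}. norm (f r - f t)) / h"
          using elim by (intro divide_nonneg_pos integral_nonneg) auto
        ultimately show ?case using elim e by (simp add: dist_real_def)
      qed
    qed
  qed
qed

lemma integral_lebesgue_on_Icc_borel:
  fixes v :: "real \<Rightarrow> 'b::{banach, second_countable_topology}"
  assumes [measurable]: "v \<in> borel_measurable borel"
  shows "(LINT r|lebesgue_on {a..b}. v r) = (LINT r:{a..<b}|lborel. v r)"
proof -
  have "(LINT r|lebesgue_on {a..b}. v r) = (LINT r|lebesgue. indicat_real {a..b} r *\<^sub>R v r)"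
    by (rule integral_restrict_space) simp
  also have "\<dots> = (LINT r|lborel. indicat_real {a..b} r *\<^sub>R v r)"
    by (rule integral_completion) measurable
  also have "\<dots> = (LINT r|lborel. indicat_real {a..<b} r *\<^sub>R v r)"
    using AE_lborel_singleton[of b] by (intro integral_cong_AE) (auto split: split_indicator)
  finally show ?thesis by (simp add: set_lebesgue_integral_def)
qed

lemma integrable_lebesgue_on_bounded:
  fixes v :: "real \<Rightarrow> 'b::{banach, second_countable_topology}"
  assumes "v \<in> borel_measurable (lebesgue_on {a..b})" "\<And>t. t \<in> {a..b} \<Longrightarrow> norm (v t) \<le> C"
  shows "integrable (lebesgue_on {a..b}) v"
proof -
  interpret finite_measure "lebesgue_on {a..b}" by (rule finite_measure_lebesgue_on) simp
  show ?thesis by (rule integrable_const_bound[of _ C]) (use assms in auto)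
qed

lemma borel_imp_lebesgue_on_measurable:
  "f \<in> borel_measurable borel \<Longrightarrow> f \<in> borel_measurable (lebesgue_on S)"
  by (intro measurable_restrict_space1 measurable_completion) simp

text \<open>An indefinite integral is differentiable at every Lebesgue point of its integrand. The parallelogram
  law is an assumption because the lemma serves both for the Hilbert space and for real functions.\<close>
lemma lipschitz_AE_differentiable:
  fixes g :: "real \<Rightarrow> 'b::{banach, second_countable_topology}"
  assumes par: "\<And>x y::'b. (norm (x + y))\<^sup>2 + (norm (x - y))\<^sup>2 = 2 * (norm x)\<^sup>2 + 2 * (norm y)\<^sup>2"
    and lip: "C-lipschitz_on {0..T} g" and T: "0 \<le> T"
  obtains v where "v \<in> borel_measurable borel" "\<And>t. norm (v t) \<le> C"
    "AE t in lebesgue_on {0..T}. (g has_vector_derivative v t) (at t)"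
    "(LINT t|lebesgue_on {0..T}. v t) = g T - g 0"
proof -
  define c where "c t = max 0 (min T t)" for t :: real
  have cl: "1-lipschitz_on UNIV c"
    by (rule lipschitz_onI) (auto simp: c_def dist_real_def)
  have "(C * 1)-lipschitz_on UNIV (g \<circ> c)"
  proof (rule lipschitz_on_compose[OF cl])
    show "C-lipschitz_on (range c) g"
      by (rule lipschitz_on_subset[OF lip]) (use T in \<open>auto simp: c_def\<close>)
  qed
  then have lip': "C-lipschitz_on UNIV (\<lambda>t. g (c t))" by (simp add: o_def)
  obtain N :: nat where N: "T < real N" using reals_Archimedean2 by blast
  obtain v where v [measurable]: "v \<in> borel_measurable borel" and vC: "\<And>t. norm (v t) \<le> C"
    and vi: "\<And>t. 0 \<le> t \<Longrightarrow> t < real N \<Longrightarrow> (LINT r:{0..<t}|lborel. v r) = g (c t) - g (c 0)"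
    using lipschitz_indefinite_integral[OF par lip', of N] by blast
  have vint: "integrable (lebesgue_on {a..b}) v" for a b
    using vC by (intro integrable_lebesgue_on_bounded[of _ _ _ C] borel_imp_lebesgue_on_measurable) auto
  have vint': "set_integrable lborel {a..<b} v" for a b
    unfolding set_integrable_def
  proof (rule Bochner_Integration.integrable_bound)
    show "integrable lborel (\<lambda>t. indicat_real {a..<b} t * C)"
      by (intro integrable_mult_left integrable_real_indicator) (auto simp: emeasure_lborel_Ico_less_top)
    show "AE x in lborel. norm (indicat_real {a..<b} x *\<^sub>R v x) \<le> norm (indicat_real {a..<b} x * C)"
      using vC lipschitz_on_nonneg[OF lip] by (auto split: split_indicator)
  qed measurable
  have ftc: "(LINT r|lebesgue_on {s..t}. v r) = g t - g s" if "0 \<le> s" "s \<le> t" "t \<le> T" for s t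
  proof -
    have "{0..<t} = {0..<s} \<union> {s..<t}" using that by auto
    then have "(LINT r:{0..<t}|lborel. v r) = (LINT r:{0..<s}|lborel. v r) + (LINT r:{s..<t}|lborel. v r)"
      using set_integral_Un[OF _ vint' vint', of 0 s s t] by simp
    moreover have "c t = t" "c s = s" using that by (auto simp: c_def)
    ultimately show ?thesis using vi[of s] vi[of t] that N by (simp add: integral_lebesgue_on_Icc_borel)
  qed
  have "AE t in lebesgue_on {0..T}. (g has_vector_derivative v t) (at t)"
  proof -
    have "AE t in lebesgue. t \<noteq> 0" "AE t in lebesgue. t \<noteq> T"
      using AE_lborel_singleton AE_completion by blast+
    then have "AE t in lebesgue. t \<in> {0..T} \<longrightarrow> (g has_vector_derivative v t) (at t)"
      using lebesgue_points[OF vint]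
    proof eventually_elim
      case (elim t)
      define \<omega> where "\<omega> h = (LINT r|lebesgue_on {t-h..t+h}. norm (v r - v t))" for h
      show ?case
      proof
        assume "t \<in> {0..T}"
        with elim have t: "0 < t" "t < T" by auto
        have nint: "integrable (lebesgue_on {a..b}) (\<lambda>r. norm (v r - v t))" for a b
          by (intro integrable_norm Bochner_Integration.integrable_diff vint) simp
        have half: "norm (g b - g a - (b - a) *\<^sub>R v t) \<le> \<omega> h"
          if ab: "0 \<le> a" "a \<le> b" "b \<le> T" "t - h \<le> a" "b \<le> t + h" for a b h
        proof -
          have "(LINT r|lebesgue_on {a..b}. v r - v t) = g b - g a - (b - a) *\<^sub>R v t"
            using ab ftc[of a b] by (subst Bochner_Integration.integral_diff) (use vint in \<open>auto simp: measure_restrict_space\<close>)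
          then have "norm (g b - g a - (b - a) *\<^sub>R v t) \<le> (LINT r|lebesgue_on {a..b}. norm (v r - v t))"
            using integral_norm_bound by metis
          also have "\<dots> \<le> \<omega> h" unfolding \<omega>_def
            by (rule integral_mono_lebesgue_on_AE) (use nint ab in auto)
          finally show ?thesis .
        qed
        have ev: "\<forall>\<^sub>F y in at t. 0 < y \<and> y < T"
          using t by (intro eventually_conj order_tendstoD[OF tendsto_ident_at])
        have "((\<lambda>y. norm (g y - g t - (y - t) *\<^sub>R v t) / norm (y - t)) \<longlongrightarrow> 0) (at t)"
        proof (rule tendsto_sandwich[OF _ _ tendsto_const])
          have "filterlim (\<lambda>y. \<bar>y - t\<bar>) (at_right 0) (at t)"
            unfolding filterlim_at
            by (auto intro!: tendsto_eq_intros simp: eventually_at_filter)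
          with elim(3) show "((\<lambda>y. \<omega> \<bar>y - t\<bar> / \<bar>y - t\<bar>) \<longlongrightarrow> 0) (at t)"
            unfolding \<omega>_def by (rule filterlim_compose)
          show "\<forall>\<^sub>F y in at t. norm (g y - g t - (y - t) *\<^sub>R v t) / norm (y - t) \<le> \<omega> \<bar>y - t\<bar> / \<bar>y - t\<bar>"
            using ev
          proof eventually_elim
            case (elim y)
            have "norm (g y - g t - (y - t) *\<^sub>R v t) \<le> \<omega> \<bar>y - t\<bar>"
            proof (cases "t \<le> y")
              case True
              then show ?thesis using half[of t y "\<bar>y - t\<bar>"] t elim by simp
            next
              case False
              have "g y - g t - (y - t) *\<^sub>R v t = - (g t - g y - (t - y) *\<^sub>R v t)"
                by (simp add: algebra_simps)
              then show ?thesis using half[of y t "\<bar>y - t\<bar>"] t elim False by (simp only: norm_minus_cancel) auto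
            qed
            then show ?case by (simp add: divide_right_mono)
          qed
        qed auto
        then show "(g has_vector_derivative v t) (at t)"
          unfolding has_vector_derivative_def has_derivative_iff_norm
          by (auto simp: bounded_linear_scaleR_left)
      qed
    qed
    then show ?thesis by (simp add: AE_restrict_space_iff)
  qed
  then show ?thesis using that v vC ftc[of 0 T] T by blast
qed

section \<open>Mollification on an interval\<close>

text \<open>Completeness makes every function measurable that agrees almost everywhere with a measurable one;
  integrands are only known almost everywhere below.\<close>
lemma complete_measure_lebesgue_on:
  assumes S: "S \<in> sets lebesgue" shows "complete_measure (lebesgue_on S)"
proof
  fix A B :: "'a set" assume AB: "B \<subseteq> A" "A \<in> null_sets (lebesgue_on S)"
  have "A \<in> null_sets lebesgue" "A \<subseteq> S" using AB(2) S by (auto simp: null_sets_restrict_space)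
  then have "B \<in> sets lebesgue" "B \<subseteq> S" using AB(1) completion.complete[of B A] by auto
  then show "B \<in> sets (lebesgue_on S)" using S by (auto simp: sets_restrict_space_iff)
qed

lemma measurable_lebesgue_on_AE:
  assumes S: "S \<in> sets lebesgue" and f: "f \<in> borel_measurable (lebesgue_on S)"
    and ae: "AE x in lebesgue_on S. f x = g x"
  shows "g \<in> borel_measurable (lebesgue_on S)"
proof (rule measurableI)
  interpret complete_measure "lebesgue_on S" by (rule complete_measure_lebesgue_on[OF S])
  fix A :: "'b set" assume A: "A \<in> sets borel"
  show "g -` A \<inter> space (lebesgue_on S) \<in> sets (lebesgue_on S)"
  proof (rule in_sets_AE)
    show "f -` A \<inter> space (lebesgue_on S) \<in> sets (lebesgue_on S)" by (rule measurable_sets[OF f A])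
    show "AE x in lebesgue_on S. x \<in> f -` A \<inter> space (lebesgue_on S) \<longleftrightarrow> x \<in> g -` A \<inter> space (lebesgue_on S)"
      using ae by eventually_elim auto
  qed auto
qed simp

lemma measurable_lebesgue_on_AE_limit:
  fixes f :: "nat \<Rightarrow> 'a::euclidean_space \<Rightarrow> 'b::{banach, second_countable_topology}"
  assumes S: "S \<in> sets lebesgue" and f: "\<And>n. f n \<in> borel_measurable (lebesgue_on S)"
    and lim: "AE x in lebesgue_on S. (\<lambda>n. f n x) \<longlonglongrightarrow> g x"
  shows "g \<in> borel_measurable (lebesgue_on S)"
proof (rule measurable_lebesgue_on_AE[OF S])
  show "(\<lambda>x. lim (\<lambda>n. f n x)) \<in> borel_measurable (lebesgue_on S)"
    by (rule borel_measurable_lim_metric) (rule f)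
  show "AE x in lebesgue_on S. lim (\<lambda>n. f n x) = g x"
    using lim by eventually_elim (rule limI)
qed

lemma integral_cong_AE_lebesgue_on:
  fixes f g :: "'a::euclidean_space \<Rightarrow> 'b::{banach, second_countable_topology}"
  assumes S: "S \<in> sets lebesgue" and f: "f \<in> borel_measurable (lebesgue_on S)"
    and ae: "AE x in lebesgue_on S. f x = g x"
  shows "integral\<^sup>L (lebesgue_on S) f = integral\<^sup>L (lebesgue_on S) g"
  by (rule integral_cong_AE[OF f measurable_lebesgue_on_AE[OF S f ae] ae])

lemma continuous_on_imp_measurable_lebesgue_on:
  assumes "continuous_on S f" shows "f \<in> borel_measurable (lebesgue_on S)"
proof -
  have "f \<in> borel_measurable (restrict_space borel S)"
    by (rule borel_measurable_continuous_on_restrict[OF assms])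
  moreover have "(\<lambda>x. x) \<in> lebesgue_on S \<rightarrow>\<^sub>M restrict_space borel S"
    by (intro measurable_restrict_space3 measurable_completion) auto
  ultimately show ?thesis using measurable_compose by fastforce
qed

text \<open>For simple \<open>y\<close> only countably many functions \<open>\<lambda>t. K t u\<close> are involved; continuity in \<open>u\<close> carries this
  over to limits of simple functions.\<close>
lemma measurable_Caratheodory:
  fixes K :: "'a \<Rightarrow> 'b::{second_countable_topology, banach} \<Rightarrow> 'c::metric_space"
  assumes K: "\<And>u. (\<lambda>t. K t u) \<in> borel_measurable M"
    and cont: "\<And>t. t \<in> space M \<Longrightarrow> continuous_on UNIV (K t)"
    and y: "y \<in> borel_measurable M"
  shows "(\<lambda>t. K t (y t)) \<in> borel_measurable M"
proof -
  obtain F where F: "\<And>i. simple_function M (F i)" "\<And>x. x \<in> space M \<Longrightarrow> (\<lambda>i. F i x) \<longlonglongrightarrow> y x"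
    using borel_measurable_implies_sequence_metric[OF y, of 0] by blast
  show ?thesis
  proof (rule borel_measurable_LIMSEQ_metric)
    show "(\<lambda>t. K t (F i t)) \<in> borel_measurable M" for i
    proof (rule measurable_compose_countable'[where I = "F i ` space M" and f = "\<lambda>u t. K t u"])
      show "countable (F i ` space M)" using F(1) by (simp add: simple_function_def countable_finite)
      show "F i \<in> M \<rightarrow>\<^sub>M count_space (F i ` space M)"
        using F(1)[of i] unfolding simple_function_def by (intro measurable_count_space_eq2[THEN iffD2]) auto
    qed (rule K)
    show "(\<lambda>i. K t (F i t)) \<longlonglongrightarrow> K t (y t)" if "t \<in> space M" for t
      by (rule continuous_on_tendsto_compose[OF cont[OF that] F(2)[OF that]]) auto
  qed
qed

lemma measurable_cinner:
  assumes "f \<in> borel_measurable M" "g \<in> borel_measurable M"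
  shows "(\<lambda>t. cinner (f t) (g t :: 'h::{complex_hilbert_space, second_countable_topology})) \<in> borel_measurable M"
  by (rule borel_measurable_continuous_Pair[OF assms])
    (intro bounded_bilinear.continuous_on[OF bounded_bilinear_cinner] continuous_intros)

text \<open>A quadratic remainder, uniform in a parameter, passes through an integral over this parameter.\<close>
lemma has_vector_derivative_quadratic:
  fixes f :: "real \<Rightarrow> 'b::real_normed_vector"
  assumes a: "0 < a" and q: "\<And>h. \<bar>h\<bar> \<le> a \<Longrightarrow> norm (f (t + h) - f t - h *\<^sub>R d) \<le> K * h\<^sup>2"
  shows "(f has_vector_derivative d) (at t)"
proof -
  have "((\<lambda>y. norm (f y - f t - (y - t) *\<^sub>R d) / norm (y - t)) \<longlongrightarrow> 0) (at t)"
  proof (rule tendsto_sandwich[OF _ _ tendsto_const])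
    show "((\<lambda>y. K * \<bar>y - t\<bar>) \<longlongrightarrow> 0) (at t)" by (auto intro!: tendsto_eq_intros)
    have "\<forall>\<^sub>F y in at t. y \<noteq> t \<and> \<bar>y - t\<bar> < a"
      unfolding eventually_at using a by (auto simp: dist_real_def intro!: exI[of _ a])
    then show "\<forall>\<^sub>F y in at t. norm (f y - f t - (y - t) *\<^sub>R d) / norm (y - t) \<le> K * \<bar>y - t\<bar>"
    proof eventually_elim
      case (elim y)
      then have "norm (f y - f t - (y - t) *\<^sub>R d) \<le> K * (y - t)\<^sup>2" using q[of "y - t"] by simp
      then have "norm (f y - f t - (y - t) *\<^sub>R d) \<le> K * \<bar>y - t\<bar> * \<bar>y - t\<bar>"
        by (simp add: power2_eq_square)
      then show ?case using elim by (simp add: divide_le_eq)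
    qed
  qed auto
  then show ?thesis
    unfolding has_vector_derivative_def has_derivative_iff_norm by (auto simp: bounded_linear_scaleR_left)
qed

text \<open>A bump of class \<open>C\<^sup>1\<close> and integral \<open>1\<close>, supported in \<open>[0,\<delta>]\<close>. The support lies to one side so that
  \<open>\<lambda>r. mol \<delta> (r - t)\<close> vanishes at \<open>0\<close>, hence is an admissible test function, for every \<open>t \<ge> 0\<close>.\<close>
definition mol :: "real \<Rightarrow> real \<Rightarrow> real" where
  "mol \<delta> s = 30 / \<delta> ^ 5 * (max 0 (s * (\<delta> - s)))\<^sup>2"

definition mol_deriv :: "real \<Rightarrow> real \<Rightarrow> real" where
  "mol_deriv \<delta> s = 60 / \<delta> ^ 5 * max 0 (s * (\<delta> - s)) * (\<delta> - 2 * s)"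

lemma mol_nonneg: "0 < \<delta> \<Longrightarrow> 0 \<le> mol \<delta> s"
  by (simp add: mol_def)

lemma mol_eq_0: "0 < \<delta> \<Longrightarrow> s \<le> 0 \<or> \<delta> \<le> s \<Longrightarrow> mol \<delta> s = 0"
  by (subgoal_tac "s * (\<delta> - s) \<le> 0") (auto simp: mol_def mult_le_0_iff)

lemma bump_le: "s * (\<delta> - s) \<le> \<delta>\<^sup>2 / (4::real)"
proof -
  have "0 \<le> (s - \<delta> / 2)\<^sup>2" by simp
  then show ?thesis by (simp add: power2_eq_square field_simps)
qed

lemma mol_le: assumes d: "0 < \<delta>" shows "mol \<delta> s \<le> 2 / \<delta>"
proof -
  have "max 0 (s * (\<delta> - s)) \<le> \<delta>\<^sup>2 / 4" using bump_le[of s \<delta>] by (intro max.boundedI) auto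
  then have "(max 0 (s * (\<delta> - s)))\<^sup>2 \<le> (\<delta>\<^sup>2 / 4)\<^sup>2" by (intro power_mono) auto
  then have "mol \<delta> s \<le> 30 / \<delta> ^ 5 * (\<delta>\<^sup>2 / 4)\<^sup>2"
    unfolding mol_def using d by (intro mult_left_mono) auto
  also have "\<dots> \<le> 2 / \<delta>" using d by (simp add: field_simps power2_eq_square eval_nat_numeral)
  finally show ?thesis .
qed

text \<open>The square of the positive part is differentiable with quadratic remainder, and its argument here is
  a quadratic polynomial.\<close>
lemma mol_quadratic:
  assumes d: "0 < \<delta>" and s: "\<bar>s\<bar> \<le> a" and h: "\<bar>h\<bar> \<le> a"
  shows "\<bar>mol \<delta> (s + h) - mol \<delta> s - h * mol_deriv \<delta> s\<bar>
    \<le> 30 / \<delta> ^ 5 * ((\<delta> + 3 * a)\<^sup>2 + \<delta>\<^sup>2 / 2) * h\<^sup>2"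
proof -
  define q where "q = s * (\<delta> - s)"
  define k where "k = h * (\<delta> - 2 * s) - h\<^sup>2"
  have qk: "(s + h) * (\<delta> - (s + h)) = q + k" by (simp add: q_def k_def power2_eq_square algebra_simps)
  have P: "\<bar>(max 0 (q + k))\<^sup>2 - (max 0 q)\<^sup>2 - 2 * k * max 0 q\<bar> \<le> k\<^sup>2"
  proof (cases "q \<ge> 0")
    case True
    show ?thesis
    proof (cases "q + k \<ge> 0")
      case False
      then have "0 \<le> q * (- q - 2 * k)" using True by (intro mult_nonneg_nonneg) auto
      moreover have "0 \<le> (k + q)\<^sup>2" by simp
      moreover have "(max 0 (q + k))\<^sup>2 - (max 0 q)\<^sup>2 - 2 * k * max 0 q = - (q * q) - 2 * k * q"
        using True False by (simp add: power2_eq_square)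
      ultimately show ?thesis by (simp add: power2_eq_square algebra_simps)
    qed (use True in \<open>simp add: power2_eq_square algebra_simps\<close>)
  next
    case False
    then show ?thesis
    proof (cases "q + k \<ge> 0")
      case True
      then have "(q + k)\<^sup>2 \<le> k\<^sup>2" using False by (intro power_mono) auto
      then show ?thesis using False True by simp
    qed simp
  qed
  have k: "\<bar>k\<bar> \<le> \<bar>h\<bar> * (\<delta> + 3 * a)"
  proof -
    have "k = h * (\<delta> - 2 * s - h)" by (simp add: k_def power2_eq_square algebra_simps)
    then have "\<bar>k\<bar> = \<bar>h\<bar> * \<bar>\<delta> - 2 * s - h\<bar>" by (simp add: abs_mult)
    also have "\<dots> \<le> \<bar>h\<bar> * (\<delta> + 3 * a)" using d s h by (intro mult_left_mono) auto
    finally show ?thesis .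
  qed
  then have "k\<^sup>2 \<le> (\<bar>h\<bar> * (\<delta> + 3 * a))\<^sup>2"
    using power_mono[OF k abs_ge_zero, of 2] by (simp only: power2_abs)
  then have k2: "k\<^sup>2 \<le> (\<delta> + 3 * a)\<^sup>2 * h\<^sup>2" by (simp add: power_mult_distrib mult.commute)
  have q: "0 \<le> max 0 q" "max 0 q \<le> \<delta>\<^sup>2 / 4"
    unfolding q_def using max.boundedI[OF _ bump_le[of s \<delta>], of 0] by auto
  define c where "c = 30 / \<delta> ^ 5"
  have m: "mol \<delta> (s + h) = c * (max 0 (q + k))\<^sup>2" "mol \<delta> s = c * (max 0 q)\<^sup>2"
    "mol_deriv \<delta> s = 2 * c * max 0 q * (\<delta> - 2 * s)"
    unfolding mol_def mol_deriv_def qk c_def q_def by simp_all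
  have "mol \<delta> (s + h) - mol \<delta> s - h * mol_deriv \<delta> s
    = 30 / \<delta> ^ 5 * (((max 0 (q + k))\<^sup>2 - (max 0 q)\<^sup>2 - 2 * k * max 0 q) - 2 * max 0 q * h\<^sup>2)"
    unfolding m c_def[symmetric] by (simp add: k_def algebra_simps)
  also have "\<bar>\<dots>\<bar> \<le> 30 / \<delta> ^ 5 * ((\<delta> + 3 * a)\<^sup>2 * h\<^sup>2 + \<delta>\<^sup>2 / 2 * h\<^sup>2)"
  proof -
    have "0 \<le> 2 * max 0 q * h\<^sup>2" "2 * max 0 q * h\<^sup>2 \<le> \<delta>\<^sup>2 / 2 * h\<^sup>2"
      using q mult_right_mono[OF q(2), of "2 * h\<^sup>2"] by (auto simp: mult_ac)
    then have "\<bar>((max 0 (q + k))\<^sup>2 - (max 0 q)\<^sup>2 - 2 * k * max 0 q) - 2 * max 0 q * h\<^sup>2\<bar>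
      \<le> (\<delta> + 3 * a)\<^sup>2 * h\<^sup>2 + \<delta>\<^sup>2 / 2 * h\<^sup>2"
      using P k2 by linarith
    then show ?thesis unfolding abs_mult using d by (auto intro!: mult_left_mono simp: divide_right_mono)
  qed
  finally show ?thesis by (simp add: algebra_simps)
qed

lemma mol_has_derivative:
  assumes d: "0 < \<delta>" shows "(mol \<delta> has_real_derivative mol_deriv \<delta> s) (at s)"
proof -
  have "(mol \<delta> has_vector_derivative mol_deriv \<delta> s) (at s)"
  proof (rule has_vector_derivative_quadratic[of "\<bar>s\<bar> + 1"])
    show "norm (mol \<delta> (s + h) - mol \<delta> s - h *\<^sub>R mol_deriv \<delta> s) \<le>
      30 / \<delta> ^ 5 * ((\<delta> + 3 * (\<bar>s\<bar> + 1))\<^sup>2 + \<delta>\<^sup>2 / 2) * h\<^sup>2" if "\<bar>h\<bar> \<le> \<bar>s\<bar> + 1" for h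
      using mol_quadratic[OF d _ that, of s] by simp
  qed auto
  then show ?thesis by (simp add: has_real_derivative_iff_has_vector_derivative)
qed

lemma continuous_on_mol: "continuous_on A (mol \<delta>)"
  unfolding mol_def by (intro continuous_intros)

lemma continuous_on_mol_deriv: "continuous_on A (mol_deriv \<delta>)"
  unfolding mol_deriv_def by (intro continuous_intros)

lemma measurable_mol [measurable]: "mol \<delta> \<in> borel_measurable borel" "mol_deriv \<delta> \<in> borel_measurable borel"
  by (intro borel_measurable_continuous_onI continuous_on_mol continuous_on_mol_deriv)+

lemma mol_deriv_bounded:
  assumes d: "0 < \<delta>" and s: "\<bar>s\<bar> \<le> a"
  shows "\<bar>mol_deriv \<delta> s\<bar> \<le> 60 / \<delta> ^ 5 * (\<delta>\<^sup>2 / 4) * (\<delta> + 2 * a)"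
  unfolding mol_deriv_def abs_mult
  using d s max.boundedI[OF _ bump_le[of s \<delta>], of 0] by (intro mult_mono) auto

lemma nn_integral_mol:
  assumes d: "0 < \<delta>" shows "(\<integral>\<^sup>+ s. ennreal (mol \<delta> s) \<partial>lborel) = 1"
proof -
  define F where "F s = 30 / \<delta> ^ 5 * (\<delta>\<^sup>2 * s ^ 3 / 3 - \<delta> * s ^ 4 / 2 + s ^ 5 / 5)" for s
  have "(\<integral>\<^sup>+ s. ennreal (mol \<delta> s) \<partial>lborel)
    = (\<integral>\<^sup>+ s. ennreal (30 / \<delta> ^ 5 * (s * (\<delta> - s))\<^sup>2) * indicator {0..\<delta>} s \<partial>lborel)"
  proof (rule nn_integral_cong)
    fix s :: real
    show "ennreal (mol \<delta> s) = ennreal (30 / \<delta> ^ 5 * (s * (\<delta> - s))\<^sup>2) * indicator {0..\<delta>} s"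
    proof (cases "0 \<le> s \<and> s \<le> \<delta>")
      case True
      then have "0 \<le> s * (\<delta> - s)" by simp
      then show ?thesis using True by (simp add: mol_def max_def)
    qed (use mol_eq_0[OF d, of s] in \<open>auto split: split_indicator\<close>)
  qed
  also have "\<dots> = ennreal (F \<delta> - F 0)"
  proof (rule nn_integral_FTC_Icc)
    show "DERIV F s :> 30 / \<delta> ^ 5 * (s * (\<delta> - s))\<^sup>2" for s
    proof -
      have "DERIV (\<lambda>s. \<delta>\<^sup>2 * s ^ 3 / 3 - \<delta> * s ^ 4 / 2 + s ^ 5 / 5) s :> \<delta>\<^sup>2 * s\<^sup>2 - 2 * \<delta> * s ^ 3 + s ^ 4"
        by (auto intro!: derivative_eq_intros)
      from DERIV_cmult[OF this, of "30 / \<delta> ^ 5"]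
      have "DERIV F s :> 30 / \<delta> ^ 5 * (\<delta>\<^sup>2 * s\<^sup>2 - 2 * \<delta> * s ^ 3 + s ^ 4)"
        unfolding F_def .
      then show ?thesis by (simp add: power2_eq_square algebra_simps eval_nat_numeral)
    qed
  qed (use d in auto)
  also have "F \<delta> - F 0 = 1" using d by (simp add: F_def field_simps eval_nat_numeral)
  finally show ?thesis by simp
qed

lemma nn_integral_mol_shift:
  assumes d: "0 < \<delta>"
  shows "(\<integral>\<^sup>+ r. ennreal (mol \<delta> (r - t)) \<partial>lborel) = 1" "(\<integral>\<^sup>+ t. ennreal (mol \<delta> (r - t)) \<partial>lborel) = 1"
proof -
  show "(\<integral>\<^sup>+ r. ennreal (mol \<delta> (r - t)) \<partial>lborel) = 1"
    using nn_integral_real_affine[of "\<lambda>s. ennreal (mol \<delta> s)" 1 "-t"] nn_integral_mol[OF d] by simp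
  show "(\<integral>\<^sup>+ t. ennreal (mol \<delta> (r - t)) \<partial>lborel) = 1"
    using nn_integral_real_affine[of "\<lambda>s. ennreal (mol \<delta> s)" "-1" r] nn_integral_mol[OF d] by simp
qed

lemma mol_integrable:
  assumes d: "0 < \<delta>" and f: "integrable (lebesgue_on {0..R}) f"
  shows "integrable (lebesgue_on {0..R}) (\<lambda>r. mol \<delta> (r - t) *\<^sub>R (f r :: 'b::{banach, second_countable_topology}))"
proof (rule Bochner_Integration.integrable_bound)
  show "integrable (lebesgue_on {0..R}) (\<lambda>r. 2 / \<delta> * norm (f r))" using f by simp
  show "(\<lambda>r. mol \<delta> (r - t) *\<^sub>R f r) \<in> borel_measurable (lebesgue_on {0..R})"
    by (rule borel_measurable_scaleR[OF borel_imp_lebesgue_on_measurable borel_measurable_integrable[OF f]])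
      measurable
  show "AE r in lebesgue_on {0..R}. norm (mol \<delta> (r - t) *\<^sub>R f r) \<le> norm (2 / \<delta> * norm (f r))"
  proof (rule AE_I2)
    fix r
    have "mol \<delta> (r - t) * norm (f r) \<le> 2 / \<delta> * norm (f r)" by (rule mult_right_mono[OF mol_le[OF d]]) simp
    then show "norm (mol \<delta> (r - t) *\<^sub>R f r) \<le> norm (2 / \<delta> * norm (f r))"
      using mol_nonneg[OF d, of "r - t"] d by simp
  qed
qed

lemma mol_deriv_integrable:
  assumes d: "0 < \<delta>" and t: "0 \<le> t" "t \<le> R" and f: "integrable (lebesgue_on {0..R}) f"
  shows "integrable (lebesgue_on {0..R}) (\<lambda>r. mol_deriv \<delta> (r - t) *\<^sub>R (f r :: 'b::{banach, second_countable_topology}))"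
proof (rule Bochner_Integration.integrable_bound)
  let ?K = "60 / \<delta> ^ 5 * (\<delta>\<^sup>2 / 4) * (\<delta> + 2 * R)"
  show "integrable (lebesgue_on {0..R}) (\<lambda>r. ?K * norm (f r))" using f by simp
  show "(\<lambda>r. mol_deriv \<delta> (r - t) *\<^sub>R f r) \<in> borel_measurable (lebesgue_on {0..R})"
    by (rule borel_measurable_scaleR[OF borel_imp_lebesgue_on_measurable borel_measurable_integrable[OF f]])
      measurable
  show "AE r in lebesgue_on {0..R}. norm (mol_deriv \<delta> (r - t) *\<^sub>R f r) \<le> norm (?K * norm (f r))"
  proof (rule AE_I2)
    fix r assume "r \<in> space (lebesgue_on {0..R})"
    then have "\<bar>r - t\<bar> \<le> R" using t by auto
    from mol_deriv_bounded[OF d this] have "\<bar>mol_deriv \<delta> (r - t)\<bar> * norm (f r) \<le> ?K * norm (f r)"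
      by (rule mult_right_mono) simp
    then show "norm (mol_deriv \<delta> (r - t) *\<^sub>R f r) \<le> norm (?K * norm (f r))"
      unfolding norm_scaleR real_norm_def by (rule order_trans[OF _ abs_ge_self])
  qed
qed

lemma mol_total_le:
  assumes d: "0 < \<delta>" shows "(LINT r|lebesgue_on {0..R}. mol \<delta> (r - t)) \<le> 1"
proof -
  have i: "integrable lborel (\<lambda>r. mol \<delta> (r - t))"
    using nn_integral_mol_shift(1)[OF d] mol_nonneg[OF d] by (intro integrableI_nonneg) auto
  have e: "(LINT r|lborel. mol \<delta> (r - t)) = 1"
    using nn_integral_mol_shift(1)[OF d, of t] mol_nonneg[OF d] by (subst integral_eq_nn_integral) auto
  have "(LINT r|lebesgue_on {0..R}. mol \<delta> (r - t)) \<le> (LINT r|lebesgue_on UNIV. mol \<delta> (r - t))"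
    using mol_nonneg[OF d] i by (intro integral_mono_lebesgue_on_AE) (auto simp: lebesgue_on_UNIV_eq integrable_completion)
  also have "\<dots> = 1" using e i by (simp add: lebesgue_on_UNIV_eq integral_completion)
  finally show ?thesis .
qed

lemma mol_total_eq:
  assumes d: "0 < \<delta>" and t: "0 \<le> t" "t + \<delta> \<le> R" shows "(LINT r|lebesgue_on {0..R}. mol \<delta> (r - t)) = 1"
proof -
  have "(LINT r|lebesgue_on {0..R}. mol \<delta> (r - t)) = (LINT r|lebesgue. indicat_real {0..R} r *\<^sub>R mol \<delta> (r - t))"
    by (rule integral_restrict_space) simp
  also have "\<dots> = (LINT r|lebesgue. mol \<delta> (r - t))"
    using mol_eq_0[OF d] t by (intro Bochner_Integration.integral_cong) (auto split: split_indicator)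
  also have "\<dots> = (LINT r|lborel. mol \<delta> (r - t))" by (rule integral_completion) measurable
  also have "\<dots> = 1"
    using nn_integral_mol_shift(1)[OF d, of t] mol_nonneg[OF d] by (subst integral_eq_nn_integral) auto
  finally show ?thesis .
qed

text \<open>A weighted mean of \<open>f\<close> over \<open>[t, t + \<delta>]\<close>, where \<open>f\<close> is continued by \<open>0\<close> beyond \<open>R\<close>.\<close>
definition mollify :: "real \<Rightarrow> real \<Rightarrow> (real \<Rightarrow> 'b::{banach, second_countable_topology}) \<Rightarrow> real \<Rightarrow> 'b" where
  "mollify R \<delta> f t = (LINT r|lebesgue_on {0..R}. mol \<delta> (r - t) *\<^sub>R f r)"

lemma norm_mollify_le:
  assumes "0 < \<delta>" shows "norm (mollify R \<delta> f t) \<le> mollify R \<delta> (\<lambda>r. norm (f r)) t"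
proof -
  have "norm (mollify R \<delta> f t) \<le> (LINT r|lebesgue_on {0..R}. norm (mol \<delta> (r - t) *\<^sub>R f r))"
    unfolding mollify_def by (rule integral_norm_bound)
  then show ?thesis using mol_nonneg[OF assms] by (simp add: mollify_def)
qed

lemma mollify_nonneg:
  fixes f :: "real \<Rightarrow> real"
  assumes "0 < \<delta>" "\<And>r. 0 \<le> f r" shows "0 \<le> mollify R \<delta> f t"
  unfolding mollify_def by (rule Bochner_Integration.integral_nonneg) (use mol_nonneg assms in auto)

text \<open>At \<open>R\<close> the mean only sees the continuation by \<open>0\<close>; this is what removes the boundary term at
  \<open>R\<close> in the energy estimate.\<close>
lemma mollify_right_end: "0 < \<delta> \<Longrightarrow> mollify R \<delta> f R = 0"
proof -
  assume d: "0 < \<delta>"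
  have "mollify R \<delta> f R = (LINT r|lebesgue_on {0..R}. 0)"
    unfolding mollify_def by (rule Bochner_Integration.integral_cong) (use mol_eq_0[OF d] in auto)
  then show ?thesis by simp
qed

lemma mollify_has_derivative:
  assumes d: "0 < \<delta>" and t: "0 \<le> t" "t \<le> R" and R: "0 < R" and f: "integrable (lebesgue_on {0..R}) f"
  shows "(mollify R \<delta> f has_vector_derivative - (LINT r|lebesgue_on {0..R}. mol_deriv \<delta> (r - t) *\<^sub>R f r)) (at t)"
proof -
  define K where "K = 30 / \<delta> ^ 5 * ((\<delta> + 3 * R)\<^sup>2 + \<delta>\<^sup>2 / 2)"
  show ?thesis
  proof (rule has_vector_derivative_quadratic[of R])
  let ?M = "lebesgue_on {0..R}"
  fix h :: real assume h: "\<bar>h\<bar> \<le> R"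
  let ?F = "\<lambda>r. (mol \<delta> (r - (t + h)) - mol \<delta> (r - t) - (- h) * mol_deriv \<delta> (r - t)) *\<^sub>R f r"
  have i: "integrable ?M (\<lambda>r. mol \<delta> (r - (t + h)) *\<^sub>R f r)" "integrable ?M (\<lambda>r. mol \<delta> (r - t) *\<^sub>R f r)"
    "integrable ?M (\<lambda>r. h *\<^sub>R (mol_deriv \<delta> (r - t) *\<^sub>R f r))"
    by (intro mol_integrable[OF d f] integrable_scaleR_right mol_deriv_integrable[OF d t f])+
  have F: "?F = (\<lambda>r. mol \<delta> (r - (t + h)) *\<^sub>R f r - mol \<delta> (r - t) *\<^sub>R f r + h *\<^sub>R (mol_deriv \<delta> (r - t) *\<^sub>R f r))"
    by (simp add: algebra_simps)
  have iF: "integrable ?M ?F" unfolding F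
    by (intro Bochner_Integration.integrable_add Bochner_Integration.integrable_diff i)
  have eq: "mollify R \<delta> f (t + h) - mollify R \<delta> f t - h *\<^sub>R - (LINT r|?M. mol_deriv \<delta> (r - t) *\<^sub>R f r)
    = (LINT r|?M. ?F r)"
    unfolding F mollify_def
    by (subst Bochner_Integration.integral_add[OF Bochner_Integration.integrable_diff[OF i(1,2)] i(3)])
       (simp only: Bochner_Integration.integral_diff[OF i(1,2)] Bochner_Integration.integral_scaleR_right
          scaleR_minus_right diff_minus_eq_add)
  have "norm (LINT r|?M. ?F r) \<le> (LINT r|?M. norm (?F r))" by (rule integral_norm_bound)
  also have "\<dots> \<le> (LINT r|?M. K * h\<^sup>2 * norm (f r))"
  proof (rule integral_mono)
    show "integrable ?M (\<lambda>r. norm (?F r))" using iF by (rule integrable_norm)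
    show "integrable ?M (\<lambda>r. K * h\<^sup>2 * norm (f r))" by (intro integrable_mult_right integrable_norm f)
    fix r assume "r \<in> space ?M"
    then have r: "\<bar>r - t\<bar> \<le> R" using t by auto
    have "\<bar>mol \<delta> (r - t + - h) - mol \<delta> (r - t) - - h * mol_deriv \<delta> (r - t)\<bar> \<le> K * (- h)\<^sup>2"
      unfolding K_def by (rule mol_quadratic[OF d r]) (use h in simp)
    then have "\<bar>mol \<delta> (r - (t + h)) - mol \<delta> (r - t) - - h * mol_deriv \<delta> (r - t)\<bar> * norm (f r) \<le> K * h\<^sup>2 * norm (f r)"
      by (intro mult_right_mono) (simp_all only: diff_diff_eq[symmetric] diff_conv_add_uminus[symmetric] power2_minus norm_ge_zero minus_mult_left[symmetric])
    then show "norm (?F r) \<le> K * h\<^sup>2 * norm (f r)" by simp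
  qed
  also have "\<dots> = (K * (LINT r|?M. norm (f r))) * h\<^sup>2" by simp
  finally show "norm (mollify R \<delta> f (t + h) - mollify R \<delta> f t
     - h *\<^sub>R - (LINT r|?M. mol_deriv \<delta> (r - t) *\<^sub>R f r)) \<le> (K * (LINT r|?M. norm (f r))) * h\<^sup>2"
    unfolding eq .
  qed (rule R)
qed

text \<open>The bump is at most \<open>2 / \<delta>\<close>, so the error at a Lebesgue point is controlled by the mean oscillation.\<close>
lemma mollify_AE_tendsto:
  assumes f: "integrable (lebesgue_on {0..R}) (f :: real \<Rightarrow> 'b::{banach, second_countable_topology})"
    and d: "\<And>n. 0 < \<delta> n" "\<delta> \<longlonglongrightarrow> 0"
  shows "AE t in lebesgue_on {0..R}. (\<lambda>n. mollify R (\<delta> n) f t) \<longlonglongrightarrow> f t"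
proof -
  define f0 where "f0 r = (if r \<in> {0..R} then f r else 0)" for r
  have f0: "integrable lebesgue f0" unfolding f0_def
    by (subst Lebesgue_Measure.integrable_restrict_UNIV) (use f in auto)
  have f0i: "integrable (lebesgue_on {a..b}) f0" for a b
    using f0 by (subst integrable_restrict_space) (auto intro!: integrable_mult_indicator)
  have "AE t in lebesgue. t \<noteq> R" using AE_lborel_singleton AE_completion by blast
  then have "AE t in lebesgue. t \<in> {0..R} \<longrightarrow> (\<lambda>n. mollify R (\<delta> n) f t) \<longlonglongrightarrow> f t"
    using lebesgue_points[OF f0i]
  proof eventually_elim
    case (elim t)
    define \<omega> where "\<omega> h = (LINT r|lebesgue_on {t-h..t+h}. norm (f0 r - f0 t))" for h
    show ?case
    proof
      assume "t \<in> {0..R}"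
      with elim have t: "0 \<le> t" "t < R" by auto
      have "\<delta> n \<noteq> 0" for n using d(1)[of n] by simp
      then have "filterlim \<delta> (at_right 0) sequentially" using d by (simp add: filterlim_at)
      with elim(2) have lim: "(\<lambda>n. 2 * (\<omega> (\<delta> n) / \<delta> n)) \<longlonglongrightarrow> 2 * 0"
        unfolding \<omega>_def by (intro tendsto_intros) (rule filterlim_compose)
      have ev: "\<forall>\<^sub>F n in sequentially. \<delta> n < R - t"
        using order_tendstoD(2)[OF d(2), of "R - t"] t by simp
      have "(\<lambda>n. norm (mollify R (\<delta> n) f t - f t)) \<longlonglongrightarrow> 0"
      proof (rule tendsto_sandwich[OF _ _ tendsto_const])
        show "(\<lambda>n. 2 * (\<omega> (\<delta> n) / \<delta> n)) \<longlonglongrightarrow> 0" using lim by simp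
        show "\<forall>\<^sub>F n in sequentially. norm (mollify R (\<delta> n) f t - f t) \<le> 2 * (\<omega> (\<delta> n) / \<delta> n)"
          using ev
        proof eventually_elim
          case (elim n)
          let ?M = "lebesgue_on {0..R}"
          have mi: "integrable ?M (\<lambda>r. mol (\<delta> n) (r - t) *\<^sub>R f r)" "integrable ?M (\<lambda>r. mol (\<delta> n) (r - t) *\<^sub>R f t)"
            by (intro mol_integrable d f; simp)+
          have "integrable ?M (\<lambda>r. mol (\<delta> n) (r - t) *\<^sub>R (1::real))" by (intro mol_integrable d) simp
          then have "(LINT r|?M. mol (\<delta> n) (r - t) *\<^sub>R f t) = f t"
            using mol_total_eq[OF d(1)[of n], of t R] t elim by simp
          then have "mollify R (\<delta> n) f t - f t = (LINT r|?M. mol (\<delta> n) (r - t) *\<^sub>R f r - mol (\<delta> n) (r - t) *\<^sub>R f t)"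
            unfolding mollify_def by (subst Bochner_Integration.integral_diff[OF mi]) simp
          also have "norm \<dots> \<le> (LINT r|?M. norm (mol (\<delta> n) (r - t) *\<^sub>R f r - mol (\<delta> n) (r - t) *\<^sub>R f t))"
            by (rule integral_norm_bound)
          also have "\<dots> = (LINT r|lebesgue. (if r \<in> {0..R} then norm (mol (\<delta> n) (r - t) *\<^sub>R f r - mol (\<delta> n) (r - t) *\<^sub>R f t) else 0))"
            by (rule Lebesgue_Measure.integral_restrict_UNIV[symmetric]) simp
          also have "\<dots> \<le> (LINT r|lebesgue. (if r \<in> {t - \<delta> n..t + \<delta> n} then 2 / \<delta> n * norm (f0 r - f0 t) else 0))"
          proof (rule integral_mono_AE')
            have "integrable (lebesgue_on {t - \<delta> n..t + \<delta> n}) (\<lambda>r. 2 / \<delta> n * norm (f0 r - f0 t))"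
              by (intro integrable_mult_right integrable_norm Bochner_Integration.integrable_diff f0i) simp
            then show "integrable lebesgue (\<lambda>r. if r \<in> {t - \<delta> n..t + \<delta> n} then 2 / \<delta> n * norm (f0 r - f0 t) else 0)"
              by (subst Lebesgue_Measure.integrable_restrict_UNIV) auto
            have "(if r \<in> {0..R} then norm (mol (\<delta> n) (r - t) *\<^sub>R f r - mol (\<delta> n) (r - t) *\<^sub>R f t) else 0)
              \<le> (if r \<in> {t - \<delta> n..t + \<delta> n} then 2 / \<delta> n * norm (f0 r - f0 t) else 0)" for r
            proof (cases "r \<in> {0..R}")
              case True
              have n: "norm (mol (\<delta> n) (r - t) *\<^sub>R f r - mol (\<delta> n) (r - t) *\<^sub>R f t) = mol (\<delta> n) (r - t) * norm (f0 r - f0 t)"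
                using True t mol_nonneg[OF d(1)] by (simp add: f0_def scaleR_diff_right[symmetric])
              show ?thesis
              proof (cases "r \<in> {t - \<delta> n..t + \<delta> n}")
                case True
                then show ?thesis using \<open>r \<in> {0..R}\<close> n mult_right_mono[OF mol_le[OF d(1)[of n]] norm_ge_zero] by simp
              next
                case False
                then have "mol (\<delta> n) (r - t) = 0" using d(1)[of n] by (intro mol_eq_0) auto
                then show ?thesis using False by simp
              qed
            qed (use d(1)[of n] in auto)
            then show "AE r in lebesgue. (if r \<in> {0..R} then norm (mol (\<delta> n) (r - t) *\<^sub>R f r - mol (\<delta> n) (r - t) *\<^sub>R f t) else 0)
              \<le> (if r \<in> {t - \<delta> n..t + \<delta> n} then 2 / \<delta> n * norm (f0 r - f0 t) else 0)" by simp
            show "AE r in lebesgue. 0 \<le> (if r \<in> {t - \<delta> n..t + \<delta> n} then 2 / \<delta> n * norm (f0 r - f0 t) else 0)"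
              using d(1)[of n] by auto
          qed
          also have "\<dots> = 2 / \<delta> n * \<omega> (\<delta> n)"
            unfolding \<omega>_def by (subst Lebesgue_Measure.integral_restrict_UNIV) simp_all
          finally show ?case by simp
        qed
      qed auto
      then show "(\<lambda>n. mollify R (\<delta> n) f t) \<longlonglongrightarrow> f t"
        using tendsto_norm_zero_iff LIM_zero_cancel by blast
    qed
  qed
  then show ?thesis by (simp add: AE_restrict_space_iff)
qed

text \<open>Jensen's inequality bounds the square of the mean by the mean of the squares, and Tonelli's
  theorem integrates the latter, the bump having total mass at most \<open>1\<close>.\<close>
lemma mollify_L2_bound:
  fixes F :: "real \<Rightarrow> real"
  assumes d: "0 < \<delta>" and F: "F \<in> borel_measurable (lebesgue_on {0..R})"
    and F2: "integrable (lebesgue_on {0..R}) (\<lambda>t. (F t)\<^sup>2)" and Fi: "integrable (lebesgue_on {0..R}) F"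
  shows "(\<integral>\<^sup>+ t. ennreal ((mollify R \<delta> F t)\<^sup>2) \<partial>lebesgue_on {0..R}) \<le> ennreal (LINT t|lebesgue_on {0..R}. (F t)\<^sup>2)"
proof -
  let ?M = "lebesgue_on {0..R}"
  have pt: "(mollify R \<delta> F t)\<^sup>2 \<le> (LINT r|?M. mol \<delta> (r - t) * (F r)\<^sup>2)" for t
  proof -
    define a where "a = mollify R \<delta> F t"
    have i: "integrable ?M (\<lambda>r. mol \<delta> (r - t) * (F r)\<^sup>2)" "integrable ?M (\<lambda>r. mol \<delta> (r - t) * F r)"
      "integrable ?M (\<lambda>r. mol \<delta> (r - t))"
      using mol_integrable[OF d F2, of t] mol_integrable[OF d Fi, of t] mol_integrable[OF d, of R "\<lambda>_. 1::real" t] by simp_all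
    have "0 \<le> (LINT r|?M. mol \<delta> (r - t) * (F r - a)\<^sup>2)" using mol_nonneg[OF d] by simp
    also have "\<dots> = (LINT r|?M. mol \<delta> (r - t) * (F r)\<^sup>2 - 2 * a * (mol \<delta> (r - t) * F r) + a\<^sup>2 * mol \<delta> (r - t))"
      by (simp add: power2_eq_square algebra_simps)
    also have "\<dots> = (LINT r|?M. mol \<delta> (r - t) * (F r)\<^sup>2) - 2 * a * a + a\<^sup>2 * (LINT r|?M. mol \<delta> (r - t))"
      using i by (simp add: a_def mollify_def)
    also have "\<dots> \<le> (LINT r|?M. mol \<delta> (r - t) * (F r)\<^sup>2) - 2 * a * a + a\<^sup>2 * 1"
      using mol_total_le[OF d] by (intro add_left_mono mult_left_mono) auto
    finally show ?thesis by (simp add: a_def power2_eq_square)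
  qed
  define H where "H r = indicat_real {0..R} r * (F r)\<^sup>2" for r
  have "H \<in> borel_measurable lebesgue"
  proof -
    have "(\<lambda>r. indicat_real {0..R} r *\<^sub>R (F r)\<^sup>2) \<in> borel_measurable lebesgue"
      using F2 by (subst borel_measurable_restrict_space_iff[symmetric]) auto
    then show ?thesis unfolding H_def by simp
  qed
  then obtain H' where H' [measurable]: "H' \<in> borel_measurable lborel" "AE r in lborel. H r = H' r"
    using completion_ex_borel_measurable_real by blast
  have H'2: "AE r in lebesgue. H r = H' r" using H'(2) by (rule AE_completion)
  let ?I = "\<lambda>t. \<integral>\<^sup>+ r. ennreal (mol \<delta> (r - t)) * ennreal (H' r) \<partial>lborel"
  have ptI: "ennreal ((mollify R \<delta> F t)\<^sup>2) \<le> ?I t" for t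
  proof -
    have ae: "AE r in lebesgue. ennreal (mol \<delta> (r - t) * (F r)\<^sup>2) * indicator {0..R} r = ennreal (mol \<delta> (r - t)) * ennreal (H' r)"
      using H'2
    proof eventually_elim
      case (elim r)
      show ?case unfolding elim[symmetric] H_def using mol_nonneg[OF d]
        by (auto simp: ennreal_mult[symmetric] split: split_indicator)
    qed
    have "ennreal ((mollify R \<delta> F t)\<^sup>2) \<le> ennreal (LINT r|?M. mol \<delta> (r - t) * (F r)\<^sup>2)"
      using pt by (rule ennreal_leI)
    also have "\<dots> = (\<integral>\<^sup>+ r. ennreal (mol \<delta> (r - t) * (F r)\<^sup>2) \<partial>?M)"
      using mol_integrable[OF d F2, of t] mol_nonneg[OF d] by (intro nn_integral_eq_integral[symmetric]) auto
    also have "\<dots> = (\<integral>\<^sup>+ r. ennreal (mol \<delta> (r - t) * (F r)\<^sup>2) * indicator {0..R} r \<partial>lebesgue)"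
      by (rule nn_integral_restrict_space) simp
    also have "\<dots> = (\<integral>\<^sup>+ r. ennreal (mol \<delta> (r - t)) * ennreal (H' r) \<partial>lebesgue)"
      by (rule nn_integral_cong_AE[OF ae])
    also have "\<dots> = ?I t" by (rule nn_integral_completion)
    finally show ?thesis .
  qed
  have swap: "(\<integral>\<^sup>+ t. ?I t \<partial>lborel)
    = (\<integral>\<^sup>+ r. (\<integral>\<^sup>+ t. ennreal (mol \<delta> (r - t)) * ennreal (H' r) \<partial>lborel) \<partial>lborel)"
    by (rule lborel_pair.Fubini'[symmetric]) measurable
  have inner: "(\<integral>\<^sup>+ t. ennreal (mol \<delta> (r - t)) * ennreal (H' r) \<partial>lborel) = ennreal (H' r)" for r
  proof -
    have [measurable]: "(\<lambda>t. ennreal (mol \<delta> (r - t))) \<in> borel_measurable lborel" by measurable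
    have "(\<integral>\<^sup>+ t. ennreal (mol \<delta> (r - t)) * ennreal (H' r) \<partial>lborel)
      = (\<integral>\<^sup>+ t. ennreal (mol \<delta> (r - t)) \<partial>lborel) * ennreal (H' r)"
      by (rule nn_integral_multc) measurable
    then show ?thesis by (simp only: nn_integral_mol_shift(2)[OF d] mult_1_left)
  qed
  have ae: "AE r in lebesgue. ennreal (H' r) = ennreal ((F r)\<^sup>2) * indicator {0..R} r"
    using H'2
  proof eventually_elim
    case (elim r)
    show ?case unfolding elim[symmetric] H_def by (auto split: split_indicator)
  qed
  have "(\<integral>\<^sup>+ t. ennreal ((mollify R \<delta> F t)\<^sup>2) \<partial>?M) \<le> (\<integral>\<^sup>+ t. ?I t \<partial>?M)"
    by (rule nn_integral_mono) (rule ptI)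
  also have "(\<integral>\<^sup>+ t. ?I t \<partial>?M) = (\<integral>\<^sup>+ t. ?I t * indicator {0..R} t \<partial>lebesgue)"
    by (rule nn_integral_restrict_space) simp
  also have "\<dots> \<le> (\<integral>\<^sup>+ t. ?I t \<partial>lebesgue)"
    by (rule nn_integral_mono) (auto split: split_indicator)
  also have "(\<integral>\<^sup>+ t. ?I t \<partial>lebesgue) = (\<integral>\<^sup>+ t. ?I t \<partial>lborel)"
    by (rule nn_integral_completion)
  also have "\<dots> = (\<integral>\<^sup>+ r. ennreal (H' r) \<partial>lborel)" unfolding swap inner ..
  also have "\<dots> = (\<integral>\<^sup>+ r. ennreal (H' r) \<partial>lebesgue)" by (rule nn_integral_completion[symmetric])
  also have "\<dots> = (\<integral>\<^sup>+ r. ennreal ((F r)\<^sup>2) * indicator {0..R} r \<partial>lebesgue)"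
    by (rule nn_integral_cong_AE[OF ae])
  also have "\<dots> = (\<integral>\<^sup>+ r. ennreal ((F r)\<^sup>2) \<partial>?M)" by (rule nn_integral_restrict_space[symmetric]) simp
  also have "\<dots> = ennreal (LINT t|?M. (F t)\<^sup>2)" using F2 by (intro nn_integral_eq_integral) auto
  finally show ?thesis .
qed

section \<open>Families of self-adjoint operators and their resolvents\<close>

text \<open>The scalar products \<open>\<langle>\<cdot>, \<cdot>\<rangle>\<^sub>t\<close> and the operators \<open>A t\<close>, all expressed in one fixed scalar product:
  \<open>\<langle>u, v\<rangle>\<^sub>t = \<langle>G t u, v\<rangle>\<close>, and \<open>B t = G t A t\<close>, which is self-adjoint in the fixed scalar product.
  The constant \<open>L\<close> bounds \<open>G\<close> and all Lipschitz constants.\<close>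
locale coercive_family =
  fixes R L c :: real
    and G :: "real \<Rightarrow> 'h::{complex_hilbert_space, second_countable_topology} \<Rightarrow>\<^sub>L 'h"
    and S :: "'h set"
    and B :: "real \<Rightarrow> 'h \<Rightarrow> 'h"
  assumes R_pos: "0 < R" and L_pos: "0 < L" and c_pos: "0 < c"
    and G_lip: "\<And>r s. r \<in> {0..R} \<Longrightarrow> s \<in> {0..R} \<Longrightarrow> norm (G r - G s) \<le> L * \<bar>r - s\<bar>"
    and G_norm: "\<And>t. t \<in> {0..R} \<Longrightarrow> norm (G t) \<le> L"
    and G_scaleC: "\<And>t a u. t \<in> {0..R} \<Longrightarrow> G t (scaleC a u) = scaleC a (G t u)"
    and G_sym: "\<And>t u v. t \<in> {0..R} \<Longrightarrow> cinner (G t u) v = cinner u (G t v)"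
    and G_pos: "\<And>t u. t \<in> {0..R} \<Longrightarrow> c * (norm u)\<^sup>2 \<le> Re (cinner (G t u) u)"
    and S_sub: "csubspace S" and S_dense: "closure S = UNIV"
    and B_lin: "\<And>t. t \<in> {0..R} \<Longrightarrow> clinear_on S (B t)"
    and B_adj: "\<And>t. t \<in> {0..R} \<Longrightarrow> adjoint_graph UNIV cinner S (B t) = {(v, B t v) |v. v \<in> S}"
    and B_lip: "\<And>r s t u. r \<in> {0..R} \<Longrightarrow> s \<in> {0..R} \<Longrightarrow> t \<in> {0..R} \<Longrightarrow> u \<in> S \<Longrightarrow>
      norm (B r u - B s u) \<le> L * \<bar>r - s\<bar> * (norm u + norm (B t u))"
begin

lemma G_bound: "t \<in> {0..R} \<Longrightarrow> norm (G t u) \<le> L * norm u"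
  using norm_blinfun[of "G t" u] mult_right_mono[OF G_norm norm_ge_zero] by (rule order_trans)

lemma G_lip_apply: "r \<in> {0..R} \<Longrightarrow> s \<in> {0..R} \<Longrightarrow> norm (G r u - G s u) \<le> L * \<bar>r - s\<bar> * norm u"
  using order_trans[OF norm_blinfun[of "G r - G s" u] mult_right_mono[OF G_lip norm_ge_zero]]
  by (simp add: blinfun.diff_left)

lemma G_below: assumes t: "t \<in> {0..R}" shows "c * norm u \<le> norm (G t u)"
proof (cases "u = 0")
  case False
  have "c * (norm u)\<^sup>2 \<le> norm (G t u) * norm u" using G_pos[OF t] Re_cinner_le order_trans by blast
  then show ?thesis using False by (simp add: power2_eq_square)
qed simp

lemma G_u_lipschitz: "(L * norm u)-lipschitz_on {0..R} (\<lambda>t. G t u)"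
  by (rule lipschitz_onI) (use G_lip_apply[of _ _ u] L_pos in \<open>auto simp: dist_norm mult_ac\<close>)

lemma G_apply_measurable:
  assumes "R' \<le> R" "s \<in> borel_measurable (lebesgue_on {0..R'})"
  shows "(\<lambda>t. G t (s t)) \<in> borel_measurable (lebesgue_on {0..R'})"
proof (rule measurable_Caratheodory[OF _ _ assms(2)])
  show "(\<lambda>t. G t u) \<in> borel_measurable (lebesgue_on {0..R'})" for u
    by (rule continuous_on_imp_measurable_lebesgue_on, rule continuous_on_subset[OF lipschitz_on_continuous_on[OF G_u_lipschitz]])
      (use assms(1) in auto)
qed (intro continuous_intros)

lemma B_sym: "t \<in> {0..R} \<Longrightarrow> u \<in> S \<Longrightarrow> v \<in> S \<Longrightarrow> cinner (B t u) v = cinner u (B t v)"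
  using B_adj[of t] by (auto simp: adjoint_graph_def set_eq_iff)

text \<open>Self-adjointness in the form in which it is used: weakly defined values are values.\<close>
lemma B_domI:
  assumes t: "t \<in> {0..R}" and "\<And>u. u \<in> S \<Longrightarrow> cinner (B t u) v = cinner u w"
  shows "v \<in> S" "B t v = w"
proof -
  have "(v, w) \<in> adjoint_graph UNIV cinner S (B t)" using assms by (simp add: adjoint_graph_def)
  then have "(v, w) \<in> {(v, B t v) |v. v \<in> S}" unfolding B_adj[OF t] .
  then show "v \<in> S" "B t v = w" by auto
qed

lemma B_closed:
  assumes t: "t \<in> {0..R}" and s: "\<And>n::nat. s n \<in> S" "s \<longlonglongrightarrow> u" "(\<lambda>n. B t (s n)) \<longlonglongrightarrow> w"
  shows "u \<in> S" "B t u = w"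
proof -
  have "cinner (B t x) u = cinner x w" if x: "x \<in> S" for x
  proof (rule LIMSEQ_unique)
    show "(\<lambda>n. cinner (B t x) (s n)) \<longlonglongrightarrow> cinner (B t x) u" by (intro cinner.tendsto tendsto_const s)
    show "(\<lambda>n. cinner (B t x) (s n)) \<longlonglongrightarrow> cinner x w"
      unfolding B_sym[OF t x s(1)] by (intro cinner.tendsto tendsto_const s)
  qed
  then show "u \<in> S" "B t u = w" using B_domI[OF t] by blast+
qed

lemmas B_simps = clinear_on_add[OF B_lin S_sub] clinear_on_scaleC[OF B_lin S_sub]
  clinear_on_diff[OF B_lin S_sub] clinear_on_0[OF B_lin S_sub] clinear_on_scaleR[OF B_lin S_sub]

lemmas S_simps = csubspace_0[OF S_sub] csubspace_add[OF S_sub] csubspace_scaleC[OF S_sub]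
  csubspace_scaleR[OF S_sub] csubspace_minus[OF S_sub] csubspace_diff[OF S_sub]

subsection \<open>The resolvent\<close>

abbreviation ie :: "real \<Rightarrow> complex" where "ie \<epsilon> \<equiv> \<i> * complex_of_real \<epsilon>"

text \<open>The factor \<open>\<i>\<close> makes the pencil invertible: as \<open>\<langle>B t u, u\<rangle>\<close> is real, the real part of
  \<open>\<langle>pencil \<epsilon> t u, u\<rangle>\<close> is \<open>\<langle>G t u, u\<rangle>\<close>.\<close>
definition pencil :: "real \<Rightarrow> real \<Rightarrow> 'h \<Rightarrow> 'h" where
  "pencil \<epsilon> t u = G t u + scaleC (ie \<epsilon>) (B t u)"

lemma pencil_below:
  assumes t: "t \<in> {0..R}" and u: "u \<in> S"
  shows "c * norm u \<le> norm (pencil \<epsilon> t u)"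
proof (cases "u = 0")
  case False
  have "cinner (B t u) u = cnj (cinner (B t u) u)" using B_sym[OF t u u] cinner_commute by metis
  then have "Im (cinner (B t u) u) = 0" by (simp add: complex_eq_iff)
  then have "Re (cinner (pencil \<epsilon> t u) u) = Re (cinner (G t u) u)"
    by (simp add: pencil_def cinner_algebra)
  then have "c * (norm u)\<^sup>2 \<le> norm (pencil \<epsilon> t u) * norm u"
    using G_pos[OF t, of u] Re_cinner_le[of "pencil \<epsilon> t u" u] by linarith
  then show ?thesis using False by (simp add: power2_eq_square)
qed simp

lemma pencil_adjoint:
  assumes t: "t \<in> {0..R}" and "u \<in> S" "v \<in> S"
  shows "cinner (pencil \<epsilon> t u) v = cinner u (pencil (- \<epsilon>) t v)"
  by (simp add: pencil_def cinner_algebra G_sym[OF t] B_sym[OF assms])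

text \<open>A vector orthogonal to the range is in the kernel of the adjoint pencil, which is the pencil for
  \<open>- \<epsilon>\<close> and bounded below as well.\<close>
lemma ex_resolvent:
  assumes t: "t \<in> {0..R}" and e: "\<epsilon> \<noteq> 0"
  shows "\<exists>P :: 'h \<Rightarrow>\<^sub>L 'h. (\<forall>f. blinfun_apply P f \<in> S) \<and> (\<forall>f. pencil \<epsilon> t (blinfun_apply P f) = f) \<and>
    (\<forall>u\<in>S. blinfun_apply P (pencil \<epsilon> t u) = u) \<and> norm P \<le> 1 / c"
proof (rule bounded_below_operator_inverse[OF S_sub _ c_pos, of "pencil \<epsilon> t"])
  have ie: "ie \<epsilon> \<noteq> 0" using e by simp
  show "clinear_on S (pencil \<epsilon> t)"
    unfolding clinear_on_def pencil_def
    by (auto simp: B_simps[OF t] G_scaleC[OF t] blinfun.add_right scaleC_add_right scaleC_scaleC mult.commute)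
  show "c * norm u \<le> norm (pencil \<epsilon> t u)" if "u \<in> S" for u by (rule pencil_below[OF t that])
  show "u \<in> S \<and> pencil \<epsilon> t u = f"
    if s: "\<And>n::nat. s n \<in> S" "s \<longlonglongrightarrow> u" "(\<lambda>n. pencil \<epsilon> t (s n)) \<longlonglongrightarrow> f" for s u f
  proof -
    have "B t (s n) = scaleC (1 / ie \<epsilon>) (pencil \<epsilon> t (s n) - G t (s n))" for n
      using ie by (simp add: pencil_def scaleC_scaleC)
    moreover have "(\<lambda>n. scaleC (1 / ie \<epsilon>) (pencil \<epsilon> t (s n) - G t (s n))) \<longlonglongrightarrow> scaleC (1 / ie \<epsilon>) (f - G t u)"
      by (intro bounded_linear.tendsto[OF bounded_linear_scaleC] tendsto_diff s blinfun.tendsto tendsto_const)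
    ultimately have "(\<lambda>n. B t (s n)) \<longlonglongrightarrow> scaleC (1 / ie \<epsilon>) (f - G t u)" by simp
    from B_closed[OF t s(1,2) this] show ?thesis using ie by (simp add: pencil_def scaleC_scaleC)
  qed
  show "v = 0" if v: "\<And>u. u \<in> S \<Longrightarrow> cinner (pencil \<epsilon> t u) v = 0" for v
  proof -
    have "cinner (B t u) v = cinner u (scaleC (- \<i> / \<epsilon>) (G t v))" if u: "u \<in> S" for u
    proof -
      have "ie \<epsilon> * cinner (B t u) v = - cinner u (G t v)"
        using v[OF u] by (simp add: pencil_def cinner_algebra G_sym[OF t] eq_neg_iff_add_eq_0 add.commute)
      from arg_cong[OF this, of "\<lambda>x. \<i> * x"]
      have "complex_of_real \<epsilon> * cinner (B t u) v = \<i> * cinner u (G t v)" by (simp add: mult.assoc)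
      then show ?thesis using e by (simp add: cinner_algebra field_simps)
    qed
    then have vS: "v \<in> S" and Bv: "B t v = scaleC (- \<i> / \<epsilon>) (G t v)" using B_domI[OF t] by blast+
    have "pencil (- \<epsilon>) t v = 0"
      unfolding pencil_def Bv scaleC_scaleC using e by (simp add: scaleC_minus_left)
    then show "v = 0" using pencil_below[OF t vS, of "- \<epsilon>"] c_pos by (simp add: mult_le_0_iff)
  qed
qed blast

text \<open>A bounded approximation of the inverse of \<open>G t\<close> with values in \<open>S\<close>.\<close>
definition res :: "real \<Rightarrow> real \<Rightarrow> 'h \<Rightarrow>\<^sub>L 'h" where
  "res \<epsilon> t = (SOME P. (\<forall>f. blinfun_apply P f \<in> S) \<and> (\<forall>f. pencil \<epsilon> t (blinfun_apply P f) = f) \<and>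
    (\<forall>u\<in>S. blinfun_apply P (pencil \<epsilon> t u) = u) \<and> norm P \<le> 1 / c)"

lemma
  assumes t: "t \<in> {0..R}" and e: "\<epsilon> \<noteq> 0"
  shows res_in: "res \<epsilon> t f \<in> S" and pencil_res: "pencil \<epsilon> t (res \<epsilon> t f) = f"
    and res_pencil: "u \<in> S \<Longrightarrow> res \<epsilon> t (pencil \<epsilon> t u) = u" and res_bound: "norm (res \<epsilon> t f) \<le> norm f / c"
proof -
  have P: "(\<forall>f. res \<epsilon> t f \<in> S) \<and> (\<forall>f. pencil \<epsilon> t (res \<epsilon> t f) = f) \<and>
    (\<forall>u\<in>S. res \<epsilon> t (pencil \<epsilon> t u) = u) \<and> norm (res \<epsilon> t) \<le> 1 / c"
    unfolding res_def by (rule someI_ex[OF ex_resolvent[OF assms]])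
  then show "res \<epsilon> t f \<in> S" "pencil \<epsilon> t (res \<epsilon> t f) = f" "u \<in> S \<Longrightarrow> res \<epsilon> t (pencil \<epsilon> t u) = u"
    by blast+
  have "norm (res \<epsilon> t f) \<le> norm (res \<epsilon> t) * norm f" by (rule norm_blinfun)
  also have "\<dots> \<le> 1 / c * norm f" using P by (intro mult_right_mono) auto
  finally show "norm (res \<epsilon> t f) \<le> norm f / c" by simp
qed

lemma res_adjoint:
  assumes t: "t \<in> {0..R}" and e: "\<epsilon> \<noteq> 0"
  shows "cinner (res \<epsilon> t f) g = cinner f (res (- \<epsilon>) t g)"
  using pencil_adjoint[OF t res_in[OF t e] res_in[OF t, of "- \<epsilon>"], of \<epsilon> f g] e
  by (simp add: pencil_res[OF t e] pencil_res[OF t, of "- \<epsilon>"])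

lemma ie_B_res:
  assumes t: "t \<in> {0..R}" and e: "\<epsilon> \<noteq> 0"
  shows "scaleC (ie \<epsilon>) (B t (res \<epsilon> t f)) = f - G t (res \<epsilon> t f)"
  using pencil_res[OF assms, of f] by (simp add: pencil_def eq_diff_eq add.commute)

lemma ie_res_B:
  assumes t: "t \<in> {0..R}" and e: "\<epsilon> \<noteq> 0" and u: "u \<in> S"
  shows "scaleC (ie \<epsilon>) (res \<epsilon> t (B t u)) = u - res \<epsilon> t (G t u)"
proof -
  have "res \<epsilon> t (scaleC a f) = scaleC a (res \<epsilon> t f)" for a f
  proof -
    have "pencil \<epsilon> t (scaleC a (res \<epsilon> t f)) = scaleC a (pencil \<epsilon> t (res \<epsilon> t f))"
      unfolding pencil_def
      by (simp add: B_simps[OF t] res_in[OF t e] G_scaleC[OF t] scaleC_add_right scaleC_scaleC mult.commute)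
    then show ?thesis
      using res_pencil[OF t e S_simps(3)[OF res_in[OF t e]], of a f] pencil_res[OF t e] by simp
  qed
  then have "scaleC (ie \<epsilon>) (res \<epsilon> t (B t u)) = res \<epsilon> t (pencil \<epsilon> t u - G t u)" by (simp add: pencil_def)
  also have "\<dots> = u - res \<epsilon> t (G t u)" by (simp add: blinfun.diff_right res_pencil[OF t e u])
  finally show ?thesis .
qed

lemma norm_ie: "norm (scaleC (ie \<epsilon>) v) = \<bar>\<epsilon>\<bar> * norm v"
  by (simp add: norm_scaleC norm_mult)

text \<open>Uniform in \<open>\<epsilon>\<close>, since \<open>\<i> \<epsilon> B (res f) = f - G (res f)\<close>. For \<open>res B\<close> the argument is the same.\<close>
lemma B_res_bound:
  assumes t: "t \<in> {0..R}" and e: "\<epsilon> \<noteq> 0"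
  shows "\<bar>\<epsilon>\<bar> * norm (B t (res \<epsilon> t f)) \<le> (1 + L / c) * norm f"
proof -
  have "\<bar>\<epsilon>\<bar> * norm (B t (res \<epsilon> t f)) = norm (f - G t (res \<epsilon> t f))"
    unfolding norm_ie[symmetric] ie_B_res[OF assms] ..
  also have "\<dots> \<le> norm f + norm (G t (res \<epsilon> t f))" by (rule norm_triangle_ineq4)
  also have "norm (G t (res \<epsilon> t f)) \<le> L * (norm f / c)"
    using G_bound[OF t] mult_left_mono[OF res_bound[OF assms]] L_pos by (meson less_imp_le order_trans)
  finally show ?thesis by (simp add: algebra_simps)
qed

lemma res_B_bound:
  assumes t: "t \<in> {0..R}" and e: "\<epsilon> \<noteq> 0" and u: "u \<in> S"
  shows "\<bar>\<epsilon>\<bar> * norm (res \<epsilon> t (B t u)) \<le> (1 + L / c) * norm u"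
proof -
  have "\<bar>\<epsilon>\<bar> * norm (res \<epsilon> t (B t u)) = norm (u - res \<epsilon> t (G t u))"
    unfolding norm_ie[symmetric] ie_res_B[OF assms] ..
  also have "\<dots> \<le> norm u + norm (res \<epsilon> t (G t u))" by (rule norm_triangle_ineq4)
  also have "norm (res \<epsilon> t (G t u)) \<le> L * norm u / c"
    using res_bound[OF t e] divide_right_mono[OF G_bound[OF t]] c_pos by (meson less_imp_le order_trans)
  finally show ?thesis by (simp add: algebra_simps)
qed

text \<open>The second resolvent identity.\<close>
lemma res_difference:
  assumes r: "r \<in> {0..R}" and s: "s \<in> {0..R}" and e: "\<epsilon> \<noteq> 0"
  shows "res \<epsilon> r f - res \<epsilon> s g = res \<epsilon> s (f - g - ((G r (res \<epsilon> r f) - G s (res \<epsilon> r f))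
    + scaleC (ie \<epsilon>) (B r (res \<epsilon> r f) - B s (res \<epsilon> r f))))"
proof -
  let ?x = "res \<epsilon> r f"
  have "f = G r ?x + scaleC (ie \<epsilon>) (B r ?x)" using pencil_res[OF r e, of f] by (simp add: pencil_def)
  then have eq: "f - g - ((G r ?x - G s ?x) + scaleC (ie \<epsilon>) (B r ?x - B s ?x)) = pencil \<epsilon> s ?x - g"
    by (simp add: pencil_def scaleC_diff_right algebra_simps)
  show ?thesis unfolding eq by (simp only: blinfun.diff_right res_pencil[OF s e res_in[OF r e]])
qed

lemma res_lipschitz:
  assumes e: "\<epsilon> \<noteq> 0"
  shows "\<exists>C\<ge>0. \<forall>r\<in>{0..R}. \<forall>s\<in>{0..R}. \<forall>f. norm (res \<epsilon> r f - res \<epsilon> s f) \<le> C * \<bar>r - s\<bar> * norm f"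
proof -
  define C where "C = L * (1 / c + \<bar>\<epsilon>\<bar> / c + (1 + L / c)) / c"
  have "norm (res \<epsilon> r f - res \<epsilon> s f) \<le> C * \<bar>r - s\<bar> * norm f" if r: "r \<in> {0..R}" and s: "s \<in> {0..R}" for r s f
  proof -
    let ?x = "res \<epsilon> r f"
    let ?m = "(G r ?x - G s ?x) + scaleC (ie \<epsilon>) (B r ?x - B s ?x)"
    have "norm (res \<epsilon> r f - res \<epsilon> s f) = norm (res \<epsilon> s ?m)"
      unfolding res_difference[OF r s e, of f f] by (simp only: diff_self diff_0 blinfun.minus_right norm_minus_cancel)
    also have "\<dots> \<le> norm ?m / c" by (rule res_bound[OF s e])
    also have "norm ?m \<le> L * \<bar>r - s\<bar> * norm ?x + \<bar>\<epsilon>\<bar> * (L * \<bar>r - s\<bar> * (norm ?x + norm (B r ?x)))"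
    proof (rule order_trans[OF norm_triangle_ineq], rule add_mono)
      show "norm (scaleC (ie \<epsilon>) (B r ?x - B s ?x)) \<le> \<bar>\<epsilon>\<bar> * (L * \<bar>r - s\<bar> * (norm ?x + norm (B r ?x)))"
        unfolding norm_ie by (intro mult_left_mono B_lip r s res_in[OF r e]) auto
    qed (rule G_lip_apply[OF r s])
    also have "\<dots> = L * \<bar>r - s\<bar> * (norm ?x + \<bar>\<epsilon>\<bar> * norm ?x + \<bar>\<epsilon>\<bar> * norm (B r ?x))"
      by (simp add: algebra_simps)
    also have "\<dots> \<le> L * \<bar>r - s\<bar> * (norm f / c + \<bar>\<epsilon>\<bar> * (norm f / c) + (1 + L / c) * norm f)"
      using L_pos by (intro mult_left_mono add_mono res_bound[OF r e] B_res_bound[OF r e]) auto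
    finally have "norm (res \<epsilon> r f - res \<epsilon> s f)
      \<le> L * \<bar>r - s\<bar> * (norm f / c + \<bar>\<epsilon>\<bar> * (norm f / c) + (1 + L / c) * norm f) / c"
      using c_pos by (simp add: divide_right_mono)
    also have "\<dots> = C * \<bar>r - s\<bar> * norm f" using c_pos by (simp add: C_def field_simps)
    finally show ?thesis .
  qed
  moreover have "0 \<le> C" using L_pos c_pos by (simp add: C_def)
  ultimately show ?thesis by blast
qed

lemma B_res_lipschitz:
  assumes e: "\<epsilon> \<noteq> 0"
  shows "\<exists>C\<ge>0. \<forall>r\<in>{0..R}. \<forall>s\<in>{0..R}. \<forall>f. norm (B r (res \<epsilon> r f) - B s (res \<epsilon> s f)) \<le> C * \<bar>r - s\<bar> * norm f"
proof -
  obtain C where C: "0 \<le> C" "\<And>r s f. r \<in> {0..R} \<Longrightarrow> s \<in> {0..R} \<Longrightarrow>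
      norm (res \<epsilon> r f - res \<epsilon> s f) \<le> C * \<bar>r - s\<bar> * norm f"
    using res_lipschitz[OF e] by blast
  define C' where "C' = (L / c + L * C) / \<bar>\<epsilon>\<bar>"
  have "norm (B r (res \<epsilon> r f) - B s (res \<epsilon> s f)) \<le> C' * \<bar>r - s\<bar> * norm f"
    if r: "r \<in> {0..R}" and s: "s \<in> {0..R}" for r s f
  proof -
    have "\<bar>\<epsilon>\<bar> * norm (B r (res \<epsilon> r f) - B s (res \<epsilon> s f)) = norm (G s (res \<epsilon> s f) - G r (res \<epsilon> r f))"
      unfolding norm_ie[symmetric] scaleC_diff_right ie_B_res[OF r e] ie_B_res[OF s e] by simp
    also have "\<dots> = norm ((G s (res \<epsilon> s f) - G r (res \<epsilon> s f)) + G r (res \<epsilon> s f - res \<epsilon> r f))"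
      by (simp add: blinfun.diff_right)
    also have "\<dots> \<le> L * \<bar>s - r\<bar> * norm (res \<epsilon> s f) + L * norm (res \<epsilon> s f - res \<epsilon> r f)"
      by (intro order_trans[OF norm_triangle_ineq] add_mono G_lip_apply G_bound r s)
    also have "\<dots> \<le> L * \<bar>s - r\<bar> * (norm f / c) + L * (C * \<bar>s - r\<bar> * norm f)"
      using L_pos by (intro add_mono mult_left_mono res_bound[OF s e] C r s) auto
    also have "\<dots> = \<bar>\<epsilon>\<bar> * (C' * \<bar>r - s\<bar> * norm f)"
    proof -
      have C': "\<bar>\<epsilon>\<bar> * C' = L / c + L * C" using e by (simp add: C'_def)
      have "\<bar>\<epsilon>\<bar> * (C' * \<bar>r - s\<bar> * norm f) = (\<bar>\<epsilon>\<bar> * C') * (\<bar>s - r\<bar> * norm f)"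
        by (simp add: abs_minus_commute)
      then show ?thesis unfolding C' by (simp add: algebra_simps)
    qed
    finally show ?thesis using e by simp
  qed
  moreover have "0 \<le> C'" using L_pos c_pos C by (simp add: C'_def)
  ultimately show ?thesis by blast
qed

lemma ex_G_inverse:
  assumes t: "t \<in> {0..R}"
  shows "\<exists>P :: 'h \<Rightarrow>\<^sub>L 'h. (\<forall>f. G t (blinfun_apply P f) = f) \<and> (\<forall>u. blinfun_apply P (G t u) = u) \<and> norm P \<le> 1 / c"
proof (rule bounded_below_operator_inverse[of UNIV "G t" c])
  show "clinear_on UNIV (G t)" by (simp add: clinear_on_def blinfun.add_right G_scaleC[OF t])
  show "c * norm u \<le> norm (G t u)" for u by (rule G_below[OF t])
  show "u \<in> UNIV \<and> G t u = f" if "s \<longlonglongrightarrow> u" "(\<lambda>n. G t (s n)) \<longlonglongrightarrow> f" for s u f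
    using LIMSEQ_unique[OF that(2) blinfun.tendsto[OF tendsto_const that(1)]] by simp
  show "v = 0" if "\<And>u. u \<in> UNIV \<Longrightarrow> cinner (G t u) v = 0" for v
  proof -
    have "c * (norm v)\<^sup>2 \<le> 0" using G_pos[OF t, of v] that[of v] by simp
    then show ?thesis using c_pos by (simp add: mult_le_0_iff)
  qed
  show "csubspace (UNIV :: 'h set)" by (simp add: csubspace_def)
  show "0 < c" by (rule c_pos)
qed blast

definition Ginv :: "real \<Rightarrow> 'h \<Rightarrow>\<^sub>L 'h" where
  "Ginv t = (SOME P. (\<forall>f. G t (blinfun_apply P f) = f) \<and> (\<forall>u. blinfun_apply P (G t u) = u) \<and> norm P \<le> 1 / c)"

lemma
  assumes t: "t \<in> {0..R}"
  shows G_Ginv: "G t (Ginv t f) = f" and Ginv_G: "Ginv t (G t u) = u"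
    and Ginv_bound: "norm (Ginv t f) \<le> norm f / c"
proof -
  have P: "(\<forall>f. G t (Ginv t f) = f) \<and> (\<forall>u. Ginv t (G t u) = u) \<and> norm (Ginv t) \<le> 1 / c"
    unfolding Ginv_def by (rule someI_ex[OF ex_G_inverse[OF assms]])
  then show "G t (Ginv t f) = f" "Ginv t (G t u) = u" by blast+
  show "norm (Ginv t f) \<le> norm f / c"
    using G_below[OF t, of "Ginv t f"] P c_pos by (simp add: field_simps)
qed

lemma Ginv_sym: assumes t: "t \<in> {0..R}" shows "cinner (Ginv t u) v = cinner u (Ginv t v)"
  using G_sym[OF t, of "Ginv t u" "Ginv t v"] G_Ginv[OF t] by simp

lemma Ginv_lipschitz:
  assumes r: "r \<in> {0..R}" and s: "s \<in> {0..R}"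
  shows "norm (Ginv r f - Ginv s f) \<le> L / c\<^sup>2 * \<bar>r - s\<bar> * norm f"
proof -
  have "Ginv r f - Ginv s f = Ginv s (G s (Ginv r f) - G r (Ginv r f))"
    by (simp add: blinfun.diff_right Ginv_G[OF s] G_Ginv[OF r])
  then have "norm (Ginv r f - Ginv s f) \<le> norm (G s (Ginv r f) - G r (Ginv r f)) / c"
    using Ginv_bound[OF s] by simp
  also have "\<dots> \<le> (L * \<bar>s - r\<bar> * (norm f / c)) / c"
    using c_pos L_pos order_trans[OF G_lip_apply[OF s r] mult_left_mono[OF Ginv_bound[OF r]]]
    by (intro divide_right_mono) auto
  finally show ?thesis by (simp add: abs_minus_commute power2_eq_square)
qed

end

text \<open>The product rule for Lipschitz constants.\<close>
lemma lipschitz_on_family_apply: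
  fixes F :: "real \<Rightarrow> 'a::real_normed_vector \<Rightarrow> 'b::real_normed_vector"
  assumes bd: "\<And>t f. t \<in> I \<Longrightarrow> norm (F t f) \<le> a * norm f"
    and lip: "\<And>r s f. r \<in> I \<Longrightarrow> s \<in> I \<Longrightarrow> norm (F r f - F s f) \<le> C * \<bar>r - s\<bar> * norm f"
    and diff: "\<And>t f g. t \<in> I \<Longrightarrow> F t (f - g) = F t f - F t g"
    and y: "K-lipschitz_on I y" and Y: "\<And>t. t \<in> I \<Longrightarrow> norm (y t) \<le> Y"
    and nn: "0 \<le> a" "0 \<le> C" "0 \<le> Y"
  shows "(C * Y + a * K)-lipschitz_on I (\<lambda>t. F t (y t))"
proof (rule lipschitz_onI)
  show "0 \<le> C * Y + a * K" using nn lipschitz_on_nonneg[OF y] by simp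
  fix r s assume rs: "r \<in> I" "s \<in> I"
  have "F r (y r) - F s (y s) = (F r (y r) - F s (y r)) + F s (y r - y s)" using rs by (simp add: diff)
  then have "norm (F r (y r) - F s (y s)) \<le> norm (F r (y r) - F s (y r)) + norm (F s (y r - y s))"
    by (simp only: norm_triangle_ineq)
  also have "\<dots> \<le> C * \<bar>r - s\<bar> * norm (y r) + a * norm (y r - y s)"
    by (intro add_mono lip bd rs)
  also have "\<dots> \<le> C * \<bar>r - s\<bar> * Y + a * (K * \<bar>r - s\<bar>)"
    using nn lipschitz_onD[OF y rs] Y[OF rs(1)]
    by (intro add_mono mult_left_mono) (auto simp: dist_norm)
  finally show "dist (F r (y r)) (F s (y s)) \<le> (C * Y + a * K) * dist r s"
    by (simp add: dist_norm algebra_simps)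
qed

lemma vector_derivative_bound_lipschitz:
  fixes f :: "real \<Rightarrow> 'b::real_normed_vector"
  assumes "\<And>t. t \<in> {a..b} \<Longrightarrow> (f has_vector_derivative f' t) (at t)"
    and "\<And>t. t \<in> {a..b} \<Longrightarrow> norm (f' t) \<le> K" and "0 \<le> K"
  shows "K-lipschitz_on {a..b} f"
proof (rule lipschitz_onI[OF _ \<open>0 \<le> K\<close>])
  fix x y assume xy: "x \<in> {a..b}" "y \<in> {a..b}"
  have "norm (f x - f y) \<le> K * norm (x - y)"
  proof (rule differentiable_bound[of "{a..b}" f "\<lambda>t h. h *\<^sub>R f' t"])
    show "(f has_derivative (\<lambda>h. h *\<^sub>R f' t)) (at t within {a..b})" if "t \<in> {a..b}" for t
      using assms(1)[OF that] unfolding has_vector_derivative_def by (rule has_derivative_at_withinI)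
    show "onorm (\<lambda>h. h *\<^sub>R f' t) \<le> K" if "t \<in> {a..b}" for t
      by (rule onorm_bound) (use assms that in \<open>auto simp: mult.commute[of K] intro!: mult_left_mono\<close>)
  qed (use xy in auto)
  then show "dist (f x) (f y) \<le> K * dist x y" by (simp add: dist_norm)
qed

section \<open>The energy estimate\<close>

lemma isCont_imp_tendsto_at_right:
  fixes f :: "real \<Rightarrow> 'b::topological_space"
  assumes "isCont f t" shows "((\<lambda>h. f (t + h)) \<longlongrightarrow> f t) (at_right 0)"
proof -
  have "(\<lambda>h. f (t + h)) \<midarrow>0\<rightarrow> f t"
    using assms unfolding isCont_def by (rule LIM_offset_zero)
  then show ?thesis by (rule tendsto_within_subset) simp
qed

lemma has_vector_derivative_iff_quotient:
  fixes f :: "real \<Rightarrow> 'b::real_normed_vector"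
  shows "(f has_vector_derivative d) (at t) \<longleftrightarrow> ((\<lambda>r. (1 / (r - t)) *\<^sub>R (f r - f t)) \<longlongrightarrow> d) (at t)"
proof -
  have "(f has_vector_derivative d) (at t) \<longleftrightarrow> ((\<lambda>r. norm (f r - f t - (r - t) *\<^sub>R d) / norm (r - t)) \<longlongrightarrow> 0) (at t)"
    unfolding has_vector_derivative_def has_derivative_iff_norm by (simp add: bounded_linear_scaleR_left)
  also have "\<dots> \<longleftrightarrow> ((\<lambda>r. norm ((1 / (r - t)) *\<^sub>R (f r - f t) - d)) \<longlongrightarrow> 0) (at t)"
  proof (rule tendsto_cong)
    have "\<forall>\<^sub>F r in at t. r \<noteq> t" by (simp add: eventually_at_filter)
    then show "\<forall>\<^sub>F r in at t. norm (f r - f t - (r - t) *\<^sub>R d) / norm (r - t) = norm ((1 / (r - t)) *\<^sub>R (f r - f t) - d)"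
    proof eventually_elim
      case (elim r)
      have "(1 / (r - t)) *\<^sub>R (f r - f t) - d = (1 / (r - t)) *\<^sub>R (f r - f t - (r - t) *\<^sub>R d)"
        using elim by (simp add: scaleR_diff_right)
      then have "norm ((1 / (r - t)) *\<^sub>R (f r - f t) - d) = norm ((1 / (r - t)) *\<^sub>R (f r - f t - (r - t) *\<^sub>R d))" by simp
      also have "\<dots> = norm (f r - f t - (r - t) *\<^sub>R d) / norm (r - t)" by (simp add: divide_inverse)
      finally show ?case by simp
    qed
  qed
  also have "\<dots> \<longleftrightarrow> ((\<lambda>r. (1 / (r - t)) *\<^sub>R (f r - f t)) \<longlongrightarrow> d) (at t)"
    unfolding tendsto_norm_zero_iff LIM_zero_iff ..
  finally show ?thesis .
qed

lemma has_vector_derivative_quotient_right: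
  fixes f :: "real \<Rightarrow> 'b::real_normed_vector"
  assumes "(f has_vector_derivative d) (at t)"
  shows "((\<lambda>h. (1 / h) *\<^sub>R (f (t + h) - f t)) \<longlongrightarrow> d) (at_right 0)"
proof -
  have "((\<lambda>h. (1 / (t + h - t)) *\<^sub>R (f (t + h) - f t)) \<longlongrightarrow> d) (at 0)"
    by (rule LIM_offset_zero[OF assms[unfolded has_vector_derivative_iff_quotient]])
  then have "((\<lambda>h. (1 / h) *\<^sub>R (f (t + h) - f t)) \<longlongrightarrow> d) (at 0)" by simp
  then show ?thesis by (rule tendsto_within_subset) simp
qed

context coercive_family begin

lemma res_apply_lipschitz:
  assumes e: "\<epsilon> \<noteq> 0" and y: "K-lipschitz_on {0..R} y" and Y: "\<And>s. s \<in> {0..R} \<Longrightarrow> norm (y s) \<le> Y"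
  shows "\<exists>C. C-lipschitz_on {0..R} (\<lambda>t. res \<epsilon> t (y t))"
proof -
  have Y0: "0 \<le> Y" using order_trans[OF norm_ge_zero Y[of 0]] R_pos by simp
  obtain C where C: "0 \<le> C" "\<And>r s f. r \<in> {0..R} \<Longrightarrow> s \<in> {0..R} \<Longrightarrow>
      norm (res \<epsilon> r f - res \<epsilon> s f) \<le> C * \<bar>r - s\<bar> * norm f"
    using res_lipschitz[OF e] by blast
  have "(C * Y + 1 / c * K)-lipschitz_on {0..R} (\<lambda>t. res \<epsilon> t (y t))"
  proof (rule lipschitz_on_family_apply[where F = "\<lambda>t. blinfun_apply (res \<epsilon> t)"])
    show "norm (res \<epsilon> t f) \<le> 1 / c * norm f" if "t \<in> {0..R}" for t f using res_bound[OF that e] by simp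
  qed (use C Y0 c_pos y Y in \<open>auto simp: blinfun.diff_right\<close>)
  then show ?thesis by blast
qed

lemma B_res_apply_lipschitz:
  assumes e: "\<epsilon> \<noteq> 0" and y: "K-lipschitz_on {0..R} y" and Y: "\<And>s. s \<in> {0..R} \<Longrightarrow> norm (y s) \<le> Y"
  shows "\<exists>C. C-lipschitz_on {0..R} (\<lambda>t. B t (res \<epsilon> t (y t)))"
proof -
  have Y0: "0 \<le> Y" using order_trans[OF norm_ge_zero Y[of 0]] R_pos by simp
  obtain C where C: "0 \<le> C" "\<And>r s f. r \<in> {0..R} \<Longrightarrow> s \<in> {0..R} \<Longrightarrow>
      norm (B r (res \<epsilon> r f) - B s (res \<epsilon> s f)) \<le> C * \<bar>r - s\<bar> * norm f"
    using B_res_lipschitz[OF e] by blast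
  have "(C * Y + (1 + L / c) / \<bar>\<epsilon>\<bar> * K)-lipschitz_on {0..R} (\<lambda>t. B t (res \<epsilon> t (y t)))"
  proof (rule lipschitz_on_family_apply[where F = "\<lambda>t f. B t (res \<epsilon> t f)"])
    show "norm (B t (res \<epsilon> t f)) \<le> (1 + L / c) / \<bar>\<epsilon>\<bar> * norm f" if "t \<in> {0..R}" for t f
      using B_res_bound[OF that e, of f] e by (simp add: pos_le_divide_eq mult.commute)
    show "B t (res \<epsilon> t (f - g)) = B t (res \<epsilon> t f) - B t (res \<epsilon> t g)" if "t \<in> {0..R}" for t f g
      unfolding blinfun.diff_right by (rule B_simps(3)[OF that res_in[OF that e] res_in[OF that e]])
    show "0 \<le> (1 + L / c) / \<bar>\<epsilon>\<bar>" using L_pos c_pos by simp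
  qed (use C Y0 y Y in auto)
  then show ?thesis by blast
qed

text \<open>The constant of \<open>energy_derivative\<close>.\<close>
definition C0 :: real where "C0 = L + 2 * L / c + 2 * L * (1 + L / c)"

lemma C0_nonneg: "0 \<le> C0"
  using L_pos c_pos by (simp add: C0_def)

text \<open>The increment of \<open>\<langle>B x, x\<rangle>\<close> is expressed by the increment of the argument of the resolvent. The
  dangerous error term \<open>\<langle>U, \<i> \<epsilon> D\<rangle>\<close> is harmless since \<open>\<epsilon> U\<close> is bounded by \<open>X + x\<close> uniformly in \<open>\<epsilon>\<close>.\<close>
lemma energy_increment:
  fixes f g :: 'h
  assumes e: "0 < \<epsilon>" and t: "t \<in> {0..R}" and r: "r \<in> {0..R}" and tr: "t < r"
  defines "X \<equiv> res \<epsilon> r f" and "x \<equiv> res \<epsilon> t g"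
  defines "U \<equiv> res (- \<epsilon>) t (B t X + B t x)" and "N \<equiv> norm X + norm (B t X)"
  shows "\<bar>Re (cinner (B r X) X) - Re (cinner (B t x) x) - Re (cinner U (f - g))\<bar>
    \<le> (r - t) * (L * N * norm X + L * norm U * norm X + L * (1 + L / c) * norm (X + x) * N)"
proof -
  have e': "\<epsilon> \<noteq> 0" "- \<epsilon> \<noteq> 0" using e by auto
  have XS: "X \<in> S" unfolding X_def by (rule res_in[OF r e'(1)])
  have xS: "x \<in> S" unfolding x_def by (rule res_in[OF t e'(1)])
  define D where "D = B r X - B t X"
  define g' where "g' = G r X - G t X"
  have D: "norm D \<le> L * (r - t) * N"
    using B_lip[OF r t t XS] tr by (simp add: D_def N_def)
  have g': "norm g' \<le> L * (r - t) * norm X"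
    using G_lip_apply[OF r t] tr by (simp add: g'_def)
  have N: "0 \<le> N" by (simp add: N_def)
  have diff: "X - x = res \<epsilon> t (f - g - (g' + scaleC (ie \<epsilon>) D))"
    unfolding X_def x_def g'_def D_def by (rule res_difference[OF r t e'(1)])
  have "Re (cinner (B t X) x) = Re (cinner (B t x) X)"
    using B_sym[OF t XS xS] Re_cinner_commute by metis
  then have "Re (cinner (B r X) X) - Re (cinner (B t x) x)
    = Re (cinner D X) + Re (cinner (B t X + B t x) (X - x))"
    by (simp add: D_def cinner_algebra)
  also have "cinner (B t X + B t x) (X - x) = cinner U (f - g - (g' + scaleC (ie \<epsilon>) D))"
    unfolding diff U_def using res_adjoint[OF t e'(2)] by simp
  also have "Re \<dots> = Re (cinner U (f - g)) - Re (cinner U g') - Re (cinner U (scaleC (ie \<epsilon>) D))"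
    by (simp add: cinner_diff_right cinner_add_right)
  finally have eq: "Re (cinner (B r X) X) - Re (cinner (B t x) x) - Re (cinner U (f - g))
    = Re (cinner D X) - Re (cinner U g') - Re (cinner U (scaleC (ie \<epsilon>) D))" by simp
  have 1: "\<bar>Re (cinner D X)\<bar> \<le> L * (r - t) * N * norm X"
    using abs_Re_cinner_le mult_right_mono[OF D norm_ge_zero] by (rule order_trans)
  have 2: "\<bar>Re (cinner U g')\<bar> \<le> norm U * (L * (r - t) * norm X)"
    using abs_Re_cinner_le mult_left_mono[OF g' norm_ge_zero] by (rule order_trans)
  have 3: "\<bar>Re (cinner U (scaleC (ie \<epsilon>) D))\<bar> \<le> (1 + L / c) * norm (X + x) * (L * (r - t) * N)"
  proof -
    have "\<bar>Re (cinner U (scaleC (ie \<epsilon>) D))\<bar> \<le> norm U * norm (scaleC (ie \<epsilon>) D)" by (rule abs_Re_cinner_le)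
    also have "\<dots> = (\<bar>- \<epsilon>\<bar> * norm U) * norm D" unfolding norm_ie by simp
    also have "\<dots> \<le> ((1 + L / c) * norm (X + x)) * (L * (r - t) * N)"
    proof (rule mult_mono)
      show "\<bar>- \<epsilon>\<bar> * norm U \<le> (1 + L / c) * norm (X + x)"
        using res_B_bound[OF t e'(2) S_simps(2)[OF XS xS]] by (simp add: U_def B_simps(1)[OF t XS xS])
    qed (use D L_pos c_pos in auto)
    finally show ?thesis .
  qed
  have "\<bar>Re (cinner D X) - Re (cinner U g') - Re (cinner U (scaleC (ie \<epsilon>) D))\<bar>
    \<le> L * (r - t) * N * norm X + norm U * (L * (r - t) * norm X) + (1 + L / c) * norm (X + x) * (L * (r - t) * N)"
    using 1 2 3 by linarith
  also have "\<dots> = (r - t) * (L * N * norm X + L * norm U * norm X + L * (1 + L / c) * norm (X + x) * N)"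
    by (simp add: divide_inverse algebra_simps)
  finally show ?thesis unfolding eq .
qed

text \<open>Only the Lipschitz bounds of the family enter, so nothing has to be differentiable but \<open>y\<close> and the
  energy itself, which is a scalar Lipschitz function. The bound does not depend on \<open>\<epsilon>\<close>.\<close>
lemma energy_derivative:
  fixes y :: "real \<Rightarrow> 'h"
  assumes e: "0 < \<epsilon>" and t: "0 < t" "t < R"
    and y: "K-lipschitz_on {0..R} y" and Y: "\<And>s. s \<in> {0..R} \<Longrightarrow> norm (y s) \<le> Y"
    and dy: "(y has_vector_derivative y') (at t)"
    and de: "((\<lambda>s. Re (cinner (B s (res \<epsilon> s (y s))) (res \<epsilon> s (y s)))) has_real_derivative E) (at t)"
  defines "x \<equiv> res \<epsilon> t (y t)"
  shows "\<bar>E - 2 * Re (cinner (res (- \<epsilon>) t (B t x)) y')\<bar> \<le> C0 * (norm x + norm (B t x)) * norm x"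
proof -
  have e': "\<epsilon> \<noteq> 0" "- \<epsilon> \<noteq> 0" using e by auto
  have tI: "t \<in> {0..R}" using t by simp
  define X where "X h = res \<epsilon> (t + h) (y (t + h))" for h
  define b where "b s = B s (res \<epsilon> s (y s))" for s
  define N where "N h = norm (X h) + norm (B t (X h))" for h
  define U where "U h = res (- \<epsilon>) t (B t (X h) + B t x)" for h
  define u where "u = res (- \<epsilon>) t (B t x)"
  define en where "en s = Re (cinner (B s (res \<epsilon> s (y s))) (res \<epsilon> s (y s)))" for s
  have ev: "\<forall>\<^sub>F h in at_right 0. 0 < h \<and> t + h < R"
  proof (rule eventually_conj)
    have "\<forall>\<^sub>F h in at_right 0. h < R - t"
      using t by (intro order_tendstoD(2)[OF tendsto_ident_at]) simp
    then show "\<forall>\<^sub>F h in at_right 0. t + h < R" by eventually_elim simp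
  qed (rule eventually_at_right_less)
  have cont: "isCont f t" if "C-lipschitz_on {0..R} f" for f :: "real \<Rightarrow> 'h" and C
  proof -
    have "continuous (at t within {0..R}) f"
      using lipschitz_on_continuous_on[OF that] tI by (simp add: continuous_on_eq_continuous_within)
    then show ?thesis unfolding at_within_Icc_at[OF t] .
  qed
  have lX: "(X \<longlongrightarrow> x) (at_right 0)"
    using isCont_imp_tendsto_at_right[OF cont] res_apply_lipschitz[OF e'(1) y Y]
    unfolding X_def x_def by blast
  have lb: "((\<lambda>h. b (t + h)) \<longlongrightarrow> B t x) (at_right 0)"
    using isCont_imp_tendsto_at_right[OF cont] B_res_apply_lipschitz[OF e'(1) y Y]
    unfolding b_def x_def by blast
  have lid: "((\<lambda>h::real. h) \<longlongrightarrow> 0) (at_right 0)" by (rule tendsto_ident_at)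
  have l0: "((\<lambda>h. b (t + h) - B t (X h)) \<longlongrightarrow> 0) (at_right 0)"
  proof (rule Lim_null_comparison)
    show "\<forall>\<^sub>F h in at_right 0. norm (b (t + h) - B t (X h)) \<le> L * h * (norm (X h) + norm (b (t + h)))"
      using ev
    proof eventually_elim
      case (elim h)
      then have h: "t + h \<in> {0..R}" using t by simp
      show ?case
        using B_lip[OF h tI h res_in[OF h e'(1), of "y (t + h)"]] elim by (simp add: b_def X_def)
    qed
    have "((\<lambda>h. L * h * (norm (X h) + norm (b (t + h)))) \<longlongrightarrow> L * 0 * (norm x + norm (B t x))) (at_right 0)"
      by (intro tendsto_intros lX lb lid)
    then show "((\<lambda>h. L * h * (norm (X h) + norm (b (t + h)))) \<longlongrightarrow> 0) (at_right 0)" by simp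
  qed
  have lBX: "((\<lambda>h. B t (X h)) \<longlongrightarrow> B t x) (at_right 0)"
    using tendsto_diff[OF lb l0] by simp
  have lU: "(U \<longlongrightarrow> u + u) (at_right 0)"
    unfolding U_def u_def blinfun.add_right[symmetric]
    by (intro blinfun.tendsto tendsto_const tendsto_add lBX)
  have lN: "(N \<longlongrightarrow> norm x + norm (B t x)) (at_right 0)"
    unfolding N_def by (intro tendsto_intros lX lBX)
  have lE: "((\<lambda>h. (en (t + h) - en t) / h) \<longlongrightarrow> E) (at_right 0)"
    using de unfolding DERIV_def en_def by (rule tendsto_within_subset) simp
  have "\<bar>E - Re (cinner (u + u) y')\<bar>
    \<le> L * (norm x + norm (B t x)) * norm x + L * norm (u + u) * norm x
      + L * (1 + L / c) * norm (x + x) * (norm x + norm (B t x))"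
  proof (rule tendsto_le[OF trivial_limit_at_right_real])
    show "((\<lambda>h. L * N h * norm (X h) + L * norm (U h) * norm (X h) + L * (1 + L / c) * norm (X h + x) * N h) \<longlongrightarrow>
      L * (norm x + norm (B t x)) * norm x + L * norm (u + u) * norm x
      + L * (1 + L / c) * norm (x + x) * (norm x + norm (B t x))) (at_right 0)"
      by (intro tendsto_intros lX lN lU)
    show "((\<lambda>h. \<bar>(en (t + h) - en t) / h - Re (cinner (U h) ((1 / h) *\<^sub>R (y (t + h) - y t)))\<bar>)
      \<longlongrightarrow> \<bar>E - Re (cinner (u + u) y')\<bar>) (at_right 0)"
      by (intro tendsto_rabs tendsto_diff lE tendsto_Re cinner.tendsto lU
          has_vector_derivative_quotient_right[OF dy])
    show "\<forall>\<^sub>F h in at_right 0. \<bar>(en (t + h) - en t) / h - Re (cinner (U h) ((1 / h) *\<^sub>R (y (t + h) - y t)))\<bar>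
      \<le> L * N h * norm (X h) + L * norm (U h) * norm (X h) + L * (1 + L / c) * norm (X h + x) * N h"
      using ev
    proof eventually_elim
      case (elim h)
      then have h: "0 < h" "t + h \<in> {0..R}" "t < t + h" using t by auto
      have "\<bar>en (t + h) - en t - Re (cinner (U h) (y (t + h) - y t))\<bar>
        \<le> h * (L * N h * norm (X h) + L * norm (U h) * norm (X h) + L * (1 + L / c) * norm (X h + x) * N h)"
        using energy_increment[OF e tI h(2,3), of "y (t + h)" "y t"]
        by (simp add: en_def X_def x_def U_def N_def)
      moreover have "(en (t + h) - en t) / h - Re (cinner (U h) ((1 / h) *\<^sub>R (y (t + h) - y t)))
        = (en (t + h) - en t - Re (cinner (U h) (y (t + h) - y t))) / h"
      proof -
        have "Re (cinner (U h) ((1 / h) *\<^sub>R d)) = Re (cinner (U h) d) / h" for d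
          unfolding cinner_scaleR_right by simp
        then show ?thesis by (simp only: diff_divide_distrib)
      qed
      ultimately show ?case using h(1) by (simp add: pos_divide_le_eq mult.commute)
    qed
  qed
  also have "\<dots> \<le> C0 * (norm x + norm (B t x)) * norm x"
  proof -
    let ?n = "norm x + norm (B t x)"
    have u: "norm u \<le> norm (B t x) / c" unfolding u_def by (rule res_bound[OF tI e'(2)])
    also have "\<dots> \<le> ?n / c" using c_pos by (intro divide_right_mono) auto
    finally have un: "norm u \<le> ?n / c" .
    have "norm (u + u) \<le> 2 * (?n / c)"
      using order_trans[OF norm_triangle_ineq add_mono[OF un un]] by (simp only: mult_2)
    then have A: "L * norm (u + u) * norm x \<le> L * (2 * (?n / c)) * norm x"
      using L_pos by (intro mult_right_mono mult_left_mono) auto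
    have xx: "norm (x + x) = 2 * norm x" using norm_scaleR[of 2 x] by (simp add: scaleR_2)
    have "L * ?n * norm x + L * norm (u + u) * norm x + L * (1 + L / c) * norm (x + x) * ?n
      \<le> L * ?n * norm x + L * (2 * (?n / c)) * norm x + L * (1 + L / c) * (2 * norm x) * ?n"
      unfolding xx by (intro add_mono A order_refl)
    also have "\<dots> = C0 * ?n * norm x" by (simp add: C0_def divide_inverse algebra_simps)
    finally show ?thesis .
  qed
  finally have "\<bar>E - Re (cinner (u + u) y')\<bar> \<le> C0 * (norm x + norm (B t x)) * norm x" .
  moreover have "Re (cinner (u + u) y') = 2 * Re (cinner u y')" by (simp add: cinner_add_left)
  ultimately show ?thesis by (simp add: u_def)
qed

text \<open>If \<open>w = 0\<close> then the pairing is \<open>\<langle>G\<^sup>-\<^sup>1 b, b\<rangle>\<close>, which is the good term of the energy estimate. The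
  vector \<open>w\<close> is the error made by mollification; it is penalised by \<open>1 / \<epsilon>\<close>.\<close>
lemma resolvent_pairing:
  fixes y :: 'h
  assumes e: "0 < \<epsilon>" and t: "t \<in> {0..R}" and s: "G t s = y + w"
  defines "b \<equiv> B t (res \<epsilon> t y)"
  shows "c / L\<^sup>2 * (norm b)\<^sup>2 - 2 / (c * \<epsilon>) * norm b * norm w \<le> Re (cinner (B t (res (- \<epsilon>) t b)) s)"
proof -
  have e': "\<epsilon> \<noteq> 0" "- \<epsilon> \<noteq> 0" using e by auto
  define x where "x = res \<epsilon> t y"
  define u where "u = res (- \<epsilon>) t b"
  define q where "q = Ginv t b"
  have "G t (x - s) = - scaleC (ie \<epsilon>) b - w"
    using ie_B_res[OF t e'(1), of y] s by (simp add: blinfun.diff_right b_def x_def)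
  from arg_cong[OF this, of "Ginv t"]
  have xs: "x - s = - Ginv t (scaleC (ie \<epsilon>) b) - Ginv t w"
    by (simp only: Ginv_G[OF t] blinfun.diff_right blinfun.minus_right)
  have "ie (- \<epsilon>) * cinner (B t u) s = cinner (scaleC (ie (- \<epsilon>)) (B t u)) s" by (simp add: cinner_scaleC_left)
  also have "\<dots> = cinner b s - cinner (G t u) s"
    unfolding u_def ie_B_res[OF t e'(2)] by (rule cinner_diff_left)
  also have "cinner (G t u) s = cinner u y + cinner u w"
    unfolding G_sym[OF t] s by (rule cinner_add_right)
  also have "cinner u y = cinner b x"
    unfolding u_def x_def using res_adjoint[OF t e'(2), of b y] by simp
  finally have "ie (- \<epsilon>) * cinner (B t u) s = - cinner b (x - s) - cinner u w"
    by (simp add: cinner_diff_right)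
  also have "cinner b (x - s) = - cinner q (scaleC (ie \<epsilon>) b) - cinner q w"
    unfolding xs q_def Ginv_sym[OF t] by (simp add: cinner_diff_right cinner_minus_right)
  finally have "ie (- \<epsilon>) * cinner (B t u) s = ie (- \<epsilon>) * cinner q b + cinner (q - u) w"
    by (simp add: cinner_scaleC_right cinner_diff_left)
  then have "cinner (B t u) s = cinner q b + cinner (q - u) w / ie (- \<epsilon>)"
    using e by (simp add: field_simps)
  then have "Re (cinner q b) - cmod (cinner (q - u) w / ie (- \<epsilon>)) \<le> Re (cinner (B t u) s)"
    using abs_Re_le_cmod[of "cinner (q - u) w / ie (- \<epsilon>)"] by simp
  moreover have "cmod (cinner (q - u) w / ie (- \<epsilon>)) \<le> 2 / (c * \<epsilon>) * norm b * norm w"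
  proof -
    have "norm (q - u) \<le> norm q + norm u" by (rule norm_triangle_ineq4)
    also have "\<dots> \<le> norm b / c + norm b / c"
      unfolding q_def u_def by (intro add_mono Ginv_bound[OF t] res_bound[OF t e'(2)])
    finally have "norm (q - u) \<le> norm b / c + norm b / c" .
    from order_trans[OF cinner_cauchy_schwarz mult_right_mono[OF this norm_ge_zero]]
    have "cmod (cinner (q - u) w) \<le> (norm b / c + norm b / c) * norm w" .
    then have "cmod (cinner (q - u) w) / \<epsilon> \<le> (norm b / c + norm b / c) * norm w / \<epsilon>"
      using e by (intro divide_right_mono) auto
    then show ?thesis using e c_pos by (simp add: norm_divide norm_mult field_simps)
  qed
  moreover have "c / L\<^sup>2 * (norm b)\<^sup>2 \<le> Re (cinner q b)"
  proof -
    have Gq: "G t q = b" unfolding q_def by (rule G_Ginv[OF t])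
    have "norm b \<le> L * norm q" using G_bound[OF t, of q] Gq by simp
    then have "(norm b)\<^sup>2 \<le> (L * norm q)\<^sup>2" by (intro power_mono) auto
    then have "(norm b)\<^sup>2 / L\<^sup>2 \<le> (norm q)\<^sup>2" using L_pos by (simp add: power_mult_distrib pos_divide_le_eq mult.commute)
    then have "c * ((norm b)\<^sup>2 / L\<^sup>2) \<le> c * (norm q)\<^sup>2" using c_pos by (intro mult_left_mono) auto
    also have "\<dots> \<le> Re (cinner b q)" using G_pos[OF t, of q] Gq by simp
    finally show ?thesis using Re_cinner_commute[of b q] by simp
  qed
  ultimately show ?thesis by (simp add: u_def)
qed

end

section \<open>Regularity of weak solutions\<close>

lemma lipschitz_on_bounded_Icc:
  fixes f :: "real \<Rightarrow> 'b::real_normed_vector"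
  assumes f: "C-lipschitz_on {0..T} f" and T: "0 \<le> T"
  obtains Y where "0 \<le> Y" "\<And>t. t \<in> {0..T} \<Longrightarrow> norm (f t) \<le> Y"
proof (rule that[of "norm (f 0) + C * T"])
  have C: "0 \<le> C" by (rule lipschitz_on_nonneg[OF f])
  then show "0 \<le> norm (f 0) + C * T" using T by simp
  show "norm (f t) \<le> norm (f 0) + C * T" if t: "t \<in> {0..T}" for t
  proof -
    have "norm (f t - f 0) \<le> C * \<bar>t - 0\<bar>" using lipschitz_onD[OF f t, of 0] T by (simp add: dist_norm)
    also have "\<dots> \<le> C * T" using C t by (intro mult_left_mono) auto
    finally show ?thesis using norm_triangle_ineq2[of "f t" "f 0"] by linarith
  qed
qed

lemma L2_imp_integrable:
  fixes f :: "real \<Rightarrow> 'b::{banach, second_countable_topology}"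
  assumes f: "f \<in> borel_measurable (lebesgue_on {0..R})"
    and f2: "integrable (lebesgue_on {0..R}) (\<lambda>t. (norm (f t))\<^sup>2)"
  shows "integrable (lebesgue_on {0..R}) f"
proof (rule Bochner_Integration.integrable_bound[OF _ f])
  show "integrable (lebesgue_on {0..R}) (\<lambda>t. 1 + (norm (f t))\<^sup>2)"
    by (intro Bochner_Integration.integrable_add f2) simp
  have "a \<le> 1 + a\<^sup>2" for a :: real
    using zero_le_power2[of "a - 1/2"] by (simp add: power2_eq_square algebra_simps)
  then show "AE t in lebesgue_on {0..R}. norm (f t) \<le> norm (1 + (norm (f t))\<^sup>2)" by simp
qed

lemma L2_bound:
  fixes f :: "'a \<Rightarrow> 'b::real_normed_vector" and g :: "'a \<Rightarrow> 'c::real_normed_vector" and h :: "'a \<Rightarrow> 'd::real_normed_vector"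
  assumes h: "h \<in> borel_measurable M" and f2: "integrable M (\<lambda>t. (norm (f t))\<^sup>2)" and g2: "integrable M (\<lambda>t. (norm (g t))\<^sup>2)"
    and le: "AE t in M. norm (h t) \<le> a * norm (f t) + b * norm (g t)"
  shows "integrable M (\<lambda>t. (norm (h t))\<^sup>2)"
proof (rule Bochner_Integration.integrable_bound)
  show "integrable M (\<lambda>t. 2 * a\<^sup>2 * (norm (f t))\<^sup>2 + 2 * b\<^sup>2 * (norm (g t))\<^sup>2)"
    by (intro Bochner_Integration.integrable_add integrable_mult_right f2 g2)
  show "(\<lambda>t. (norm (h t))\<^sup>2) \<in> borel_measurable M"
    by (intro borel_measurable_power measurable_compose[OF h borel_measurable_norm])
  show "AE t in M. norm ((norm (h t))\<^sup>2) \<le> norm (2 * a\<^sup>2 * (norm (f t))\<^sup>2 + 2 * b\<^sup>2 * (norm (g t))\<^sup>2)"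
    using le
  proof eventually_elim
    case (elim t)
    have "(norm (h t))\<^sup>2 \<le> (a * norm (f t) + b * norm (g t))\<^sup>2" using elim by (intro power_mono) auto
    also have "\<dots> \<le> 2 * a\<^sup>2 * (norm (f t))\<^sup>2 + 2 * b\<^sup>2 * (norm (g t))\<^sup>2"
      using zero_le_power2[of "a * norm (f t) - b * norm (g t)"] by (simp add: power2_eq_square algebra_simps)
    finally show ?case by simp
  qed
qed

lemma mollify_bound:
  fixes f :: "real \<Rightarrow> 'b::{banach, second_countable_topology}"
  assumes d: "0 < \<delta>" and f: "integrable (lebesgue_on {0..R}) f" and F: "integrable (lebesgue_on {0..R}) F"
    and le: "\<And>r. r \<in> {0..R} \<Longrightarrow> 0 < r - t \<Longrightarrow> r - t < \<delta> \<Longrightarrow> norm (f r) \<le> C * F r"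
  shows "norm (mollify R \<delta> f t) \<le> C * mollify R \<delta> F t"
proof -
  have "norm (mollify R \<delta> f t) \<le> (LINT r|lebesgue_on {0..R}. mol \<delta> (r - t) *\<^sub>R norm (f r))"
    using norm_mollify_le[OF d] by (simp add: mollify_def)
  also have "\<dots> \<le> (LINT r|lebesgue_on {0..R}. mol \<delta> (r - t) *\<^sub>R (C * F r))"
  proof (rule integral_mono)
    show "integrable (lebesgue_on {0..R}) (\<lambda>r. mol \<delta> (r - t) *\<^sub>R norm (f r))"
      by (intro mol_integrable d integrable_norm f)
    show "integrable (lebesgue_on {0..R}) (\<lambda>r. mol \<delta> (r - t) *\<^sub>R (C * F r))"
      by (intro mol_integrable d integrable_mult_right F)
    fix r assume r: "r \<in> space (lebesgue_on {0..R})"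
    show "mol \<delta> (r - t) *\<^sub>R norm (f r) \<le> mol \<delta> (r - t) *\<^sub>R (C * F r)"
    proof (cases "0 < r - t \<and> r - t < \<delta>")
      case True
      then show ?thesis using le[of r] r mol_nonneg[OF d] by (intro scaleR_left_mono) auto
    next
      case False
      then have "mol \<delta> (r - t) = 0" using mol_eq_0[OF d, of "r - t"] by auto
      then show ?thesis by simp
    qed
  qed
  also have "\<dots> = C * mollify R \<delta> F t" by (simp add: mollify_def mult.left_commute)
  finally show ?thesis .
qed

lemma lipschitz_on_Re_cinner:
  fixes f g :: "real \<Rightarrow> 'h::complex_hilbert_space"
  assumes f: "C-lipschitz_on {0..R} f" and g: "D-lipschitz_on {0..R} g" and R: "0 \<le> R"
  shows "\<exists>E. E-lipschitz_on {0..R} (\<lambda>t. Re (cinner (f t) (g t)))"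
proof -
  obtain a where a: "0 \<le> a" "\<And>t. t \<in> {0..R} \<Longrightarrow> norm (f t) \<le> a" by (rule lipschitz_on_bounded_Icc[OF f R]) blast
  obtain b where b: "0 \<le> b" "\<And>t. t \<in> {0..R} \<Longrightarrow> norm (g t) \<le> b" by (rule lipschitz_on_bounded_Icc[OF g R]) blast
  have "(C * b + a * D)-lipschitz_on {0..R} (\<lambda>t. Re (cinner (f t) (g t)))"
  proof (rule lipschitz_onI)
    show "0 \<le> C * b + a * D"
      by (intro add_nonneg_nonneg[OF mult_nonneg_nonneg[OF lipschitz_on_nonneg[OF f] b(1)]
            mult_nonneg_nonneg[OF a(1) lipschitz_on_nonneg[OF g]]])
    fix r s assume rs: "r \<in> {0..R}" "s \<in> {0..R}"
    have "Re (cinner (f r) (g r)) - Re (cinner (f s) (g s))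
      = Re (cinner (f r - f s) (g r)) + Re (cinner (f s) (g r - g s))"
      by (simp add: cinner_algebra)
    then have "\<bar>Re (cinner (f r) (g r)) - Re (cinner (f s) (g s))\<bar>
      \<le> \<bar>Re (cinner (f r - f s) (g r))\<bar> + \<bar>Re (cinner (f s) (g r - g s))\<bar>" by (simp only: abs_triangle_ineq)
    also have "\<dots> \<le> norm (f r - f s) * norm (g r) + norm (f s) * norm (g r - g s)"
      by (intro add_mono abs_Re_cinner_le)
    also have "\<dots> \<le> (C * \<bar>r - s\<bar>) * b + a * (D * \<bar>r - s\<bar>)"
    proof (intro add_mono mult_mono)
      show "norm (f r - f s) \<le> C * \<bar>r - s\<bar>" using lipschitz_onD[OF f rs] by (simp add: dist_norm)
      show "norm (g r - g s) \<le> D * \<bar>r - s\<bar>" using lipschitz_onD[OF g rs] by (simp add: dist_norm)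
    qed (use a b rs lipschitz_on_nonneg[OF f] in auto)
    finally show "dist (Re (cinner (f r) (g r))) (Re (cinner (f s) (g s))) \<le> (C * b + a * D) * dist r s"
      by (simp add: dist_real_def algebra_simps)
  qed
  then show ?thesis by blast
qed

text \<open>The equation \<open>(G \<sigma>)' + B \<sigma> = k\<close> in weak form. The unbounded operator acts on the test vector,
  and test functions are free at \<open>R\<close>, which encodes that \<open>\<sigma>\<close> vanishes beyond \<open>R\<close>.\<close>
locale weak_solution = coercive_family R L c G S B
  for R L c :: real
    and G :: "real \<Rightarrow> 'h::{complex_hilbert_space, second_countable_topology} \<Rightarrow>\<^sub>L 'h"
    and S :: "'h set" and B :: "real \<Rightarrow> 'h \<Rightarrow> 'h" +
  fixes \<sigma> k :: "real \<Rightarrow> 'h"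
  assumes \<sigma>_meas: "\<sigma> \<in> borel_measurable (lebesgue_on {0..R})"
    and \<sigma>_L2: "integrable (lebesgue_on {0..R}) (\<lambda>t. (norm (\<sigma> t))\<^sup>2)"
    and k_meas: "k \<in> borel_measurable (lebesgue_on {0..R})"
    and k_L2: "integrable (lebesgue_on {0..R}) (\<lambda>t. (norm (k t))\<^sup>2)"
    and weak: "\<And>K \<phi> \<phi>' u. K-lipschitz_on {0..R} \<phi> \<Longrightarrow> \<phi> 0 = 0 \<Longrightarrow>
      \<phi>' \<in> borel_measurable (lebesgue_on {0..R}) \<Longrightarrow> (\<And>t. t \<in> {0..R} \<Longrightarrow> \<bar>\<phi>' t\<bar> \<le> K) \<Longrightarrow>
      (AE t in lebesgue_on {0..R}. (\<phi> has_real_derivative \<phi>' t) (at t)) \<Longrightarrow> u \<in> S \<Longrightarrow>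
      (LINT t|lebesgue_on {0..R}. \<phi>' t *\<^sub>R cinner u (G t (\<sigma> t))
        + \<phi> t *\<^sub>R (cinner u (k t) - cinner (B t u) (\<sigma> t))) = 0"
begin

abbreviation M :: "real measure" where "M \<equiv> lebesgue_on {0..R}"

definition z :: "real \<Rightarrow> 'h" where "z t = G t (\<sigma> t)"

text \<open>The square integrable function to which all error terms are compared.\<close>
definition F :: "real \<Rightarrow> real" where "F t = norm (\<sigma> t) + norm (k t)"

lemma \<sigma>_int: "integrable M \<sigma>" by (rule L2_imp_integrable[OF \<sigma>_meas \<sigma>_L2])
lemma k_int: "integrable M k" by (rule L2_imp_integrable[OF k_meas k_L2])
lemma F_int: "integrable M F" unfolding F_def by (intro Bochner_Integration.integrable_add integrable_norm \<sigma>_int k_int)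
lemma F_meas: "F \<in> borel_measurable M" using F_int by (rule borel_measurable_integrable)
lemma F_nonneg: "0 \<le> F t" by (simp add: F_def)
lemma F_L2: "integrable M (\<lambda>t. (F t)\<^sup>2)"
  using L2_bound[OF F_meas \<sigma>_L2 k_L2, of 1 1] by (simp add: F_def[abs_def])

lemma z_meas: "z \<in> borel_measurable M"
  unfolding z_def by (rule G_apply_measurable[OF order_refl \<sigma>_meas])

lemma z_le: "t \<in> {0..R} \<Longrightarrow> norm (z t) \<le> L * F t"
  using order_trans[OF G_bound mult_left_mono[of "norm (\<sigma> t)" "F t" L]] L_pos by (simp add: z_def F_def)

lemma z_int: "integrable M z"
proof (rule Bochner_Integration.integrable_bound[OF integrable_mult_right[OF F_int] z_meas])
  show "AE t in M. norm (z t) \<le> norm (L * F t)"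
    by (rule AE_I2) (use z_le L_pos F_nonneg in auto)
qed

lemma B_u_lipschitz:
  assumes u: "u \<in> S" shows "(L * (norm u + norm (B 0 u)))-lipschitz_on {0..R} (\<lambda>t. B t u)"
  by (rule lipschitz_onI) (use B_lip[of _ _ 0 u] u R_pos L_pos in \<open>auto simp: dist_norm mult_ac\<close>)

lemma B_u_\<sigma>_int:
  assumes u: "u \<in> S" shows "integrable M (\<lambda>r. cinner (B r u) (\<sigma> r))"
proof (rule Bochner_Integration.integrable_bound)
  let ?K = "norm (B 0 u) + L * (norm u + norm (B 0 u)) * R"
  show "integrable M (\<lambda>r. ?K * norm (\<sigma> r))" by (intro integrable_mult_right integrable_norm \<sigma>_int)
  have "(\<lambda>t. B t u) \<in> borel_measurable M"
    by (intro continuous_on_imp_measurable_lebesgue_on lipschitz_on_continuous_on[OF B_u_lipschitz[OF u]])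
  then show "(\<lambda>r. cinner (B r u) (\<sigma> r)) \<in> borel_measurable M" using \<sigma>_meas by (rule measurable_cinner)
  show "AE r in M. norm (cinner (B r u) (\<sigma> r)) \<le> norm (?K * norm (\<sigma> r))"
  proof (rule AE_I2)
    fix r assume "r \<in> space M"
    then have r: "r \<in> {0..R}" by simp
    have "norm (B r u - B 0 u) \<le> L * \<bar>r - 0\<bar> * (norm u + norm (B 0 u))"
      using r R_pos by (intro B_lip u) auto
    also have "\<dots> \<le> L * R * (norm u + norm (B 0 u))" using r L_pos by (intro mult_right_mono mult_left_mono) auto
    finally have "norm (B r u) \<le> ?K" using norm_triangle_ineq2[of "B r u" "B 0 u"] by (simp add: mult_ac)
    then have "norm (B r u) * norm (\<sigma> r) \<le> ?K * norm (\<sigma> r)" by (rule mult_right_mono) simp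
    with cinner_cauchy_schwarz have "norm (cinner (B r u) (\<sigma> r)) \<le> ?K * norm (\<sigma> r)" by (rule order_trans)
    then show "norm (cinner (B r u) (\<sigma> r)) \<le> norm (?K * norm (\<sigma> r))"
      by (rule order_trans) (simp only: real_norm_def abs_ge_self)
  qed
qed

subsection \<open>Mollification of the equation\<close>

definition z' :: "real \<Rightarrow> real \<Rightarrow> 'h" where
  "z' \<delta> t = - (LINT r|M. mol_deriv \<delta> (r - t) *\<^sub>R z r)"

lemma mollify_z_derivative:
  "0 < \<delta> \<Longrightarrow> t \<in> {0..R} \<Longrightarrow> (mollify R \<delta> z has_vector_derivative z' \<delta> t) (at t)"
  unfolding z'_def by (rule mollify_has_derivative) (use R_pos z_int in auto)

text \<open>The weak equation tested with the translated bump.\<close>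
lemma mollified_equation:
  assumes d: "0 < \<delta>" and t: "t \<in> {0..R}" and u: "u \<in> S"
  shows "cinner u (z' \<delta> t) = cinner u (mollify R \<delta> k t) - (LINT r|M. mol \<delta> (r - t) *\<^sub>R cinner (B r u) (\<sigma> r))"
proof -
  let ?K = "60 / \<delta> ^ 5 * (\<delta>\<^sup>2 / 4) * (\<delta> + 2 * R)"
  let ?f = "\<lambda>r. mol \<delta> (r - t)" and ?f' = "\<lambda>r. mol_deriv \<delta> (r - t)"
  have bd: "\<bar>?f' r\<bar> \<le> ?K" if "r \<in> {0..R}" for r
    by (rule mol_deriv_bounded[OF d]) (use that t in auto)
  have K: "0 \<le> ?K" using d R_pos by simp
  have der: "(?f has_real_derivative ?f' r) (at r)" for r
  proof -
    have "((\<lambda>r. r - t) has_real_derivative 1) (at r)" by (auto intro!: derivative_eq_intros)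
    from DERIV_chain2[OF mol_has_derivative[OF d] this] show ?thesis by simp
  qed
  have lip: "?K-lipschitz_on {0..R} ?f"
    by (rule vector_derivative_bound_lipschitz[where f' = ?f'])
      (use der bd K in \<open>auto simp: has_real_derivative_iff_has_vector_derivative[symmetric]\<close>)
  have z0: "mol \<delta> (0 - t) = 0" using t by (intro mol_eq_0[OF d]) auto
  have m': "?f' \<in> borel_measurable M" by (rule borel_imp_lebesgue_on_measurable) measurable
  have i1: "integrable M (\<lambda>r. ?f' r *\<^sub>R z r)" by (rule mol_deriv_integrable) (use d t z_int in auto)
  have i2: "integrable M (\<lambda>r. ?f r *\<^sub>R k r)" by (intro mol_integrable d k_int)
  have i3: "integrable M (\<lambda>r. ?f r *\<^sub>R cinner (B r u) (\<sigma> r))" by (intro mol_integrable d B_u_\<sigma>_int u)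
  have j1: "integrable M (\<lambda>r. cinner u (?f' r *\<^sub>R z r))" by (intro integrable_bounded_linear[OF cinner.bounded_linear_right] i1)
  have j2: "integrable M (\<lambda>r. cinner u (?f r *\<^sub>R k r))" by (intro integrable_bounded_linear[OF cinner.bounded_linear_right] i2)
  have "0 = (LINT r|M. ?f' r *\<^sub>R cinner u (G r (\<sigma> r)) + ?f r *\<^sub>R (cinner u (k r) - cinner (B r u) (\<sigma> r)))"
    by (rule weak[OF lip z0 m' bd _ u, symmetric]) (use der in auto)
  also have "\<dots> = (LINT r|M. cinner u (?f' r *\<^sub>R z r) + (cinner u (?f r *\<^sub>R k r) - ?f r *\<^sub>R cinner (B r u) (\<sigma> r)))"
    by (simp add: z_def cinner.scaleR_right scaleR_diff_right)
  also have "\<dots> = (LINT r|M. cinner u (?f' r *\<^sub>R z r)) + ((LINT r|M. cinner u (?f r *\<^sub>R k r))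
      - (LINT r|M. ?f r *\<^sub>R cinner (B r u) (\<sigma> r)))"
    using j1 j2 i3 by (subst Bochner_Integration.integral_add) (auto intro!: Bochner_Integration.integrable_diff Bochner_Integration.integral_diff)
  also have "(LINT r|M. cinner u (?f' r *\<^sub>R z r)) = cinner u (- z' \<delta> t)"
    unfolding integral_bounded_linear[OF cinner.bounded_linear_right i1] z'_def by simp
  also have "(LINT r|M. cinner u (?f r *\<^sub>R k r)) = cinner u (mollify R \<delta> k t)"
    unfolding integral_bounded_linear[OF cinner.bounded_linear_right i2] mollify_def ..
  finally show ?thesis by (simp add: cinner_minus_right)
qed

text \<open>Mollification does not commute with \<open>B\<close> and \<open>G\<close>, but on the support of the bump these differ from
  their values at \<open>t\<close> by \<open>O(\<delta>)\<close>.\<close>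
lemma mollified_B_error:
  assumes d: "0 < \<delta>" and t: "t \<in> {0..R}" and u: "u \<in> S"
  shows "cmod ((LINT r|M. mol \<delta> (r - t) *\<^sub>R cinner (B r u) (\<sigma> r)) - cinner (B t u) (mollify R \<delta> \<sigma> t))
    \<le> L * \<delta> * (norm u + norm (B t u)) * mollify R \<delta> F t"
proof -
  have i1: "integrable M (\<lambda>r. mol \<delta> (r - t) *\<^sub>R cinner (B r u) (\<sigma> r))" by (intro mol_integrable d B_u_\<sigma>_int u)
  have i2: "integrable M (\<lambda>r. mol \<delta> (r - t) *\<^sub>R \<sigma> r)" by (intro mol_integrable d \<sigma>_int)
  have i3: "integrable M (\<lambda>r. cinner (B t u) (mol \<delta> (r - t) *\<^sub>R \<sigma> r))"
    by (intro integrable_bounded_linear[OF cinner.bounded_linear_right] i2)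
  have "cinner (B t u) (mollify R \<delta> \<sigma> t) = (LINT r|M. cinner (B t u) (mol \<delta> (r - t) *\<^sub>R \<sigma> r))"
    unfolding integral_bounded_linear[OF cinner.bounded_linear_right i2] mollify_def ..
  then have "(LINT r|M. mol \<delta> (r - t) *\<^sub>R cinner (B r u) (\<sigma> r)) - cinner (B t u) (mollify R \<delta> \<sigma> t)
    = (LINT r|M. mol \<delta> (r - t) *\<^sub>R cinner (B r u) (\<sigma> r) - cinner (B t u) (mol \<delta> (r - t) *\<^sub>R \<sigma> r))"
    by (simp only: Bochner_Integration.integral_diff[OF i1 i3])
  also have "\<dots> = mollify R \<delta> (\<lambda>r. cinner (B r u) (\<sigma> r) - cinner (B t u) (\<sigma> r)) t"
    unfolding mollify_def by (simp add: cinner.scaleR_right scaleR_diff_right)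
  finally have eq: "(LINT r|M. mol \<delta> (r - t) *\<^sub>R cinner (B r u) (\<sigma> r)) - cinner (B t u) (mollify R \<delta> \<sigma> t)
    = mollify R \<delta> (\<lambda>r. cinner (B r u) (\<sigma> r) - cinner (B t u) (\<sigma> r)) t" .
  show ?thesis unfolding eq
  proof (rule mollify_bound[OF d _ F_int])
    show "integrable M (\<lambda>r. cinner (B r u) (\<sigma> r) - cinner (B t u) (\<sigma> r))"
      by (intro Bochner_Integration.integrable_diff B_u_\<sigma>_int u integrable_bounded_linear[OF cinner.bounded_linear_right] \<sigma>_int)
    fix r assume r: "r \<in> {0..R}" "0 < r - t" "r - t < \<delta>"
    have "norm (B r u - B t u) \<le> L * \<bar>r - t\<bar> * (norm u + norm (B t u))" by (rule B_lip[OF r(1) t t u])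
    also have "\<dots> \<le> L * \<delta> * (norm u + norm (B t u))" using r L_pos by (intro mult_right_mono mult_left_mono) auto
    finally have "norm (B r u - B t u) * norm (\<sigma> r) \<le> L * \<delta> * (norm u + norm (B t u)) * F r"
      using L_pos d by (intro mult_mono) (auto simp: F_def)
    with cinner_cauchy_schwarz have "cmod (cinner (B r u - B t u) (\<sigma> r)) \<le> L * \<delta> * (norm u + norm (B t u)) * F r"
      by (rule order_trans)
    then show "cmod (cinner (B r u) (\<sigma> r) - cinner (B t u) (\<sigma> r)) \<le> L * \<delta> * (norm u + norm (B t u)) * F r"
      by (simp only: cinner_diff_left)
  qed
qed

lemma mollified_G_error:
  assumes d: "0 < \<delta>" and t: "t \<in> {0..R}"
  shows "norm (G t (mollify R \<delta> \<sigma> t) - mollify R \<delta> z t) \<le> L * \<delta> * mollify R \<delta> F t"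
proof -
  have i1: "integrable M (\<lambda>r. mol \<delta> (r - t) *\<^sub>R \<sigma> r)" by (intro mol_integrable d \<sigma>_int)
  have i2: "integrable M (\<lambda>r. G t (mol \<delta> (r - t) *\<^sub>R \<sigma> r))"
    by (intro integrable_bounded_linear[OF blinfun.bounded_linear_right] i1)
  have i3: "integrable M (\<lambda>r. mol \<delta> (r - t) *\<^sub>R z r)" by (intro mol_integrable d z_int)
  have "G t (mollify R \<delta> \<sigma> t) - mollify R \<delta> z t
    = (LINT r|M. G t (mol \<delta> (r - t) *\<^sub>R \<sigma> r)) - (LINT r|M. mol \<delta> (r - t) *\<^sub>R z r)"
    unfolding integral_bounded_linear[OF blinfun.bounded_linear_right i1] mollify_def ..
  also have "\<dots> = (LINT r|M. G t (mol \<delta> (r - t) *\<^sub>R \<sigma> r) - mol \<delta> (r - t) *\<^sub>R z r)"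
    by (rule Bochner_Integration.integral_diff[OF i2 i3, symmetric])
  also have "\<dots> = mollify R \<delta> (\<lambda>r. G t (\<sigma> r) - z r) t"
    unfolding mollify_def by (simp add: blinfun.scaleR_right scaleR_diff_right)
  finally have eq: "G t (mollify R \<delta> \<sigma> t) - mollify R \<delta> z t = mollify R \<delta> (\<lambda>r. G t (\<sigma> r) - z r) t" .
  show ?thesis unfolding eq
  proof (rule mollify_bound[OF d _ F_int])
    show "integrable M (\<lambda>r. G t (\<sigma> r) - z r)"
      by (intro Bochner_Integration.integrable_diff z_int integrable_bounded_linear[OF blinfun.bounded_linear_right] \<sigma>_int)
    fix r assume r: "r \<in> {0..R}" "0 < r - t" "r - t < \<delta>"
    have "norm (G t (\<sigma> r) - z r) \<le> L * \<bar>t - r\<bar> * norm (\<sigma> r)"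
      unfolding z_def by (rule G_lip_apply[OF t r(1)])
    also have "\<dots> \<le> L * \<delta> * F r" using r L_pos d by (intro mult_mono) (auto simp: F_def)
    finally show "norm (G t (\<sigma> r) - z r) \<le> L * \<delta> * F r" .
  qed
qed

lemma mollified_bounds:
  assumes d: "0 < \<delta>"
  shows "norm (mollify R \<delta> z t) \<le> L * mollify R \<delta> F t" "norm (mollify R \<delta> k t) \<le> mollify R \<delta> F t"
    "0 \<le> mollify R \<delta> F t"
proof -
  show "norm (mollify R \<delta> z t) \<le> L * mollify R \<delta> F t" by (rule mollify_bound[OF d z_int F_int]) (rule z_le)
  have "norm (mollify R \<delta> k t) \<le> 1 * mollify R \<delta> F t" by (rule mollify_bound[OF d k_int F_int]) (simp add: F_def)
  then show "norm (mollify R \<delta> k t) \<le> mollify R \<delta> F t" by simp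
  show "0 \<le> mollify R \<delta> F t" by (rule mollify_nonneg[OF d F_nonneg])
qed

end

context coercive_family begin

text \<open>The error of mollification in \<open>energy_inequality\<close> is \<open>\<delta> Q \<epsilon>\<close> times \<open>|B x|\<close> times the mean of \<open>F\<close>.\<close>
definition Q :: "real \<Rightarrow> real" where
  "Q \<epsilon> = 2 * R * L * (1 / c + (1 + L / c) / \<epsilon>) + 4 * R * L / (c * \<epsilon>)"

text \<open>The lower bound of the quadratic form of \<open>G\<^sup>-\<^sup>1\<close>.\<close>
definition \<kappa> :: real where "\<kappa> = c / L\<^sup>2"

text \<open>The total coefficient of \<open>|B x|\<close> times the mean of \<open>F\<close> in the energy estimate; completing the square
  leaves \<open>A0\<close> as coefficient of the squared mean. The summand \<open>1\<close> is the error of mollification.\<close>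
definition P0 :: real where "P0 = C0 * (R * L / c) + 2 * R / c + 2 * L / c + 1"

definition A0 :: real where "A0 = C0 * (R * L / c)\<^sup>2 + P0\<^sup>2 / (4 * \<kappa>)"

lemma \<kappa>_pos: "0 < \<kappa>" using c_pos L_pos by (simp add: \<kappa>_def)

lemma Q_pos: "0 < \<epsilon> \<Longrightarrow> 0 < Q \<epsilon>"
  using c_pos L_pos R_pos by (simp add: Q_def add_pos_pos)

lemma A0_nonneg: "0 \<le> A0"
  using \<kappa>_pos C0_nonneg by (simp add: A0_def)

end

context weak_solution begin

text \<open>The factor \<open>t\<close> removes the boundary term of the energy at \<open>0\<close>.\<close>
definition y :: "real \<Rightarrow> real \<Rightarrow> 'h" where "y \<delta> t = t *\<^sub>R mollify R \<delta> z t"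

definition x :: "real \<Rightarrow> real \<Rightarrow> real \<Rightarrow> 'h" where "x \<epsilon> \<delta> t = res \<epsilon> t (y \<delta> t)"

lemma y_derivative:
  assumes "0 < \<delta>" "t \<in> {0..R}"
  shows "(y \<delta> has_vector_derivative mollify R \<delta> z t + t *\<^sub>R z' \<delta> t) (at t)"
proof -
  have "((\<lambda>t. t *\<^sub>R mollify R \<delta> z t) has_vector_derivative (t *\<^sub>R z' \<delta> t + 1 *\<^sub>R mollify R \<delta> z t)) (at t)"
    by (rule has_vector_derivative_scaleR[OF DERIV_ident mollify_z_derivative[OF assms]])
  then show ?thesis by (simp add: y_def[abs_def] add.commute)
qed

lemma y_lipschitz:
  assumes d: "0 < \<delta>"
  shows "\<exists>K. K-lipschitz_on {0..R} (y \<delta>)" "\<exists>Y. \<forall>t\<in>{0..R}. norm (y \<delta> t) \<le> Y"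
proof -
  let ?I = "LINT r|M. norm (z r)"
  have I: "0 \<le> ?I" by simp
  have m: "norm (mollify R \<delta> z t) \<le> 2 / \<delta> * ?I" for t
  proof -
    have "norm (mollify R \<delta> z t) \<le> (LINT r|M. norm (mol \<delta> (r - t) *\<^sub>R z r))"
      unfolding mollify_def by (rule integral_norm_bound)
    also have "\<dots> \<le> (LINT r|M. 2 / \<delta> * norm (z r))"
    proof (rule integral_mono)
      show "integrable M (\<lambda>r. norm (mol \<delta> (r - t) *\<^sub>R z r))" by (intro integrable_norm mol_integrable d z_int)
      show "integrable M (\<lambda>r. 2 / \<delta> * norm (z r))" by (intro integrable_mult_right integrable_norm z_int)
      show "norm (mol \<delta> (r - t) *\<^sub>R z r) \<le> 2 / \<delta> * norm (z r)" for r
        using mult_right_mono[OF mol_le[OF d] norm_ge_zero] mol_nonneg[OF d, of "r - t"] by simp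
    qed
    also have "\<dots> = 2 / \<delta> * ?I" by (rule Bochner_Integration.integral_mult_right_zero)
    finally show ?thesis .
  qed
  let ?K = "60 / \<delta> ^ 5 * (\<delta>\<^sup>2 / 4) * (\<delta> + 2 * R)"
  have m': "norm (z' \<delta> t) \<le> ?K * ?I" if t: "t \<in> {0..R}" for t
  proof -
    have "norm (z' \<delta> t) \<le> (LINT r|M. norm (mol_deriv \<delta> (r - t) *\<^sub>R z r))"
      unfolding z'_def norm_minus_cancel by (rule integral_norm_bound)
    also have "\<dots> \<le> (LINT r|M. ?K * norm (z r))"
    proof (rule integral_mono)
      show "integrable M (\<lambda>r. norm (mol_deriv \<delta> (r - t) *\<^sub>R z r))"
        using t by (intro integrable_norm mol_deriv_integrable d z_int) auto
      show "integrable M (\<lambda>r. ?K * norm (z r))" by (intro integrable_mult_right integrable_norm z_int)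
      show "norm (mol_deriv \<delta> (r - t) *\<^sub>R z r) \<le> ?K * norm (z r)" if "r \<in> space M" for r
        unfolding norm_scaleR by (intro mult_right_mono mol_deriv_bounded d) (use that t in auto)
    qed
    also have "\<dots> = ?K * ?I" by (rule Bochner_Integration.integral_mult_right_zero)
    finally show ?thesis .
  qed
  have "(2 / \<delta> * ?I + R * (?K * ?I))-lipschitz_on {0..R} (y \<delta>)"
  proof (rule vector_derivative_bound_lipschitz)
    show "(y \<delta> has_vector_derivative mollify R \<delta> z t + t *\<^sub>R z' \<delta> t) (at t)" if "t \<in> {0..R}" for t
      by (rule y_derivative[OF d that])
    show "norm (mollify R \<delta> z t + t *\<^sub>R z' \<delta> t) \<le> 2 / \<delta> * ?I + R * (?K * ?I)" if "t \<in> {0..R}" for t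
    proof (rule order_trans[OF norm_triangle_ineq], rule add_mono[OF m])
      show "norm (t *\<^sub>R z' \<delta> t) \<le> R * (?K * ?I)"
        unfolding norm_scaleR by (intro mult_mono m' that) (use that R_pos in auto)
    qed
    show "0 \<le> 2 / \<delta> * ?I + R * (?K * ?I)"
      using d R_pos I by (intro add_nonneg_nonneg mult_nonneg_nonneg) auto
  qed
  then show "\<exists>K. K-lipschitz_on {0..R} (y \<delta>)" by blast
  have "norm (y \<delta> t) \<le> R * (2 / \<delta> * ?I)" if "t \<in> {0..R}" for t
    unfolding y_def norm_scaleR by (intro mult_mono m) (use that in auto)
  then show "\<exists>Y. \<forall>t\<in>{0..R}. norm (y \<delta> t) \<le> Y" by blast
qed

definition energy :: "real \<Rightarrow> real \<Rightarrow> real \<Rightarrow> real" where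
  "energy \<epsilon> \<delta> t = Re (cinner (B t (x \<epsilon> \<delta> t)) (x \<epsilon> \<delta> t))"

text \<open>The derivative of the energy is, up to controlled terms, twice the pairing of \<open>res (- \<epsilon>) t (B x)\<close> with
  \<open>t\<close> times the derivative of the mollified \<open>G \<sigma>\<close>. The equation turns this into the pairing with \<open>- B (t \<sigma>)\<close>, where \<open>resolvent_pairing\<close>
  applies.\<close>
lemma energy_inequality:
  assumes e: "0 < \<epsilon>" and d: "0 < \<delta>" and dQ: "\<delta> * Q \<epsilon> \<le> 1" and t: "0 < t" "t < R"
    and E: "(energy \<epsilon> \<delta> has_real_derivative E) (at t)"
  shows "\<kappa> * (norm (B t (x \<epsilon> \<delta> t)))\<^sup>2 \<le> - E + A0 * (mollify R \<delta> F t)\<^sup>2"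
proof -
  have e': "\<epsilon> \<noteq> 0" "- \<epsilon> \<noteq> 0" using e by auto
  have tI: "t \<in> {0..R}" using t by simp
  define b where "b = B t (x \<epsilon> \<delta> t)"
  define u where "u = res (- \<epsilon>) t b"
  define J where "J = mollify R \<delta> F t"
  define s where "s = t *\<^sub>R mollify R \<delta> \<sigma> t"
  define w where "w = G t s - y \<delta> t"
  define I where "I = (LINT r|M. mol \<delta> (r - t) *\<^sub>R cinner (B r u) (\<sigma> r))"
  have uS: "u \<in> S" unfolding u_def by (rule res_in[OF tI e'(2)])
  have J0: "0 \<le> J" unfolding J_def by (rule mollified_bounds(3)[OF d])
  obtain K Y where K: "K-lipschitz_on {0..R} (y \<delta>)" and Y: "\<And>s. s \<in> {0..R} \<Longrightarrow> norm (y \<delta> s) \<le> Y"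
    using y_lipschitz[OF d] by blast
  have nz: "norm (mollify R \<delta> z t) \<le> L * J" unfolding J_def by (rule mollified_bounds(1)[OF d])
  have ny: "norm (y \<delta> t) \<le> R * (L * J)"
    unfolding y_def norm_scaleR by (intro mult_mono nz) (use t in auto)
  have nx: "norm (x \<epsilon> \<delta> t) \<le> R * L / c * J"
  proof -
    have "norm (x \<epsilon> \<delta> t) \<le> norm (y \<delta> t) / c" unfolding x_def by (rule res_bound[OF tI e'(1)])
    also have "\<dots> \<le> R * (L * J) / c" using ny c_pos by (intro divide_right_mono) auto
    finally show ?thesis by simp
  qed
  have nu: "norm u \<le> norm b / c" unfolding u_def by (rule res_bound[OF tI e'(2)])
  have nBu: "norm (B t u) \<le> (1 + L / c) / \<epsilon> * norm b"
    using B_res_bound[OF tI e'(2), of b] e by (simp add: u_def pos_le_divide_eq mult.commute)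
  have nw: "norm w \<le> R * (L * \<delta> * J)"
  proof -
    have "w = t *\<^sub>R (G t (mollify R \<delta> \<sigma> t) - mollify R \<delta> z t)"
      by (simp add: w_def s_def y_def blinfun.scaleR_right scaleR_diff_right)
    then have "norm w = \<bar>t\<bar> * norm (G t (mollify R \<delta> \<sigma> t) - mollify R \<delta> z t)" by simp
    also have "\<dots> \<le> R * (L * \<delta> * J)"
      unfolding J_def by (intro mult_mono mollified_G_error d tI) (use t in auto)
    finally show ?thesis .
  qed
  \<comment> \<open>The vector \<open>w\<close> is the error from interchanging mollification with \<open>G\<close>.\<close>
  have s1: "\<kappa> * (norm b)\<^sup>2 \<le> Re (cinner (B t u) s) + 2 / (c * \<epsilon>) * norm b * norm w"
    using resolvent_pairing[OF e tI, of s "y \<delta> t" w]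
    unfolding w_def[symmetric] by (simp add: w_def \<kappa>_def b_def x_def u_def)
  \<comment> \<open>Mollification is interchanged with \<open>B\<close>, to make the integral of the weak equation appear.\<close>
  have s2: "Re (cinner (B t u) s) \<le> t * Re I + R * (L * \<delta> * (norm u + norm (B t u)) * J)"
  proof -
    have err: "cmod (I - cinner (B t u) (mollify R \<delta> \<sigma> t)) \<le> L * \<delta> * (norm u + norm (B t u)) * J"
      unfolding I_def J_def by (rule mollified_B_error[OF d tI uS])
    have "Re (cinner (B t u) s) = t * Re (cinner (B t u) (mollify R \<delta> \<sigma> t))"
      unfolding s_def cinner_scaleR_right by simp
    also have "\<dots> = t * Re I - t * Re (I - cinner (B t u) (mollify R \<delta> \<sigma> t))"
      by (simp add: algebra_simps)
    also have "\<dots> \<le> t * Re I + t * cmod (I - cinner (B t u) (mollify R \<delta> \<sigma> t))"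
    proof -
      have "- Re (I - cinner (B t u) (mollify R \<delta> \<sigma> t)) \<le> cmod (I - cinner (B t u) (mollify R \<delta> \<sigma> t))"
        using abs_Re_le_cmod[of "I - cinner (B t u) (mollify R \<delta> \<sigma> t)"] by linarith
      then have "t * - Re (I - cinner (B t u) (mollify R \<delta> \<sigma> t)) \<le> t * cmod (I - cinner (B t u) (mollify R \<delta> \<sigma> t))"
        using t by (intro mult_left_mono) auto
      then show ?thesis unfolding mult_minus_right by linarith
    qed
    also have "\<dots> \<le> t * Re I + R * (L * \<delta> * (norm u + norm (B t u)) * J)"
      using t by (intro add_left_mono mult_mono err) auto
    finally show ?thesis .
  qed
  have s3: "Re (cinner u (z' \<delta> t)) = Re (cinner u (mollify R \<delta> k t)) - Re I"
    unfolding mollified_equation[OF d tI uS] I_def by simp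
  have s4: "\<bar>E - 2 * Re (cinner u (mollify R \<delta> z t + t *\<^sub>R z' \<delta> t))\<bar>
      \<le> C0 * (norm (x \<epsilon> \<delta> t) + norm b) * norm (x \<epsilon> \<delta> t)"
    unfolding u_def b_def x_def
    by (rule energy_derivative[OF e t K Y y_derivative[OF d tI]])
       (use E in \<open>simp_all add: energy_def[abs_def] x_def\<close>)
  have s5: "Re (cinner u (mollify R \<delta> z t + t *\<^sub>R z' \<delta> t))
      = Re (cinner u (mollify R \<delta> z t)) + t * Re (cinner u (mollify R \<delta> k t)) - t * Re I"
    unfolding cinner_add_right cinner_scaleR_right plus_complex.sel Re_divide_of_real
    by (simp add: s3 right_diff_distrib)
  have s6: "Re (cinner u (mollify R \<delta> z t)) \<le> norm b / c * (L * J)"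
    using Re_cinner_le by (rule order_trans) (intro mult_mono nu nz, use c_pos in auto)
  have s7: "t * Re (cinner u (mollify R \<delta> k t)) \<le> R * (norm b / c * J)"
  proof -
    have "Re (cinner u (mollify R \<delta> k t)) \<le> norm b / c * J"
      using Re_cinner_le
      by (rule order_trans) (intro mult_mono nu mollified_bounds(2)[OF d, of t, folded J_def], use c_pos in auto)
    then have "t * Re (cinner u (mollify R \<delta> k t)) \<le> t * (norm b / c * J)" using t by (intro mult_left_mono) auto
    also have "\<dots> \<le> R * (norm b / c * J)" using t J0 c_pos by (intro mult_right_mono mult_nonneg_nonneg) auto
    finally show ?thesis .
  qed
  have s8: "C0 * (norm (x \<epsilon> \<delta> t) + norm b) * norm (x \<epsilon> \<delta> t)
      \<le> C0 * (R * L / c * J + norm b) * (R * L / c * J)"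
    using nx C0_nonneg R_pos L_pos c_pos J0
    by (intro mult_mono mult_left_mono add_right_mono mult_nonneg_nonneg add_nonneg_nonneg) auto
  have s9: "2 * (R * (L * \<delta> * (norm u + norm (B t u)) * J)) + 2 * (2 / (c * \<epsilon>) * norm b * norm w) \<le> norm b * J"
  proof -
    have "norm u + norm (B t u) \<le> norm b / c + (1 + L / c) / \<epsilon> * norm b" by (rule add_mono[OF nu nBu])
    also have "\<dots> = (1 / c + (1 + L / c) / \<epsilon>) * norm b" by (simp add: divide_inverse algebra_simps)
    finally have "R * (L * \<delta> * (norm u + norm (B t u)) * J)
      \<le> R * (L * \<delta> * ((1 / c + (1 + L / c) / \<epsilon>) * norm b) * J)"
      using R_pos L_pos d J0 by (intro mult_left_mono mult_right_mono) auto
    moreover have "2 / (c * \<epsilon>) * norm b * norm w \<le> 2 / (c * \<epsilon>) * norm b * (R * (L * \<delta> * J))"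
      using c_pos e by (intro mult_left_mono nw mult_nonneg_nonneg) auto
    ultimately have "2 * (R * (L * \<delta> * (norm u + norm (B t u)) * J)) + 2 * (2 / (c * \<epsilon>) * norm b * norm w)
      \<le> 2 * (R * (L * \<delta> * ((1 / c + (1 + L / c) / \<epsilon>) * norm b) * J))
        + 2 * (2 / (c * \<epsilon>) * norm b * (R * (L * \<delta> * J)))"
      by - (rule add_mono[OF mult_left_mono mult_left_mono], assumption, simp, assumption, simp)
    also have "\<dots> = (\<delta> * Q \<epsilon>) * (norm b * J)"
      by (simp add: Q_def divide_inverse algebra_simps)
    also have "\<dots> \<le> 1 * (norm b * J)" using dQ J0 by (intro mult_right_mono) auto
    finally show ?thesis by simp
  qed
  have "2 * (\<kappa> * (norm b)\<^sup>2) \<le> - E + C0 * (R * L / c * J + norm b) * (R * L / c * J)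
      + 2 * (norm b / c * (L * J)) + 2 * (R * (norm b / c * J)) + norm b * J"
  proof -
    have "2 * kb \<le> - E + Y2 + 2 * Z + 2 * K + BJ"
      if "kb \<le> q + W" "q \<le> tI + V" "\<bar>E - 2 * (uz + uk - tI)\<bar> \<le> Y1" "uz \<le> Z" "uk \<le> K" "Y1 \<le> Y2"
        "2 * V + 2 * W \<le> BJ" for kb q W tI V uz uk Y1 Y2 Z K BJ :: real
    proof -
      have "E - 2 * (uz + uk - tI) \<le> Y1" using that(3) by (rule abs_le_D1)
      then show ?thesis using that(1,2,4-) by (simp only: right_diff_distrib distrib_left)
    qed
    from this[OF s1 s2 s4[unfolded s5] s6 s7 s8 s9] show ?thesis .
  qed
  also have "\<dots> = - E + C0 * (R * L / c)\<^sup>2 * J\<^sup>2 + P0 * (norm b * J)"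
    by (simp add: P0_def power2_eq_square divide_inverse algebra_simps)
  also have "P0 * (norm b * J) \<le> \<kappa> * (norm b)\<^sup>2 + P0\<^sup>2 / (4 * \<kappa>) * J\<^sup>2"
  proof -
    \<comment> \<open>One half of the good term absorbs the terms that are linear in \<open>b\<close>.\<close>
    have "0 \<le> (2 * \<kappa> * norm b - P0 * J)\<^sup>2 / (4 * \<kappa>)" using \<kappa>_pos by simp
    also have "\<dots> = \<kappa> * (norm b)\<^sup>2 + P0\<^sup>2 / (4 * \<kappa>) * J\<^sup>2 - P0 * (norm b * J)"
      using \<kappa>_pos by (simp add: power2_eq_square field_simps)
    finally show ?thesis by simp
  qed
  finally have "\<kappa> * (norm b)\<^sup>2 \<le> - E + (C0 * (R * L / c)\<^sup>2 * J\<^sup>2 + P0\<^sup>2 / (4 * \<kappa>) * J\<^sup>2)" by simp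
  then show ?thesis by (simp add: A0_def b_def J_def distrib_right)
qed

text \<open>The energy vanishes at \<open>0\<close> because of the factor \<open>t\<close>, and at \<open>R\<close> because the mollifier looks to the right.\<close>
lemma integrated_energy_inequality:
  assumes e: "0 < \<epsilon>" and d: "0 < \<delta>" and dQ: "\<delta> * Q \<epsilon> \<le> 1"
  shows "(\<lambda>t. B t (x \<epsilon> \<delta> t)) \<in> borel_measurable M"
    "(\<integral>\<^sup>+ t. ennreal ((norm (B t (x \<epsilon> \<delta> t)))\<^sup>2) \<partial>M) \<le> ennreal (A0 / \<kappa> * (LINT t|M. (F t)\<^sup>2))"
proof -
  have e': "\<epsilon> \<noteq> 0" using e by auto
  obtain K Y where K: "K-lipschitz_on {0..R} (y \<delta>)" and Y: "\<And>s. s \<in> {0..R} \<Longrightarrow> norm (y \<delta> s) \<le> Y"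
    using y_lipschitz[OF d] by blast
  obtain C1 C2 where C1: "C1-lipschitz_on {0..R} (x \<epsilon> \<delta>)" and C2: "C2-lipschitz_on {0..R} (\<lambda>t. B t (x \<epsilon> \<delta> t))"
    unfolding x_def[abs_def] using res_apply_lipschitz[OF e' K Y] B_res_apply_lipschitz[OF e' K Y] by blast
  have bc: "continuous_on {0..R} (\<lambda>t. B t (x \<epsilon> \<delta> t))" by (rule lipschitz_on_continuous_on[OF C2])
  then show bm: "(\<lambda>t. B t (x \<epsilon> \<delta> t)) \<in> borel_measurable M" by (rule continuous_on_imp_measurable_lebesgue_on)
  obtain C where C: "C-lipschitz_on {0..R} (energy \<epsilon> \<delta>)"
    unfolding energy_def[abs_def] using lipschitz_on_Re_cinner[OF C2 C1] R_pos by auto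
  obtain v where v: "v \<in> borel_measurable borel" "\<And>t. norm (v t) \<le> C"
    "AE t in M. (energy \<epsilon> \<delta> has_vector_derivative v t) (at t)"
    "(LINT t|M. v t) = energy \<epsilon> \<delta> R - energy \<epsilon> \<delta> 0"
  proof (rule lipschitz_AE_differentiable[OF _ C])
    show "(norm (a + b))\<^sup>2 + (norm (a - b))\<^sup>2 = 2 * (norm a)\<^sup>2 + 2 * (norm b)\<^sup>2" for a b :: real
      by (simp add: power2_eq_square algebra_simps)
  qed (use R_pos in auto)
  have "energy \<epsilon> \<delta> R = 0" "energy \<epsilon> \<delta> 0 = 0"
    by (simp_all add: energy_def x_def y_def blinfun.zero_right mollify_right_end[OF d])
  then have v0: "(LINT t|M. v t) = 0" using v(4) by simp
  have vi: "integrable M v"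
    by (rule integrable_lebesgue_on_bounded[of _ _ _ C]) (use v in \<open>auto intro: borel_imp_lebesgue_on_measurable\<close>)
  have Jc: "continuous_on {0..R} (mollify R \<delta> F)"
    using mollify_has_derivative[OF d _ _ R_pos F_int]
    by (intro continuous_at_imp_continuous_on ballI) (auto dest: has_vector_derivative_continuous)
  have int: "integrable M f" if "continuous_on {0..R} f" for f :: "real \<Rightarrow> real"
  proof -
    have "compact (f ` {0..R})" using that by (intro compact_continuous_image) auto
    then obtain Z where "\<And>t. t \<in> {0..R} \<Longrightarrow> norm (f t) \<le> Z"
      using compact_imp_bounded bounded_iff by (metis image_eqI)
    then show ?thesis using continuous_on_imp_measurable_lebesgue_on[OF that]
      by (intro integrable_lebesgue_on_bounded[of _ _ _ Z]) auto
  qed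
  have J2: "integrable M (\<lambda>t. (mollify R \<delta> F t)\<^sup>2)" by (intro int continuous_intros Jc)
  have b2: "integrable M (\<lambda>t. (norm (B t (x \<epsilon> \<delta> t)))\<^sup>2)" by (intro int continuous_intros bc)
  have "\<kappa> * (LINT t|M. (norm (B t (x \<epsilon> \<delta> t)))\<^sup>2) = (LINT t|M. \<kappa> * (norm (B t (x \<epsilon> \<delta> t)))\<^sup>2)" by simp
  also have "\<dots> \<le> (LINT t|M. - v t + A0 * (mollify R \<delta> F t)\<^sup>2)"
  proof (rule integral_mono_AE)
    show "integrable M (\<lambda>t. \<kappa> * (norm (B t (x \<epsilon> \<delta> t)))\<^sup>2)" using b2 by simp
    show "integrable M (\<lambda>t. - v t + A0 * (mollify R \<delta> F t)\<^sup>2)"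
      using vi J2 by (intro Bochner_Integration.integrable_add Bochner_Integration.integrable_minus integrable_mult_right)
    have "AE t in lebesgue. t \<noteq> 0" "AE t in lebesgue. t \<noteq> R"
      using AE_lborel_singleton AE_completion by blast+
    then have "AE t in M. t \<noteq> 0" "AE t in M. t \<noteq> R" by (auto simp: AE_restrict_space_iff elim: eventually_mono)
    with v(3) AE_space show "AE t in M. \<kappa> * (norm (B t (x \<epsilon> \<delta> t)))\<^sup>2 \<le> - v t + A0 * (mollify R \<delta> F t)\<^sup>2"
    proof eventually_elim
      case (elim t)
      show ?case
        by (rule energy_inequality[OF e d dQ])
           (use elim in \<open>auto simp: has_real_derivative_iff_has_vector_derivative\<close>)
    qed
  qed
  also have "\<dots> = A0 * (LINT t|M. (mollify R \<delta> F t)\<^sup>2)"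
    using vi J2 v0 by (subst Bochner_Integration.integral_add) auto
  also have "\<dots> \<le> A0 * (LINT t|M. (F t)\<^sup>2)"
  proof (rule mult_left_mono[OF _ A0_nonneg])
    have "ennreal (LINT t|M. (mollify R \<delta> F t)\<^sup>2) = (\<integral>\<^sup>+ t. ennreal ((mollify R \<delta> F t)\<^sup>2) \<partial>M)"
      by (rule nn_integral_eq_integral[symmetric, OF J2]) simp
    also have "\<dots> \<le> ennreal (LINT t|M. (F t)\<^sup>2)" by (rule mollify_L2_bound[OF d F_meas F_L2 F_int])
    finally show "(LINT t|M. (mollify R \<delta> F t)\<^sup>2) \<le> (LINT t|M. (F t)\<^sup>2)"
      by (simp add: ennreal_le_iff)
  qed
  finally have "(LINT t|M. (norm (B t (x \<epsilon> \<delta> t)))\<^sup>2) \<le> A0 / \<kappa> * (LINT t|M. (F t)\<^sup>2)"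
    using \<kappa>_pos by (simp add: pos_le_divide_eq mult.commute)
  then show "(\<integral>\<^sup>+ t. ennreal ((norm (B t (x \<epsilon> \<delta> t)))\<^sup>2) \<partial>M) \<le> ennreal (A0 / \<kappa> * (LINT t|M. (F t)\<^sup>2))"
    using b2 by (subst nn_integral_eq_integral) (auto intro: ennreal_leI)
qed

end

context coercive_family begin

text \<open>A bound on \<open>B x\<close> along a subsequence with \<open>x \<longlonglongrightarrow> s\<close> makes \<open>\<lambda>u. \<langle>B u, s\<rangle>\<close> a bounded functional,
  so that \<open>s\<close> is in the domain of the adjoint, which is \<open>B\<close>.\<close>
lemma resolvent_limit:
  assumes t: "t \<in> {0..R}" and e: "\<And>n. 0 < \<epsilon> n" "\<epsilon> \<longlonglongrightarrow> 0" and f: "f \<longlonglongrightarrow> G t s"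
    and fr: "\<exists>\<^sub>F n in sequentially. (norm (B t (res (\<epsilon> n) t (f n))))\<^sup>2 \<le> \<beta>"
  shows "s \<in> S \<and> (norm (B t s))\<^sup>2 \<le> \<beta>"
proof -
  have "infinite {n. (norm (B t (res (\<epsilon> n) t (f n))))\<^sup>2 \<le> \<beta>}"
    using fr by (simp add: frequently_cofinite cofinite_eq_sequentially[symmetric])
  from infinite_enumerate[OF this] obtain r :: "nat \<Rightarrow> nat" where r: "strict_mono r"
    "\<And>n. (norm (B t (res (\<epsilon> (r n)) t (f (r n)))))\<^sup>2 \<le> \<beta>" by auto
  define xn where "xn n = res (\<epsilon> (r n)) t (f (r n))" for n
  have en: "\<epsilon> (r n) \<noteq> 0" for n using e(1)[of "r n"] by simp
  have \<beta>: "0 \<le> \<beta>" using order_trans[OF zero_le_power2 r(2)] .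
  have bn: "norm (B t (xn n)) \<le> sqrt \<beta>" for n
    using r(2)[of n] unfolding xn_def by (rule real_le_rsqrt)
  have xS: "xn n \<in> S" for n unfolding xn_def by (rule res_in[OF t en])
  have er: "(\<lambda>n. \<epsilon> (r n)) \<longlonglongrightarrow> 0" using LIMSEQ_subseq_LIMSEQ[OF e(2) r(1)] by (simp add: o_def)
  have fr': "(\<lambda>n. f (r n)) \<longlonglongrightarrow> G t s" using LIMSEQ_subseq_LIMSEQ[OF f r(1)] by (simp add: o_def)
  have "(\<lambda>n. scaleC (ie (\<epsilon> (r n))) (B t (xn n))) \<longlonglongrightarrow> 0"
  proof (rule Lim_null_comparison)
    show "\<forall>\<^sub>F n in sequentially. norm (scaleC (ie (\<epsilon> (r n))) (B t (xn n))) \<le> \<epsilon> (r n) * sqrt \<beta>"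
      unfolding norm_ie using bn e(1) by (intro always_eventually allI) (simp add: abs_of_pos mult_left_mono less_imp_le)
    show "(\<lambda>n. \<epsilon> (r n) * sqrt \<beta>) \<longlonglongrightarrow> 0" using tendsto_mult_right[OF er, of "sqrt \<beta>"] by simp
  qed
  then have "(\<lambda>n. f (r n) - scaleC (ie (\<epsilon> (r n))) (B t (xn n))) \<longlonglongrightarrow> G t s - 0" by (intro tendsto_diff fr')
  moreover have "f (r n) - scaleC (ie (\<epsilon> (r n))) (B t (xn n)) = G t (xn n)" for n
    unfolding xn_def ie_B_res[OF t en] by simp
  ultimately have "(\<lambda>n. G t (xn n)) \<longlonglongrightarrow> G t s" by simp
  then have "(\<lambda>n. Ginv t (G t (xn n))) \<longlonglongrightarrow> Ginv t (G t s)" by (rule blinfun.tendsto[OF tendsto_const])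
  then have xs: "xn \<longlonglongrightarrow> s" unfolding Ginv_G[OF t] .
  have lim: "(\<lambda>n. cinner u (B t (xn n))) \<longlonglongrightarrow> cinner (B t u) s" if u: "u \<in> S" for u
    unfolding B_sym[OF t u xS, symmetric] by (intro cinner.tendsto tendsto_const xs)
  have bd: "cmod (cinner (B t u) s) \<le> sqrt \<beta> * norm u" if u: "u \<in> S" for u
  proof (rule LIMSEQ_le_const2[OF tendsto_norm[OF lim[OF u]]], intro exI allI impI)
    fix n
    show "cmod (cinner u (B t (xn n))) \<le> sqrt \<beta> * norm u"
      using order_trans[OF cinner_cauchy_schwarz mult_left_mono[OF bn norm_ge_zero]] by (simp add: mult.commute)
  qed
  obtain w where w: "\<And>u. u \<in> S \<Longrightarrow> cinner (B t u) s = cinner u w"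
    by (rule riesz_representation_dense[OF S_sub S_dense, of "\<lambda>u. cinner (B t u) s" "sqrt \<beta>"])
      (auto simp: B_simps[OF t] cinner_algebra bd)
  from B_domI[OF t w] have sS: "s \<in> S" and Bs: "B t s = w" by blast+
  obtain un where un: "\<And>n. un n \<in> S" "un \<longlonglongrightarrow> w" using S_dense closure_sequential[of w S] by auto
  have "cmod (cinner w w) \<le> sqrt \<beta> * norm w"
  proof (rule LIMSEQ_le)
    show "(\<lambda>n. cmod (cinner (un n) w)) \<longlonglongrightarrow> cmod (cinner w w)" by (intro tendsto_norm cinner.tendsto un tendsto_const)
    show "(\<lambda>n. sqrt \<beta> * norm (un n)) \<longlonglongrightarrow> sqrt \<beta> * norm w" by (intro tendsto_intros un)
    show "\<exists>N. \<forall>n\<ge>N. cmod (cinner (un n) w) \<le> sqrt \<beta> * norm (un n)"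
      using bd[OF un(1)] w[OF un(1)] by auto
  qed
  then have "norm w * norm w \<le> sqrt \<beta> * norm w" by (simp add: cinner_self power2_eq_square norm_mult)
  then have "norm w \<le> sqrt \<beta>" using \<beta> by (cases "norm w = 0") auto
  then have "(norm w)\<^sup>2 \<le> (sqrt \<beta>)\<^sup>2" by (intro power_mono) auto
  then show ?thesis using sS Bs \<beta> by simp
qed

text \<open>On \<open>G t v\<close> with \<open>v \<in> S\<close> the error is \<open>\<epsilon> res (B v)\<close>; the resolvents being uniformly bounded, the dense
  set \<open>S\<close> suffices.\<close>
lemma res_tendsto_Ginv:
  assumes t: "t \<in> {0..R}" and e: "\<And>n. 0 < \<epsilon> n" "\<epsilon> \<longlonglongrightarrow> 0"
  shows "(\<lambda>n. res (\<epsilon> n) t w) \<longlonglongrightarrow> Ginv t w"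
proof (rule LIMSEQ_I)
  fix \<eta> :: real assume \<eta>: "0 < \<eta>"
  define a where "a = L / c + 1"
  have a: "0 < a" using L_pos c_pos by (simp add: a_def add_pos_pos)
  have "Ginv t w \<in> closure S" using S_dense by simp
  then obtain v where v: "v \<in> S" "dist v (Ginv t w) < \<eta> / (2 * a)"
    using \<eta> a unfolding closure_approachable by (metis divide_pos_pos mult_pos_pos zero_less_numeral)
  have "(\<lambda>n. \<epsilon> n * norm (B t v) / c) \<longlonglongrightarrow> 0 * norm (B t v) / c"
    using c_pos by (intro tendsto_intros e) simp
  then have "\<forall>\<^sub>F n in sequentially. \<epsilon> n * norm (B t v) / c < \<eta> / 2"
    using \<eta> by (intro order_tendstoD(2)) auto
  then obtain N where N: "\<And>n. n \<ge> N \<Longrightarrow> \<epsilon> n * norm (B t v) / c < \<eta> / 2"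
    unfolding eventually_sequentially by blast
  have "norm (res (\<epsilon> n) t w - Ginv t w) < \<eta>" if n: "n \<ge> N" for n
  proof -
    have en: "\<epsilon> n \<noteq> 0" using e(1)[of n] by simp
    have 1: "norm (res (\<epsilon> n) t (w - G t v)) \<le> L / c * norm (v - Ginv t w)"
    proof -
      have "w - G t v = - G t (v - Ginv t w)" by (simp add: blinfun.diff_right G_Ginv[OF t])
      then have "norm (w - G t v) \<le> L * norm (v - Ginv t w)" using G_bound[OF t] by (simp only: norm_minus_cancel)
      then have "norm (w - G t v) / c \<le> L * norm (v - Ginv t w) / c" using c_pos by (intro divide_right_mono) auto
      then show ?thesis using order_trans[OF res_bound[OF t en]] by simp
    qed
    have 2: "norm (v - res (\<epsilon> n) t (G t v)) \<le> \<epsilon> n * norm (B t v) / c"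
    proof -
      have "norm (v - res (\<epsilon> n) t (G t v)) = \<epsilon> n * norm (res (\<epsilon> n) t (B t v))"
        unfolding ie_res_B[OF t en v(1), symmetric] norm_ie using e(1)[of n] by simp
      also have "\<dots> \<le> \<epsilon> n * (norm (B t v) / c)" using e(1)[of n] by (intro mult_left_mono res_bound[OF t en]) auto
      finally show ?thesis by simp
    qed
    have "res (\<epsilon> n) t w - Ginv t w
      = res (\<epsilon> n) t (w - G t v) - (v - res (\<epsilon> n) t (G t v)) + (v - Ginv t w)" by (simp add: blinfun.diff_right)
    then have "norm (res (\<epsilon> n) t w - Ginv t w)
      \<le> norm (res (\<epsilon> n) t (w - G t v) - (v - res (\<epsilon> n) t (G t v))) + norm (v - Ginv t w)"
      by (simp only: norm_triangle_ineq)
    also have "\<dots> \<le> (norm (res (\<epsilon> n) t (w - G t v)) + norm (v - res (\<epsilon> n) t (G t v))) + norm (v - Ginv t w)"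
      by (intro add_right_mono norm_triangle_ineq4)
    also have "\<dots> \<le> (L / c * norm (v - Ginv t w) + \<epsilon> n * norm (B t v) / c) + norm (v - Ginv t w)"
      by (intro add_right_mono add_mono 1 2)
    also have "\<dots> = a * norm (v - Ginv t w) + \<epsilon> n * norm (B t v) / c" by (simp add: a_def algebra_simps)
    also have "\<dots> < a * (\<eta> / (2 * a)) + \<eta> / 2"
      using v(2) a N[OF n] by (intro add_strict_mono mult_strict_left_mono) (auto simp: dist_norm)
    also have "\<dots> = \<eta>" using a by (simp add: field_simps)
    finally show ?thesis .
  qed
  then show "\<exists>no. \<forall>n\<ge>no. norm (res (\<epsilon> n) t w - Ginv t w) < \<eta>" by blast
qed

lemma Yosida_tendsto:
  assumes t: "t \<in> {0..R}" and e: "\<And>n. 0 < \<epsilon> n" "\<epsilon> \<longlonglongrightarrow> 0" and s: "s \<in> S"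
  shows "(\<lambda>n. B t (res (\<epsilon> n) t (G t s))) \<longlonglongrightarrow> B t s"
proof -
  have "B t (res (\<epsilon> n) t (G t s)) = G t (res (\<epsilon> n) t (B t s))" for n
  proof -
    have en: "\<epsilon> n \<noteq> 0" using e(1)[of n] by simp
    let ?r = "res (\<epsilon> n) t (B t s)"
    have rS: "?r \<in> S" by (rule res_in[OF t en])
    have "res (\<epsilon> n) t (G t s) = s - scaleC (ie (\<epsilon> n)) ?r" unfolding ie_res_B[OF t en s] by simp
    then have "B t (res (\<epsilon> n) t (G t s)) = B t s - scaleC (ie (\<epsilon> n)) (B t ?r)"
      by (simp add: B_simps[OF t] s rS S_simps)
    then show ?thesis unfolding ie_B_res[OF t en] by simp
  qed
  moreover have "(\<lambda>n. G t (res (\<epsilon> n) t (B t s))) \<longlonglongrightarrow> G t (Ginv t (B t s))"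
    by (rule blinfun.tendsto[OF tendsto_const res_tendsto_Ginv[OF t e]])
  ultimately show ?thesis by (simp add: G_Ginv[OF t])
qed

text \<open>Measurability in the graph norm is automatic: \<open>B t \<circ> res \<epsilon> t \<circ> G t\<close> is bounded, Lipschitz in \<open>t\<close>, and
  approximates \<open>B t\<close>.\<close>
lemma B_measurable:
  assumes s: "s \<in> borel_measurable (lebesgue_on {0..R})" and sS: "AE t in lebesgue_on {0..R}. s t \<in> S"
  shows "(\<lambda>t. B t (s t)) \<in> borel_measurable (lebesgue_on {0..R})"
proof -
  define \<epsilon> :: "nat \<Rightarrow> real" where "\<epsilon> n = inverse (real (Suc n))" for n
  have e: "\<And>n. 0 < \<epsilon> n" "\<epsilon> \<longlonglongrightarrow> 0"
    unfolding \<epsilon>_def[abs_def] using LIMSEQ_inverse_real_of_nat by auto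
  have gs: "(\<lambda>t. G t (s t)) \<in> borel_measurable (lebesgue_on {0..R})"
    by (rule G_apply_measurable[OF order_refl s])
  have m: "(\<lambda>t. B t (res (\<epsilon> n) t (G t (s t)))) \<in> borel_measurable (lebesgue_on {0..R})" for n
  proof (rule measurable_Caratheodory[OF _ _ gs])
    have en: "\<epsilon> n \<noteq> 0" using e(1)[of n] by simp
    show "(\<lambda>t. B t (res (\<epsilon> n) t u)) \<in> borel_measurable (lebesgue_on {0..R})" for u
    proof -
      have "0-lipschitz_on {0..R} (\<lambda>t. u)" by (rule lipschitz_onI) auto
      from B_res_apply_lipschitz[OF en this, of "norm u"] show ?thesis
        using continuous_on_imp_measurable_lebesgue_on lipschitz_on_continuous_on by blast
    qed
    fix t assume "t \<in> space (lebesgue_on {0..R})"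
    then have t: "t \<in> {0..R}" by simp
    have "((1 + L / c) / \<epsilon> n)-lipschitz_on UNIV (\<lambda>f. B t (res (\<epsilon> n) t f))"
    proof (rule lipschitz_onI)
      fix f g
      have "B t (res (\<epsilon> n) t f) - B t (res (\<epsilon> n) t g) = B t (res (\<epsilon> n) t (f - g))"
        unfolding blinfun.diff_right by (rule B_simps(3)[OF t res_in[OF t en] res_in[OF t en], symmetric])
      then show "dist (B t (res (\<epsilon> n) t f)) (B t (res (\<epsilon> n) t g)) \<le> (1 + L / c) / \<epsilon> n * dist f g"
        using B_res_bound[OF t en, of "f - g"] e(1)[of n] by (simp add: dist_norm pos_le_divide_eq mult.commute)
    qed (use L_pos c_pos e(1)[of n] in auto)
    then show "continuous_on UNIV (\<lambda>f. B t (res (\<epsilon> n) t f))" by (rule lipschitz_on_continuous_on)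
  qed
  have l: "AE t in lebesgue_on {0..R}. (\<lambda>n. B t (res (\<epsilon> n) t (G t (s t)))) \<longlonglongrightarrow> B t (s t)"
    using sS AE_space by eventually_elim (rule Yosida_tendsto[OF _ e], auto)
  show ?thesis by (rule measurable_lebesgue_on_AE_limit[OF _ m l]) simp
qed

end

context weak_solution begin

text \<open>The energy estimate is uniform along a sequence \<open>\<epsilon> \<longlonglongrightarrow> 0\<close>, provided that \<open>\<delta>\<close> is chosen small
  enough for each \<open>\<epsilon>\<close>. By Fatou's lemma the lower limit of \<open>|B x|\<^sup>2\<close> is then integrable, in particular
  finite almost everywhere, and \<open>resolvent_limit\<close> applies pointwise.\<close>
theorem regularity:
  shows \<sigma>_in_S: "AE t in M. \<sigma> t \<in> S"
    and tB\<sigma>_L2: "integrable M (\<lambda>t. (t * norm (B t (\<sigma> t)))\<^sup>2)"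
proof -
  define \<epsilon> :: "nat \<Rightarrow> real" where "\<epsilon> n = inverse (real (Suc n))" for n
  \<comment> \<open>The mollification parameter has to beat the growth of \<open>Q\<close> for small \<open>\<epsilon>\<close>.\<close>
  define \<delta> where "\<delta> n = min (\<epsilon> n) (1 / Q (\<epsilon> n))" for n
  have e: "\<And>n. 0 < \<epsilon> n" "\<epsilon> \<longlonglongrightarrow> 0"
    unfolding \<epsilon>_def[abs_def] using LIMSEQ_inverse_real_of_nat by auto
  have d: "0 < \<delta> n" "\<delta> n * Q (\<epsilon> n) \<le> 1" for n
  proof -
    show "0 < \<delta> n" using e(1)[of n] Q_pos[OF e(1)[of n]] by (simp add: \<delta>_def)
    have "\<delta> n \<le> 1 / Q (\<epsilon> n)" by (simp add: \<delta>_def)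
    then show "\<delta> n * Q (\<epsilon> n) \<le> 1" using Q_pos[OF e(1)[of n]] by (simp add: pos_le_divide_eq)
  qed
  have d0: "\<delta> \<longlonglongrightarrow> 0"
  proof (rule tendsto_sandwich[OF _ _ tendsto_const e(2)])
    show "\<forall>\<^sub>F n in sequentially. 0 \<le> \<delta> n" using d(1) by (simp add: less_imp_le)
    show "\<forall>\<^sub>F n in sequentially. \<delta> n \<le> \<epsilon> n" by (simp add: \<delta>_def)
  qed
  define b where "b n t = B t (x (\<epsilon> n) (\<delta> n) t)" for n t
  define Y where "Y t = liminf (\<lambda>n. ennreal ((norm (b n t))\<^sup>2))" for t
  let ?C = "ennreal (A0 / \<kappa> * (LINT t|M. (F t)\<^sup>2))"
  have bm [measurable]: "b n \<in> borel_measurable M" for n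
    unfolding b_def by (rule integrated_energy_inequality(1)[OF e(1) d])
  have Ym: "Y \<in> borel_measurable M" unfolding Y_def by measurable
  have "(\<integral>\<^sup>+ t. Y t \<partial>M) \<le> liminf (\<lambda>n. \<integral>\<^sup>+ t. ennreal ((norm (b n t))\<^sup>2) \<partial>M)"
    unfolding Y_def by (rule nn_integral_liminf) measurable
  also have "\<dots> \<le> liminf (\<lambda>n::nat. ?C)"
    unfolding b_def using integrated_energy_inequality(2)[OF e(1) d] by (intro Liminf_mono always_eventually allI)
  also have "\<dots> = ?C" by (rule Liminf_const) simp
  finally have YC: "(\<integral>\<^sup>+ t. Y t \<partial>M) \<le> ?C" .
  then have "(\<integral>\<^sup>+ t. Y t \<partial>M) \<noteq> \<infinity>" using le_less_trans[OF YC ennreal_less_top] by auto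
  then have Yfin: "AE t in M. Y t \<noteq> \<infinity>" by (rule nn_integral_PInf_AE[OF Ym])
  have pos: "AE t in M. t \<noteq> 0"
    using AE_completion[OF AE_lborel_singleton[of 0]] by (auto simp: AE_restrict_space_iff elim: eventually_mono)
  have main: "AE t in M. \<sigma> t \<in> S \<and> ennreal ((t * norm (B t (\<sigma> t)))\<^sup>2) \<le> Y t"
    using Yfin pos mollify_AE_tendsto[OF z_int d(1) d0] AE_space
  proof eventually_elim
    case (elim t)
    then have t: "t \<in> {0..R}" "0 < t" by auto
    have f: "(\<lambda>n. y (\<delta> n) t) \<longlonglongrightarrow> G t (t *\<^sub>R \<sigma> t)"
      unfolding y_def blinfun.scaleR_right z_def[symmetric] by (intro tendsto_intros elim(3))
    obtain \<rho> where \<rho>: "Y t = ennreal \<rho>" "0 \<le> \<rho>" using elim(1) by (cases "Y t") auto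
    \<comment> \<open>The lower limit \<open>\<rho>\<close> need not be attained, but each larger bound holds infinitely often.\<close>
    have lim: "t *\<^sub>R \<sigma> t \<in> S \<and> (norm (B t (t *\<^sub>R \<sigma> t)))\<^sup>2 \<le> \<beta>" if \<beta>: "\<rho> < \<beta>" for \<beta>
    proof (rule resolvent_limit[OF t(1) e f], rule ccontr)
      assume "\<not> (\<exists>\<^sub>F n in sequentially. (norm (B t (res (\<epsilon> n) t (y (\<delta> n) t))))\<^sup>2 \<le> \<beta>)"
      then have "\<forall>\<^sub>F n in sequentially. ennreal \<beta> \<le> ennreal ((norm (b n t))\<^sup>2)"
        unfolding not_frequently b_def x_def by eventually_elim (auto intro!: ennreal_leI)
      then have "ennreal \<beta> \<le> Y t" unfolding Y_def by (rule Liminf_bounded)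
      then show False using \<rho> \<beta> by (simp add: ennreal_le_iff)
    qed
    then have tS: "t *\<^sub>R \<sigma> t \<in> S" using lim[of "\<rho> + 1"] by simp
    have "(1 / t) *\<^sub>R (t *\<^sub>R \<sigma> t) \<in> S" by (rule S_simps(4)[OF tS])
    then have sS: "\<sigma> t \<in> S" using t by simp
    have "(norm (B t (t *\<^sub>R \<sigma> t)))\<^sup>2 \<le> \<rho>" by (rule dense_ge) (use lim in auto)
    moreover have "norm (B t (t *\<^sub>R \<sigma> t)) = t * norm (B t (\<sigma> t))"
      unfolding B_simps(5)[OF t(1) sS] using t by simp
    ultimately show ?case using sS \<rho> by (auto intro: ennreal_leI)
  qed
  then show 1: "AE t in M. \<sigma> t \<in> S" by eventually_elim simp
  have m: "(\<lambda>t. (t * norm (B t (\<sigma> t)))\<^sup>2) \<in> borel_measurable M"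
    by (intro borel_measurable_power borel_measurable_times measurable_compose[OF B_measurable[OF \<sigma>_meas 1] borel_measurable_norm]
        borel_imp_lebesgue_on_measurable) simp
  show "integrable M (\<lambda>t. (t * norm (B t (\<sigma> t)))\<^sup>2)"
  proof (rule integrableI_nonneg[OF m])
    have "(\<integral>\<^sup>+ t. ennreal ((t * norm (B t (\<sigma> t)))\<^sup>2) \<partial>M) \<le> (\<integral>\<^sup>+ t. Y t \<partial>M)"
      by (rule nn_integral_mono_AE) (use main in eventually_elim, simp)
    also have "\<dots> \<le> ?C" by (rule YC)
    also have "\<dots> < \<infinity>" by simp
    finally show "(\<integral>\<^sup>+ t. ennreal ((t * norm (B t (\<sigma> t)))\<^sup>2) \<partial>M) < \<infinity>" .
  qed simp
qed

text \<open>The weak derivative of \<open>G \<sigma>\<close>.\<close>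
definition f :: "real \<Rightarrow> 'h" where "f t = k t - B t (\<sigma> t)"

lemma B\<sigma>_meas: "(\<lambda>t. B t (\<sigma> t)) \<in> borel_measurable M"
  by (rule B_measurable[OF \<sigma>_meas \<sigma>_in_S])

lemma f_meas: "f \<in> borel_measurable M"
  unfolding f_def by (intro borel_measurable_diff k_meas B\<sigma>_meas)

lemma tB\<sigma>_int: "integrable M (\<lambda>t. t * norm (B t (\<sigma> t)))"
proof (rule L2_imp_integrable)
  show "(\<lambda>t. t * norm (B t (\<sigma> t))) \<in> borel_measurable M"
    by (intro borel_measurable_times measurable_compose[OF B\<sigma>_meas borel_measurable_norm]
        borel_imp_lebesgue_on_measurable) simp
  show "integrable M (\<lambda>t. (norm (t * norm (B t (\<sigma> t))))\<^sup>2)" using tB\<sigma>_L2 by simp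
qed

lemma tf_int: "integrable M (\<lambda>t. t * norm (f t))"
proof (rule Bochner_Integration.integrable_bound)
  show "integrable M (\<lambda>t. R * norm (k t) + t * norm (B t (\<sigma> t)))"
    by (intro Bochner_Integration.integrable_add integrable_mult_right integrable_norm k_int tB\<sigma>_int)
  show "(\<lambda>t. t * norm (f t)) \<in> borel_measurable M"
    by (intro borel_measurable_times measurable_compose[OF f_meas borel_measurable_norm]
        borel_imp_lebesgue_on_measurable) simp
  show "AE t in M. norm (t * norm (f t)) \<le> norm (R * norm (k t) + t * norm (B t (\<sigma> t)))"
  proof (rule AE_I2)
    fix t assume "t \<in> space M"
    then have t: "0 \<le> t" "t \<le> R" by auto
    have "t * norm (f t) \<le> t * (norm (k t) + norm (B t (\<sigma> t)))"
      unfolding f_def using t by (intro mult_left_mono norm_triangle_ineq4) auto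
    also have "\<dots> \<le> R * norm (k t) + t * norm (B t (\<sigma> t))"
      unfolding distrib_left using t by (intro add_right_mono mult_right_mono) auto
    finally show "norm (t * norm (f t)) \<le> norm (R * norm (k t) + t * norm (B t (\<sigma> t)))" using t by simp
  qed
qed

text \<open>Since \<open>t f\<close> is integrable, the equation can be tested against functions vanishing at \<open>0\<close>
  without moving \<open>B\<close> to the test function.\<close>
lemma weak_vector:
  assumes lip: "K-lipschitz_on {0..R} \<phi>" and z0: "\<phi> 0 = 0" and m: "\<phi>' \<in> borel_measurable M"
    and bd: "\<And>t. t \<in> {0..R} \<Longrightarrow> \<bar>\<phi>' t\<bar> \<le> K" and der: "AE t in M. (\<phi> has_real_derivative \<phi>' t) (at t)"
  shows "integrable M (\<lambda>t. \<phi>' t *\<^sub>R z t + \<phi> t *\<^sub>R f t)" "(LINT t|M. \<phi>' t *\<^sub>R z t + \<phi> t *\<^sub>R f t) = 0"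
proof -
  have K: "0 \<le> K" by (rule lipschitz_on_nonneg[OF lip])
  have i1: "integrable M (\<lambda>t. \<phi>' t *\<^sub>R z t)"
  proof (rule Bochner_Integration.integrable_bound)
    show "integrable M (\<lambda>t. K * norm (z t))" by (intro integrable_mult_right integrable_norm z_int)
    show "(\<lambda>t. \<phi>' t *\<^sub>R z t) \<in> borel_measurable M" by (intro borel_measurable_scaleR m z_meas)
    show "AE t in M. norm (\<phi>' t *\<^sub>R z t) \<le> norm (K * norm (z t))"
      by (rule AE_I2) (use bd K in \<open>auto intro!: mult_right_mono\<close>)
  qed
  have \<phi>m: "\<phi> \<in> borel_measurable M"
    by (intro continuous_on_imp_measurable_lebesgue_on lipschitz_on_continuous_on[OF lip])
  have i2: "integrable M (\<lambda>t. \<phi> t *\<^sub>R f t)"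
  proof (rule Bochner_Integration.integrable_bound)
    show "integrable M (\<lambda>t. K * (t * norm (f t)))" by (intro integrable_mult_right tf_int)
    show "(\<lambda>t. \<phi> t *\<^sub>R f t) \<in> borel_measurable M" by (intro borel_measurable_scaleR \<phi>m f_meas)
    show "AE t in M. norm (\<phi> t *\<^sub>R f t) \<le> norm (K * (t * norm (f t)))"
    proof (rule AE_I2)
      fix t assume t: "t \<in> space M"
      then have "\<bar>\<phi> t\<bar> \<le> K * t" using lipschitz_onD[OF lip, of t 0] R_pos z0 by (simp add: dist_real_def)
      then have "\<bar>\<phi> t\<bar> * norm (f t) \<le> (K * t) * norm (f t)" by (rule mult_right_mono) simp
      then show "norm (\<phi> t *\<^sub>R f t) \<le> norm (K * (t * norm (f t)))"
        using t K by (simp add: mult.assoc)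
    qed
  qed
  show i: "integrable M (\<lambda>t. \<phi>' t *\<^sub>R z t + \<phi> t *\<^sub>R f t)" by (intro Bochner_Integration.integrable_add i1 i2)
  show "(LINT t|M. \<phi>' t *\<^sub>R z t + \<phi> t *\<^sub>R f t) = 0"
  proof (rule cinner_eq_0_dense[OF S_dense])
    fix u assume u: "u \<in> S"
    have "cinner u (LINT t|M. \<phi>' t *\<^sub>R z t + \<phi> t *\<^sub>R f t)
      = (LINT t|M. cinner u (\<phi>' t *\<^sub>R z t + \<phi> t *\<^sub>R f t))"
      by (rule integral_bounded_linear[OF cinner.bounded_linear_right i, symmetric])
    also have "\<dots> = (LINT t|M. \<phi>' t *\<^sub>R cinner u (G t (\<sigma> t)) + \<phi> t *\<^sub>R (cinner u (k t) - cinner (B t u) (\<sigma> t)))"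
    proof (rule integral_cong_AE_lebesgue_on)
      show "(\<lambda>t. cinner u (\<phi>' t *\<^sub>R z t + \<phi> t *\<^sub>R f t)) \<in> borel_measurable M"
        by (rule borel_measurable_integrable[OF integrable_bounded_linear[OF cinner.bounded_linear_right i]])
      show "AE t in M. cinner u (\<phi>' t *\<^sub>R z t + \<phi> t *\<^sub>R f t)
        = \<phi>' t *\<^sub>R cinner u (G t (\<sigma> t)) + \<phi> t *\<^sub>R (cinner u (k t) - cinner (B t u) (\<sigma> t))"
        using \<sigma>_in_S AE_space
      proof eventually_elim
        case (elim t)
        then have "cinner (B t u) (\<sigma> t) = cinner u (B t (\<sigma> t))" by (intro B_sym u) auto
        then show ?case
          by (simp add: f_def z_def cinner_add_right cinner_diff_right cinner.scaleR_right)
      qed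
    qed simp
    also have "\<dots> = 0" by (rule weak[OF lip z0 m bd der u])
    finally show "cinner u (LINT t|M. \<phi>' t *\<^sub>R z t + \<phi> t *\<^sub>R f t) = 0" .
  qed
qed

end

text \<open>The antiderivative of the indicator function of a dyadic interval; sums of ramps with the dyadic slopes
  as coefficients interpolate a function piecewise linearly.\<close>
definition ramp :: "nat \<Rightarrow> nat \<Rightarrow> real \<Rightarrow> real" where
  "ramp n j t = min t (real (Suc j) / 2 ^ n) - min t (real j / 2 ^ n)"

definition ramp_deriv :: "nat \<Rightarrow> nat \<Rightarrow> real \<Rightarrow> real" where
  "ramp_deriv n j t = (if real j / 2 ^ n \<le> t \<and> t < real (Suc j) / 2 ^ n then 1 else 0)"

lemma dyadic_less: "real j / 2 ^ n < real (Suc j) / 2 ^ n"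
  by (intro divide_strict_right_mono) auto

lemma ramp_lipschitz: "1-lipschitz_on A (ramp n j)"
  using dyadic_less[of j n] by (intro lipschitz_onI) (auto simp: ramp_def dist_real_def min_def)

lemma ramp_0: "ramp n j 0 = 0"
  by (simp add: ramp_def)

lemma ramp_has_derivative:
  assumes "t \<noteq> real j / 2 ^ n" "t \<noteq> real (Suc j) / 2 ^ n"
  shows "(ramp n j has_real_derivative ramp_deriv n j t) (at t)"
proof -
  define a where "a = real j / 2 ^ n"
  define b where "b = real (Suc j) / 2 ^ n"
  have ab: "a < b" unfolding a_def b_def by (rule dyadic_less)
  have r: "ramp n j = (\<lambda>t. min t b - min t a)" "ramp_deriv n j t = (if a \<le> t \<and> t < b then 1 else 0)"
    by (simp_all add: ramp_def[abs_def] ramp_deriv_def a_def b_def)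
  consider "t < a" | "a < t" "t < b" | "b < t" using assms unfolding a_def[symmetric] b_def[symmetric] by linarith
  then show ?thesis
  proof cases
    case 1
    show ?thesis unfolding r
      by (rule has_field_derivative_transform_within_open[where f = "\<lambda>_. 0" and S = "{..<a}"])
        (use 1 ab in \<open>auto intro!: derivative_eq_intros\<close>)
  next
    case 2
    show ?thesis unfolding r
      by (rule has_field_derivative_transform_within_open[where f = "\<lambda>t. t - a" and S = "{a<..<b}"])
        (use 2 ab in \<open>auto intro!: derivative_eq_intros\<close>)
  next
    case 3
    show ?thesis unfolding r
      by (rule has_field_derivative_transform_within_open[where f = "\<lambda>_. b - a" and S = "{b<..}"])
        (use 3 ab in \<open>auto intro!: derivative_eq_intros\<close>)
  qed
qed

lemma dyadic_index_bounds:
  assumes "0 \<le> t"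
  shows "real (dyadic_index n t) / 2 ^ n \<le> t" "t < real (Suc (dyadic_index n t)) / 2 ^ n"
proof -
  have "real (dyadic_index n t) = of_int \<lfloor>2 ^ n * t\<rfloor>" using assms by (simp add: dyadic_index_def)
  then have "real (dyadic_index n t) \<le> 2 ^ n * t" "2 ^ n * t < real (Suc (dyadic_index n t))"
    by linarith+
  then show "real (dyadic_index n t) / 2 ^ n \<le> t" "t < real (Suc (dyadic_index n t)) / 2 ^ n"
    by (simp_all add: pos_divide_le_eq pos_less_divide_eq mult.commute)
qed

lemma ramp_sum:
  assumes t: "0 \<le> t" "dyadic_index n t < m"
  shows "(\<Sum>j<m. ramp_deriv n j t *\<^sub>R dyadic_slope g n j) = dyadic_slope g n (dyadic_index n t)"
    and "(\<Sum>j<m. ramp n j t *\<^sub>R dyadic_slope g n j)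
      = g (real (dyadic_index n t) / 2 ^ n) - g 0
        + (t - real (dyadic_index n t) / 2 ^ n) *\<^sub>R dyadic_slope g n (dyadic_index n t)"
proof -
  define i where "i = dyadic_index n t"
  have i: "real i / 2 ^ n \<le> t" "t < real (Suc i) / 2 ^ n" unfolding i_def by (rule dyadic_index_bounds[OF t(1)])+
  have "ramp_deriv n j t = (if j = i then 1 else 0)" for j
  proof (cases "j = i")
    case True
    then show ?thesis unfolding ramp_deriv_def using i by (simp only: if_True simp_thms)
  next
    case False
    then have "\<not> (real j / 2 ^ n \<le> t \<and> t < real (Suc j) / 2 ^ n)"
      using dyadic_index_eq[of j n t] unfolding i_def by blast
    then show ?thesis unfolding ramp_deriv_def using False by (simp only: if_False)
  qed
  then show "(\<Sum>j<m. ramp_deriv n j t *\<^sub>R dyadic_slope g n j) = dyadic_slope g n (dyadic_index n t)"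
    using t(2) by (simp add: i_def[symmetric] if_distrib[of "\<lambda>a. a *\<^sub>R _"] sum.delta cong: if_cong)
  have lo: "ramp n j t = 1 / 2 ^ n" if "j < i" for j
  proof -
    have "real (Suc j) / 2 ^ n \<le> real i / 2 ^ n" "real j / 2 ^ n \<le> real i / 2 ^ n"
      using that by (intro divide_right_mono; simp)+
    then have "ramp n j t = real (Suc j) / 2 ^ n - real j / 2 ^ n" unfolding ramp_def using i by linarith
    then show ?thesis by (simp add: diff_divide_distrib[symmetric])
  qed
  have hi: "ramp n j t = 0" if "i < j" for j
  proof -
    have "real (Suc i) / 2 ^ n \<le> real j / 2 ^ n" using that by (intro divide_right_mono) simp_all
    then show ?thesis using i dyadic_less[of j n] by (simp add: ramp_def)
  qed
  have mid: "ramp n i t = t - real i / 2 ^ n" using i by (simp add: ramp_def)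
  have "(\<Sum>j<m. ramp n j t *\<^sub>R dyadic_slope g n j) = (\<Sum>j<Suc i. ramp n j t *\<^sub>R dyadic_slope g n j)"
    by (rule sum.mono_neutral_right) (use t(2) hi in \<open>auto simp: i_def[symmetric]\<close>)
  also have "\<dots> = (\<Sum>j<i. (1 / 2 ^ n) *\<^sub>R dyadic_slope g n j) + (t - real i / 2 ^ n) *\<^sub>R dyadic_slope g n i"
    using lo mid by simp
  also have "(\<Sum>j<i. (1 / 2 ^ n) *\<^sub>R dyadic_slope g n j) = g (real i / 2 ^ n) - g 0"
    unfolding scaleR_sum_right[symmetric] by (rule dyadic_slope_telescope)
  finally show "(\<Sum>j<m. ramp n j t *\<^sub>R dyadic_slope g n j)
      = g (real (dyadic_index n t) / 2 ^ n) - g 0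
        + (t - real (dyadic_index n t) / 2 ^ n) *\<^sub>R dyadic_slope g n (dyadic_index n t)" by (simp add: i_def)
qed

lemma dyadic_slope_tendsto_derivative:
  fixes g :: "real \<Rightarrow> 'b::real_normed_vector"
  assumes t: "0 \<le> t" and d: "(g has_vector_derivative d) (at t)"
  shows "(\<lambda>n. dyadic_slope g n (dyadic_index n t)) \<longlonglongrightarrow> d"
proof (rule LIMSEQ_I)
  fix e :: real assume e: "0 < e"
  have "\<forall>e>0. \<exists>\<eta>>0. \<forall>s. norm (s - t) < \<eta> \<longrightarrow> norm (g s - g t - (s - t) *\<^sub>R d) \<le> e * norm (s - t)"
    using d unfolding has_vector_derivative_def has_derivative_within_alt by simp
  then obtain \<eta> where \<eta>: "0 < \<eta>" "\<And>s. norm (s - t) < \<eta> \<Longrightarrow> norm (g s - g t - (s - t) *\<^sub>R d) \<le> e / 2 * norm (s - t)"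
    using e by (meson half_gt_zero)
  have "(\<lambda>n. (1::real) / 2 ^ n) \<longlonglongrightarrow> 0" by (rule LIMSEQ_divide_realpow_zero) simp
  then have "\<forall>\<^sub>F n in sequentially. (1::real) / 2 ^ n < \<eta>" using \<eta>(1) by (rule order_tendstoD(2))
  then obtain N where N: "\<And>n. n \<ge> N \<Longrightarrow> (1::real) / 2 ^ n < \<eta>" unfolding eventually_sequentially by blast
  have "norm (dyadic_slope g n (dyadic_index n t) - d) < e" if n: "n \<ge> N" for n
  proof -
    define a where "a = real (dyadic_index n t) / 2 ^ n"
    define b where "b = real (Suc (dyadic_index n t)) / 2 ^ n"
    have ab: "a \<le> t" "t < b" unfolding a_def b_def by (rule dyadic_index_bounds[OF t])+
    have ba: "b - a = 1 / 2 ^ n" by (simp add: a_def b_def diff_divide_distrib[symmetric])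
    have na: "norm (g a - g t - (a - t) *\<^sub>R d) \<le> e / 2 * (t - a)"
      using \<eta>(2)[of a] ab ba N[OF n] by simp
    have nb: "norm (g b - g t - (b - t) *\<^sub>R d) \<le> e / 2 * (b - t)"
      using \<eta>(2)[of b] ab ba N[OF n] by simp
    have "dyadic_slope g n (dyadic_index n t) - d = 2 ^ n *\<^sub>R (g b - g a - (b - a) *\<^sub>R d)"
      unfolding dyadic_slope_def a_def[symmetric] b_def[symmetric] ba by (simp add: scaleR_diff_right)
    also have "g b - g a - (b - a) *\<^sub>R d = (g b - g t - (b - t) *\<^sub>R d) - (g a - g t - (a - t) *\<^sub>R d)"
      by (simp add: algebra_simps)
    finally have "norm (dyadic_slope g n (dyadic_index n t) - d)
      = 2 ^ n * norm ((g b - g t - (b - t) *\<^sub>R d) - (g a - g t - (a - t) *\<^sub>R d))" by simp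
    also have "\<dots> \<le> 2 ^ n * (e / 2 * (b - t) + e / 2 * (t - a))"
      by (intro mult_left_mono order_trans[OF norm_triangle_ineq4 add_mono[OF nb na]]) simp
    also have "e / 2 * (b - t) + e / 2 * (t - a) = e / 2 * (b - a)"
      unfolding distrib_left[symmetric] by simp
    also have "2 ^ n * (e / 2 * (b - a)) = e / 2" unfolding ba by simp
    finally show ?thesis using e by simp
  qed
  then show "\<exists>no. \<forall>n\<ge>no. norm (dyadic_slope g n (dyadic_index n t) - d) < e" by blast
qed

context weak_solution begin

text \<open>For piecewise linear interpolations of \<open>g\<close> the equation is a finite combination of scalar ones. The
  interpolations are bounded by \<open>C t\<close> like \<open>g\<close> itself, so dominated convergence applies even though
  only \<open>t f\<close> is integrable.\<close>
theorem weak_lipschitz: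
  fixes g g' :: "real \<Rightarrow> 'h"
  assumes lip: "C-lipschitz_on {0..R} g" and g0: "g 0 = 0"
    and der: "AE t in M. (g has_vector_derivative g' t) (at t)"
  shows "integrable M (\<lambda>t. cinner (g' t) (z t) + cinner (g t) (f t))"
    "(LINT t|M. cinner (g' t) (z t) + cinner (g t) (f t)) = 0"
proof -
  have C0: "0 \<le> C" by (rule lipschitz_on_nonneg[OF lip])
  define cl where "cl t = max 0 (min R t)" for t :: real
  define gg where "gg t = g (cl t)" for t
  have "(C * 1)-lipschitz_on UNIV (g \<circ> cl)"
  proof (rule lipschitz_on_compose)
    show "1-lipschitz_on UNIV cl" by (rule lipschitz_onI) (auto simp: cl_def dist_real_def)
    show "C-lipschitz_on (range cl) g"
      by (rule lipschitz_on_subset[OF lip]) (use R_pos in \<open>auto simp: cl_def\<close>)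
  qed
  then have lip': "C-lipschitz_on UNIV gg" by (simp add: o_def gg_def[abs_def])
  have lipD: "norm (gg s - gg t) \<le> C * \<bar>s - t\<bar>" for s t
    using lipschitz_onD[OF lip', of s t] by (simp add: dist_norm)
  have gg0: "gg 0 = 0" using R_pos g0 by (simp add: gg_def cl_def)
  have ggt: "gg t = g t" if "t \<in> {0..R}" for t using that by (simp add: gg_def cl_def)
  obtain N :: nat where N: "R < real N" using reals_Archimedean2 by blast
  define s where "s n t = (\<Sum>j<N * 2 ^ n. cinner (dyadic_slope gg n j) (ramp_deriv n j t *\<^sub>R z t + ramp n j t *\<^sub>R f t))" for n t
  have wv: "integrable M (\<lambda>t. ramp_deriv n j t *\<^sub>R z t + ramp n j t *\<^sub>R f t)"
    "(LINT t|M. ramp_deriv n j t *\<^sub>R z t + ramp n j t *\<^sub>R f t) = 0" for n j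
  proof -
    have m: "ramp_deriv n j \<in> borel_measurable M"
      unfolding ramp_deriv_def by (rule borel_imp_lebesgue_on_measurable) measurable
    have "AE t in lebesgue. t \<noteq> real j / 2 ^ n" "AE t in lebesgue. t \<noteq> real (Suc j) / 2 ^ n"
      using AE_lborel_singleton AE_completion by blast+
    then have "AE t in M. t \<noteq> real j / 2 ^ n" "AE t in M. t \<noteq> real (Suc j) / 2 ^ n"
      by (auto simp: AE_restrict_space_iff elim: eventually_mono)
    then have d: "AE t in M. (ramp n j has_real_derivative ramp_deriv n j t) (at t)"
      by eventually_elim (rule ramp_has_derivative)
    show "integrable M (\<lambda>t. ramp_deriv n j t *\<^sub>R z t + ramp n j t *\<^sub>R f t)"
      "(LINT t|M. ramp_deriv n j t *\<^sub>R z t + ramp n j t *\<^sub>R f t) = 0"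
      by (rule weak_vector[OF ramp_lipschitz ramp_0 m _ d]; simp add: ramp_deriv_def)+
  qed
  have ci: "integrable M (\<lambda>t. cinner (dyadic_slope gg n j) (ramp_deriv n j t *\<^sub>R z t + ramp n j t *\<^sub>R f t))" for n j
    by (intro integrable_bounded_linear[OF cinner.bounded_linear_right] wv)
  have si: "integrable M (s n)" for n
    unfolding s_def[abs_def] by (intro Bochner_Integration.integrable_sum ci)
  have s0: "(LINT t|M. s n t) = 0" for n
  proof -
    have "(LINT t|M. s n t) = (\<Sum>j<N * 2 ^ n. LINT t|M. cinner (dyadic_slope gg n j) (ramp_deriv n j t *\<^sub>R z t + ramp n j t *\<^sub>R f t))"
      unfolding s_def by (rule Bochner_Integration.integral_sum) (rule ci)
    also have "\<dots> = (\<Sum>j<N * 2 ^ n. 0)"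
      by (rule sum.cong) (simp_all only: integral_bounded_linear[OF cinner.bounded_linear_right wv(1)] wv(2) cinner_zero_right)
    finally show ?thesis by simp
  qed
  define h where "h n t = gg (real (dyadic_index n t) / 2 ^ n)
      + (t - real (dyadic_index n t) / 2 ^ n) *\<^sub>R dyadic_slope gg n (dyadic_index n t)" for n t
  have seq: "s n t = cinner (dyadic_slope gg n (dyadic_index n t)) (z t) + cinner (h n t) (f t)" if t: "t \<in> {0..R}" for n t
  proof -
    have "real (dyadic_index n t) \<le> 2 ^ n * t"
      using dyadic_index_bounds(1)[of t n] t by (simp add: pos_divide_le_eq mult.commute)
    also have "\<dots> < 2 ^ n * real N" using t N by simp
    finally have "real (dyadic_index n t) < real (N * 2 ^ n)" by (simp add: mult.commute)
    then have k: "dyadic_index n t < N * 2 ^ n" by (simp only: of_nat_less_iff)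
    have t0: "0 \<le> t" using t by simp
    have "s n t = (\<Sum>j<N * 2 ^ n. cinner (ramp_deriv n j t *\<^sub>R dyadic_slope gg n j) (z t)
      + cinner (ramp n j t *\<^sub>R dyadic_slope gg n j) (f t))"
      unfolding s_def by (simp add: cinner_add_right cinner.scaleR_right cinner.scaleR_left)
    also have "\<dots> = cinner (\<Sum>j<N * 2 ^ n. ramp_deriv n j t *\<^sub>R dyadic_slope gg n j) (z t)
      + cinner (\<Sum>j<N * 2 ^ n. ramp n j t *\<^sub>R dyadic_slope gg n j) (f t)"
      by (simp add: sum.distrib cinner.sum_left)
    also have "\<dots> = cinner (dyadic_slope gg n (dyadic_index n t)) (z t) + cinner (h n t) (f t)"
      unfolding ramp_sum[OF t0 k] h_def gg0 by simp
    finally show ?thesis .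
  qed
  have sl: "norm (dyadic_slope gg n j) \<le> C" for n j by (rule dyadic_slope_le[OF lip'])
  have hbd: "norm (h n t) \<le> C * t" if t: "t \<in> {0..R}" for n t
  proof -
    let ?a = "real (dyadic_index n t) / 2 ^ n"
    have a: "0 \<le> ?a" "?a \<le> t" using dyadic_index_bounds(1)[of t n] t by simp_all
    have "norm (h n t) \<le> norm (gg ?a) + (t - ?a) * norm (dyadic_slope gg n (dyadic_index n t))"
      unfolding h_def using norm_triangle_ineq[of "gg ?a" "(t - ?a) *\<^sub>R dyadic_slope gg n (dyadic_index n t)"] a by simp
    also have "\<dots> \<le> C * ?a + (t - ?a) * C"
      using lipD[of ?a 0] gg0 a by (intro add_mono mult_left_mono sl) auto
    also have "\<dots> = C * t" by (simp add: algebra_simps)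
    finally show ?thesis .
  qed
  have hlim: "(\<lambda>n. h n t) \<longlonglongrightarrow> g t" if t: "t \<in> {0..R}" for t
  proof -
    have "(\<lambda>n. h n t - g t) \<longlonglongrightarrow> 0"
    proof (rule Lim_null_comparison)
      have "(\<lambda>n. 2 * C * (1 / 2 ^ n)) \<longlonglongrightarrow> 2 * C * 0"
        by (intro tendsto_intros LIMSEQ_divide_realpow_zero) simp
      then show "(\<lambda>n. 2 * C * (1 / 2 ^ n)) \<longlonglongrightarrow> 0" by simp
      show "\<forall>\<^sub>F n in sequentially. norm (h n t - g t) \<le> 2 * C * (1 / 2 ^ n)"
      proof (intro always_eventually allI)
        fix n
        let ?a = "real (dyadic_index n t) / 2 ^ n"
        have a: "?a \<le> t" "t - ?a \<le> 1 / 2 ^ n"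
          using dyadic_index_bounds[of t n] t by (simp_all add: add_divide_distrib)
        have "h n t - g t = (gg ?a - gg t) + (t - ?a) *\<^sub>R dyadic_slope gg n (dyadic_index n t)"
          by (simp add: h_def ggt[OF t])
        then have "norm (h n t - g t) \<le> norm (gg ?a - gg t) + norm ((t - ?a) *\<^sub>R dyadic_slope gg n (dyadic_index n t))"
          by (simp only: norm_triangle_ineq)
        also have "\<dots> \<le> C * (1 / 2 ^ n) + (1 / 2 ^ n) * C"
        proof (rule add_mono)
          have "norm (gg ?a - gg t) \<le> C * \<bar>?a - t\<bar>" by (rule lipD)
          also have "\<dots> \<le> C * (1 / 2 ^ n)" using a C0 by (intro mult_left_mono) auto
          finally show "norm (gg ?a - gg t) \<le> C * (1 / 2 ^ n)" .
          show "norm ((t - ?a) *\<^sub>R dyadic_slope gg n (dyadic_index n t)) \<le> (1 / 2 ^ n) * C"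
            unfolding norm_scaleR by (intro mult_mono sl) (use a in auto)
        qed
        finally show "norm (h n t - g t) \<le> 2 * C * (1 / 2 ^ n)" by simp
      qed
    qed
    then show ?thesis by (rule LIM_zero_cancel)
  qed
  let ?w = "\<lambda>t. C * norm (z t) + C * (t * norm (f t))"
  have wi: "integrable M ?w"
    by (intro Bochner_Integration.integrable_add integrable_mult_right integrable_norm z_int tf_int)
  have sw: "AE t in M. norm (s n t) \<le> ?w t" for n
  proof (rule AE_I2)
    fix t assume "t \<in> space M"
    then have t: "t \<in> {0..R}" by simp
    have "norm (s n t) \<le> norm (dyadic_slope gg n (dyadic_index n t)) * norm (z t) + norm (h n t) * norm (f t)"
      unfolding seq[OF t] by (intro order_trans[OF norm_triangle_ineq] add_mono cinner_cauchy_schwarz)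
    also have "\<dots> \<le> C * norm (z t) + (C * t) * norm (f t)"
      by (intro add_mono mult_right_mono sl hbd t norm_ge_zero)
    finally show "norm (s n t) \<le> ?w t" by (simp add: mult.assoc)
  qed
  have ends: "AE t in M. t \<noteq> 0" "AE t in M. t \<noteq> R"
    using AE_completion[OF AE_lborel_singleton[of 0]] AE_completion[OF AE_lborel_singleton[of R]]
    by (auto simp: AE_restrict_space_iff elim: eventually_mono)
  have sl: "AE t in M. (\<lambda>n. s n t) \<longlonglongrightarrow> cinner (g' t) (z t) + cinner (g t) (f t)"
    using der ends AE_space
  proof eventually_elim
    case (elim t)
    then have t: "0 < t" "t < R" "t \<in> {0..R}" by auto
    have "(gg has_vector_derivative g' t) (at t)"
      by (rule has_vector_derivative_transform_within_open[OF elim(1), of "{0<..<R}"]) (use t ggt in auto)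
    then have "(\<lambda>n. dyadic_slope gg n (dyadic_index n t)) \<longlonglongrightarrow> g' t"
      using t by (intro dyadic_slope_tendsto_derivative) auto
    then show ?case unfolding seq[OF t(3)] by (intro tendsto_add cinner.tendsto tendsto_const hlim t)
  qed
  have lm: "(\<lambda>t. cinner (g' t) (z t) + cinner (g t) (f t)) \<in> borel_measurable M"
    by (rule measurable_lebesgue_on_AE_limit[OF _ borel_measurable_integrable[OF si] sl]) simp
  show "integrable M (\<lambda>t. cinner (g' t) (z t) + cinner (g t) (f t))"
    by (rule integrable_dominated_convergence[OF lm borel_measurable_integrable[OF si] wi sl sw])
  have "(\<lambda>n. LINT t|M. s n t) \<longlonglongrightarrow> (LINT t|M. cinner (g' t) (z t) + cinner (g t) (f t))"
    by (rule integral_dominated_convergence[OF lm borel_measurable_integrable[OF si] wi sl sw])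
  then show "(LINT t|M. cinner (g' t) (z t) + cinner (g t) (f t)) = 0"
    unfolding s0 by (rule LIMSEQ_unique[OF _ tendsto_const])
qed

end

section \<open>Compatible scalar products\<close>

lemma compatible_scalar_productD:
  assumes "compatible_scalar_product s"
  shows "s (u + v) w = s u w + s v w" "s (scaleC a u) v = a * s u v" "s u v = cnj (s v u)"
    "0 \<le> Re (s u u)" "(sp_norm s u)\<^sup>2 = Re (s u u)" "s u u = complex_of_real (Re (s u u))"
    "s 0 u = 0" "s u 0 = 0" "s u (v + w) = s u v + s u w" "s u (scaleC a v) = cnj a * s u v" "0 \<le> sp_norm s u"
proof -
  show add: "s (u + v) w = s u w + s v w" for u v w using assms unfolding compatible_scalar_product_def by blast
  show sc: "s (scaleC a u) v = a * s u v" for a u v using assms unfolding compatible_scalar_product_def by blast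
  show herm: "s u v = cnj (s v u)" for u v using assms unfolding compatible_scalar_product_def by blast
  show z: "s 0 u = 0" for u using add[of 0 0 u] by simp
  show "s u 0 = 0" using z[of u] herm[of u 0] by simp
  show nn: "0 \<le> Re (s u u)"
  proof (cases "u = 0")
    case False
    then have "0 < Re (s u u)" using assms unfolding compatible_scalar_product_def by blast
    then show ?thesis by simp
  qed (simp add: z)
  then show "(sp_norm s u)\<^sup>2 = Re (s u u)" by (simp add: sp_norm_def)
  show "0 \<le> sp_norm s u" using nn by (simp add: sp_norm_def)
  have "Im (s u u) = 0" using arg_cong[OF herm[of u u], of Im] by simp
  then show "s u u = complex_of_real (Re (s u u))" by (simp add: complex_eq_iff)
  show "s u (v + w) = s u v + s u w"
    using arg_cong[OF add[of v w u], of cnj] herm[of u "v + w"] herm[of u v] herm[of u w] by simp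
  show "s u (scaleC a v) = cnj a * s u v"
    using arg_cong[OF sc[of a v u], of cnj] herm[of u "scaleC a v"] herm[of u v] by simp
qed

lemma compatible_cauchy_schwarz:
  assumes s: "compatible_scalar_product s"
  shows "cmod (s u v) \<le> sp_norm s u * sp_norm s v"
proof (cases "v = 0")
  case True
  then show ?thesis
    using compatible_scalar_productD(8)[OF s] compatible_scalar_productD(11)[OF s] by simp
next
  case False
  note D = compatible_scalar_productD[OF s]
  define q where "q = Re (s v v)"
  have q: "0 < q" using False s unfolding q_def compatible_scalar_product_def by blast
  define a where "a = s u v / complex_of_real q"
  have uv: "s u v = a * complex_of_real q" using q by (simp add: a_def)
  have vv: "s v v = complex_of_real q" unfolding q_def by (rule D(6))
  have vu: "s v u = cnj a * complex_of_real q" using D(3)[of v u] uv by simp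
  let ?d = "u + scaleC (- a) v"
  have "s ?d ?d = s u u + (- cnj a) * s u v + (- a) * s v u + a * cnj a * s v v"
    by (simp add: D(1,2,9,10) algebra_simps)
  also have "\<dots> = s u u - a * cnj a * complex_of_real q"
    unfolding uv vu vv by (simp add: algebra_simps)
  also have "a * cnj a = complex_of_real ((cmod a)\<^sup>2)" by (rule complex_norm_square[symmetric])
  finally have "Re (s ?d ?d) = Re (s u u) - (cmod a)\<^sup>2 * q" by simp
  then have "(cmod a)\<^sup>2 * q \<le> Re (s u u)" using D(4)[of ?d] by simp
  then have "(cmod a)\<^sup>2 * q * q \<le> Re (s u u) * q" using q by (intro mult_right_mono) auto
  moreover have "cmod (s u v) = cmod a * q" unfolding uv using q by (simp add: norm_mult)
  ultimately have "(cmod (s u v))\<^sup>2 \<le> (sp_norm s u * sp_norm s v)\<^sup>2"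
    unfolding power_mult_distrib D(5) q_def[symmetric] by (simp add: power2_eq_square mult_ac)
  then show ?thesis by (rule power2_le_imp_le) (intro mult_nonneg_nonneg D(11))
qed

lemma compatible_bounds:
  assumes s: "compatible_scalar_product s"
  obtains K where "1 \<le> K" "\<And>u. sp_norm s u \<le> K * norm u" "\<And>u. norm u \<le> K * sp_norm s u"
proof -
  obtain c C where c: "0 < c" "\<And>u. c * norm u \<le> sp_norm s u" "\<And>u. sp_norm s u \<le> C * norm u"
    using s unfolding compatible_scalar_product_def by blast
  define K where "K = max 1 (max C (1 / c))"
  have K: "1 \<le> K" "C \<le> K" "1 / c \<le> K" by (simp_all add: K_def)
  show ?thesis
  proof (rule that[OF K(1)])
    show "sp_norm s u \<le> K * norm u" for u
      using c(3)[of u] mult_right_mono[OF K(2) norm_ge_zero[of u]] by linarith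
    show "norm u \<le> K * sp_norm s u" for u
    proof -
      have "norm u \<le> 1 / c * sp_norm s u" using c(2)[of u] c(1) by (simp add: field_simps)
      also have "\<dots> \<le> K * sp_norm s u"
        by (rule mult_right_mono[OF K(3) compatible_scalar_productD(11)[OF s]])
      finally show ?thesis .
    qed
  qed
qed

lemma graph_norm_le:
  assumes "0 \<le> sp_norm s u" "0 \<le> sp_norm s (T u)"
  shows "graph_norm s T u \<le> sp_norm s u + sp_norm s (T u)"
  unfolding graph_norm_def using assms by (intro real_le_lsqrt) (auto simp: power2_eq_square algebra_simps)

text \<open>Riesz representation in the second argument.\<close>
lemma ex_scalar_product_operator:
  assumes s: "compatible_scalar_product s"
  shows "\<exists>P :: 'h::complex_hilbert_space \<Rightarrow>\<^sub>L 'h. \<forall>u v. s u v = cinner (blinfun_apply P u) v"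
proof -
  note D = compatible_scalar_productD[OF s]
  obtain K where K: "1 \<le> K" "\<And>u. sp_norm s u \<le> K * norm u" by (rule compatible_bounds[OF s]) blast
  have bd: "cmod (s u v) \<le> (K * K * norm v) * norm u" for u v
  proof -
    have "cmod (s u v) \<le> sp_norm s u * sp_norm s v" by (rule compatible_cauchy_schwarz[OF s])
    also have "\<dots> \<le> (K * norm u) * (K * norm v)" using K D(11) by (intro mult_mono) auto
    finally show ?thesis by (simp add: mult_ac)
  qed
  have "\<exists>w. \<forall>u. s u v = cinner u w" for v
    by (rule riesz_representation[of "\<lambda>u. s u v" "K * K * norm v"]) (auto simp: D(1,2) bd)
  then obtain p where p: "\<And>u v. s u v = cinner u (p v)" by metis
  have p': "s u v = cinner (p u) v" for u v using D(3)[of u v] p[of v u] cinner_commute[of "p u" v] by simp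
  have "bounded_linear p"
  proof (rule bounded_linear_intro)
    show "p (x + y) = p x + p y" for x y
      by (rule cinner_eqI_left) (simp add: p'[symmetric] D(1) cinner_add_left)
    show "p (r *\<^sub>R x) = r *\<^sub>R p x" for r x
      by (rule cinner_eqI_left) (simp add: p'[symmetric] D(2) scaleC_of_real[symmetric] cinner_scaleC_left)
    show "norm (p x) \<le> norm x * (K * K)" for x
    proof (cases "p x = 0")
      case False
      have "(norm (p x))\<^sup>2 = Re (s x (p x))" by (simp add: p' Re_cinner_self)
      also have "\<dots> \<le> (K * K * norm (p x)) * norm x" using bd[of x "p x"] complex_Re_le_cmod order_trans by blast
      finally show ?thesis using False by (simp add: power2_eq_square mult_ac)
    qed (use K(1) in simp)
  qed
  then show ?thesis using p' by (intro exI[of _ "Blinfun p"]) (simp add: bounded_linear_Blinfun_apply)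
qed

section \<open>Dirac systems as coercive families\<close>

context dirac_system begin

text \<open>The metric is represented in the scalar product of the type and not in \<open>ip 0\<close>. Thereby the given system and
  the one with constant coefficients live in the same background space.\<close>
definition Gop :: "real \<Rightarrow> 'h \<Rightarrow>\<^sub>L 'h" where
  "Gop t = (SOME P. \<forall>u v. ip t u v = cinner (blinfun_apply P u) v)"

definition Bop :: "real \<Rightarrow> 'h \<Rightarrow> 'h" where "Bop t u = Gop t (A t u)"

lemma ip_Gop: "0 \<le> t \<Longrightarrow> ip t u v = cinner (Gop t u) v"
  using someI_ex[OF ex_scalar_product_operator[OF ip_compatible], of t] unfolding Gop_def[symmetric] by blast

text \<open>The Lipschitz condition compares \<open>\<langle>u, u\<rangle>\<^sub>r\<close> with \<open>\<langle>u, u\<rangle>\<^sub>t\<close> up to the factor \<open>1 + C T\<close>, and one scalar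
  product is comparable with the norm of the type.\<close>
lemma norm_equivalence:
  assumes T: "0 \<le> T"
  obtains K where "1 \<le> K" "\<And>t u. t \<in> {0..T} \<Longrightarrow> sp_norm (ip t) u \<le> K * norm u"
    "\<And>t u. t \<in> {0..T} \<Longrightarrow> norm u \<le> K * sp_norm (ip t) u"
proof -
  obtain K0 where K0: "1 \<le> K0" "\<And>u. sp_norm (ip 0) u \<le> K0 * norm u" "\<And>u. norm u \<le> K0 * sp_norm (ip 0) u"
    by (rule compatible_bounds[OF ip_compatible[OF order_refl]]) blast
  obtain C where C: "\<And>u v r s t. r \<in> {0..T} \<Longrightarrow> s \<in> {0..T} \<Longrightarrow> t \<in> {0..T} \<Longrightarrow>
      cmod (ip r u v - ip s u v) \<le> C * sp_norm (ip t) u * sp_norm (ip t) v * \<bar>r - s\<bar>"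
    using ip_lipschitz[OF T] by blast
  define a where "a = sqrt (1 + \<bar>C\<bar> * T)"
  have a1: "1 \<le> a" using T by (simp add: a_def)
  have cmp: "sp_norm (ip r) u \<le> a * sp_norm (ip t) u" if r: "r \<in> {0..T}" and t: "t \<in> {0..T}" for r t u
  proof -
    note D = compatible_scalar_productD[OF ip_compatible]
    have nn: "0 \<le> sp_norm (ip t) u" "0 \<le> sp_norm (ip r) u" using D(11) r t by auto
    have "Re (ip r u u) - Re (ip t u u) \<le> cmod (ip r u u - ip t u u)"
      using complex_Re_le_cmod[of "ip r u u - ip t u u"] by simp
    also have "\<dots> \<le> C * sp_norm (ip t) u * sp_norm (ip t) u * \<bar>r - t\<bar>" by (rule C[OF r t t])
    also have "\<dots> = C * (\<bar>r - t\<bar> * (sp_norm (ip t) u)\<^sup>2)" by (simp add: power2_eq_square mult_ac)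
    also have "\<dots> \<le> \<bar>C\<bar> * (T * (sp_norm (ip t) u)\<^sup>2)"
      using r t by (intro mult_mono mult_right_mono) auto
    finally have "(sp_norm (ip r) u)\<^sup>2 \<le> (1 + \<bar>C\<bar> * T) * (sp_norm (ip t) u)\<^sup>2"
      using r t by (simp add: D(5) algebra_simps)
    also have "\<dots> = (a * sp_norm (ip t) u)\<^sup>2" using T by (simp add: a_def power_mult_distrib)
    finally show ?thesis by (rule power2_le_imp_le) (use nn a1 in simp)
  qed
  have I0: "0 \<in> {0..T}" using T by simp
  show ?thesis
  proof (rule that[of "a * K0"])
    show "1 \<le> a * K0" using a1 K0(1) mult_mono[of 1 a 1 K0] by simp
    show "sp_norm (ip t) u \<le> a * K0 * norm u" if t: "t \<in> {0..T}" for t u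
      using order_trans[OF cmp[OF t I0] mult_left_mono[OF K0(2)]] a1 by (simp add: mult.assoc)
    show "norm u \<le> a * K0 * sp_norm (ip t) u" if t: "t \<in> {0..T}" for t u
      using order_trans[OF K0(3) mult_left_mono[OF cmp[OF I0 t]]] K0(1) by (simp add: mult_ac)
  qed
qed

text \<open>Norm equivalence converts the conditions on \<open>ip\<close> and \<open>A\<close> into norm bounds on \<open>Gop\<close> and \<open>Bop\<close>: test
  with the difference of the two values itself. Self-adjointness transfers because \<open>Gop t\<close> is onto.\<close>
lemma coercive_family_exists:
  assumes T: "0 < T"
  shows "\<exists>L c. coercive_family T L c Gop H_A Bop"
proof -
  have T0: "0 \<le> T" using T by simp
  obtain K where K: "1 \<le> K" "\<And>t u. t \<in> {0..T} \<Longrightarrow> sp_norm (ip t) u \<le> K * norm u"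
    "\<And>t u. t \<in> {0..T} \<Longrightarrow> norm u \<le> K * sp_norm (ip t) u"
    by (rule norm_equivalence[OF T0]) blast
  obtain C1 where C1: "\<And>u v r s t. r \<in> {0..T} \<Longrightarrow> s \<in> {0..T} \<Longrightarrow> t \<in> {0..T} \<Longrightarrow>
      cmod (ip r u v - ip s u v) \<le> C1 * sp_norm (ip t) u * sp_norm (ip t) v * \<bar>r - s\<bar>"
    using ip_lipschitz[OF T0] by blast
  obtain C2 where C2: "\<And>u v r s t. u \<in> H_A \<Longrightarrow> r \<in> {0..T} \<Longrightarrow> s \<in> {0..T} \<Longrightarrow> t \<in> {0..T} \<Longrightarrow>
      cmod (ip r (A r u) v - ip s (A s u) v) \<le> C2 * graph_norm (ip t) (A t) u * sp_norm (ip t) v * \<bar>r - s\<bar>"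
    using A_lipschitz[OF T0] by blast
  have nn: "0 \<le> sp_norm (ip t) u" if "t \<in> {0..T}" for t u
    using compatible_scalar_productD(11)[OF ip_compatible] that by auto
  define c where "c = 1 / K\<^sup>2"
  define L where "L = K\<^sup>2 + \<bar>C1\<bar> * K\<^sup>2 + \<bar>C2\<bar> * K\<^sup>2 * K\<^sup>2"
  have K0: "0 < K" using K(1) by simp
  have K2: "1 \<le> K\<^sup>2" using K(1) by (simp add: one_le_power)
  have c: "0 < c" using K0 by (simp add: c_def)
  have Lge: "K\<^sup>2 \<le> L" "\<bar>C1\<bar> * K\<^sup>2 \<le> L" "\<bar>C2\<bar> * K\<^sup>2 * K\<^sup>2 \<le> L" unfolding L_def by simp_all
  have L: "0 < L" using Lge(1) K2 by linarith
  have herm: "ip t u v = cnj (ip t v u)" if "t \<in> {0..T}" for t u v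
    by (rule compatible_scalar_productD(3)[OF ip_compatible]) (use that in simp)
  have Gpos: "c * (norm u)\<^sup>2 \<le> Re (cinner (Gop t u) u)" if t: "t \<in> {0..T}" for t u
  proof -
    have "(norm u)\<^sup>2 \<le> (K * sp_norm (ip t) u)\<^sup>2" using K(3)[OF t] by (intro power_mono) auto
    also have "\<dots> = K\<^sup>2 * Re (cinner (Gop t u) u)"
      using t compatible_scalar_productD(5)[OF ip_compatible, of t u] by (simp add: power_mult_distrib ip_Gop)
    finally show ?thesis using K0 by (simp add: c_def field_simps)
  qed
  have Gsym: "cinner (Gop t u) v = cinner u (Gop t v)" if t: "t \<in> {0..T}" for t u v
  proof -
    have t0: "0 \<le> t" using t by simp
    show ?thesis using herm[OF t, of u v] unfolding ip_Gop[OF t0] cinner_commute[of "Gop t v" u] complex_cnj_cnj .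
  qed
  have norm_le: "norm w \<le> D" if "(norm w)\<^sup>2 \<le> D * norm w" "0 \<le> D" for w :: 'h and D
    using that by (cases "w = 0") (auto simp: power2_eq_square)
  have Gbd: "norm (Gop t u) \<le> K\<^sup>2 * norm u" if t: "t \<in> {0..T}" for t u
  proof (rule norm_le)
    have "(norm (Gop t u))\<^sup>2 = Re (ip t u (Gop t u))" using t by (simp add: ip_Gop Re_cinner_self)
    also have "\<dots> \<le> cmod (ip t u (Gop t u))" by (rule complex_Re_le_cmod)
    also have "\<dots> \<le> sp_norm (ip t) u * sp_norm (ip t) (Gop t u)"
      using t by (intro compatible_cauchy_schwarz ip_compatible) auto
    also have "\<dots> \<le> (K * norm u) * (K * norm (Gop t u))" using t K0 by (intro mult_mono K(2) nn) auto
    finally show "(norm (Gop t u))\<^sup>2 \<le> K\<^sup>2 * norm u * norm (Gop t u)" by (simp add: power2_eq_square mult_ac)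
  qed simp
  have Glip: "norm (Gop r u - Gop s u) \<le> L * \<bar>r - s\<bar> * norm u" if r: "r \<in> {0..T}" and s: "s \<in> {0..T}" for r s u
  proof (rule norm_le)
    let ?w = "Gop r u - Gop s u"
    have "(norm ?w)\<^sup>2 = Re (ip r u ?w - ip s u ?w)" using r s by (simp add: ip_Gop Re_cinner_self[symmetric] cinner_diff_left)
    also have "\<dots> \<le> cmod (ip r u ?w - ip s u ?w)" by (rule complex_Re_le_cmod)
    also have "\<dots> \<le> C1 * sp_norm (ip r) u * sp_norm (ip r) ?w * \<bar>r - s\<bar>" by (rule C1[OF r s r])
    also have "\<dots> = C1 * ((sp_norm (ip r) u * sp_norm (ip r) ?w) * \<bar>r - s\<bar>)" by (simp add: mult_ac)
    also have "\<dots> \<le> \<bar>C1\<bar> * (((K * norm u) * (K * norm ?w)) * \<bar>r - s\<bar>)"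
      using r K0 by (intro mult_mono mult_right_mono K(2) nn mult_nonneg_nonneg) auto
    also have "\<dots> = (\<bar>C1\<bar> * K\<^sup>2) * (\<bar>r - s\<bar> * norm u * norm ?w)" by (simp add: power2_eq_square mult_ac)
    also have "\<dots> \<le> L * (\<bar>r - s\<bar> * norm u * norm ?w)" by (intro mult_right_mono Lge) auto
    finally show "(norm ?w)\<^sup>2 \<le> L * \<bar>r - s\<bar> * norm u * norm ?w" by (simp add: mult_ac)
  qed (use L in auto)
  have Gbelow: "c * norm u \<le> norm (Gop t u)" if t: "t \<in> {0..T}" for t u
  proof (cases "u = 0")
    case False
    have "c * (norm u)\<^sup>2 \<le> norm (Gop t u) * norm u" using Gpos[OF t] Re_cinner_le order_trans by blast
    then show ?thesis using False by (simp add: power2_eq_square)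
  qed simp
  have sa: "csubspace H_A" "closure H_A = UNIV" "clinear_on H_A (A t)"
    "adjoint_graph UNIV (ip t) H_A (A t) = {(v, A t v) |v. v \<in> H_A}" if "0 \<le> t" for t
    using A_self_adjoint[OF that] unfolding self_adjoint_op_def by blast+
  have Gsc: "Gop t (scaleC a u) = scaleC a (Gop t u)" if t: "t \<in> {0..T}" for t a u
  proof (rule cinner_eqI_left)
    show "cinner (Gop t (scaleC a u)) v = cinner (scaleC a (Gop t u)) v" for v
      using t compatible_scalar_productD(2)[OF ip_compatible, of t a u v] by (simp add: ip_Gop cinner_scaleC_left)
  qed
  have Blip: "norm (Bop r u - Bop s u) \<le> L * \<bar>r - s\<bar> * (norm u + norm (Bop t u))"
    if r: "r \<in> {0..T}" and s: "s \<in> {0..T}" and t: "t \<in> {0..T}" and u: "u \<in> H_A" for r s t u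
  proof (rule norm_le)
    let ?w = "Bop r u - Bop s u"
    have g: "graph_norm (ip t) (A t) u \<le> K * K\<^sup>2 * (norm u + norm (Bop t u))"
    proof -
      have "graph_norm (ip t) (A t) u \<le> sp_norm (ip t) u + sp_norm (ip t) (A t u)"
        by (rule graph_norm_le[OF nn[OF t] nn[OF t]])
      also have "\<dots> \<le> K * norm u + K * norm (A t u)" by (intro add_mono K(2) t)
      also have "\<dots> \<le> K * (K\<^sup>2 * norm u) + K * (K\<^sup>2 * norm (Bop t u))"
      proof (intro add_mono mult_left_mono)
        show "norm u \<le> K\<^sup>2 * norm u" using K2 mult_right_mono[of 1 "K\<^sup>2" "norm u"] by simp
        show "norm (A t u) \<le> K\<^sup>2 * norm (Bop t u)"
          using Gbelow[OF t, of "A t u"] K0 by (simp add: Bop_def c_def field_simps)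
      qed (use K0 in auto)
      finally show ?thesis by (simp add: algebra_simps)
    qed
    have "(norm ?w)\<^sup>2 = Re (ip r (A r u) ?w - ip s (A s u) ?w)"
      using r s by (simp add: ip_Gop Bop_def Re_cinner_self[symmetric] cinner_diff_left)
    also have "\<dots> \<le> cmod (ip r (A r u) ?w - ip s (A s u) ?w)" by (rule complex_Re_le_cmod)
    also have "\<dots> \<le> C2 * graph_norm (ip t) (A t) u * sp_norm (ip t) ?w * \<bar>r - s\<bar>" by (rule C2[OF u r s t])
    also have "\<dots> = C2 * ((graph_norm (ip t) (A t) u * sp_norm (ip t) ?w) * \<bar>r - s\<bar>)" by (simp add: mult_ac)
    also have "\<dots> \<le> \<bar>C2\<bar> * (((K * K\<^sup>2 * (norm u + norm (Bop t u))) * (K * norm ?w)) * \<bar>r - s\<bar>)"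
    proof (intro mult_mono mult_right_mono g K(2) t nn)
      show "0 \<le> graph_norm (ip t) (A t) u * sp_norm (ip t) ?w * \<bar>r - s\<bar>"
        using nn[OF t] by (simp add: graph_norm_def)
    qed (use K0 in auto)
    also have "\<dots> = (\<bar>C2\<bar> * K\<^sup>2 * K\<^sup>2) * (\<bar>r - s\<bar> * (norm u + norm (Bop t u)) * norm ?w)"
      by (simp add: power2_eq_square mult_ac)
    also have "\<dots> \<le> L * (\<bar>r - s\<bar> * (norm u + norm (Bop t u)) * norm ?w)" by (intro mult_right_mono Lge) auto
    finally show "(norm ?w)\<^sup>2 \<le> L * \<bar>r - s\<bar> * (norm u + norm (Bop t u)) * norm ?w" by (simp add: mult_ac)
  qed (use L in auto)
  have "coercive_family T L c Gop H_A Bop"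
  proof
    show "norm (Gop r - Gop s) \<le> L * \<bar>r - s\<bar>" if "r \<in> {0..T}" "s \<in> {0..T}" for r s
      by (rule norm_blinfun_bound) (use L Glip[OF that] in \<open>auto simp: blinfun.diff_left\<close>)
    show "norm (Gop t) \<le> L" if "t \<in> {0..T}" for t
    proof (rule norm_blinfun_bound)
      show "norm (Gop t u) \<le> L * norm u" for u
        using order_trans[OF Gbd[OF that] mult_right_mono[OF Lge(1) norm_ge_zero]] .
    qed (use L in simp)
    show "clinear_on H_A (Bop t)" if "t \<in> {0..T}" for t
      using sa(3)[of t] that by (auto simp: clinear_on_def Bop_def blinfun.add_right Gsc)
    show "adjoint_graph UNIV cinner H_A (Bop t) = {(v, Bop t v) |v. v \<in> H_A}" if t: "t \<in> {0..T}" for t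
    proof (intro set_eqI iffI; clarsimp)
      fix v w assume vw: "(v, w) \<in> adjoint_graph UNIV cinner H_A (Bop t)"
      obtain P where P: "\<And>f. Gop t (blinfun_apply P f) = f"
      proof (rule bounded_below_operator_inverse[of UNIV "Gop t" c])
        show "clinear_on UNIV (Gop t)" by (simp add: clinear_on_def blinfun.add_right Gsc[OF t])
        show "c * norm u \<le> norm (Gop t u)" for u by (rule Gbelow[OF t])
        show "u \<in> UNIV \<and> Gop t u = f" if "s \<longlonglongrightarrow> u" "(\<lambda>n. Gop t (s n)) \<longlonglongrightarrow> f" for s u f
          using LIMSEQ_unique[OF that(2) blinfun.tendsto[OF tendsto_const that(1)]] by simp
        show "x = 0" if "\<And>u. u \<in> UNIV \<Longrightarrow> cinner (Gop t u) x = 0" for x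
        proof -
          have "c * (norm x)\<^sup>2 \<le> 0" using Gpos[OF t, of x] that[of x] by simp
          then show ?thesis using c by (simp add: mult_le_0_iff)
        qed
        show "csubspace (UNIV :: 'h set)" by (simp add: csubspace_def)
        show "0 < c" by (rule c)
      qed blast
      have "(v, blinfun_apply P w) \<in> adjoint_graph UNIV (ip t) H_A (A t)"
        using vw t unfolding adjoint_graph_def by (simp add: ip_Gop Bop_def Gsym[OF t] P)
      then have "v \<in> H_A" "A t v = blinfun_apply P w" using sa(4)[of t] t by auto
      then show "w = Bop t v \<and> v \<in> H_A" by (simp add: Bop_def P)
    next
      fix v assume v: "v \<in> H_A"
      then have "(v, A t v) \<in> adjoint_graph UNIV (ip t) H_A (A t)" using sa(4)[of t] t by auto
      then show "(v, Bop t v) \<in> adjoint_graph UNIV cinner H_A (Bop t)"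
        using t unfolding adjoint_graph_def by (simp add: ip_Gop Bop_def Gsym[OF t])
    qed
  qed (use T L c Gsc Gsym Gpos sa(1,2)[of 0] Blip in auto)
  then show ?thesis by blast
qed

end

section \<open>The derivative of the metric\<close>

context coercive_family begin

definition dG :: "real \<Rightarrow> 'h \<Rightarrow> 'h" where
  "dG t u = vector_derivative (\<lambda>r. G r u) (at t)"

text \<open>Strong differentiability of \<open>G\<close>. The end points are excluded to have two-sided derivatives.\<close>
definition good :: "real \<Rightarrow> bool" where
  "good t \<longleftrightarrow> 0 < t \<and> t < R \<and> (\<forall>u. ((\<lambda>r. G r u) has_vector_derivative dG t u) (at t))"

lemma G_quotient_le:
  assumes "r \<in> {0..R}" "t \<in> {0..R}"
  shows "norm ((1 / (r - t)) *\<^sub>R (G r u - G t u)) \<le> L * norm u"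
proof (cases "r = t")
  case False
  then have "norm ((1 / (r - t)) *\<^sub>R (G r u - G t u)) = norm (G r u - G t u) / \<bar>r - t\<bar>" by simp
  also have "\<dots> \<le> L * \<bar>r - t\<bar> * norm u / \<bar>r - t\<bar>" by (intro divide_right_mono G_lip_apply assms) simp
  also have "\<dots> = L * norm u" using False by simp
  finally show ?thesis .
qed (use L_pos in simp)

text \<open>Almost every \<open>t\<close> works for a countable dense set of \<open>u\<close>; the uniform Lipschitz bound
  carries this over to all \<open>u\<close>.\<close>
lemma AE_good: "AE t in lebesgue_on {0..R}. good t"
proof -
  obtain D :: "'h set" where D: "countable D" "\<And>X. open X \<Longrightarrow> X \<noteq> {} \<Longrightarrow> \<exists>d\<in>D. d \<in> X"
    using countable_dense_setE by blast
  have "AE t in lebesgue_on {0..R}. \<exists>v. ((\<lambda>r. G r d) has_vector_derivative v) (at t)" for d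
  proof -
    obtain v where "AE t in lebesgue_on {0..R}. ((\<lambda>r. G r d) has_vector_derivative v t) (at t)"
      by (rule lipschitz_AE_differentiable[OF parallelogram G_u_lipschitz less_imp_le[OF R_pos]])
    then show ?thesis by eventually_elim blast
  qed
  then have "AE t in lebesgue_on {0..R}. \<forall>d\<in>D. \<exists>v. ((\<lambda>r. G r d) has_vector_derivative v) (at t)"
    using D(1) by (simp add: AE_ball_countable)
  moreover have "AE t in lebesgue_on {0..R}. t \<noteq> 0" "AE t in lebesgue_on {0..R}. t \<noteq> R"
    using AE_completion[OF AE_lborel_singleton[of 0]] AE_completion[OF AE_lborel_singleton[of R]]
    by (auto simp: AE_restrict_space_iff elim: eventually_mono)
  ultimately show ?thesis using AE_space
  proof eventually_elim
    case (elim t)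
    then have t: "0 < t" "t < R" "t \<in> {0..R}" by auto
    define q where "q u r = (1 / (r - t)) *\<^sub>R (G r u - G t u)" for u r
    have qdiff: "q u r - q v r = q (u - v) r" for u v r
      by (simp add: q_def blinfun.diff_right scaleR_diff_right)
    have qle: "norm (q u r) \<le> L * norm u" if "r \<in> {0..R}" for u r
      unfolding q_def by (rule G_quotient_le[OF that t(3)])
    have "((\<lambda>r. G r u) has_vector_derivative dG t u) (at t)" for u
    proof -
      have "\<exists>d\<in>D. d \<in> ball u (inverse (real (Suc n)))" for n by (rule D(2)) auto
      then obtain d where d: "\<And>n. d n \<in> D" "\<And>n. dist u (d n) < inverse (real (Suc n))" by (metis mem_ball)
      have du: "d \<longlonglongrightarrow> u"
      proof (rule LIM_zero_cancel, rule Lim_null_comparison[OF _ LIMSEQ_inverse_real_of_nat])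
        show "\<forall>\<^sub>F n in sequentially. norm (d n - u) \<le> inverse (real (Suc n))"
          using d(2) by (intro always_eventually allI less_imp_le) (simp add: dist_norm norm_minus_commute)
      qed
      have "\<forall>n. \<exists>v. ((\<lambda>r. G r (d n)) has_vector_derivative v) (at t)"
        using elim(1) d(1) by blast
      from choice[OF this] obtain v where "\<forall>n. ((\<lambda>r. G r (d n)) has_vector_derivative v n) (at t)" by blast
      then have v: "((\<lambda>r. q (d n) r) \<longlongrightarrow> v n) (at t within {0..R})" for n
        unfolding at_within_Icc_at[OF t(1,2)] q_def has_vector_derivative_iff_quotient by blast
      have nt: "at t within {0..R} \<noteq> bot" unfolding at_within_Icc_at[OF t(1,2)] by simp
      have vd: "norm (v n - v m) \<le> L * norm (d n - d m)" for n m
      proof (rule tendsto_upperbound[OF tendsto_norm[OF tendsto_diff[OF v v]] _ nt])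
        show "\<forall>\<^sub>F r in at t within {0..R}. norm (q (d n) r - q (d m) r) \<le> L * norm (d n - d m)"
          unfolding qdiff using qle by (simp add: eventually_at_filter)
      qed
      have "Cauchy v"
      proof (rule CauchyI)
        fix e :: real assume e: "0 < e"
        have "Cauchy d" using du by (rule LIMSEQ_imp_Cauchy)
        then obtain N where N: "\<And>m n. m \<ge> N \<Longrightarrow> n \<ge> N \<Longrightarrow> norm (d m - d n) < e / L"
          using CauchyD[of d "e / L"] e L_pos by auto
        have "norm (v m - v n) < e" if "m \<ge> N" "n \<ge> N" for m n
        proof -
          have "norm (v m - v n) \<le> L * norm (d m - d n)" by (rule vd)
          also have "\<dots> < L * (e / L)" using N[OF that] L_pos by (intro mult_strict_left_mono) auto
          finally show ?thesis using L_pos by simp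
        qed
        then show "\<exists>N. \<forall>m\<ge>N. \<forall>n\<ge>N. norm (v m - v n) < e" by blast
      qed
      then obtain l where l: "v \<longlonglongrightarrow> l" using Cauchy_convergent convergent_def by blast
      have "(q u \<longlongrightarrow> l) (at t within {0..R})"
      proof (rule swap_uniform_limit[OF _ l])
        show "\<forall>\<^sub>F n in sequentially. (q (d n) \<longlongrightarrow> v n) (at t within {0..R})" using v by simp
        show "uniform_limit {0..R} (\<lambda>n. q (d n)) (q u) sequentially"
        proof (rule uniform_limitI)
          fix e :: real assume e: "0 < e"
          have "\<forall>\<^sub>F n in sequentially. dist (d n) u < e / L" using tendstoD[OF du] e L_pos by simp
          then show "\<forall>\<^sub>F n in sequentially. \<forall>r\<in>{0..R}. dist (q (d n) r) (q u r) < e"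
          proof eventually_elim
            case (elim n)
            show ?case
            proof
              fix r assume r: "r \<in> {0..R}"
              have "dist (q (d n) r) (q u r) \<le> L * norm (d n - u)"
                unfolding dist_norm qdiff by (rule qle[OF r])
              also have "\<dots> < L * (e / L)" using elim L_pos by (intro mult_strict_left_mono) (auto simp: dist_norm)
              finally show "dist (q (d n) r) (q u r) < e" using L_pos by simp
            qed
          qed
        qed
      qed simp
      then have "((\<lambda>r. G r u) has_vector_derivative l) (at t)"
        unfolding at_within_Icc_at[OF t(1,2)] q_def has_vector_derivative_iff_quotient .
      then show ?thesis unfolding dG_def by (simp add: vector_derivative_at)
    qed
    then show ?case using t by (simp add: good_def)
  qed
qed

lemma goodD:
  assumes "good t" shows "0 < t" "t < R" "t \<in> {0..R}" "((\<lambda>r. G r u) has_vector_derivative dG t u) (at t)"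
  using assms by (auto simp: good_def)

lemma dG_bound:
  assumes "good t" shows "norm (dG t u) \<le> L * norm u"
proof (rule tendsto_upperbound)
  note t = goodD[OF assms]
  show "((\<lambda>r. norm ((1 / (r - t)) *\<^sub>R (G r u - G t u))) \<longlongrightarrow> norm (dG t u)) (at t within {0..R})"
    unfolding at_within_Icc_at[OF t(1,2)]
    by (rule tendsto_norm[OF t(4)[unfolded has_vector_derivative_iff_quotient]])
  show "\<forall>\<^sub>F r in at t within {0..R}. norm ((1 / (r - t)) *\<^sub>R (G r u - G t u)) \<le> L * norm u"
    using G_quotient_le[OF _ t(3)] by (simp add: eventually_at_filter)
  show "at t within {0..R} \<noteq> bot" unfolding at_within_Icc_at[OF t(1,2)] by simp
qed

lemma dG_sym:
  assumes "good t" shows "cinner (dG t u) v = cinner u (dG t v)"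
proof (rule tendsto_unique)
  note t = goodD[OF assms]
  let ?F = "at t within {0..R}"
  show "?F \<noteq> bot" unfolding at_within_Icc_at[OF t(1,2)] by simp
  show "((\<lambda>r. cinner ((1 / (r - t)) *\<^sub>R (G r u - G t u)) v) \<longlongrightarrow> cinner (dG t u) v) ?F"
    unfolding at_within_Icc_at[OF t(1,2)]
    by (rule cinner.tendsto[OF t(4)[unfolded has_vector_derivative_iff_quotient] tendsto_const])
  have "((\<lambda>r. cinner u ((1 / (r - t)) *\<^sub>R (G r v - G t v))) \<longlongrightarrow> cinner u (dG t v)) ?F"
    unfolding at_within_Icc_at[OF t(1,2)]
    by (rule cinner.tendsto[OF tendsto_const t(4)[unfolded has_vector_derivative_iff_quotient]])
  then show "((\<lambda>r. cinner ((1 / (r - t)) *\<^sub>R (G r u - G t u)) v) \<longlongrightarrow> cinner u (dG t v)) ?F"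
  proof (rule Lim_transform_eventually)
    show "\<forall>\<^sub>F r in ?F. cinner u ((1 / (r - t)) *\<^sub>R (G r v - G t v)) = cinner ((1 / (r - t)) *\<^sub>R (G r u - G t u)) v"
      unfolding eventually_at_filter
    proof (intro always_eventually allI impI)
      fix r assume r: "r \<in> {0..R}"
      show "cinner u ((1 / (r - t)) *\<^sub>R (G r v - G t v)) = cinner ((1 / (r - t)) *\<^sub>R (G r u - G t u)) v"
        by (simp add: cinner.scaleR_right cinner.scaleR_left cinner_diff_left cinner_diff_right G_sym[OF r] G_sym[OF t(3)])
    qed
  qed
qed

lemma Ginv_f_lipschitz:
  assumes g: "K-lipschitz_on {0..R} g" and Y: "\<And>t. t \<in> {0..R} \<Longrightarrow> norm (g t) \<le> Y"
  shows "\<exists>C. C-lipschitz_on {0..R} (\<lambda>t. Ginv t (g t))"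
proof -
  have Y0: "0 \<le> Y" using order_trans[OF norm_ge_zero Y[of 0]] R_pos by simp
  have "(L / c\<^sup>2 * Y + 1 / c * K)-lipschitz_on {0..R} (\<lambda>t. Ginv t (g t))"
  proof (rule lipschitz_on_family_apply[where F = "\<lambda>t. blinfun_apply (Ginv t)"])
    show "norm (Ginv t f) \<le> 1 / c * norm f" if "t \<in> {0..R}" for t f using Ginv_bound[OF that] by simp
    show "norm (Ginv r f - Ginv s f) \<le> L / c\<^sup>2 * \<bar>r - s\<bar> * norm f" if "r \<in> {0..R}" "s \<in> {0..R}" for r s f
      by (rule Ginv_lipschitz[OF that])
  qed (use g Y Y0 L_pos c_pos in \<open>auto simp: blinfun.diff_right\<close>)
  then show ?thesis by blast
qed

lemma G_f_lipschitz:
  assumes g: "K-lipschitz_on {0..R} g" and Y: "\<And>t. t \<in> {0..R} \<Longrightarrow> norm (g t) \<le> Y"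
  shows "\<exists>C. C-lipschitz_on {0..R} (\<lambda>t. G t (g t))"
proof -
  have Y0: "0 \<le> Y" using order_trans[OF norm_ge_zero Y[of 0]] R_pos by simp
  have "(L * Y + L * K)-lipschitz_on {0..R} (\<lambda>t. G t (g t))"
    by (rule lipschitz_on_family_apply[where F = "\<lambda>t. blinfun_apply (G t)"])
       (use g Y Y0 L_pos G_bound G_lip_apply in \<open>auto simp: blinfun.diff_right\<close>)
  then show ?thesis by blast
qed

lemma Ginv_apply_measurable:
  assumes s: "s \<in> borel_measurable (lebesgue_on {0..R})"
  shows "(\<lambda>t. Ginv t (s t)) \<in> borel_measurable (lebesgue_on {0..R})"
proof (rule measurable_Caratheodory[OF _ _ s])
  show "(\<lambda>t. Ginv t u) \<in> borel_measurable (lebesgue_on {0..R})" for u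
  proof -
    have "0-lipschitz_on {0..R} (\<lambda>t. u)" by (rule lipschitz_onI) auto
    then obtain C where "C-lipschitz_on {0..R} (\<lambda>t. Ginv t u)" using Ginv_f_lipschitz[of 0 "\<lambda>t. u" "norm u"] by auto
    then show ?thesis by (rule continuous_on_imp_measurable_lebesgue_on[OF lipschitz_on_continuous_on])
  qed
qed (intro continuous_intros)

text \<open>The derivative is a limit of difference quotients. They look to the right of \<open>t\<close>, hence the room
  between \<open>R'\<close> and \<open>R\<close>.\<close>
lemma dG_measurable:
  assumes R': "R' < R" and s: "s \<in> borel_measurable (lebesgue_on {0..R'})"
  shows "(\<lambda>t. dG t (s t)) \<in> borel_measurable (lebesgue_on {0..R'})"
proof (rule measurable_lebesgue_on_AE_limit)
  define q where "q n t = real (Suc n) *\<^sub>R (G (min R (t + 1 / real (Suc n))) (s t) - G t (s t))" for n t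
  show "q n \<in> borel_measurable (lebesgue_on {0..R'})" for n
  proof -
    have "(\<lambda>t. G (min R (t + 1 / real (Suc n))) (s t)) \<in> borel_measurable (lebesgue_on {0..R'})"
    proof (rule measurable_Caratheodory[OF _ _ s])
      show "(\<lambda>t. G (min R (t + 1 / real (Suc n))) u) \<in> borel_measurable (lebesgue_on {0..R'})" for u
      proof (rule continuous_on_imp_measurable_lebesgue_on)
        show "continuous_on {0..R'} (\<lambda>t. G (min R (t + 1 / real (Suc n))) u)"
          by (rule continuous_on_compose2[OF lipschitz_on_continuous_on[OF G_u_lipschitz[of u]]])
            (use R_pos in \<open>auto intro!: continuous_intros\<close>)
      qed
    qed (intro continuous_intros)
    then show ?thesis unfolding q_def
      by (intro borel_measurable_scaleR borel_measurable_diff G_apply_measurable s) (use R' in auto)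
  qed
  have "AE t in lebesgue_on {0..R'}. good t"
    by (rule lebesgue_on_mono[OF _]) (use AE_good R' in \<open>auto simp: AE_restrict_space_iff elim: eventually_mono\<close>)
  then show "AE t in lebesgue_on {0..R'}. (\<lambda>n. q n t) \<longlonglongrightarrow> dG t (s t)"
  proof eventually_elim
    case (elim t)
    note t = goodD[OF elim]
    have l0: "(\<lambda>n. 1 / real (Suc n)) \<longlonglongrightarrow> 0"
      using LIMSEQ_inverse_real_of_nat by (simp add: inverse_eq_divide)
    have "filterlim (\<lambda>n. 1 / real (Suc n)) (at_right 0) sequentially"
      unfolding filterlim_at using l0 by simp
    from filterlim_compose[OF has_vector_derivative_quotient_right[OF t(4)[of "s t"]] this]
    have "(\<lambda>n. (1 / (1 / real (Suc n))) *\<^sub>R (G (t + 1 / real (Suc n)) (s t) - G t (s t))) \<longlonglongrightarrow> dG t (s t)" .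
    then show ?case
    proof (rule Lim_transform_eventually)
      have "\<forall>\<^sub>F n in sequentially. 1 / real (Suc n) < R - t" using order_tendstoD(2)[OF l0, of "R - t"] t by simp
      then show "\<forall>\<^sub>F n in sequentially. (1 / (1 / real (Suc n))) *\<^sub>R (G (t + 1 / real (Suc n)) (s t) - G t (s t)) = q n t"
      proof eventually_elim
        case (elim n)
        then have "min R (t + 1 / real (Suc n)) = t + 1 / real (Suc n)" by simp
        then show ?case unfolding q_def by (simp only: div_by_1 divide_divide_eq_right mult_1_left)
      qed
    qed
  qed
qed simp

end

section \<open>The Dirac operator on an interval\<close>

text \<open>Bounds are available on \<open>[0, R + 1]\<close> so that test sections can be cut off beyond \<open>R\<close>, where the sections
  of interest vanish. The unqualified facts concern \<open>[0,R]\<close>.\<close>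
locale dirac_on = dirac_system ip H_A A \<gamma>
  for ip :: "real \<Rightarrow> 'h::{complex_hilbert_space, second_countable_topology} \<Rightarrow> 'h \<Rightarrow> complex"
    and H_A :: "'h set" and A :: "real \<Rightarrow> 'h \<Rightarrow> 'h" and \<gamma> :: "real \<Rightarrow> 'h \<Rightarrow>\<^sub>L 'h" +
  fixes R L c :: real
  assumes R_pos: "0 < R" and fam: "coercive_family (R + 1) L c Gop H_A Bop"
begin

sublocale big: coercive_family "R + 1" L c Gop H_A Bop
  by (rule fam)

sublocale coercive_family R L c Gop H_A Bop
proof
  show "norm (Gop r - Gop s) \<le> L * \<bar>r - s\<bar>" if "r \<in> {0..R}" "s \<in> {0..R}" for r s
    using that by (intro big.G_lip) auto
  show "norm (Gop t) \<le> L" if "t \<in> {0..R}" for t using that by (intro big.G_norm) auto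
  show "Gop t (scaleC a u) = scaleC a (Gop t u)" if "t \<in> {0..R}" for t a u using that by (intro big.G_scaleC) auto
  show "cinner (Gop t u) v = cinner u (Gop t v)" if "t \<in> {0..R}" for t u v using that by (intro big.G_sym) auto
  show "c * (norm u)\<^sup>2 \<le> Re (cinner (Gop t u) u)" if "t \<in> {0..R}" for t u using that by (intro big.G_pos) auto
  show "clinear_on H_A (Bop t)" if "t \<in> {0..R}" for t using that by (intro big.B_lin) auto
  show "adjoint_graph UNIV cinner H_A (Bop t) = {(v, Bop t v) |v. v \<in> H_A}" if "t \<in> {0..R}" for t
    using that by (intro big.B_adj) auto
  show "norm (Bop r u - Bop s u) \<le> L * \<bar>r - s\<bar> * (norm u + norm (Bop t u))"
    if "r \<in> {0..R}" "s \<in> {0..R}" "t \<in> {0..R}" "u \<in> H_A" for r s t u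
    using that by (intro big.B_lip) auto
qed (use R_pos big.L_pos big.c_pos big.S_sub big.S_dense in auto)

lemma metric_op_eq: "0 \<le> t \<Longrightarrow> metric_op ip t u = Ginv 0 (Gop t u)"
  unfolding metric_op_def
proof (rule the_equality)
  assume t: "0 \<le> t"
  have I0: "0 \<in> {0..R}" using R_pos by simp
  show "\<forall>v. ip 0 (Ginv 0 (Gop t u)) v = ip t u v"
    using t by (simp add: ip_Gop G_Ginv[OF I0])
  fix w assume "\<forall>v. ip 0 w v = ip t u v"
  then have "Gop 0 w = Gop t u" using t by (intro cinner_eqI_left) (simp add: ip_Gop)
  then show "w = Ginv 0 (Gop t u)" using Ginv_G[OF I0, of w] by simp
qed

lemma metric_op_deriv_eq:
  assumes t: "big.good t" shows "metric_op_deriv ip t u = Ginv 0 (dG t u)"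
  unfolding metric_op_deriv_def
proof (rule the_equality)
  note g = big.goodD[OF t]
  have I0: "0 \<in> {0..R}" using R_pos by simp
  have at: "at t within {0..} = at t" using g(1) by (intro at_within_interior) simp
  have der: "((\<lambda>r. ip 0 (metric_op ip r u) v) has_vector_derivative cinner (dG t u) v) (at t)" for v
  proof (rule has_vector_derivative_transform_within_open[of "\<lambda>r. cinner (Gop r u) v" _ _ "{0<..}"])
    show "((\<lambda>r. cinner (Gop r u) v) has_vector_derivative cinner (dG t u) v) (at t)"
      by (rule bounded_linear.has_vector_derivative[OF cinner.bounded_linear_left g(4)])
    show "cinner (Gop r u) v = ip 0 (metric_op ip r u) v" if "r \<in> {0<..}" for r
      using that by (simp add: metric_op_eq ip_Gop G_Ginv[OF I0])
  qed (use g in auto)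
  show "\<forall>v. ((\<lambda>r. ip 0 (metric_op ip r u) v) has_vector_derivative ip 0 (Ginv 0 (dG t u)) v) (at t within {0..})"
    unfolding at using der by (simp add: ip_Gop G_Ginv[OF I0])
  fix w assume w: "\<forall>v. ((\<lambda>r. ip 0 (metric_op ip r u) v) has_vector_derivative ip 0 w v) (at t within {0..})"
  have "Gop 0 w = dG t u"
  proof (rule cinner_eqI_left)
    fix v
    have "ip 0 w v = cinner (dG t u) v"
      using w der[of v] unfolding at by (intro vector_derivative_unique_at) auto
    then show "cinner (Gop 0 w) v = cinner (dG t u) v" by (simp add: ip_Gop)
  qed
  then show "w = Ginv 0 (dG t u)" using Ginv_G[OF I0, of w] by simp
qed

text \<open>The base point \<open>ip 0\<close> in \<open>metric_op\<close> cancels between the inverse and the derivative.\<close>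
lemma Gamma_op_eq:
  assumes t: "big.good t" shows "Gamma_op ip t u = (1/2) *\<^sub>R Ginv t (dG t u)"
proof -
  note g = big.goodD[OF t]
  have I0: "0 \<in> {0..R + 1}" using R_pos by simp
  have m: "metric_op ip t v = Ginv 0 (Gop t v)" for v using g(1) by (intro metric_op_eq) simp
  have "inv (metric_op ip t) (Ginv 0 (dG t u)) = Ginv t (dG t u)"
  proof (rule inv_f_eq)
    show "inj (metric_op ip t)"
    proof (rule injI)
      fix x y assume "metric_op ip t x = metric_op ip t y"
      then have "Gop 0 (Ginv 0 (Gop t x)) = Gop 0 (Ginv 0 (Gop t y))" by (simp add: m)
      then have "Ginv t (Gop t x) = Ginv t (Gop t y)" by (simp add: big.G_Ginv[OF I0])
      then show "x = y" by (simp add: big.Ginv_G[OF g(3)])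
    qed
    show "metric_op ip t (Ginv t (dG t u)) = Ginv 0 (dG t u)" by (simp add: m big.G_Ginv[OF g(3)])
  qed
  then show ?thesis by (simp add: Gamma_op_def metric_op_deriv_eq[OF t])
qed

lemma ip_Gamma:
  assumes t: "big.good t" shows "ip t (Gamma_op ip t u) v = (1/2) *\<^sub>R cinner (dG t u) v"
proof -
  note g = big.goodD[OF t]
  have t0: "0 \<le> t" using g(1) by simp
  show ?thesis
    by (simp add: ip_Gop[OF t0] Gamma_op_eq[OF t] blinfun.scaleR_right big.G_Ginv[OF g(3)] cinner.scaleR_left)
qed

lemma \<gamma>_G: "0 \<le> t \<Longrightarrow> cinner (Gop t (\<gamma> t u)) v = - cinner (Gop t u) (\<gamma> t v)"
  using \<gamma>_adjoint[of t u v] by (simp add: ip_Gop cinner_minus_right)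

lemma \<gamma>_lipschitz:
  assumes "0 \<le> T" shows "\<exists>C. C-lipschitz_on {0..T} \<gamma>"
  using \<gamma>_Lip_loc assms by (auto simp: Lip_loc_def)

end

section \<open>Function spaces on the half line\<close>

lemma integrable_lebesgue_on_subset:
  fixes f :: "real \<Rightarrow> 'b::{banach, second_countable_topology}"
  assumes f: "integrable (lebesgue_on S) f" and "T \<subseteq> S" "S \<in> sets lebesgue" "T \<in> sets lebesgue"
  shows "integrable (lebesgue_on T) f"
proof -
  have "integrable lebesgue (\<lambda>x. indicator S x *\<^sub>R f x)"
    using f assms(3) by (subst (asm) integrable_restrict_space) auto
  then have "integrable lebesgue (\<lambda>x. indicator T x *\<^sub>R (indicator S x *\<^sub>R f x))"
    by (rule integrable_mult_indicator[OF assms(4)])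
  then have "integrable lebesgue (\<lambda>x. indicator T x *\<^sub>R f x)"
    by (rule Bochner_Integration.integrable_cong[THEN iffD1, rotated 2])
       (use assms(2) in \<open>auto split: split_indicator\<close>)
  then show ?thesis using assms(4) by (subst integrable_restrict_space) auto
qed

lemma integral_halfline:
  fixes h :: "real \<Rightarrow> 'b::{banach, second_countable_topology}"
  assumes h: "h \<in> borel_measurable (lebesgue_on {0..T})"
    and eq: "AE t in lebesgue_on {0..T}. F t = h t" and z: "AE t in lebesgue_on {0..}. T < t \<longrightarrow> F t = 0"
  shows "(LINT t|lebesgue_on {0..}. F t) = (LINT t|lebesgue_on {0..T}. h t)"
proof -
  define N where "N t = indicat_real {0..T} t *\<^sub>R h t" for t
  have "N \<in> borel_measurable lebesgue"
    unfolding N_def using h by (subst (asm) borel_measurable_restrict_space_iff) auto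
  then have Nm: "N \<in> borel_measurable (lebesgue_on {0..})" by (rule measurable_restrict_space1)
  have "AE t in lebesgue. t \<in> {0..T} \<longrightarrow> F t = h t" "AE t in lebesgue. t \<in> {0..} \<longrightarrow> T < t \<longrightarrow> F t = 0"
    using eq z by (simp_all add: AE_restrict_space_iff)
  then have "AE t in lebesgue. t \<in> {0..} \<longrightarrow> N t = F t"
    by eventually_elim (auto simp: N_def split: split_indicator)
  then have "AE t in lebesgue_on {0..}. N t = F t" by (simp add: AE_restrict_space_iff)
  from integral_cong_AE_lebesgue_on[OF _ Nm this]
  have "(LINT t|lebesgue_on {0..}. F t) = (LINT t|lebesgue_on {0..}. N t)" by simp
  also have "\<dots> = (LINT t|lebesgue. indicat_real {0..} t *\<^sub>R N t)" by (rule integral_restrict_space) simp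
  also have "\<dots> = (LINT t|lebesgue. indicat_real {0..T} t *\<^sub>R h t)"
    by (rule Bochner_Integration.integral_cong) (auto simp: N_def split: split_indicator)
  also have "\<dots> = (LINT t|lebesgue_on {0..T}. h t)" by (rule integral_restrict_space[symmetric]) simp
  finally show ?thesis .
qed

lemma AE_lebesgue_on_subset:
  assumes "AE t in lebesgue_on S. P t" "T \<subseteq> S" "S \<in> sets lebesgue" "T \<in> sets lebesgue"
  shows "AE t in lebesgue_on T. P t"
  using assms by (auto simp: AE_restrict_space_iff elim: eventually_mono)

lemma Lip_loc_measurable:
  fixes f :: "real \<Rightarrow> 'b::metric_space"
  assumes f: "f \<in> Lip_loc" shows "f \<in> borel_measurable (lebesgue_on {0..})"
proof (rule continuous_on_imp_measurable_lebesgue_on)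
  show "continuous_on {0..} f" unfolding continuous_on_iff
  proof (intro ballI allI impI)
    fix x e :: real assume x: "x \<in> {0..}" and e: "0 < e"
    have "0 \<le> x + 1" using x by simp
    then obtain C where C: "C-lipschitz_on {0..x + 1} f" using f unfolding Lip_loc_def by blast
    have C0: "0 \<le> C" by (rule lipschitz_on_nonneg[OF C])
    show "\<exists>d>0. \<forall>x'\<in>{0..}. dist x' x < d \<longrightarrow> dist (f x') (f x) < e"
    proof (intro exI[of _ "min 1 (e / (C + 1))"] conjI ballI impI)
      show "0 < min 1 (e / (C + 1))" using e C0 by simp
      fix y assume y: "y \<in> {0..}" and d: "dist y x < min 1 (e / (C + 1))"
      have "dist (f y) (f x) \<le> C * dist y x"
        by (rule lipschitz_onD[OF C]) (use x y d in \<open>auto simp: dist_real_def\<close>)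
      also have "\<dots> \<le> (C + 1) * dist y x" by (intro mult_right_mono) auto
      also have "\<dots> < (C + 1) * (e / (C + 1))" using d C0 by (intro mult_strict_left_mono) auto
      finally show "dist (f y) (f x) < e" using C0 by simp
    qed
  qed
qed

section \<open>The maximal domain\<close>

text \<open>The weak derivative of \<open>\<sigma>\<close>, continued by \<open>0\<close> beyond \<open>R\<close>, is \<open>f\<close>. Neither \<open>f\<close> nor \<open>A \<sigma>\<close> need be
  integrable near \<open>0\<close>; therefore the test functions vanish there. Apart from \<open>A\<close> nothing in the
  condition depends on the system.\<close>
definition regular_pair ::
  "real \<Rightarrow> 'h::complex_hilbert_space set \<Rightarrow> (real \<Rightarrow> 'h \<Rightarrow> 'h) \<Rightarrow> (real \<Rightarrow> 'h) \<Rightarrow> (real \<Rightarrow> 'h) \<Rightarrow> bool" where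
  "regular_pair R S A \<sigma> f \<longleftrightarrow>
    (AE t in lebesgue_on {0..R}. \<sigma> t \<in> S) \<and>
    (\<lambda>t. A t (\<sigma> t)) \<in> borel_measurable (lebesgue_on {0..R}) \<and>
    integrable (lebesgue_on {0..R}) (\<lambda>t. (t * norm (A t (\<sigma> t)))\<^sup>2) \<and>
    f \<in> borel_measurable (lebesgue_on {0..R}) \<and>
    integrable (lebesgue_on {0..R}) (\<lambda>t. (norm (f t + A t (\<sigma> t)))\<^sup>2) \<and>
    (\<forall>C g g'. C-lipschitz_on {0..R} g \<longrightarrow> g 0 = 0 \<longrightarrow>
      (AE t in lebesgue_on {0..R}. (g has_vector_derivative g' t) (at t)) \<longrightarrow>
      integrable (lebesgue_on {0..R}) (\<lambda>t. cinner (g' t) (\<sigma> t) + cinner (g t) (f t)) \<and>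
      (LINT t|lebesgue_on {0..R}. cinner (g' t) (\<sigma> t) + cinner (g t) (f t)) = 0)"

context dirac_system begin

lemma L2_space_restrict:
  assumes w: "w \<in> L2_space ip" and T: "0 \<le> T"
  shows "w \<in> borel_measurable (lebesgue_on {0..T})" "integrable (lebesgue_on {0..T}) (\<lambda>t. (norm (w t))\<^sup>2)"
proof -
  show wm: "w \<in> borel_measurable (lebesgue_on {0..T})"
    by (rule measurable_restrict_mono[of _ _ "{0..}"]) (use w in \<open>auto simp: L2_space_def\<close>)
  obtain K where K: "1 \<le> K" "\<And>t u. t \<in> {0..T} \<Longrightarrow> norm u \<le> K * sp_norm (ip t) u"
    by (rule norm_equivalence[OF T]) blast
  show "integrable (lebesgue_on {0..T}) (\<lambda>t. (norm (w t))\<^sup>2)"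
  proof (rule Bochner_Integration.integrable_bound)
    have "integrable (lebesgue_on {0..T}) (\<lambda>t. (sp_norm (ip t) (w t))\<^sup>2)"
      by (rule integrable_lebesgue_on_subset[of "{0..}"]) (use w in \<open>auto simp: L2_space_def\<close>)
    then show "integrable (lebesgue_on {0..T}) (\<lambda>t. K\<^sup>2 * (sp_norm (ip t) (w t))\<^sup>2)" by simp
    show "(\<lambda>t. (norm (w t))\<^sup>2) \<in> borel_measurable (lebesgue_on {0..T})"
      by (intro borel_measurable_power measurable_compose[OF wm borel_measurable_norm])
    show "AE t in lebesgue_on {0..T}. norm ((norm (w t))\<^sup>2) \<le> norm (K\<^sup>2 * (sp_norm (ip t) (w t))\<^sup>2)"
    proof (rule AE_I2)
      fix t assume "t \<in> space (lebesgue_on {0..T})"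
      then have t: "t \<in> {0..T}" by simp
      have "(norm (w t))\<^sup>2 \<le> (K * sp_norm (ip t) (w t))\<^sup>2" using K(2)[OF t] by (intro power_mono) auto
      then show "norm ((norm (w t))\<^sup>2) \<le> norm (K\<^sup>2 * (sp_norm (ip t) (w t))\<^sup>2)" by (simp add: power_mult_distrib)
    qed
  qed
qed

text \<open>On a bounded interval the norms of the system are uniformly equivalent to the norm of the type.\<close>
lemma L2_spaceI:
  assumes w: "w \<in> borel_measurable (lebesgue_on {0..})" and T: "0 \<le> T"
    and w2: "integrable (lebesgue_on {0..T}) (\<lambda>t. (norm (w t))\<^sup>2)" and z: "AE t in lebesgue_on {0..}. T < t \<longrightarrow> w t = 0"
  shows "w \<in> L2_space ip"
proof -
  obtain K where K: "1 \<le> K" "\<And>t u. t \<in> {0..T} \<Longrightarrow> sp_norm (ip t) u \<le> K * norm u"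
    by (rule norm_equivalence[OF T]) blast
  define h where "h t = (sp_norm (ip t) (w t))\<^sup>2" for t
  obtain L c where cf: "coercive_family (T + 1) L c Gop H_A Bop" using coercive_family_exists[of "T + 1"] T by auto
  interpret cf: coercive_family "T + 1" L c Gop H_A Bop by (rule cf)
  have wT: "w \<in> borel_measurable (lebesgue_on {0..T})"
    by (rule measurable_restrict_mono[OF w]) auto
  have hm: "h \<in> borel_measurable (lebesgue_on {0..T})"
  proof -
    have "(\<lambda>t. Re (cinner (Gop t (w t)) (w t))) \<in> borel_measurable (lebesgue_on {0..T})"
    proof (rule measurable_compose[OF _ borel_measurable_Re])
      show "(\<lambda>t. cinner (Gop t (w t)) (w t)) \<in> borel_measurable (lebesgue_on {0..T})"
        by (rule measurable_cinner[OF cf.G_apply_measurable[OF _ wT] wT]) simp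
    qed
    moreover have "h t = Re (cinner (Gop t (w t)) (w t))" if "t \<in> {0..T}" for t
      using that compatible_scalar_productD(5)[OF ip_compatible, of t "w t"] by (simp add: h_def ip_Gop)
    ultimately show ?thesis by (subst measurable_cong) auto
  qed
  have hT: "integrable (lebesgue_on {0..T}) h"
  proof (rule Bochner_Integration.integrable_bound[OF _ hm])
    show "integrable (lebesgue_on {0..T}) (\<lambda>t. K\<^sup>2 * (norm (w t))\<^sup>2)" using w2 by simp
    show "AE t in lebesgue_on {0..T}. norm (h t) \<le> norm (K\<^sup>2 * (norm (w t))\<^sup>2)"
    proof (rule AE_I2)
      fix t assume "t \<in> space (lebesgue_on {0..T})"
      then have t: "t \<in> {0..T}" by simp
      have "(sp_norm (ip t) (w t))\<^sup>2 \<le> (K * norm (w t))\<^sup>2"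
        using K(2)[OF t] compatible_scalar_productD(11)[OF ip_compatible] t by (intro power_mono) auto
      then show "norm (h t) \<le> norm (K\<^sup>2 * (norm (w t))\<^sup>2)" by (simp add: h_def power_mult_distrib)
    qed
  qed
  have hz: "h t = 0" if "0 \<le> t" "w t = 0" for t
    using compatible_scalar_productD(5,7)[OF ip_compatible, of t 0] that by (simp add: h_def)
  have i: "integrable lebesgue (\<lambda>t. indicat_real {0..T} t *\<^sub>R h t)"
    using hT by (subst (asm) integrable_restrict_space) auto
  have zl: "AE t in lebesgue. t \<in> {0..} \<longrightarrow> T < t \<longrightarrow> w t = 0"
    using z by (simp add: AE_restrict_space_iff)
  have ae: "AE t in lebesgue. indicat_real {0..T} t *\<^sub>R h t = indicat_real {0..} t *\<^sub>R h t"
    using zl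
    by eventually_elim (use hz in \<open>auto split: split_indicator\<close>)
  have "(\<lambda>t. indicat_real {0..} t *\<^sub>R h t) \<in> borel_measurable (lebesgue_on UNIV)"
    by (rule measurable_lebesgue_on_AE[OF _ borel_measurable_integrable])
      (unfold lebesgue_on_UNIV_eq, simp, rule i, rule ae)
  then have "integrable lebesgue (\<lambda>t. indicat_real {0..} t *\<^sub>R h t)"
    using integrable_cong_AE[OF borel_measurable_integrable[OF i] _ ae] i by (simp add: lebesgue_on_UNIV_eq)
  then have "integrable (lebesgue_on {0..}) h" by (subst integrable_restrict_space) auto
  then show ?thesis using w by (simp add: L2_space_def h_def[abs_def])
qed

lemma \<gamma>_apply_Lip_loc:
  assumes y: "y \<in> Lip_loc" shows "(\<lambda>t. \<gamma> t (y t)) \<in> Lip_loc"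
  unfolding Lip_loc_def
proof (intro CollectI allI impI)
  fix T :: real assume T: "0 \<le> T"
  obtain C where C: "C-lipschitz_on {0..T} \<gamma>" using \<gamma>_Lip_loc T by (auto simp: Lip_loc_def)
  obtain K where K: "K-lipschitz_on {0..T} y" using y T by (auto simp: Lip_loc_def)
  obtain a where a: "0 \<le> a" "\<And>t. t \<in> {0..T} \<Longrightarrow> norm (\<gamma> t) \<le> a" by (rule lipschitz_on_bounded_Icc[OF C T]) blast
  obtain Y where Y: "0 \<le> Y" "\<And>t. t \<in> {0..T} \<Longrightarrow> norm (y t) \<le> Y" by (rule lipschitz_on_bounded_Icc[OF K T]) blast
  have "(C * Y + a * K)-lipschitz_on {0..T} (\<lambda>t. \<gamma> t (y t))"
  proof (rule lipschitz_on_family_apply[where F = "\<lambda>t. blinfun_apply (\<gamma> t)"])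
    show "norm (\<gamma> t f) \<le> a * norm f" if "t \<in> {0..T}" for t f
      using order_trans[OF norm_blinfun mult_right_mono[OF a(2)[OF that] norm_ge_zero]] .
    show "norm (\<gamma> r f - \<gamma> s f) \<le> C * \<bar>r - s\<bar> * norm f" if rs: "r \<in> {0..T}" "s \<in> {0..T}" for r s f
    proof -
      have "norm (\<gamma> r - \<gamma> s) \<le> C * \<bar>r - s\<bar>" using lipschitz_onD[OF C rs] by (simp add: dist_norm)
      from order_trans[OF norm_blinfun mult_right_mono[OF this norm_ge_zero]]
      show ?thesis by (simp add: blinfun.diff_left)
    qed
  qed (use K Y a lipschitz_on_nonneg[OF C] in \<open>auto simp: blinfun.diff_right\<close>)
  then show "\<exists>C. C-lipschitz_on {0..T} (\<lambda>t. \<gamma> t (y t))" by blast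
qed

lemma A_linear: "0 \<le> t \<Longrightarrow> clinear_on H_A (A t)" and H_A_csubspace: "csubspace H_A"
  using A_self_adjoint[of t] A_self_adjoint[of 0] unfolding self_adjoint_op_def by blast+

text \<open>Here \<open>[\<partial>, \<gamma>] = 0\<close> and \<open>A \<gamma> + \<gamma> A = 0\<close> enter: after them only \<open>\<rho> = \<gamma> \<tau>\<close> matters.\<close>
lemma dirac_op_eq:
  assumes \<tau>: "\<tau> \<in> Lip_loc" and dom: "AE t in lebesgue_on {0..}. \<tau> t \<in> H_A"
  shows "AE t in lebesgue_on {0..}. dirac_op ip A \<gamma> \<tau> t
    = partial_op ip (\<lambda>r. \<gamma> r (\<tau> r)) t - A t (\<gamma> t (\<tau> t))"
  using \<gamma>_parallel[OF \<tau>] dom AE_space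
proof eventually_elim
  case (elim t)
  then have t: "0 \<le> t" by simp
  have "A t (\<gamma> t (\<tau> t)) + \<gamma> t (A t (\<tau> t)) = 0" using \<gamma>_anticommute[OF t elim(2)] by blast
  then have "\<gamma> t (A t (\<tau> t)) = - A t (\<gamma> t (\<tau> t))" by (simp add: eq_neg_iff_add_eq_0 add.commute)
  then show ?case by (simp add: dirac_op_def blinfun.add_right elim(1))
qed

lemma graph_norm_scaleR:
  assumes v: "v \<in> H_A" shows "graph_norm (ip 0) (A 0) (a *\<^sub>R v) = \<bar>a\<bar> * graph_norm (ip 0) (A 0) v"
proof -
  have sp: "(sp_norm (ip 0) (a *\<^sub>R x))\<^sup>2 = a\<^sup>2 * (sp_norm (ip 0) x)\<^sup>2" for x
  proof -
    note D = compatible_scalar_productD[OF ip_compatible[OF order_refl]]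
    show ?thesis
      unfolding D(5) by (simp add: ip_Gop blinfun.scaleR_right cinner.scaleR_left cinner.scaleR_right power2_eq_square)
  qed
  have "A 0 (a *\<^sub>R v) = a *\<^sub>R A 0 v" by (rule clinear_on_scaleR[OF A_linear[OF order_refl] H_A_csubspace v])
  then have "graph_norm (ip 0) (A 0) (a *\<^sub>R v) = sqrt (a\<^sup>2 * ((sp_norm (ip 0) v)\<^sup>2 + (sp_norm (ip 0) (A 0 v))\<^sup>2))"
    unfolding graph_norm_def by (simp add: sp distrib_left)
  then show ?thesis by (simp add: real_sqrt_mult graph_norm_def)
qed

text \<open>The sections \<open>- \<gamma> (\<psi> u)\<close> are the admissible test functions that turn the Dirac operator into
  \<open>\<partial> - A\<close> acting on \<open>\<psi> u\<close>.\<close>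
lemma test_function_in_L_0c:
  assumes \<psi>: "K-lipschitz_on UNIV \<psi>" and \<psi>0: "\<psi> 0 = 0" and supp: "\<And>t. b < t \<Longrightarrow> \<psi> t = 0" and u: "u \<in> H_A"
  shows "(\<lambda>t. \<gamma> t (- (\<psi> t *\<^sub>R u))) \<in> L_0c ip H_A A"
proof -
  let ?\<tau> = "\<lambda>t. \<gamma> t (- (\<psi> t *\<^sub>R u))"
  have \<tau>eq: "?\<tau> t = (- \<psi> t) *\<^sub>R \<gamma> t u" for t by (simp add: blinfun.minus_right blinfun.scaleR_right)
  have "(K * norm u)-lipschitz_on UNIV (\<lambda>t. - (\<psi> t *\<^sub>R u))"
  proof (rule lipschitz_onI)
    fix x y
    have "dist (- (\<psi> x *\<^sub>R u)) (- (\<psi> y *\<^sub>R u)) = norm ((\<psi> y - \<psi> x) *\<^sub>R u)"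
      by (simp add: dist_norm scaleR_diff_left)
    also have "\<dots> = dist (\<psi> x) (\<psi> y) * norm u" by (simp add: dist_real_def abs_minus_commute)
    also have "\<dots> \<le> (K * dist x y) * norm u" by (intro mult_right_mono lipschitz_onD[OF \<psi>]) auto
    finally show "dist (- (\<psi> x *\<^sub>R u)) (- (\<psi> y *\<^sub>R u)) \<le> K * norm u * dist x y" by (simp add: mult_ac)
  qed (use lipschitz_on_nonneg[OF \<psi>] in simp)
  then have "(\<lambda>t. - (\<psi> t *\<^sub>R u)) \<in> Lip_loc"
    unfolding Lip_loc_def using lipschitz_on_subset by blast
  then have L: "?\<tau> \<in> Lip_loc" by (rule \<gamma>_apply_Lip_loc)
  have \<gamma>u: "\<gamma> t u \<in> H_A" if "0 \<le> t" for t using \<gamma>_anticommute[OF that u] by blast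
  have \<psi>m: "\<psi> \<in> borel_measurable (lebesgue_on {0..})"
    by (rule continuous_on_imp_measurable_lebesgue_on, rule continuous_on_subset[OF lipschitz_on_continuous_on[OF \<psi>]]) simp
  have "?\<tau> \<in> Linf_loc_dom (ip 0) H_A (A 0)"
    unfolding Linf_loc_dom_def
  proof (intro CollectI conjI allI impI)
    show "?\<tau> \<in> borel_measurable (lebesgue_on {0..})" by (rule Lip_loc_measurable[OF L])
    have eq: "A 0 (?\<tau> t) = (- \<psi> t) *\<^sub>R A 0 (\<gamma> t u)" if "t \<in> space (lebesgue_on {0..})" for t
      unfolding \<tau>eq by (rule clinear_on_scaleR[OF A_linear[OF order_refl] H_A_csubspace \<gamma>u]) (use that in simp)
    have m: "(\<lambda>t. (- \<psi> t) *\<^sub>R A 0 (\<gamma> t u)) \<in> borel_measurable (lebesgue_on {0..})"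
      by (intro borel_measurable_scaleR borel_measurable_uminus \<psi>m \<gamma>_Linf_loc_measurable u)
    show "(\<lambda>t. A 0 (?\<tau> t)) \<in> borel_measurable (lebesgue_on {0..})"
      by (subst measurable_cong[OF eq]) (assumption, rule m)
    show "AE t in lebesgue_on {0..}. ?\<tau> t \<in> H_A"
      unfolding \<tau>eq by (rule AE_I2, rule csubspace_scaleR[OF H_A_csubspace \<gamma>u]) simp
    fix d :: real assume d: "0 \<le> d"
    obtain C where C: "AE t in lebesgue_on {0..d}. \<forall>v\<in>H_A. \<gamma> t v \<in> H_A \<and>
        graph_norm (ip 0) (A 0) (\<gamma> t v) \<le> C * graph_norm (ip 0) (A 0) v"
      using \<gamma>_Linf_loc_bound[OF d] by blast
    show "\<exists>C. AE t in lebesgue_on {0..d}. graph_norm (ip 0) (A 0) (?\<tau> t) \<le> C"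
    proof (rule exI)
      show "AE t in lebesgue_on {0..d}. graph_norm (ip 0) (A 0) (?\<tau> t) \<le> K * d * (C * graph_norm (ip 0) (A 0) u)"
        using C AE_space
      proof eventually_elim
        case (elim t)
        then have t: "0 \<le> t" "t \<le> d" by auto
        have "\<bar>\<psi> t\<bar> \<le> K * t" using lipschitz_onD[OF \<psi>, of t 0] \<psi>0 t by (simp add: dist_real_def)
        also have "\<dots> \<le> K * d" using t lipschitz_on_nonneg[OF \<psi>] by (intro mult_left_mono) auto
        finally have \<psi>d: "\<bar>- \<psi> t\<bar> \<le> K * d" by simp
        have "0 \<le> graph_norm (ip 0) (A 0) (\<gamma> t u)" by (simp add: graph_norm_def)
        then show ?case
          unfolding \<tau>eq graph_norm_scaleR[OF \<gamma>u[OF t(1)]] using \<psi>d elim(1) u by (intro mult_mono) auto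
      qed
    qed
  qed
  moreover have "\<exists>b. \<forall>t>b. ?\<tau> t = 0" using supp by (intro exI[of _ b]) (simp add: blinfun.zero_right)
  moreover have "?\<tau> 0 = 0" using \<psi>0 by (simp add: blinfun.zero_right)
  ultimately show ?thesis using L by (simp add: L_0c_def L_c_def)
qed

end

section \<open>Characterisation of the maximal domain\<close>

context coercive_family begin

lemma G_product_derivative:
  assumes t: "good t" and g: "(g has_vector_derivative g') (at t)"
  shows "((\<lambda>r. G r (g r)) has_vector_derivative dG t (g t) + G t g') (at t)"
proof -
  note d = goodD[OF t]
  have "L-lipschitz_on {0..R} G"
    by (rule lipschitz_onI) (use G_lip L_pos in \<open>auto simp: dist_norm\<close>)
  then have "(G \<longlongrightarrow> G t) (at t within {0..R})"
    using lipschitz_on_continuous_on d(3) unfolding continuous_on_def by blast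
  then have Gt: "(G \<longlongrightarrow> G t) (at t)" unfolding at_within_Icc_at[OF d(1,2)] .
  have "((\<lambda>r. (1 / (r - t)) *\<^sub>R (G r (g t) - G t (g t)) + G r ((1 / (r - t)) *\<^sub>R (g r - g t)))
    \<longlongrightarrow> dG t (g t) + G t g') (at t)"
    by (intro tendsto_add blinfun.tendsto Gt g[unfolded has_vector_derivative_iff_quotient]
        d(4)[unfolded has_vector_derivative_iff_quotient])
  then show ?thesis
    unfolding has_vector_derivative_iff_quotient
    by (simp add: blinfun.scaleR_right blinfun.diff_right scaleR_diff_right)
qed

end

lemma measurable_halfline_extension:
  fixes h :: "real \<Rightarrow> 'b::{banach, second_countable_topology}"
  assumes h: "h \<in> borel_measurable (lebesgue_on {0..T})"
  shows "(\<lambda>t. indicat_real {0..T} t *\<^sub>R h t) \<in> borel_measurable (lebesgue_on {0..})"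
proof (rule measurable_restrict_space1)
  show "(\<lambda>t. indicat_real {0..T} t *\<^sub>R h t) \<in> borel_measurable lebesgue"
    using h by (subst (asm) borel_measurable_restrict_space_iff) auto
qed

context dirac_on begin

lemma AE_big_good: "AE t in lebesgue_on {0..R}. big.good t"
  by (rule AE_lebesgue_on_subset[OF big.AE_good]) auto

lemma G_A: "Gop t (A t u) = Bop t u" by (simp add: Bop_def)

lemma Ginv_B: "t \<in> {0..R} \<Longrightarrow> Ginv t (Bop t u) = A t u"
  by (simp add: Bop_def Ginv_G)

lemma A_measurable:
  assumes s: "s \<in> borel_measurable (lebesgue_on {0..R})" and sS: "AE t in lebesgue_on {0..R}. s t \<in> H_A"
  shows "(\<lambda>t. A t (s t)) \<in> borel_measurable (lebesgue_on {0..R})"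
proof (subst measurable_cong)
  show "A t (s t) = Ginv t (Bop t (s t))" if "t \<in> space (lebesgue_on {0..R})" for t
    using that by (simp add: Ginv_B)
  show "(\<lambda>t. Ginv t (Bop t (s t))) \<in> borel_measurable (lebesgue_on {0..R})"
    by (rule Ginv_apply_measurable[OF B_measurable[OF s sS]])
qed

lemma dG_apply_measurable:
  assumes "s \<in> borel_measurable (lebesgue_on {0..R})"
  shows "(\<lambda>t. dG t (s t)) \<in> borel_measurable (lebesgue_on {0..R})"
  by (rule big.dG_measurable[OF _ assms]) simp

lemma \<gamma>_apply_measurable:
  assumes T: "0 \<le> T" and s: "s \<in> borel_measurable (lebesgue_on {0..T})"
  shows "(\<lambda>t. \<gamma> t (s t)) \<in> borel_measurable (lebesgue_on {0..T})"
proof (rule measurable_Caratheodory[OF _ _ s])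
  obtain C where C: "C-lipschitz_on {0..T} \<gamma>" using \<gamma>_lipschitz[OF T] by blast
  show "(\<lambda>t. \<gamma> t u) \<in> borel_measurable (lebesgue_on {0..T})" for u
    by (intro continuous_on_imp_measurable_lebesgue_on blinfun.continuous_on lipschitz_on_continuous_on[OF C] continuous_intros)
qed (intro continuous_intros)

lemma \<gamma>_bound:
  obtains a where "0 \<le> a" "\<And>t u. t \<in> {0..R + 1} \<Longrightarrow> norm (\<gamma> t u) \<le> a * norm u"
proof -
  have R1: "0 \<le> R + 1" using R_pos by simp
  obtain C where C: "C-lipschitz_on {0..R + 1} \<gamma>" using \<gamma>_lipschitz[OF R1] by blast
  obtain a where a: "0 \<le> a" "\<And>t. t \<in> {0..R + 1} \<Longrightarrow> norm (\<gamma> t) \<le> a"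
    by (rule lipschitz_on_bounded_Icc[OF C R1]) blast
  show ?thesis
    by (rule that[OF a(1)]) (rule order_trans[OF norm_blinfun mult_right_mono[OF a(2) norm_ge_zero]])
qed

text \<open>With \<open>y = (\<partial> + A) \<sigma>\<close>, formed with the derivative \<open>f\<close>, the image of \<open>\<sigma>\<close> is \<open>w = \<gamma> y\<close>. The two sides
  of the adjoint relation differ by the weak equation of \<open>f\<close> tested with \<open>g = G \<gamma> \<tau>\<close>; the derivative
  of \<open>G\<close> that appears in the derivative of \<open>g\<close> is twice the term in \<open>\<partial>\<close>, once for each factor of the scalar product.\<close>
lemma regular_pair_imp_D_max:
  assumes \<sigma>: "\<sigma> \<in> L2_space ip" and supp: "AE t in lebesgue_on {0..}. R < t \<longrightarrow> \<sigma> t = 0"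
    and rp: "regular_pair R H_A A \<sigma> f"
  shows "\<sigma> \<in> D_max_dom ip H_A A \<gamma>"
proof -
  let ?M = "lebesgue_on {0..R}"
  have R0: "0 \<le> R" using R_pos by simp
  note \<sigma>m = L2_space_restrict[OF \<sigma> R0]
  have \<sigma>S: "AE t in ?M. \<sigma> t \<in> H_A" and Am: "(\<lambda>t. A t (\<sigma> t)) \<in> borel_measurable ?M"
    and fm: "f \<in> borel_measurable ?M" and fA: "integrable ?M (\<lambda>t. (norm (f t + A t (\<sigma> t)))\<^sup>2)"
    using rp by (auto simp: regular_pair_def)
  define y where "y t = f t + A t (\<sigma> t) + (1/2) *\<^sub>R Ginv t (dG t (\<sigma> t))" for t
  define w where "w t = indicat_real {0..R} t *\<^sub>R \<gamma> t (y t)" for t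
  have dm: "(\<lambda>t. (1/2) *\<^sub>R Ginv t (dG t (\<sigma> t))) \<in> borel_measurable ?M"
    by (intro borel_measurable_scaleR borel_measurable_const Ginv_apply_measurable dG_apply_measurable \<sigma>m)
  have ym: "y \<in> borel_measurable ?M"
    unfolding y_def by (intro borel_measurable_add fm Am dm)
  have y2: "integrable ?M (\<lambda>t. (norm (y t))\<^sup>2)"
  proof (rule L2_bound[OF ym fA \<sigma>m(2), of 1 "L / c"])
    show "AE t in ?M. norm (y t) \<le> 1 * norm (f t + A t (\<sigma> t)) + L / c * norm (\<sigma> t)"
      using AE_big_good AE_space
    proof eventually_elim
      case (elim t)
      then have t: "t \<in> {0..R}" by simp
      have "norm ((1/2) *\<^sub>R Ginv t (dG t (\<sigma> t))) \<le> norm (Ginv t (dG t (\<sigma> t)))" by simp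
      also have "\<dots> \<le> norm (dG t (\<sigma> t)) / c" by (rule Ginv_bound[OF t])
      also have "\<dots> \<le> L * norm (\<sigma> t) / c" using c_pos by (intro divide_right_mono big.dG_bound elim(1)) simp
      also have "\<dots> = L / c * norm (\<sigma> t)" by simp
      finally have h: "norm ((1/2) *\<^sub>R Ginv t (dG t (\<sigma> t))) \<le> L / c * norm (\<sigma> t)" .
      show ?case
        unfolding y_def mult_1_left by (rule order_trans[OF norm_triangle_ineq add_left_mono[OF h]])
    qed
  qed
  obtain a where a: "0 \<le> a" "\<And>t u. t \<in> {0..R + 1} \<Longrightarrow> norm (\<gamma> t u) \<le> a * norm u" by (rule \<gamma>_bound) blast
  have wm: "w \<in> borel_measurable (lebesgue_on {0..})"
    unfolding w_def by (rule measurable_halfline_extension[OF \<gamma>_apply_measurable[OF R0 ym]])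
  have w_eq: "w t = \<gamma> t (y t)" if "t \<in> {0..R}" for t using that by (simp add: w_def)
  have w0: "w t = 0" if "R < t" for t using that by (simp add: w_def)
  have wL2: "w \<in> L2_space ip"
  proof (rule L2_spaceI[OF wm R0])
    have "w \<in> borel_measurable ?M" by (rule measurable_restrict_mono[OF wm]) auto
    then show "integrable ?M (\<lambda>t. (norm (w t))\<^sup>2)"
    proof (rule L2_bound[OF _ y2 y2, of _ a 0])
      show "AE t in ?M. norm (w t) \<le> a * norm (y t) + 0 * norm (y t)"
        by (rule AE_I2) (use a(2) w_eq in auto)
    qed
    show "AE t in lebesgue_on {0..}. R < t \<longrightarrow> w t = 0" using w0 by simp
  qed
  have "L2_inner ip (dirac_op ip A \<gamma> \<tau>) \<sigma> = L2_inner ip \<tau> w" if \<tau>: "\<tau> \<in> L_0c ip H_A A" for \<tau>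
  proof -
    have \<tau>L: "\<tau> \<in> Lip_loc" and \<tau>S: "AE t in lebesgue_on {0..}. \<tau> t \<in> H_A" and \<tau>0: "\<tau> 0 = 0"
      using \<tau> by (auto simp: L_0c_def L_c_def Linf_loc_dom_def)
    define \<rho> where "\<rho> t = \<gamma> t (\<tau> t)" for t
    define g where "g t = Gop t (\<rho> t)" for t
    have R1: "0 \<le> R + 1" using R_pos by simp
    have "\<rho> \<in> Lip_loc" unfolding \<rho>_def[abs_def] by (rule \<gamma>_apply_Lip_loc[OF \<tau>L])
    then obtain K where K: "K-lipschitz_on {0..R + 1} \<rho>" using R1 unfolding Lip_loc_def by blast
    obtain Y where Y: "0 \<le> Y" "\<And>t. t \<in> {0..R + 1} \<Longrightarrow> norm (\<rho> t) \<le> Y"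
      by (rule lipschitz_on_bounded_Icc[OF K R1]) blast
    obtain \<rho>' where \<rho>': "AE t in lebesgue_on {0..R + 1}. (\<rho> has_vector_derivative \<rho>' t) (at t)"
      by (rule lipschitz_AE_differentiable[OF parallelogram K R1]) blast
    obtain Cg where "Cg-lipschitz_on {0..R + 1} g"
      using big.G_f_lipschitz[OF K Y(2)] unfolding g_def[abs_def] by blast
    then have gL: "Cg-lipschitz_on {0..R} g" by (rule lipschitz_on_subset) auto
    have g0: "g 0 = 0" by (simp add: g_def \<rho>_def \<tau>0 blinfun.zero_right)
    have \<rho>'R: "AE t in ?M. (\<rho> has_vector_derivative \<rho>' t) (at t)"
      by (rule AE_lebesgue_on_subset[OF \<rho>']) auto
    define g' where "g' t = dG t (\<rho> t) + Gop t (\<rho>' t)" for t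
    have "AE t in ?M. (g has_vector_derivative g' t) (at t)"
      using AE_big_good \<rho>'R unfolding g_def[abs_def] g'_def
      by eventually_elim (rule big.G_product_derivative)
    then have hi: "integrable ?M (\<lambda>t. cinner (g' t) (\<sigma> t) + cinner (g t) (f t))"
      and h0: "(LINT t|?M. cinner (g' t) (\<sigma> t) + cinner (g t) (f t)) = 0"
      using rp gL g0 unfolding regular_pair_def by blast+
    have gm: "g \<in> borel_measurable ?M"
      by (rule continuous_on_imp_measurable_lebesgue_on[OF lipschitz_on_continuous_on[OF gL]])
    have qm: "(\<lambda>t. cinner (g t) (y t)) \<in> borel_measurable ?M" by (rule measurable_cinner[OF gm ym])
    have qi: "integrable ?M (\<lambda>t. cinner (g t) (y t))"
    proof (rule Bochner_Integration.integrable_bound[OF _ qm])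
      show "integrable ?M (\<lambda>t. (L * Y) * norm (y t))"
        by (intro integrable_mult_right integrable_norm L2_imp_integrable[OF ym y2])
      show "AE t in ?M. norm (cinner (g t) (y t)) \<le> norm ((L * Y) * norm (y t))"
      proof (rule AE_I2)
        fix t assume "t \<in> space ?M"
        then have t: "t \<in> {0..R}" by simp
        have "norm (g t) \<le> L * norm (\<rho> t)" unfolding g_def by (rule G_bound[OF t])
        also have "\<dots> \<le> L * Y" using t L_pos by (intro mult_left_mono Y(2)) auto
        finally have "norm (g t) * norm (y t) \<le> (L * Y) * norm (y t)" by (rule mult_right_mono) simp
        with cinner_cauchy_schwarz have "norm (cinner (g t) (y t)) \<le> (L * Y) * norm (y t)" by (rule order_trans)
        then show "norm (cinner (g t) (y t)) \<le> norm ((L * Y) * norm (y t))"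
          by (rule order_trans) (simp only: real_norm_def abs_ge_self)
      qed
    qed
    have ip0: "ip t u 0 = 0" if "0 \<le> t" for t u using ip_Gop[OF that] by simp
    have right: "L2_inner ip \<tau> w = (LINT t|?M. - cinner (g t) (y t))"
      unfolding L2_inner_def
    proof (rule integral_halfline)
      show "(\<lambda>t. - cinner (g t) (y t)) \<in> borel_measurable ?M" using qm by (rule borel_measurable_uminus)
      show "AE t in ?M. ip t (\<tau> t) (w t) = - cinner (g t) (y t)"
      proof (rule AE_I2)
        fix t assume "t \<in> space ?M"
        then have t: "t \<in> {0..R}" "0 \<le> t" by auto
        show "ip t (\<tau> t) (w t) = - cinner (g t) (y t)"
          unfolding w_eq[OF t(1)] ip_Gop[OF t(2)] g_def \<rho>_def \<gamma>_G[OF t(2)] by simp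
      qed
      show "AE t in lebesgue_on {0..}. R < t \<longrightarrow> ip t (\<tau> t) (w t) = 0"
        by (rule AE_I2) (use w0 ip0 in auto)
    qed
    have left: "L2_inner ip (dirac_op ip A \<gamma> \<tau>) \<sigma>
      = (LINT t|?M. (cinner (g' t) (\<sigma> t) + cinner (g t) (f t)) + (- cinner (g t) (y t)))"
      unfolding L2_inner_def
    proof (rule integral_halfline)
      show "(\<lambda>t. (cinner (g' t) (\<sigma> t) + cinner (g t) (f t)) + (- cinner (g t) (y t))) \<in> borel_measurable ?M"
        by (intro borel_measurable_add[OF borel_measurable_integrable[OF hi]] borel_measurable_uminus qm)
      have D: "AE t in ?M. dirac_op ip A \<gamma> \<tau> t = partial_op ip \<rho> t - A t (\<rho> t)"
        unfolding \<rho>_def by (rule AE_lebesgue_on_subset[OF dirac_op_eq[OF \<tau>L \<tau>S]]) auto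
      have \<tau>SR: "AE t in ?M. \<tau> t \<in> H_A" by (rule AE_lebesgue_on_subset[OF \<tau>S]) auto
      show "AE t in ?M. ip t (dirac_op ip A \<gamma> \<tau> t) (\<sigma> t)
        = (cinner (g' t) (\<sigma> t) + cinner (g t) (f t)) + (- cinner (g t) (y t))"
        using D \<tau>SR \<sigma>S \<rho>'R AE_big_good AE_space
      proof eventually_elim
        case (elim t)
        then have t: "t \<in> {0..R}" and t0: "0 \<le> t" by auto
        have \<rho>S: "\<rho> t \<in> H_A" unfolding \<rho>_def using \<gamma>_anticommute[OF t0 elim(2)] by blast
        have at: "at t within {0..} = at t" using big.goodD(1)[OF elim(5)] by (intro at_within_interior) simp
        have p: "partial_op ip \<rho> t = \<rho>' t + Gamma_op ip t (\<rho> t)"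
          unfolding partial_op_def at by (simp add: vector_derivative_at[OF elim(4)])
        have l: "ip t (dirac_op ip A \<gamma> \<tau> t) (\<sigma> t)
          = cinner (Gop t (\<rho>' t)) (\<sigma> t) + (1/2) *\<^sub>R cinner (dG t (\<rho> t)) (\<sigma> t) - cinner (Bop t (\<rho> t)) (\<sigma> t)"
          unfolding elim(1) p
          using ip_Gamma[OF elim(5), of "\<rho> t" "\<sigma> t"]
          by (simp add: ip_Gop[OF t0] blinfun.diff_right blinfun.add_right cinner_diff_left cinner_add_left G_A)
        have b: "cinner (Bop t (\<rho> t)) (\<sigma> t) = cinner (g t) (A t (\<sigma> t))"
          unfolding B_sym[OF t \<rho>S elim(3)] g_def G_sym[OF t] by (simp add: Bop_def)
        have d: "cinner (g t) (Ginv t (dG t (\<sigma> t))) = cinner (dG t (\<rho> t)) (\<sigma> t)"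
          unfolding g_def G_sym[OF t] G_Ginv[OF t] big.dG_sym[OF elim(5)] ..
        show ?case
          unfolding l b y_def g'_def
          by (simp add: cinner_add_right cinner_add_left cinner.scaleR_right d scaleR_conv_of_real)
      qed
      show "AE t in lebesgue_on {0..}. R < t \<longrightarrow> ip t (dirac_op ip A \<gamma> \<tau> t) (\<sigma> t) = 0"
        using supp AE_space by eventually_elim (auto simp: ip0)
    qed
    show ?thesis
      unfolding left right
      by (subst Bochner_Integration.integral_add[OF hi]) (use qi h0 in simp_all)
  qed
  then have "(\<sigma>, w) \<in> adjoint_graph (L2_space ip) (L2_inner ip) (L_0c ip H_A A) (dirac_op ip A \<gamma>)"
    using \<sigma> wL2 by (simp add: adjoint_graph_def)
  then show ?thesis unfolding D_max_dom_def by (rule DomainI)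
qed

end

context dirac_on begin

text \<open>Test functions on \<open>[0,R]\<close> need not vanish at \<open>R\<close>, but sections in the domain of the Dirac
  operator live on the half line. Therefore the test function is continued by a constant and cut
  off on \<open>[R, R + 1/n]\<close>; since \<open>\<sigma>\<close> vanishes there, only the term with \<open>w\<close> sees the cutoff, and it
  tends to \<open>0\<close>.\<close>
lemma adjoint_imp_weak:
  assumes \<sigma>: "\<sigma> \<in> L2_space ip" and w: "w \<in> L2_space ip"
    and supp: "AE t in lebesgue_on {0..}. R < t \<longrightarrow> \<sigma> t = 0"
    and adj: "\<And>\<tau>. \<tau> \<in> L_0c ip H_A A \<Longrightarrow> L2_inner ip (dirac_op ip A \<gamma> \<tau>) \<sigma> = L2_inner ip \<tau> w"
    and \<phi>: "K-lipschitz_on {0..R} \<phi>" and \<phi>0: "\<phi> 0 = 0"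
    and der: "AE t in lebesgue_on {0..R}. (\<phi> has_real_derivative \<phi>' t) (at t)" and u: "u \<in> H_A"
  shows "(LINT t|lebesgue_on {0..R}. \<phi>' t *\<^sub>R cinner u (Gop t (\<sigma> t))
    + \<phi> t *\<^sub>R (cinner u ((1/2) *\<^sub>R dG t (\<sigma> t) - Gop t (\<gamma> t (w t))) - cinner (Bop t u) (\<sigma> t))) = 0"
    (is "(LINT t|_. ?h t) = 0")
proof (cases "integrable (lebesgue_on {0..R}) ?h")
  case hi: True
  let ?M = "lebesgue_on {0..R}" and ?N = "lebesgue_on {0..R + 1}"
  have R0: "0 \<le> R" and R1: "0 \<le> R + 1" using R_pos by auto
  note \<sigma>m = L2_space_restrict[OF \<sigma> R0] and wN = L2_space_restrict[OF w R1]
  have K0: "0 \<le> K" by (rule lipschitz_on_nonneg[OF \<phi>])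
  define \<Phi> where "\<Phi> t = \<phi> (max 0 (min R t))" for t
  have \<Phi>L: "K-lipschitz_on UNIV \<Phi>"
  proof (rule lipschitz_onI[OF _ K0])
    fix s t :: real
    have "dist (\<Phi> s) (\<Phi> t) \<le> K * dist (max 0 (min R s)) (max 0 (min R t))"
      unfolding \<Phi>_def by (rule lipschitz_onD[OF \<phi>]) (use R0 in auto)
    also have "\<dots> \<le> K * dist s t" by (intro mult_left_mono K0) (auto simp: dist_real_def)
    finally show "dist (\<Phi> s) (\<Phi> t) \<le> K * dist s t" .
  qed
  have \<Phi>b: "\<bar>\<Phi> t\<bar> \<le> K * R" for t
  proof -
    have "\<bar>\<Phi> t\<bar> \<le> K * \<bar>max 0 (min R t)\<bar>"
      using lipschitz_onD[OF \<phi>, of "max 0 (min R t)" 0] R0 by (simp add: \<Phi>_def \<phi>0 dist_real_def)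
    also have "\<dots> \<le> K * R" using R0 by (intro mult_left_mono K0) auto
    finally show ?thesis .
  qed
  have KR: "0 \<le> K * R" using K0 R0 by simp
  have \<Phi>_eq: "\<Phi> t = \<phi> t" if "t \<in> {0..R}" for t using that by (simp add: \<Phi>_def)
  define \<eta> where "\<eta> n t = max 0 (min 1 (1 - real (Suc n) * (t - R)))" for n t
  have \<eta>b: "0 \<le> \<eta> n t" "\<eta> n t \<le> 1" for n t by (auto simp: \<eta>_def)
  have \<eta>1: "\<eta> n t = 1" if "t \<le> R" for n t
  proof -
    have "real (Suc n) * (t - R) \<le> 0" using that by (intro mult_nonneg_nonpos) auto
    then show ?thesis by (simp add: \<eta>_def)
  qed
  have \<eta>0: "\<eta> n t = 0" if "1 \<le> real (Suc n) * (t - R)" for n t using that by (simp add: \<eta>_def)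
  have \<eta>L: "\<bar>\<eta> n r - \<eta> n s\<bar> \<le> real (Suc n) * \<bar>r - s\<bar>" for n r s
  proof -
    have "\<bar>\<eta> n r - \<eta> n s\<bar> \<le> \<bar>real (Suc n) * (r - R) - real (Suc n) * (s - R)\<bar>"
      unfolding \<eta>_def by linarith
    also have "\<dots> = \<bar>real (Suc n) * (r - s)\<bar>" by (simp add: algebra_simps)
    finally show ?thesis by (simp add: abs_mult)
  qed
  define \<psi> where "\<psi> n t = \<eta> n t * \<Phi> t" for n t
  have \<psi>L: "(real (Suc n) * (K * R) + 1 * K)-lipschitz_on UNIV (\<psi> n)" for n
    unfolding \<psi>_def[abs_def]
  proof (rule lipschitz_on_family_apply[where F = "\<lambda>t f. \<eta> n t * f", OF _ _ _ \<Phi>L])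
    show "norm (\<eta> n t * f) \<le> 1 * norm f" for t f
      using \<eta>b[of n t] by (simp add: abs_mult mult_left_le_one_le)
    show "norm (\<eta> n r * f - \<eta> n s * f) \<le> real (Suc n) * \<bar>r - s\<bar> * norm f" for r s f
      unfolding left_diff_distrib[symmetric] real_norm_def abs_mult by (rule mult_right_mono[OF \<eta>L]) simp
  qed (use \<Phi>b KR in \<open>simp_all add: right_diff_distrib\<close>)
  have \<psi>0: "\<psi> n 0 = 0" for n using \<Phi>_eq[of 0] R0 by (simp add: \<psi>_def \<phi>0)
  have \<psi>z: "\<psi> n t = 0" if "R + 1 < t" for n t
  proof -
    have "1 * 1 \<le> real (Suc n) * (t - R)" using that by (intro mult_mono) auto
    then show ?thesis by (simp add: \<psi>_def \<eta>0)
  qed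
  have \<psi>_eq: "\<psi> n t = \<phi> t" if "t \<in> {0..R}" for n t using that by (simp add: \<psi>_def \<Phi>_eq \<eta>1)
  have \<psi>b: "\<bar>\<psi> n t\<bar> \<le> K * R" for n t
    using mult_mono[OF \<eta>b(2)[of n t] \<Phi>b[of t]] \<eta>b[of n t] by (simp add: \<psi>_def abs_mult)
  define q where "q t = cinner u (Gop t (\<gamma> t (w t)))" for t
  have qm: "q \<in> borel_measurable ?N"
    unfolding q_def
    by (intro measurable_cinner borel_measurable_const big.G_apply_measurable \<gamma>_apply_measurable R1 wN order_refl)
  obtain a where a: "0 \<le> a" "\<And>t u. t \<in> {0..R + 1} \<Longrightarrow> norm (\<gamma> t u) \<le> a * norm u" by (rule \<gamma>_bound) blast
  have qi: "integrable ?N q"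
  proof (rule Bochner_Integration.integrable_bound[OF _ qm])
    show "integrable ?N (\<lambda>t. (norm u * (L * a)) * norm (w t))"
      by (intro integrable_mult_right integrable_norm L2_imp_integrable[OF wN])
    show "AE t in ?N. norm (q t) \<le> norm ((norm u * (L * a)) * norm (w t))"
    proof (rule AE_I2)
      fix t assume "t \<in> space ?N"
      then have t: "t \<in> {0..R + 1}" by simp
      have "norm (Gop t (\<gamma> t (w t))) \<le> L * (a * norm (w t))"
        using order_trans[OF big.G_bound[OF t] mult_left_mono[OF a(2)[OF t]]] L_pos by simp
      then have "norm u * norm (Gop t (\<gamma> t (w t))) \<le> norm u * (L * (a * norm (w t)))"
        by (rule mult_left_mono) simp
      with cinner_cauchy_schwarz have "norm (q t) \<le> norm u * (L * (a * norm (w t)))"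
        unfolding q_def by (rule order_trans)
      also have "\<dots> = (norm u * (L * a)) * norm (w t)" by (simp add: mult_ac)
      also have "\<dots> \<le> norm ((norm u * (L * a)) * norm (w t))" by (simp only: real_norm_def abs_ge_self)
      finally show "norm (q t) \<le> norm ((norm u * (L * a)) * norm (w t))" .
    qed
  qed
  have qM: "q \<in> borel_measurable ?M" by (rule measurable_restrict_mono[OF qm]) auto
  have qiM: "integrable ?M q" by (rule integrable_lebesgue_on_subset[OF qi]) auto
  have \<phi>m: "\<phi> \<in> borel_measurable ?M"
    by (intro continuous_on_imp_measurable_lebesgue_on lipschitz_on_continuous_on[OF \<phi>])
  have \<phi>q: "integrable ?M (\<lambda>t. \<phi> t *\<^sub>R q t)"
  proof (rule Bochner_Integration.integrable_bound)
    show "integrable ?M (\<lambda>t. (K * R) * norm (q t))" by (intro integrable_mult_right integrable_norm qiM)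
    show "(\<lambda>t. \<phi> t *\<^sub>R q t) \<in> borel_measurable ?M" by (intro borel_measurable_scaleR \<phi>m qM)
    show "AE t in ?M. norm (\<phi> t *\<^sub>R q t) \<le> norm ((K * R) * norm (q t))"
    proof (rule AE_I2)
      fix t assume "t \<in> space ?M"
      then have "\<bar>\<phi> t\<bar> \<le> K * R" using \<Phi>b[of t] \<Phi>_eq[of t] by simp
      then show "norm (\<phi> t *\<^sub>R q t) \<le> norm ((K * R) * norm (q t))" using KR by (simp add: mult_right_mono)
    qed
  qed
  \<comment> \<open>On the left the cutoff has disappeared because \<open>\<sigma>\<close> vanishes beyond \<open>R\<close>.\<close>
  have key: "(LINT t|?M. ?h t + \<phi> t *\<^sub>R q t) = (LINT t|?N. \<psi> n t *\<^sub>R q t)" for n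
  proof -
    define \<tau> where "\<tau> t = \<gamma> t (- (\<psi> n t *\<^sub>R u))" for t
    have \<tau>: "\<tau> \<in> L_0c ip H_A A"
      unfolding \<tau>_def[abs_def] by (rule test_function_in_L_0c[OF \<psi>L \<psi>0 \<psi>z u])
    then have \<tau>L: "\<tau> \<in> Lip_loc" and \<tau>S: "AE t in lebesgue_on {0..}. \<tau> t \<in> H_A"
      by (auto simp: L_0c_def L_c_def Linf_loc_dom_def)
    have \<gamma>\<tau>: "\<gamma> t (\<tau> t) = \<psi> n t *\<^sub>R u" if "0 \<le> t" for t using that by (simp add: \<tau>_def \<gamma>_square)
    have "L2_inner ip (dirac_op ip A \<gamma> \<tau>) \<sigma> = (LINT t|?M. ?h t + \<phi> t *\<^sub>R q t)"
      unfolding L2_inner_def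
    proof (rule integral_halfline)
      show "(\<lambda>t. ?h t + \<phi> t *\<^sub>R q t) \<in> borel_measurable ?M"
        by (rule borel_measurable_integrable[OF Bochner_Integration.integrable_add[OF hi \<phi>q]])
      have D: "AE t in ?M. dirac_op ip A \<gamma> \<tau> t = partial_op ip (\<lambda>r. \<gamma> r (\<tau> r)) t - A t (\<gamma> t (\<tau> t))"
        by (rule AE_lebesgue_on_subset[OF dirac_op_eq[OF \<tau>L \<tau>S]]) auto
      show "AE t in ?M. ip t (dirac_op ip A \<gamma> \<tau> t) (\<sigma> t) = ?h t + \<phi> t *\<^sub>R q t"
        using D der AE_good AE_big_good
      proof eventually_elim
        case (elim t)
        note g = goodD(1-3)[OF elim(3)]
        have t0: "0 \<le> t" using g(1) by simp
        have at: "at t within {0..} = at t" using g(1) by (intro at_within_interior) simp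
        have "((\<lambda>r. \<phi> r *\<^sub>R u) has_vector_derivative \<phi>' t *\<^sub>R u) (at t)"
          by (rule has_vector_derivative_scaleR[OF elim(2), of "\<lambda>_. u" 0, simplified])
        then have "((\<lambda>r. \<gamma> r (\<tau> r)) has_vector_derivative \<phi>' t *\<^sub>R u) (at t)"
          by (rule has_vector_derivative_transform_within_open[of _ _ _ "{0<..<R}"])
             (use g in \<open>auto simp: \<gamma>\<tau> \<psi>_eq\<close>)
        then have p: "partial_op ip (\<lambda>r. \<gamma> r (\<tau> r)) t = \<phi>' t *\<^sub>R u + Gamma_op ip t (\<phi> t *\<^sub>R u)"
          unfolding partial_op_def at by (simp add: vector_derivative_at \<gamma>\<tau>[OF t0] \<psi>_eq[OF g(3)])
        have \<Gamma>: "cinner (Gop t (Gamma_op ip t (\<phi> t *\<^sub>R u))) (\<sigma> t) = (1/2) *\<^sub>R (\<phi> t *\<^sub>R cinner u (dG t (\<sigma> t)))"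
          using ip_Gamma[OF elim(4), of "\<phi> t *\<^sub>R u" "\<sigma> t"]
          by (simp add: ip_Gop[OF t0] big.dG_sym[OF elim(4)] cinner.scaleR_left)
        have B: "A t (\<phi> t *\<^sub>R u) = \<phi> t *\<^sub>R A t u"
          by (rule clinear_on_scaleR[OF A_linear[OF t0] H_A_csubspace u])
        show ?case
          unfolding elim(1) p \<gamma>\<tau>[OF t0] \<psi>_eq[OF g(3)] B
          by (simp add: ip_Gop[OF t0] blinfun.diff_right blinfun.add_right blinfun.scaleR_right cinner_diff_left
              cinner_add_left cinner.scaleR_left cinner_diff_right cinner.scaleR_right \<Gamma> G_A G_sym[OF g(3), symmetric]
              q_def scaleR_conv_of_real algebra_simps)
      qed
      show "AE t in lebesgue_on {0..}. R < t \<longrightarrow> ip t (dirac_op ip A \<gamma> \<tau> t) (\<sigma> t) = 0"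
        using supp AE_space by eventually_elim (auto simp: ip_Gop)
    qed
    moreover have "L2_inner ip \<tau> w = (LINT t|?N. \<psi> n t *\<^sub>R q t)"
      unfolding L2_inner_def
    proof (rule integral_halfline)
      have "\<psi> n \<in> borel_measurable ?N"
        by (rule continuous_on_imp_measurable_lebesgue_on, rule continuous_on_subset[OF lipschitz_on_continuous_on[OF \<psi>L]]) simp
      then show "(\<lambda>t. \<psi> n t *\<^sub>R q t) \<in> borel_measurable ?N" by (intro borel_measurable_scaleR qm)
      show "AE t in ?N. ip t (\<tau> t) (w t) = \<psi> n t *\<^sub>R q t"
      proof (rule AE_I2)
        fix t assume "t \<in> space ?N"
        then have t: "t \<in> {0..R + 1}" "0 \<le> t" by auto
        show "ip t (\<tau> t) (w t) = \<psi> n t *\<^sub>R q t"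
          unfolding ip_Gop[OF t(2)] \<tau>_def \<gamma>_G[OF t(2)] q_def
          by (simp add: blinfun.minus_right blinfun.scaleR_right cinner_minus_left cinner.scaleR_left big.G_sym[OF t(1)])
      qed
      show "AE t in lebesgue_on {0..}. R + 1 < t \<longrightarrow> ip t (\<tau> t) (w t) = 0"
        by (rule AE_I2) (simp add: \<tau>_def \<psi>z ip_Gop blinfun.zero_right)
    qed
    ultimately show ?thesis using adj[OF \<tau>] by simp
  qed
  have "(\<lambda>n. LINT t|?N. \<psi> n t *\<^sub>R q t) \<longlonglongrightarrow> (LINT t|?N. (indicat_real {0..R} t * \<phi> t) *\<^sub>R q t)"
  proof (rule integral_dominated_convergence)
    have "(\<lambda>t. indicat_real {0..R} t *\<^sub>R \<phi> t) \<in> borel_measurable (lebesgue_on {0..})"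
      by (rule measurable_halfline_extension[OF \<phi>m])
    then have "(\<lambda>t. indicat_real {0..R} t *\<^sub>R \<phi> t) \<in> borel_measurable ?N"
      by (rule measurable_restrict_mono) auto
    then show "(\<lambda>t. (indicat_real {0..R} t * \<phi> t) *\<^sub>R q t) \<in> borel_measurable ?N"
      by (intro borel_measurable_scaleR qm) simp
    show "integrable ?N (\<lambda>t. (K * R) * norm (q t))" by (intro integrable_mult_right integrable_norm qi)
    show "(\<lambda>t. \<psi> n t *\<^sub>R q t) \<in> borel_measurable ?N" for n
      by (intro borel_measurable_scaleR qm continuous_on_imp_measurable_lebesgue_on
          continuous_on_subset[OF lipschitz_on_continuous_on[OF \<psi>L]]) simp
    show "AE t in ?N. norm (\<psi> n t *\<^sub>R q t) \<le> K * R * norm (q t)" for n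
      by (rule AE_I2) (use \<psi>b in \<open>auto intro!: mult_right_mono\<close>)
    show "AE t in ?N. (\<lambda>n. \<psi> n t *\<^sub>R q t) \<longlonglongrightarrow> (indicat_real {0..R} t * \<phi> t) *\<^sub>R q t"
    proof (rule AE_I2)
      fix t assume "t \<in> space ?N"
      then have t: "0 \<le> t" by simp
      show "(\<lambda>n. \<psi> n t *\<^sub>R q t) \<longlonglongrightarrow> (indicat_real {0..R} t * \<phi> t) *\<^sub>R q t"
      proof (cases "t \<le> R")
        case True
        then show ?thesis using t by (simp add: \<psi>_eq)
      next
        case False
        have "\<forall>\<^sub>F n in sequentially. \<psi> n t *\<^sub>R q t = 0"
        proof -
          obtain m :: nat where m: "1 / (t - R) \<le> real m" using real_arch_simple by blast
          have "\<psi> n t = 0" if "m \<le> n" for n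
          proof -
            have "1 / (t - R) \<le> real (Suc n)" using m that by linarith
            then have "1 \<le> real (Suc n) * (t - R)" using False by (simp add: pos_divide_le_eq)
            then show ?thesis by (simp add: \<psi>_def \<eta>0)
          qed
          then show ?thesis unfolding eventually_sequentially by (intro exI[of _ m]) simp
        qed
        then show ?thesis using False by (simp add: tendsto_eventually)
      qed
    qed
  qed
  then have "(\<lambda>n::nat. LINT t|?M. ?h t + \<phi> t *\<^sub>R q t) \<longlonglongrightarrow> (LINT t|?N. (indicat_real {0..R} t * \<phi> t) *\<^sub>R q t)"
    unfolding key[symmetric] .
  then have "(LINT t|?M. ?h t + \<phi> t *\<^sub>R q t) = (LINT t|?N. (indicat_real {0..R} t * \<phi> t) *\<^sub>R q t)"
    by (simp only: LIMSEQ_const_iff)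
  also have "\<dots> = (LINT t|lebesgue. indicat_real {0..R + 1} t *\<^sub>R ((indicat_real {0..R} t * \<phi> t) *\<^sub>R q t))"
    by (rule integral_restrict_space) simp
  also have "\<dots> = (LINT t|lebesgue. indicat_real {0..R} t *\<^sub>R (\<phi> t *\<^sub>R q t))"
    by (rule Bochner_Integration.integral_cong) (auto split: split_indicator)
  also have "\<dots> = (LINT t|?M. \<phi> t *\<^sub>R q t)" by (rule integral_restrict_space[symmetric]) simp
  finally show ?thesis by (subst (asm) Bochner_Integration.integral_add[OF hi \<phi>q]) simp
\<comment> \<open>A function that is not integrable has integral \<open>0\<close>.\<close>
qed (rule not_integrable_integral_eq)

text \<open>The adjoint relation is an equation for \<open>G \<sigma>\<close>. Testing it with \<open>G\<^sup>-\<^sup>1 g\<close> turns it into one for \<open>\<sigma>\<close>.\<close>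
lemma D_max_imp_regular_pair:
  assumes \<sigma>: "\<sigma> \<in> L2_space ip" and supp: "AE t in lebesgue_on {0..}. R < t \<longrightarrow> \<sigma> t = 0"
    and dom: "\<sigma> \<in> D_max_dom ip H_A A \<gamma>"
  shows "\<exists>f. regular_pair R H_A A \<sigma> f"
proof -
  let ?M = "lebesgue_on {0..R}"
  have R0: "0 \<le> R" using R_pos by simp
  obtain w where w: "w \<in> L2_space ip"
    and adj: "\<And>\<tau>. \<tau> \<in> L_0c ip H_A A \<Longrightarrow> L2_inner ip (dirac_op ip A \<gamma> \<tau>) \<sigma> = L2_inner ip \<tau> w"
    using dom unfolding D_max_dom_def adjoint_graph_def by auto
  note \<sigma>m = L2_space_restrict[OF \<sigma> R0] and wm = L2_space_restrict[OF w R0]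
  define k where "k t = (1/2) *\<^sub>R dG t (\<sigma> t) - Gop t (\<gamma> t (w t))" for t
  have dm: "(\<lambda>t. dG t (\<sigma> t)) \<in> borel_measurable ?M" by (rule dG_apply_measurable[OF \<sigma>m(1)])
  have km: "k \<in> borel_measurable ?M"
    unfolding k_def
    by (intro borel_measurable_diff borel_measurable_scaleR borel_measurable_const dm G_apply_measurable
        \<gamma>_apply_measurable wm R0 order_refl)
  obtain a where a: "0 \<le> a" "\<And>t u. t \<in> {0..R + 1} \<Longrightarrow> norm (\<gamma> t u) \<le> a * norm u" by (rule \<gamma>_bound) blast
  have k2: "integrable ?M (\<lambda>t. (norm (k t))\<^sup>2)"
  proof (rule L2_bound[OF km \<sigma>m(2) wm(2)])
    show "AE t in ?M. norm (k t) \<le> L * norm (\<sigma> t) + (L * a) * norm (w t)"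
      using AE_big_good AE_space
    proof eventually_elim
      case (elim t)
      then have t: "t \<in> {0..R}" by simp
      have "norm (k t) \<le> norm ((1/2) *\<^sub>R dG t (\<sigma> t)) + norm (Gop t (\<gamma> t (w t)))"
        unfolding k_def by (rule norm_triangle_ineq4)
      also have "\<dots> \<le> L * norm (\<sigma> t) + L * (a * norm (w t))"
      proof (intro add_mono)
        have "norm ((1/2) *\<^sub>R dG t (\<sigma> t)) \<le> norm (dG t (\<sigma> t))" by simp
        also have "\<dots> \<le> L * norm (\<sigma> t)" by (rule big.dG_bound[OF elim(1)])
        finally show "norm ((1/2) *\<^sub>R dG t (\<sigma> t)) \<le> L * norm (\<sigma> t)" .
        have "norm (\<gamma> t (w t)) \<le> a * norm (w t)" using t by (intro a(2)) simp
        then show "norm (Gop t (\<gamma> t (w t))) \<le> L * (a * norm (w t))"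
          using order_trans[OF G_bound[OF t] mult_left_mono] L_pos by simp
      qed
      finally show ?case by (simp add: mult_ac)
    qed
  qed
  interpret ws: weak_solution R L c Gop H_A Bop \<sigma> k
  proof
    show "\<sigma> \<in> borel_measurable ?M" "integrable ?M (\<lambda>t. (norm (\<sigma> t))\<^sup>2)" by (fact \<sigma>m)+
    show "k \<in> borel_measurable ?M" "integrable ?M (\<lambda>t. (norm (k t))\<^sup>2)" by (fact km k2)+
    show "(LINT t|?M. \<phi>' t *\<^sub>R cinner u (Gop t (\<sigma> t)) + \<phi> t *\<^sub>R (cinner u (k t) - cinner (Bop t u) (\<sigma> t))) = 0"
      if "K-lipschitz_on {0..R} \<phi>" "\<phi> 0 = 0"
        "AE t in ?M. (\<phi> has_real_derivative \<phi>' t) (at t)" "u \<in> H_A" for K \<phi> \<phi>' u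
      unfolding k_def by (rule adjoint_imp_weak[OF \<sigma> w supp adj that])
  qed
  define f where "f t = Ginv t (ws.f t - dG t (\<sigma> t))" for t
  have fm: "f \<in> borel_measurable ?M"
    unfolding f_def by (intro Ginv_apply_measurable borel_measurable_diff ws.f_meas dm)
  have Am: "(\<lambda>t. A t (\<sigma> t)) \<in> borel_measurable ?M" by (rule A_measurable[OF \<sigma>m(1) ws.\<sigma>_in_S])
  have "regular_pair R H_A A \<sigma> f"
    unfolding regular_pair_def
  proof (intro conjI allI impI)
    show "AE t in ?M. \<sigma> t \<in> H_A" by (rule ws.\<sigma>_in_S)
    show "(\<lambda>t. A t (\<sigma> t)) \<in> borel_measurable ?M" "f \<in> borel_measurable ?M" by (fact Am fm)+
    show "integrable ?M (\<lambda>t. (t * norm (A t (\<sigma> t)))\<^sup>2)"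
    proof -
      have m: "(\<lambda>t. t * norm (A t (\<sigma> t))) \<in> borel_measurable ?M"
        by (intro borel_measurable_times measurable_compose[OF Am borel_measurable_norm]
            borel_imp_lebesgue_on_measurable) simp
      have i: "integrable ?M (\<lambda>t. (norm (t * norm (Bop t (\<sigma> t))))\<^sup>2)" using ws.tB\<sigma>_L2 by simp
      have "integrable ?M (\<lambda>t. (norm (t * norm (A t (\<sigma> t))))\<^sup>2)"
      proof (rule L2_bound[OF m i i, of "1 / c" 0])
        show "AE t in ?M. norm (t * norm (A t (\<sigma> t)))
          \<le> 1 / c * norm (t * norm (Bop t (\<sigma> t))) + 0 * norm (t * norm (Bop t (\<sigma> t)))"
        proof (rule AE_I2)
          fix t assume "t \<in> space ?M"
          then have t: "t \<in> {0..R}" "0 \<le> t" by auto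
          have "t * norm (A t (\<sigma> t)) \<le> t * (norm (Bop t (\<sigma> t)) / c)"
            using Ginv_bound[OF t(1), of "Bop t (\<sigma> t)"] t(2) unfolding Ginv_B[OF t(1)] by (rule mult_left_mono)
          then show "norm (t * norm (A t (\<sigma> t)))
            \<le> 1 / c * norm (t * norm (Bop t (\<sigma> t))) + 0 * norm (t * norm (Bop t (\<sigma> t)))"
            using t(2) by simp
        qed
      qed
      then show ?thesis by simp
    qed
    show "integrable ?M (\<lambda>t. (norm (f t + A t (\<sigma> t)))\<^sup>2)"
    proof (rule L2_bound[OF borel_measurable_add[OF fm Am] k2 \<sigma>m(2)])
      show "AE t in ?M. norm (f t + A t (\<sigma> t)) \<le> 1 / c * norm (k t) + L / c * norm (\<sigma> t)"
        using AE_big_good AE_space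
      proof eventually_elim
        case (elim t)
        then have t: "t \<in> {0..R}" by simp
        have "f t + A t (\<sigma> t) = Ginv t (k t - dG t (\<sigma> t))"
          unfolding f_def ws.f_def by (simp add: blinfun.diff_right Ginv_B[OF t])
        also have "norm \<dots> \<le> norm (k t - dG t (\<sigma> t)) / c" by (rule Ginv_bound[OF t])
        also have "\<dots> \<le> (norm (k t) + L * norm (\<sigma> t)) / c"
          using order_trans[OF norm_triangle_ineq4 add_left_mono[OF big.dG_bound[OF elim(1)]]] c_pos
          by (intro divide_right_mono) auto
        finally show ?case by (simp add: add_divide_distrib)
      qed
    qed
    fix C and g g' :: "real \<Rightarrow> 'h"
    assume gL: "C-lipschitz_on {0..R} g" and g0: "g 0 = 0"
      and gd: "AE t in ?M. (g has_vector_derivative g' t) (at t)"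
    obtain Y where Y: "0 \<le> Y" "\<And>t. t \<in> {0..R} \<Longrightarrow> norm (g t) \<le> Y"
      by (rule lipschitz_on_bounded_Icc[OF gL R0]) blast
    define p where "p t = Ginv t (g t)" for t
    obtain C' where pL: "C'-lipschitz_on {0..R} p"
      using Ginv_f_lipschitz[OF gL Y(2)] unfolding p_def[abs_def] by blast
    obtain p' where pd: "AE t in ?M. (p has_vector_derivative p' t) (at t)"
      by (rule lipschitz_AE_differentiable[OF parallelogram pL R0]) blast
    have p0: "p 0 = 0" by (simp add: p_def g0 blinfun.zero_right)
    note W = ws.weak_lipschitz[OF pL p0 pd]
    have ae: "AE t in ?M. cinner (p' t) (ws.z t) + cinner (p t) (ws.f t) = cinner (g' t) (\<sigma> t) + cinner (g t) (f t)"
      using gd pd AE_good AE_big_good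
    proof eventually_elim
      case (elim t)
      note d = goodD(1-3)[OF elim(3)]
      have "((\<lambda>r. Gop r (p r)) has_vector_derivative dG t (p t) + Gop t (p' t)) (at t)"
        by (rule G_product_derivative[OF elim(3,2)])
      then have "(g has_vector_derivative dG t (p t) + Gop t (p' t)) (at t)"
        by (rule has_vector_derivative_transform_within_open[of _ _ _ "{0<..<R}"])
           (use d in \<open>auto simp: p_def G_Ginv\<close>)
      then have g': "g' t = dG t (p t) + Gop t (p' t)"
        by (rule vector_derivative_unique_at[OF elim(1)])
      have "cinner (g t) (f t) = cinner (p t) (ws.f t - dG t (\<sigma> t))"
        unfolding f_def p_def Ginv_sym[OF d(3)] ..
      then show ?case
        unfolding g' ws.z_def
        by (simp add: cinner_add_left cinner_diff_right big.dG_sym[OF elim(4)] G_sym[OF d(3)])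
    qed
    have m: "(\<lambda>t. cinner (g' t) (\<sigma> t) + cinner (g t) (f t)) \<in> borel_measurable ?M"
      by (rule measurable_lebesgue_on_AE[OF _ borel_measurable_integrable[OF W(1)] ae]) simp
    show "integrable ?M (\<lambda>t. cinner (g' t) (\<sigma> t) + cinner (g t) (f t))"
      by (rule integrable_cong_AE_imp[OF W(1) m]) (use ae in eventually_elim, simp)
    show "(LINT t|?M. cinner (g' t) (\<sigma> t) + cinner (g t) (f t)) = 0"
      using integral_cong_AE_lebesgue_on[OF _ borel_measurable_integrable[OF W(1)] ae] W(2) by simp
  qed
  then show ?thesis by blast
qed

end

section \<open>Comparison with the constant coefficient system\<close>

text \<open>The factor \<open>t\<close> in the difference of the two families turns the weighted bound on \<open>A \<sigma>\<close> into
  a square integrable error.\<close>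
lemma regular_pair_perturb:
  fixes \<sigma> f :: "real \<Rightarrow> 'h::{complex_hilbert_space, second_countable_topology}"
  assumes rp: "regular_pair R S A \<sigma> f" and R: "0 \<le> R" and C: "0 \<le> C"
    and \<sigma>m: "\<sigma> \<in> borel_measurable (lebesgue_on {0..R})" and \<sigma>2: "integrable (lebesgue_on {0..R}) (\<lambda>t. (norm (\<sigma> t))\<^sup>2)"
    and A'm: "(\<lambda>t. A' t (\<sigma> t)) \<in> borel_measurable (lebesgue_on {0..R})"
    and le: "\<And>t u. t \<in> {0..R} \<Longrightarrow> u \<in> S \<Longrightarrow> norm (A' t u - A t u) \<le> C * t * (norm u + norm (A t u))"
  shows "regular_pair R S A' \<sigma> f"
proof -
  let ?M = "lebesgue_on {0..R}"
  have \<sigma>S: "AE t in ?M. \<sigma> t \<in> S" and Am: "(\<lambda>t. A t (\<sigma> t)) \<in> borel_measurable ?M"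
    and fm: "f \<in> borel_measurable ?M" and fA: "integrable ?M (\<lambda>t. (norm (f t + A t (\<sigma> t)))\<^sup>2)"
    and tA: "integrable ?M (\<lambda>t. (norm (t *\<^sub>R A t (\<sigma> t)))\<^sup>2)"
    using rp by (auto simp: regular_pair_def power_mult_distrib)
  define d where "d t = A' t (\<sigma> t) - A t (\<sigma> t)" for t
  have dm: "d \<in> borel_measurable ?M" unfolding d_def by (intro borel_measurable_diff A'm Am)
  have idm: "(\<lambda>t. t) \<in> borel_measurable ?M" by (rule borel_imp_lebesgue_on_measurable) simp
  have d2: "integrable ?M (\<lambda>t. (norm (d t))\<^sup>2)"
  proof (rule L2_bound[OF dm \<sigma>2 tA])
    show "AE t in ?M. norm (d t) \<le> (C * R) * norm (\<sigma> t) + C * norm (t *\<^sub>R A t (\<sigma> t))"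
      using \<sigma>S AE_space
    proof eventually_elim
      case (elim t)
      then have t: "t \<in> {0..R}" "0 \<le> t" "t \<le> R" by auto
      have "norm (d t) \<le> C * t * (norm (\<sigma> t) + norm (A t (\<sigma> t)))"
        unfolding d_def by (rule le[OF t(1) elim(1)])
      also have "\<dots> = (C * t) * norm (\<sigma> t) + C * norm (t *\<^sub>R A t (\<sigma> t))" using t by (simp add: algebra_simps)
      also have "\<dots> \<le> (C * R) * norm (\<sigma> t) + C * norm (t *\<^sub>R A t (\<sigma> t))"
        using t C by (intro add_right_mono mult_right_mono mult_left_mono) auto
      finally show ?case .
    qed
  qed
  have A'_eq: "A' t (\<sigma> t) = A t (\<sigma> t) + d t" for t by (simp add: d_def)
  have "integrable ?M (\<lambda>t. (norm (t *\<^sub>R A' t (\<sigma> t)))\<^sup>2)"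
  proof (rule L2_bound[OF borel_measurable_scaleR[OF idm A'm] tA d2, of 1 R])
    show "AE t in ?M. norm (t *\<^sub>R A' t (\<sigma> t)) \<le> 1 * norm (t *\<^sub>R A t (\<sigma> t)) + R * norm (d t)"
    proof (rule AE_I2)
      fix t assume "t \<in> space ?M"
      then have t: "0 \<le> t" "t \<le> R" by auto
      have "norm (t *\<^sub>R A' t (\<sigma> t)) \<le> norm (t *\<^sub>R A t (\<sigma> t)) + norm (t *\<^sub>R d t)"
        unfolding A'_eq scaleR_add_right by (rule norm_triangle_ineq)
      also have "norm (t *\<^sub>R d t) \<le> R * norm (d t)" using t by (simp add: mult_right_mono)
      finally show "norm (t *\<^sub>R A' t (\<sigma> t)) \<le> 1 * norm (t *\<^sub>R A t (\<sigma> t)) + R * norm (d t)" by simp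
    qed
  qed
  then have tA': "integrable ?M (\<lambda>t. (t * norm (A' t (\<sigma> t)))\<^sup>2)" by (simp add: power_mult_distrib)
  have "integrable ?M (\<lambda>t. (norm (f t + A' t (\<sigma> t)))\<^sup>2)"
  proof (rule L2_bound[OF borel_measurable_add[OF fm A'm] fA d2, of 1 1])
    show "AE t in ?M. norm (f t + A' t (\<sigma> t)) \<le> 1 * norm (f t + A t (\<sigma> t)) + 1 * norm (d t)"
      by (rule AE_I2) (simp add: A'_eq add.assoc[symmetric] norm_triangle_ineq)
  qed
  with tA' A'm rp show ?thesis unfolding regular_pair_def by blast
qed

context dirac_on begin

lemma A_difference:
  assumes r: "r \<in> {0..R}" and s: "s \<in> {0..R}" and u: "u \<in> H_A"
  shows "norm (A r u - A s u) \<le> (L / c + L * L / c + L / c\<^sup>2 * L) * \<bar>r - s\<bar> * (norm u + norm (A s u))"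
proof -
  have Bs: "norm (Bop s u) \<le> L * norm (A s u)" unfolding Bop_def by (rule G_bound[OF s])
  have nn: "0 \<le> L / c * \<bar>r - s\<bar>" "0 \<le> L / c\<^sup>2 * \<bar>r - s\<bar>" using L_pos c_pos by auto
  have "A r u - A s u = Ginv r (Bop r u - Bop s u) + (Ginv r (Bop s u) - Ginv s (Bop s u))"
    by (simp add: blinfun.diff_right Ginv_B[OF r] Ginv_B[OF s])
  then have "norm (A r u - A s u) \<le> norm (Ginv r (Bop r u - Bop s u)) + norm (Ginv r (Bop s u) - Ginv s (Bop s u))"
    by (simp only: norm_triangle_ineq)
  also have "\<dots> \<le> L * \<bar>r - s\<bar> * (norm u + norm (Bop s u)) / c + L / c\<^sup>2 * \<bar>r - s\<bar> * norm (Bop s u)"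
  proof (rule add_mono[OF order_trans[OF Ginv_bound[OF r]] Ginv_lipschitz[OF r s]])
    show "norm (Bop r u - Bop s u) / c \<le> L * \<bar>r - s\<bar> * (norm u + norm (Bop s u)) / c"
      using c_pos by (intro divide_right_mono B_lip[OF r s s u]) simp
  qed
  also have "\<dots> = L / c * \<bar>r - s\<bar> * (norm u + norm (Bop s u)) + L / c\<^sup>2 * \<bar>r - s\<bar> * norm (Bop s u)" by simp
  also have "\<dots> \<le> L / c * \<bar>r - s\<bar> * (norm u + L * norm (A s u)) + L / c\<^sup>2 * \<bar>r - s\<bar> * (L * norm (A s u))"
    using nn Bs by (intro add_mono mult_left_mono) auto
  also have "\<dots> \<le> L / c * \<bar>r - s\<bar> * ((1 + L) * (norm u + norm (A s u)))
      + L / c\<^sup>2 * \<bar>r - s\<bar> * (L * (norm u + norm (A s u)))"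
    using nn L_pos by (intro add_mono mult_left_mono) (auto simp: algebra_simps)
  also have "\<dots> = (L / c + L * L / c + L / c\<^sup>2 * L) * \<bar>r - s\<bar> * (norm u + norm (A s u))"
    by (simp add: algebra_simps add_divide_distrib)
  finally show ?thesis .
qed

lemma D_max_iff_regular_pair:
  assumes "\<sigma> \<in> L2_space ip" "AE t in lebesgue_on {0..}. R < t \<longrightarrow> \<sigma> t = 0"
  shows "\<sigma> \<in> D_max_dom ip H_A A \<gamma> \<longleftrightarrow> (\<exists>f. regular_pair R H_A A \<sigma> f)"
  using D_max_imp_regular_pair[OF assms] regular_pair_imp_D_max[OF assms] by blast

end

lemma Lip_loc_AE_differentiable:
  fixes \<sigma> :: "real \<Rightarrow> 'h::{complex_hilbert_space, second_countable_topology}"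
  assumes \<sigma>: "\<sigma> \<in> Lip_loc"
  shows "AE t in lebesgue_on {0..}. \<exists>d. (\<sigma> has_vector_derivative d) (at t)"
proof -
  have all: "AE t in lebesgue. t \<in> {0..real n} \<longrightarrow> (\<exists>d. (\<sigma> has_vector_derivative d) (at t))" for n
  proof -
    obtain C where C: "C-lipschitz_on {0..real n} \<sigma>"
      using \<sigma> of_nat_0_le_iff[of n] unfolding Lip_loc_def by blast
    obtain v where "AE t in lebesgue_on {0..real n}. (\<sigma> has_vector_derivative v t) (at t)"
      by (rule lipschitz_AE_differentiable[OF parallelogram C]) auto
    then have "AE t in lebesgue_on {0..real n}. \<exists>d. (\<sigma> has_vector_derivative d) (at t)" by eventually_elim blast
    then show ?thesis by (simp add: AE_restrict_space_iff)
  qed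
  have "AE t in lebesgue. \<forall>n. t \<in> {0..real n} \<longrightarrow> (\<exists>d. (\<sigma> has_vector_derivative d) (at t))"
    unfolding AE_all_countable by (intro allI all)
  then have "AE t in lebesgue. t \<in> {0..} \<longrightarrow> (\<exists>d. (\<sigma> has_vector_derivative d) (at t))"
  proof eventually_elim
    case (elim t)
    then show ?case using real_arch_simple[of t] by auto
  qed
  then show ?thesis by (simp add: AE_restrict_space_iff)
qed

context dirac_system begin

lemma constant_Gamma:
  assumes t: "0 < t" shows "Gamma_op (\<lambda>_. ip 0) t u = 0"
proof -
  have nondeg: "w = v" if "\<And>x. ip 0 w x = ip 0 v x" for v w
  proof -
    have "ip 0 (w - v) (w - v) = 0"
      using that[of "w - v"] by (simp add: ip_Gop blinfun.diff_right cinner_diff_left)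
    then have "\<not> 0 < Re (ip 0 (w - v) (w - v))" by simp
    then have "w - v = 0" using ip_compatible[OF order_refl] unfolding compatible_scalar_product_def by blast
    then show ?thesis by simp
  qed
  have at: "at t within {0..} = at t" using t by (intro at_within_interior) simp
  have m: "metric_op (\<lambda>_. ip 0) r v = v" for r v
    unfolding metric_op_def by (rule the_equality) (auto intro: nondeg)
  have "metric_op_deriv (\<lambda>_. ip 0) t u = 0"
    unfolding metric_op_deriv_def m at
  proof (rule the_equality)
    show "\<forall>v. ((\<lambda>r. ip 0 u v) has_vector_derivative ip 0 0 v) (at t)" by (simp add: ip_Gop blinfun.zero_right)
    fix w assume w: "\<forall>v. ((\<lambda>r. ip 0 u v) has_vector_derivative ip 0 w v) (at t)"
    show "w = 0"
    proof (rule nondeg)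
      fix v
      have "ip 0 w v = 0" by (rule vector_derivative_unique_at[OF w[rule_format] has_vector_derivative_const])
      then show "ip 0 w v = ip 0 0 v" by (simp add: ip_Gop blinfun.zero_right)
    qed
  qed
  moreover have "metric_op (\<lambda>_. ip 0) t = id" using m by auto
  ultimately show ?thesis by (simp add: Gamma_op_def)
qed

lemma constant_partial_op:
  assumes "0 < t" "(\<sigma> has_vector_derivative d) (at t)"
  shows "partial_op (\<lambda>_. ip 0) \<sigma> t = d"
proof -
  have "at t within {0..} = at t" using assms(1) by (intro at_within_interior) simp
  then show ?thesis using assms by (simp add: partial_op_def constant_Gamma vector_derivative_at)
qed

text \<open>The connection term vanishes for constant metric, so that \<open>[\<partial>, \<gamma> 0] = 0\<close> is linearity of the derivative.\<close>
lemma constant_system: "dirac_system (\<lambda>_. ip 0) H_A (\<lambda>_. A 0) (\<lambda>_. \<gamma> 0)"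
proof
  show "\<exists>C. \<forall>u v. \<forall>r\<in>{0..T}. \<forall>s\<in>{0..T}. \<forall>t\<in>{0..T}.
      cmod (ip 0 u v - ip 0 u v) \<le> C * sp_norm (ip 0) u * sp_norm (ip 0) v * \<bar>r - s\<bar>" for T :: real
    by (rule exI[of _ 0]) simp
  show "\<exists>C. \<forall>u\<in>H_A. \<forall>v. \<forall>r\<in>{0..T}. \<forall>s\<in>{0..T}. \<forall>t\<in>{0..T}.
      cmod (ip 0 (A 0 u) v - ip 0 (A 0 u) v) \<le> C * graph_norm (ip 0) (A 0) u * sp_norm (ip 0) v * \<bar>r - s\<bar>" for T :: real
    by (rule exI[of _ 0]) simp
  show "(\<lambda>_. \<gamma> 0) \<in> Lip_loc"
    unfolding Lip_loc_def by (intro CollectI allI impI exI[of _ 0] lipschitz_onI) auto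
  show "\<exists>C. AE t in lebesgue_on {0..T}. \<forall>u\<in>H_A. \<gamma> 0 u \<in> H_A \<and>
      graph_norm (ip 0) (A 0) (\<gamma> 0 u) \<le> C * graph_norm (ip 0) (A 0) u" for T :: real
  proof (intro exI[of _ 1] AE_I2 ballI conjI)
    fix u assume u: "u \<in> H_A"
    note a = \<gamma>_anticommute[OF order_refl u]
    then show "\<gamma> 0 u \<in> H_A" by blast
    have iso: "sp_norm (ip 0) (\<gamma> 0 v) = sp_norm (ip 0) v" for v
      unfolding sp_norm_def \<gamma>_adjoint[OF order_refl] \<gamma>_square[OF order_refl] by simp
    have "A 0 (\<gamma> 0 u) = \<gamma> 0 (- A 0 u)"
      using a by (simp add: blinfun.minus_right eq_neg_iff_add_eq_0)
    moreover have "sp_norm (ip 0) (- v) = sp_norm (ip 0) v" for v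
      by (simp add: sp_norm_def ip_Gop blinfun.minus_right cinner_minus_left cinner_minus_right)
    ultimately show "graph_norm (ip 0) (A 0) (\<gamma> 0 u) \<le> 1 * graph_norm (ip 0) (A 0) u"
      by (simp add: graph_norm_def iso)
  qed
  show "AE t in lebesgue_on {0..}. partial_op (\<lambda>_. ip 0) (\<lambda>r. \<gamma> 0 (\<sigma> r)) t = \<gamma> 0 (partial_op (\<lambda>_. ip 0) \<sigma> t)"
    if \<sigma>: "\<sigma> \<in> Lip_loc" for \<sigma>
  proof -
    have "AE t in lebesgue_on {0..}. t \<noteq> (0::real)"
      using AE_completion[OF AE_lborel_singleton[of "0::real"]] by (auto simp: AE_restrict_space_iff elim: eventually_mono)
    with Lip_loc_AE_differentiable[OF \<sigma>] show ?thesis using AE_space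
    proof eventually_elim
      case (elim t)
      then have t: "0 < t" by simp
      from elim obtain d where d: "(\<sigma> has_vector_derivative d) (at t)" by blast
      have "((\<lambda>r. \<gamma> 0 (\<sigma> r)) has_vector_derivative \<gamma> 0 d) (at t)"
        by (rule bounded_linear.has_vector_derivative[OF blinfun.bounded_linear_right d])
      then show ?case by (simp add: constant_partial_op[OF t d] constant_partial_op[OF t])
    qed
  qed
qed (use ip_compatible A_self_adjoint H_A_compact \<gamma>_clinear \<gamma>_adjoint \<gamma>_square \<gamma>_anticommute in auto)

end

theorem theorem2:
  fixes ip :: "real \<Rightarrow> 'h::{complex_hilbert_space, second_countable_topology} \<Rightarrow> 'h \<Rightarrow> complex"
    and H_A :: "'h set"
    and A :: "real \<Rightarrow> 'h \<Rightarrow> 'h"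
    and \<gamma> :: "real \<Rightarrow> 'h \<Rightarrow>\<^sub>L 'h"
    and \<sigma> :: "real \<Rightarrow> 'h"
  assumes "dirac_system ip H_A A \<gamma>"
    and "\<sigma> \<in> L2_space ip"
    and "compact_support_AE \<sigma>"
  shows "\<sigma> \<in> D_max_dom ip H_A A \<gamma> \<longleftrightarrow>
    \<sigma> \<in> D_max_dom (\<lambda>_. ip 0) H_A (\<lambda>_. A 0) (\<lambda>_. \<gamma> 0)"
proof -
  interpret d: dirac_system ip H_A A \<gamma> by (rule assms(1))
  interpret d0: dirac_system "\<lambda>_. ip 0" H_A "\<lambda>_. A 0" "\<lambda>_. \<gamma> 0" by (rule d.constant_system)
  obtain R0 where R0: "AE t in lebesgue_on {0..}. R0 < t \<longrightarrow> \<sigma> t = 0"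
    using assms(3) unfolding compact_support_AE_def by blast
  define R where "R = max 1 R0"
  have R: "0 < R" "0 \<le> R" "0 < R + 1" by (auto simp: R_def)
  have supp: "AE t in lebesgue_on {0..}. R < t \<longrightarrow> \<sigma> t = 0"
    using R0 by eventually_elim (auto simp: R_def)
  note \<sigma>m = d.L2_space_restrict[OF assms(2) R(2)]
  have "\<sigma> \<in> borel_measurable (lebesgue_on {0..})" using assms(2) by (simp add: L2_space_def)
  then have \<sigma>0: "\<sigma> \<in> L2_space (\<lambda>_. ip 0)" by (rule d0.L2_spaceI[OF _ R(2) \<sigma>m(2) supp])
  obtain L c where "coercive_family (R + 1) L c d.Gop H_A d.Bop" using d.coercive_family_exists[OF R(3)] by blast
  then interpret e: dirac_on ip H_A A \<gamma> R L c
    by (intro dirac_on.intro assms(1) dirac_on_axioms.intro R(1))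
  obtain L' c' where "coercive_family (R + 1) L' c' d0.Gop H_A d0.Bop" using d0.coercive_family_exists[OF R(3)] by blast
  then interpret e0: dirac_on "\<lambda>_. ip 0" H_A "\<lambda>_. A 0" "\<lambda>_. \<gamma> 0" R L' c'
    by (intro dirac_on.intro d.constant_system dirac_on_axioms.intro R(1))
  define C where "C = L / c + L * L / c + L / c\<^sup>2 * L"
  have C: "0 \<le> C" using e.L_pos e.c_pos by (simp add: C_def)
  have I0: "0 \<in> {0..R}" using R by simp
  have "regular_pair R H_A A \<sigma> f \<longleftrightarrow> regular_pair R H_A (\<lambda>_. A 0) \<sigma> f" for f
  proof
    assume rp: "regular_pair R H_A A \<sigma> f"
    then have \<sigma>S: "AE t in lebesgue_on {0..R}. \<sigma> t \<in> H_A" unfolding regular_pair_def by blast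
    show "regular_pair R H_A (\<lambda>_. A 0) \<sigma> f"
    proof (rule regular_pair_perturb[where A' = "\<lambda>_. A 0", OF rp R(2) C \<sigma>m e0.A_measurable[OF \<sigma>m(1) \<sigma>S]])
      show "norm (A 0 u - A t u) \<le> C * t * (norm u + norm (A t u))" if "t \<in> {0..R}" "u \<in> H_A" for t u
        using e.A_difference[OF I0 that] that(1) by (simp add: C_def)
    qed
  next
    assume rp: "regular_pair R H_A (\<lambda>_. A 0) \<sigma> f"
    then have \<sigma>S: "AE t in lebesgue_on {0..R}. \<sigma> t \<in> H_A" unfolding regular_pair_def by blast
    show "regular_pair R H_A A \<sigma> f"
    proof (rule regular_pair_perturb[where A' = A, OF rp R(2) C \<sigma>m e.A_measurable[OF \<sigma>m(1) \<sigma>S]])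
      show "norm (A t u - A 0 u) \<le> C * t * (norm u + norm (A 0 u))" if "t \<in> {0..R}" "u \<in> H_A" for t u
        using e.A_difference[OF that(1) I0 that(2)] that(1) by (simp add: C_def)
    qed
  qed
  then show ?thesis
    unfolding e.D_max_iff_regular_pair[OF assms(2) supp] e0.D_max_iff_regular_pair[OF \<sigma>0 supp] by blast
qed

end
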